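(* The equivalence $K^s\colon\mathrm{ShSkMulti}_{lr}\to\mathrm{SkMon}$ between left representable short skew multicategories and skew monoidal categories (defined in the context) restricts to an equivalence $K^s_c\colon\mathrm{ShSkMulti}^{cl}_{lr}\to\mathrm{SkMon}^{cl}$ between left representable closed short skew multicategories and closed skew monoidal categories, which fits in a commutative triangle of equivalences $T^s_c=K^s_c\circ U^{s,cl}_{lr}$, where $U^{s,cl}_{lr}\colon\mathrm{SkMulti}^{cl}_{lr}\to\mathrm{ShSkMulti}^{cl}_{lr}$ is the forgetful functor and $T^s_c\colon\mathrm{SkMulti}^{cl}_{lr}\to\mathrm{SkMon}^{cl}$ is the known equivalence between left representable closed skew multicategories and closed skew monoidal categories.
   Context: For $x,y\in\{t,l\}$ put $x\circ_iy=t$ if ($x=y=t$ and $i=1$) or ($x=t$ and $i\ne1$), and $x\circ_iy=l$ otherwise. ($t$ = "tight", $l$ = "loose".) **Short skew multicategories.** A short skew multicategory $\mathbb C$ consists of a category $\mathcal C$; functors $\mathbb C^t_n(-;-)\colon(\mathcal C^n)^{op}\times\mathcal C\to\mathrm{Set}$ for $1\le n\le4$ with $\mathbb C^t_1(-;-)=\mathcal C(-,-)$; functors $\mathbb C^l_n(-;-)\colon(\mathcal C^n)^{op}\times\mathcal C\to\mathrm{Set}$ for $n=0,1,2$; natural transformations $j\colon\mathbb C^t_n\to\mathbb C^l_n$ for $n=1,2$. Nullary maps are loose. The functorial action of tight unary maps (morphisms of $\mathcal C$) is written $q\circ f$ (codomain) and $f\circ_ip$ ($i$-th input). Furthermore there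 are substitution functions $\circ_i\colon\mathbb C^x_n(\bar b;c)\times\mathbb C^y_m(\bar a;b_i)\to\mathbb C^{x\circ_iy}_{n+m-1}(\bar b_{<i},\bar a,\bar b_{>i};c)$, natural in all $a_k$, $b_k$ ($k\neq i$), $c$ and dinatural in $b_i$, in the following cases: tight binary into tight binary or tight ternary; tight ternary into tight binary; nullary into tight binary or tight ternary; nullary into loose unary; loose unary into tight binary; tight binary into loose unary. Axioms: for $f$ tight binary, $g$ $n$-ary, $h$ $p$-ary (all tight except that nullary maps are loose), (A) $f\circ_i(g\circ_jh)=(f\circ_ig)\circ_{j+i-1}h$ for $1\le i\le2$, $1\le j\le n$, when $(n,p)\in\{(2,2),(2,0)\}$; (B) $(f\circ_1g)\circ_{n+1}h=(f\circ_2h)\circ_1g$ when $(n,p)\in\{(2,2),(2,0),(0,2),(0,0)\}$; and compatibility of $j$: for $g$ tight binary, $p,q$ tight unary, $v$ nullary, $g\circ_2jp=g\circ_2p$, $g\circ_1jp=j(g\circ_1p)$, $q\circ jp=j(q\circ p)$, $jp\circ g=j(p\circ g)$, $jp\circ v=p\circ v$. A morphism $F\colon\mathbb C\to\mathbb D$ is a functor $F\colon\mathcal C\to\mathcal D$ with natural families $F^t_n\colon\mathbb C^t_n(\bar a;b)\to\mathbb D^t_n(F\bar a;Fb)$ ($1\le n\le4$, $F^t_1=F$) and $F^l_n\colon\mathbb C^l_n(\bar a;b)\to\mathbb D^l_n(F\bar a;Fb)$ ($0\le n\le2$) commuting with all substitutions and with $j$. **Left representability and closedness (short skew).** $\mathbb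 C$ is left representable if there are tight binary maps $\theta_{a,b}\colon a,b\to ab$ (all $a,b$) such that $-\circ_1\theta_{a,b}\colon\mathbb C^t_n(ab,\bar x;d)\to\mathbb C^t_{n+1}(a,b,\bar x;d)$ is bijective for $n=1,2,3$, and a nullary map $u\in\mathbb C^l_0(\,;i)$ such that $-\circ_1u\colon\mathbb C^t_{n+1}(i,\bar x;d)\to\mathbb C^l_n(\bar x;d)$ is bijective for $n=0,1,2$. $\mathbb C$ is closed if for all $b,c$ there are an object $[b,c]$ and a tight binary map $e_{b,c}\colon[b,c],b\to c$ such that $e_{b,c}\circ_1-\colon\mathbb C^t_n(\bar x;[b,c])\to\mathbb C^t_{n+1}(\bar x,b;c)$ is bijective for $n=1,2,3$ and $e_{b,c}\circ_1-\colon\mathbb C^l_n(\bar x;[b,c])\to\mathbb C^l_{n+1}(\bar x,b;c)$ is bijective for $n=0,1$. $\mathrm{ShSkMulti}_{lr}$ and $\mathrm{ShSkMulti}^{cl}_{lr}$ are the full subcategories of short skew multicategories that are left representable, resp. left representable and closed. **Skew multicategories.** A skew multicategory has objects, sets $\mathbb C^t_n(\bar a;b)$ ($n\ge1$) and $\mathbb C^l_n(\bar a;b)$ ($n\ge0$), functions $j\colon\mathbb C^t_n(\bar a;b)\to\mathbb C^l_n(\bar a;b)$ ($n\ge1$), identities $1_a\in\mathbb C^t_1(a;a)$, and substitutions $\circ_i\colon\mathbb C^x_n(\bar b;c)\times\mathbb C^y_m(\bar a;b_i)\to\mathbb C^{x\circ_iy}_{n+m-1}(\bar b_{<i},\bar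 a,\bar b_{>i};c)$ for all $n\ge1$, $m\ge 0$, $1\le i\le n$ and all types, satisfying the usual multicategory associativity, commutativity and identity axioms, and compatible with $j$: replacing a tight argument of $g\circ_if$ by its image under $j$ leaves $g\circ_i f$ unchanged if the type of the result does not change, and replaces it by $j(g\circ_if)$ if the type changes from $t$ to $l$. Its underlying category is that of tight unary maps. Skew multifunctors are functors on underlying categories with natural families $F^t_n$ ($n\ge1$), $F^l_n$ ($n\ge0$), $F_1^t=F$, commuting with substitution and $j$. A skew multicategory is left representable if for each $x\in\{t,l\}$ and each $\bar a$ of length $n$ ($n\ge1$ if $x=t$, $n\ge0$ if $x=l$) there is $\theta^x_{\bar a}\in\mathbb C^x_n(\bar a;m^x\bar a)$ such that $-\circ_1\theta^x_{\bar a}\colon\mathbb C^t_{1+r}(m^x\bar a,\bar y;b)\to\mathbb C^x_{n+r}(\bar a,\bar y;b)$ is bijective for all $r\ge0$, $\bar y$ of length $r$, $b$. It is closed if for all $b,c$ there are $[b,c]$ and $e_{b,c}\in\mathbb C^t_2([b,c],b;c)$ such that $e_{b,c}\circ_1-\colon\mathbb C^x_n(\bar a;[b,c])\to\mathbb C^x_{n+1}(\bar a,b;c)$ is bijective for all $\bar a$ and $x=t,l$. $\mathrm{SkMulti}^{cl}_{lr}$ is the category of left representable closed skew multicategories and skew multifunctors. $U^{s,cl}_{lr}$ keeps tight $n$-ary maps for $1\le n\le4$, loose $n$-ary maps for $0\le n\le2$ and the operations listed in the definition of short skew multicategory. **Skew monoidal categories.** A (left) skew monoidal category is a category $\mathcal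 C$ with a functor $(a,b)\mapsto ab$, $\mathcal C\times\mathcal C\to\mathcal C$, an object $i$, and natural families $\alpha_{a,b,c}\colon(ab)c\to a(bc)$, $\lambda_a\colon ia\to a$, $\rho_a\colon a\to ai$ (not necessarily invertible) satisfying $\alpha_{a,b,cd}\alpha_{ab,c,d}=(a\,\alpha_{b,c,d})\alpha_{a,bc,d}(\alpha_{a,b,c}\,d)$, $\lambda_{ab}\alpha_{i,a,b}=\lambda_a b$, $\alpha_{a,b,i}\rho_{ab}=a\rho_b$, $(a\lambda_b)\alpha_{a,i,b}(\rho_a b)=1_{ab}$, $\lambda_i\rho_i=1_i$. It is closed if each functor $-\otimes b\colon a\mapsto ab$ has a right adjoint. A lax monoidal functor is a functor $F$ with a map $f_0\colon i\to Fi$ and a natural family $f_2\colon FaFb\to F(ab)$ such that $F\alpha\circ f_2\circ(f_2\cdot Fc)=f_2\circ(Fa\cdot f_2)\circ\alpha$, $F\lambda\circ f_2\circ(f_0\cdot Fa)=\lambda$, $f_2\circ(Fa\cdot f_0)\circ\rho=F\rho$. $\mathrm{SkMon}$ (resp. $\mathrm{SkMon}^{cl}$) is the category of (closed) skew monoidal categories and lax monoidal functors. **The functors $K^s$ and $T^s_c$.** For each left representable short skew multicategory fix a choice of tight binary maps $\theta_{a,b}\colon a,b\to ab$ (all $a,b$) such that $-\circ_1\theta_{a,b}\colon\mathbb C^t_n(ab,\bar x;d)\to\mathbb C^t_{n+1}(a,b,\bar x;d)$ is bijective for $n=1,2,3$, and of a nullary map $u\in\mathbb C^l_0(\,;i)$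 such that $-\circ_1u\colon\mathbb C^t_{n+1}(i,\bar x;d)\to\mathbb C^l_n(\bar x;d)$ is bijective for $n=0,1,2$. $K^s\mathbb C$ has underlying category $\mathcal C$, tensor $ab$, unit $i$; for tight unary $f\colon a\to b$, $g\colon c\to d$, $fg$ is the unique map with $(fg)\circ\theta_{a,c}=(\theta_{b,d}\circ_1f)\circ_2g$; $\alpha$ is the unique map with $(\alpha\circ\theta_{ab,c})\circ_1\theta_{a,b}=\theta_{a,bc}\circ_2\theta_{b,c}$; $\lambda_a$ is the unique map with $(\lambda_a\circ\theta_{i,a})\circ_1u=j(1_a)$; $\rho_a=\theta_{a,i}\circ_2u$. On a morphism $F$, $K^sF=(F,f_0,f_2)$ with $f_2$ unique such that $f_2\circ\theta_{Fa,Fb}=F^t_2(\theta_{a,b})$ and $f_0$ unique such that $f_0\circ u=F^l_0(u)$. $T^s_c$ is given by the same formulas in a left representable closed skew multicategory (with the same choices of tight binary and nullary classifiers); it is known to be an equivalence. *)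

theory Defs
  imports Main
begin

section \<open>Categories, functors, equivalences, adjunctions\<close>

text \<open>
  Hom-sets are families of sets of one type and need not be disjoint; hence every operation on
  arrows takes the objects involved as explicit arguments.  \<open>Comp C a b c g f\<close> is the
  composite of \<open>f : a \<rightarrow> b\<close> and \<open>g : b \<rightarrow> c\<close>.
  Values outside the carriers are irrelevant.
\<close>

record ('o, 'm) cat =
  Ob :: "'o set"
  Hom :: "'o \<Rightarrow> 'o \<Rightarrow> 'm set"
  Idn :: "'o \<Rightarrow> 'm"
  Comp :: "'o \<Rightarrow> 'o \<Rightarrow> 'o \<Rightarrow> 'm \<Rightarrow> 'm \<Rightarrow> 'm"

definition category :: "('o, 'm, 'z) cat_scheme \<Rightarrow> bool" where
  "category C \<longleftrightarrow>
     (\<forall>a\<in>Ob C. Idn C a \<in> Hom C a a) \<and>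
     (\<forall>a\<in>Ob C. \<forall>b\<in>Ob C. \<forall>c\<in>Ob C. \<forall>f\<in>Hom C a b. \<forall>g\<in>Hom C b c.
        Comp C a b c g f \<in> Hom C a c) \<and>
     (\<forall>a\<in>Ob C. \<forall>b\<in>Ob C. \<forall>f\<in>Hom C a b.
        Comp C a a b f (Idn C a) = f \<and> Comp C a b b (Idn C b) f = f) \<and>
     (\<forall>a\<in>Ob C. \<forall>b\<in>Ob C. \<forall>c\<in>Ob C. \<forall>d\<in>Ob C.
        \<forall>f\<in>Hom C a b. \<forall>g\<in>Hom C b c. \<forall>h\<in>Hom C c d.
        Comp C a b d (Comp C b c d h g) f = Comp C a c d h (Comp C a b c g f))"

definition prod_cat :: "('o, 'm, 'y) cat_scheme \<Rightarrow> ('p, 'n, 'z) cat_scheme \<Rightarrow> ('o \<times> 'p, 'm \<times> 'n) cat" where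
  "prod_cat C D =
     \<lparr> Ob = Ob C \<times> Ob D,
       Hom = (\<lambda>(a, a') (b, b'). Hom C a b \<times> Hom D a' b'),
       Idn = (\<lambda>(a, a'). (Idn C a, Idn D a')),
       Comp = (\<lambda>(a, a') (b, b') (c, c') (g, g') (f, f'). (Comp C a b c g f, Comp D a' b' c' g' f')) \<rparr>"

definition iso_in :: "('o, 'm, 'z) cat_scheme \<Rightarrow> 'o \<Rightarrow> 'o \<Rightarrow> 'm \<Rightarrow> bool" where
  "iso_in C a b f \<longleftrightarrow> f \<in> Hom C a b \<and>
     (\<exists>g\<in>Hom C b a. Comp C a b a g f = Idn C a \<and> Comp C b a b f g = Idn C b)"

record ('o, 'm, 'p, 'n) fctr =
  FO :: "'o \<Rightarrow> 'p"
  FA :: "'o \<Rightarrow> 'o \<Rightarrow> 'm \<Rightarrow> 'n"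

definition is_functor ::
  "('o, 'm, 'y) cat_scheme \<Rightarrow> ('p, 'n, 'z) cat_scheme \<Rightarrow> ('o, 'm, 'p, 'n) fctr \<Rightarrow> bool" where
  "is_functor C D F \<longleftrightarrow> category C \<and> category D \<and>
     (\<forall>a\<in>Ob C. FO F a \<in> Ob D) \<and>
     (\<forall>a\<in>Ob C. \<forall>b\<in>Ob C. \<forall>f\<in>Hom C a b. FA F a b f \<in> Hom D (FO F a) (FO F b)) \<and>
     (\<forall>a\<in>Ob C. FA F a a (Idn C a) = Idn D (FO F a)) \<and>
     (\<forall>a\<in>Ob C. \<forall>b\<in>Ob C. \<forall>c\<in>Ob C. \<forall>f\<in>Hom C a b. \<forall>g\<in>Hom C b c.
        FA F a c (Comp C a b c g f) =
          Comp D (FO F a) (FO F b) (FO F c) (FA F b c g) (FA F a b f))"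

definition id_fctr :: "('o, 'm, 'o, 'm) fctr" where
  "id_fctr = \<lparr> FO = (\<lambda>a. a), FA = (\<lambda>a b f. f) \<rparr>"

definition comp_fctr ::
  "('p, 'n, 'q, 'k) fctr \<Rightarrow> ('o, 'm, 'p, 'n) fctr \<Rightarrow> ('o, 'm, 'q, 'k) fctr" where
  "comp_fctr G F =
     \<lparr> FO = (\<lambda>a. FO G (FO F a)), FA = (\<lambda>a b f. FA G (FO F a) (FO F b) (FA F a b f)) \<rparr>"

text \<open>Equality of functors out of \<open>C\<close>: the same values on the objects and arrows of \<open>C\<close>.\<close>

definition fctr_eq ::
  "('o, 'm, 'z) cat_scheme \<Rightarrow> ('o, 'm, 'p, 'n) fctr \<Rightarrow> ('o, 'm, 'p, 'n) fctr \<Rightarrow> bool" where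
  "fctr_eq C F G \<longleftrightarrow>
     (\<forall>a\<in>Ob C. FO F a = FO G a) \<and>
     (\<forall>a\<in>Ob C. \<forall>b\<in>Ob C. \<forall>f\<in>Hom C a b. FA F a b f = FA G a b f)"

definition nat_trans ::
  "('o, 'm, 'y) cat_scheme \<Rightarrow> ('p, 'n, 'z) cat_scheme \<Rightarrow>
   ('o, 'm, 'p, 'n) fctr \<Rightarrow> ('o, 'm, 'p, 'n) fctr \<Rightarrow> ('o \<Rightarrow> 'n) \<Rightarrow> bool" where
  "nat_trans C D F G \<tau> \<longleftrightarrow>
     (\<forall>a\<in>Ob C. \<tau> a \<in> Hom D (FO F a) (FO G a)) \<and>
     (\<forall>a\<in>Ob C. \<forall>b\<in>Ob C. \<forall>f\<in>Hom C a b.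
        Comp D (FO F a) (FO F b) (FO G b) (\<tau> b) (FA F a b f) =
        Comp D (FO F a) (FO G a) (FO G b) (FA G a b f) (\<tau> a))"

definition nat_iso ::
  "('o, 'm, 'y) cat_scheme \<Rightarrow> ('p, 'n, 'z) cat_scheme \<Rightarrow>
   ('o, 'm, 'p, 'n) fctr \<Rightarrow> ('o, 'm, 'p, 'n) fctr \<Rightarrow> ('o \<Rightarrow> 'n) \<Rightarrow> bool" where
  "nat_iso C D F G \<tau> \<longleftrightarrow>
     nat_trans C D F G \<tau> \<and> (\<forall>a\<in>Ob C. iso_in D (FO F a) (FO G a) (\<tau> a))"

definition is_equivalence ::
  "('o, 'm, 'y) cat_scheme \<Rightarrow> ('p, 'n, 'z) cat_scheme \<Rightarrow> ('o, 'm, 'p, 'n) fctr \<Rightarrow> bool" where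
  "is_equivalence C D F \<longleftrightarrow> is_functor C D F \<and>
     (\<exists>G \<eta> \<epsilon>. is_functor D C G \<and>
        nat_iso C C id_fctr (comp_fctr G F) \<eta> \<and>
        nat_iso D D (comp_fctr F G) id_fctr \<epsilon>)"

definition has_right_adjoint ::
  "('o, 'm, 'y) cat_scheme \<Rightarrow> ('p, 'n, 'z) cat_scheme \<Rightarrow> ('o, 'm, 'p, 'n) fctr \<Rightarrow> bool" where
  "has_right_adjoint C D F \<longleftrightarrow>
     (\<exists>G \<eta> \<epsilon>. is_functor D C G \<and>
        nat_trans C C id_fctr (comp_fctr G F) \<eta> \<and>
        nat_trans D D (comp_fctr F G) id_fctr \<epsilon> \<and>
        (\<forall>a\<in>Ob C. Comp D (FO F a) (FO F (FO G (FO F a))) (FO F a)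
            (\<epsilon> (FO F a)) (FA F a (FO G (FO F a)) (\<eta> a)) = Idn D (FO F a)) \<and>
        (\<forall>d\<in>Ob D. Comp C (FO G d) (FO G (FO F (FO G d))) (FO G d)
            (FA G (FO F (FO G d)) d (\<epsilon> d)) (\<eta> (FO G d)) = Idn C (FO G d)))"


section \<open>Skew monoidal categories\<close>

text \<open>\<open>TA S a b c d f g\<close> is the tensor product of \<open>f : a \<rightarrow> b\<close> and \<open>g : c \<rightarrow> d\<close>.\<close>

record ('o, 'm) skmon = "('o, 'm) cat" +
  TO :: "'o \<Rightarrow> 'o \<Rightarrow> 'o" (infixl "\<otimes>\<index>" 70)
  TA :: "'o \<Rightarrow> 'o \<Rightarrow> 'o \<Rightarrow> 'o \<Rightarrow> 'm \<Rightarrow> 'm \<Rightarrow> 'm"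
  Unit :: "'o"
  Assoc :: "'o \<Rightarrow> 'o \<Rightarrow> 'o \<Rightarrow> 'm"
  LUnit :: "'o \<Rightarrow> 'm"
  RUnit :: "'o \<Rightarrow> 'm"

definition tensor_fctr :: "('o, 'm) skmon \<Rightarrow> ('o \<times> 'o, 'm \<times> 'm, 'o, 'm) fctr" where
  "tensor_fctr S =
     \<lparr> FO = (\<lambda>(a, c). a \<otimes>\<^bsub>S\<^esub> c), FA = (\<lambda>(a, c) (b, d) (f, g). TA S a b c d f g) \<rparr>"

locale skew_monoidal_category =
  fixes S :: "('o, 'm) skmon" (structure)
  assumes tensor_functor: "is_functor (prod_cat S S) S (tensor_fctr S)"
    and underlying_category: "category S"
    and unit_ob: "Unit S \<in> Ob S"
    and assoc_hom: "\<lbrakk>a \<in> Ob S; b \<in> Ob S; c \<in> Ob S\<rbrakk> \<Longrightarrow>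
          Assoc S a b c \<in> Hom S (a \<otimes> b \<otimes> c) (a \<otimes> (b \<otimes> c))"
    and lunit_hom: "a \<in> Ob S \<Longrightarrow> LUnit S a \<in> Hom S (Unit S \<otimes> a) a"
    and runit_hom: "a \<in> Ob S \<Longrightarrow> RUnit S a \<in> Hom S a (a \<otimes> Unit S)"
    and assoc_natural:
      "\<lbrakk>a \<in> Ob S; a' \<in> Ob S; b \<in> Ob S; b' \<in> Ob S; c \<in> Ob S; c' \<in> Ob S;
        f \<in> Hom S a a'; g \<in> Hom S b b'; h \<in> Hom S c c'\<rbrakk> \<Longrightarrow>
       Comp S (a \<otimes> b \<otimes> c) (a' \<otimes> b' \<otimes> c') (a' \<otimes> (b' \<otimes> c'))
         (Assoc S a' b' c') (TA S (a \<otimes> b) (a' \<otimes> b') c c' (TA S a a' b b' f g) h) =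
       Comp S (a \<otimes> b \<otimes> c) (a \<otimes> (b \<otimes> c)) (a' \<otimes> (b' \<otimes> c'))
         (TA S a a' (b \<otimes> c) (b' \<otimes> c') f (TA S b b' c c' g h)) (Assoc S a b c)"
    and lunit_natural:
      "\<lbrakk>a \<in> Ob S; a' \<in> Ob S; f \<in> Hom S a a'\<rbrakk> \<Longrightarrow>
       Comp S (Unit S \<otimes> a) (Unit S \<otimes> a') a'
         (LUnit S a') (TA S (Unit S) (Unit S) a a' (Idn S (Unit S)) f) =
       Comp S (Unit S \<otimes> a) a a' f (LUnit S a)"
    and runit_natural:
      "\<lbrakk>a \<in> Ob S; a' \<in> Ob S; f \<in> Hom S a a'\<rbrakk> \<Longrightarrow>
       Comp S a a' (a' \<otimes> Unit S) (RUnit S a') f =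
       Comp S a (a \<otimes> Unit S) (a' \<otimes> Unit S)
         (TA S a a' (Unit S) (Unit S) f (Idn S (Unit S))) (RUnit S a)"
    and pentagon:
      "\<lbrakk>a \<in> Ob S; b \<in> Ob S; c \<in> Ob S; d \<in> Ob S\<rbrakk> \<Longrightarrow>
       Comp S (a \<otimes> b \<otimes> c \<otimes> d) (a \<otimes> b \<otimes> (c \<otimes> d)) (a \<otimes> (b \<otimes> (c \<otimes> d)))
         (Assoc S a b (c \<otimes> d)) (Assoc S (a \<otimes> b) c d) =
       Comp S (a \<otimes> b \<otimes> c \<otimes> d) (a \<otimes> (b \<otimes> c \<otimes> d)) (a \<otimes> (b \<otimes> (c \<otimes> d)))
         (TA S a a (b \<otimes> c \<otimes> d) (b \<otimes> (c \<otimes> d)) (Idn S a) (Assoc S b c d))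
         (Comp S (a \<otimes> b \<otimes> c \<otimes> d) (a \<otimes> (b \<otimes> c) \<otimes> d) (a \<otimes> (b \<otimes> c \<otimes> d))
           (Assoc S a (b \<otimes> c) d)
           (TA S (a \<otimes> b \<otimes> c) (a \<otimes> (b \<otimes> c)) d d (Assoc S a b c) (Idn S d)))"
    and lunit_assoc:
      "\<lbrakk>a \<in> Ob S; b \<in> Ob S\<rbrakk> \<Longrightarrow>
       Comp S (Unit S \<otimes> a \<otimes> b) (Unit S \<otimes> (a \<otimes> b)) (a \<otimes> b)
         (LUnit S (a \<otimes> b)) (Assoc S (Unit S) a b) =
       TA S (Unit S \<otimes> a) a b b (LUnit S a) (Idn S b)"
    and runit_assoc:
      "\<lbrakk>a \<in> Ob S; b \<in> Ob S\<rbrakk> \<Longrightarrow>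
       Comp S (a \<otimes> b) (a \<otimes> b \<otimes> Unit S) (a \<otimes> (b \<otimes> Unit S))
         (Assoc S a b (Unit S)) (RUnit S (a \<otimes> b)) =
       TA S a a b (b \<otimes> Unit S) (Idn S a) (RUnit S b)"
    and unit_triangle:
      "\<lbrakk>a \<in> Ob S; b \<in> Ob S\<rbrakk> \<Longrightarrow>
       Comp S (a \<otimes> b) (a \<otimes> (Unit S \<otimes> b)) (a \<otimes> b)
         (TA S a a (Unit S \<otimes> b) b (Idn S a) (LUnit S b))
         (Comp S (a \<otimes> b) (a \<otimes> Unit S \<otimes> b) (a \<otimes> (Unit S \<otimes> b))
           (Assoc S a (Unit S) b)
           (TA S a (a \<otimes> Unit S) b b (RUnit S a) (Idn S b))) =
       Idn S (a \<otimes> b)"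
    and unit_unit:
      "Comp S (Unit S) (Unit S \<otimes> Unit S) (Unit S) (LUnit S (Unit S)) (RUnit S (Unit S)) =
       Idn S (Unit S)"

definition tensor_right :: "('o, 'm) skmon \<Rightarrow> 'o \<Rightarrow> ('o, 'm, 'o, 'm) fctr" where
  "tensor_right S b =
     \<lparr> FO = (\<lambda>a. a \<otimes>\<^bsub>S\<^esub> b), FA = (\<lambda>a a' f. TA S a a' b b f (Idn S b)) \<rparr>"

definition closed_skmon :: "('o, 'm) skmon \<Rightarrow> bool" where
  "closed_skmon S \<longleftrightarrow> (\<forall>b\<in>Ob S. has_right_adjoint S S (tensor_right S b))"

record ('o, 'm) laxmor =
  LF :: "('o, 'm, 'o, 'm) fctr"
  L0 :: "'m"
  L2 :: "'o \<Rightarrow> 'o \<Rightarrow> 'm"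

text \<open>
  The arrow part of a functor and the family \<open>f\<^sub>2\<close> are required to be \<open>undefined\<close> off their
  domains, so that lax monoidal functors are equal exactly if they have the same values.
\<close>

definition lax_monoidal ::
  "('o, 'm) skmon \<Rightarrow> ('o, 'm) skmon \<Rightarrow> ('o, 'm) laxmor \<Rightarrow> bool" where
  "lax_monoidal S R \<Phi> \<longleftrightarrow>
     (let F = FO (LF \<Phi>); A = FA (LF \<Phi>); f0 = L0 \<Phi>; f2 = L2 \<Phi>; i = Unit S; i' = Unit R in
      is_functor S R (LF \<Phi>) \<and>
      f0 \<in> Hom R i' (F i) \<and>
      (\<forall>a\<in>Ob S. \<forall>b\<in>Ob S. f2 a b \<in> Hom R (F a \<otimes>\<^bsub>R\<^esub> F b) (F (a \<otimes>\<^bsub>S\<^esub> b))) \<and>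
      (\<forall>a\<in>Ob S. \<forall>a'\<in>Ob S. \<forall>b\<in>Ob S. \<forall>b'\<in>Ob S. \<forall>f\<in>Hom S a a'. \<forall>g\<in>Hom S b b'.
         Comp R (F a \<otimes>\<^bsub>R\<^esub> F b) (F a' \<otimes>\<^bsub>R\<^esub> F b') (F (a' \<otimes>\<^bsub>S\<^esub> b'))
           (f2 a' b') (TA R (F a) (F a') (F b) (F b') (A a a' f) (A b b' g)) =
         Comp R (F a \<otimes>\<^bsub>R\<^esub> F b) (F (a \<otimes>\<^bsub>S\<^esub> b)) (F (a' \<otimes>\<^bsub>S\<^esub> b'))
           (A (a \<otimes>\<^bsub>S\<^esub> b) (a' \<otimes>\<^bsub>S\<^esub> b') (TA S a a' b b' f g)) (f2 a b)) \<and>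
      (\<forall>a\<in>Ob S. \<forall>b\<in>Ob S. \<forall>c\<in>Ob S.
         Comp R (F a \<otimes>\<^bsub>R\<^esub> F b \<otimes>\<^bsub>R\<^esub> F c) (F (a \<otimes>\<^bsub>S\<^esub> b \<otimes>\<^bsub>S\<^esub> c)) (F (a \<otimes>\<^bsub>S\<^esub> (b \<otimes>\<^bsub>S\<^esub> c)))
           (A (a \<otimes>\<^bsub>S\<^esub> b \<otimes>\<^bsub>S\<^esub> c) (a \<otimes>\<^bsub>S\<^esub> (b \<otimes>\<^bsub>S\<^esub> c)) (Assoc S a b c))
           (Comp R (F a \<otimes>\<^bsub>R\<^esub> F b \<otimes>\<^bsub>R\<^esub> F c) (F (a \<otimes>\<^bsub>S\<^esub> b) \<otimes>\<^bsub>R\<^esub> F c) (F (a \<otimes>\<^bsub>S\<^esub> b \<otimes>\<^bsub>S\<^esub> c))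
             (f2 (a \<otimes>\<^bsub>S\<^esub> b) c)
             (TA R (F a \<otimes>\<^bsub>R\<^esub> F b) (F (a \<otimes>\<^bsub>S\<^esub> b)) (F c) (F c) (f2 a b) (Idn R (F c)))) =
         Comp R (F a \<otimes>\<^bsub>R\<^esub> F b \<otimes>\<^bsub>R\<^esub> F c) (F a \<otimes>\<^bsub>R\<^esub> F (b \<otimes>\<^bsub>S\<^esub> c)) (F (a \<otimes>\<^bsub>S\<^esub> (b \<otimes>\<^bsub>S\<^esub> c)))
           (f2 a (b \<otimes>\<^bsub>S\<^esub> c))
           (Comp R (F a \<otimes>\<^bsub>R\<^esub> F b \<otimes>\<^bsub>R\<^esub> F c) (F a \<otimes>\<^bsub>R\<^esub> (F b \<otimes>\<^bsub>R\<^esub> F c)) (F a \<otimes>\<^bsub>R\<^esub> F (b \<otimes>\<^bsub>S\<^esub> c))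
             (TA R (F a) (F a) (F b \<otimes>\<^bsub>R\<^esub> F c) (F (b \<otimes>\<^bsub>S\<^esub> c)) (Idn R (F a)) (f2 b c))
             (Assoc R (F a) (F b) (F c)))) \<and>
      (\<forall>a\<in>Ob S.
         Comp R (i' \<otimes>\<^bsub>R\<^esub> F a) (F (i \<otimes>\<^bsub>S\<^esub> a)) (F a)
           (A (i \<otimes>\<^bsub>S\<^esub> a) a (LUnit S a))
           (Comp R (i' \<otimes>\<^bsub>R\<^esub> F a) (F i \<otimes>\<^bsub>R\<^esub> F a) (F (i \<otimes>\<^bsub>S\<^esub> a))
             (f2 i a) (TA R i' (F i) (F a) (F a) f0 (Idn R (F a)))) =
         LUnit R (F a)) \<and>
      (\<forall>a\<in>Ob S.
         Comp R (F a) (F a \<otimes>\<^bsub>R\<^esub> F i) (F (a \<otimes>\<^bsub>S\<^esub> i))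
           (f2 a i)
           (Comp R (F a) (F a \<otimes>\<^bsub>R\<^esub> i') (F a \<otimes>\<^bsub>R\<^esub> F i)
             (TA R (F a) (F a) i' (F i) (Idn R (F a)) f0) (RUnit R (F a))) =
         A a (a \<otimes>\<^bsub>S\<^esub> i) (RUnit S a)) \<and>
      (\<forall>a. a \<notin> Ob S \<longrightarrow> F a = undefined) \<and>
      (\<forall>a b f. \<not> (a \<in> Ob S \<and> b \<in> Ob S \<and> f \<in> Hom S a b) \<longrightarrow> A a b f = undefined) \<and>
      (\<forall>a b. \<not> (a \<in> Ob S \<and> b \<in> Ob S) \<longrightarrow> f2 a b = undefined))"

definition id_lax :: "('o, 'm) skmon \<Rightarrow> ('o, 'm) laxmor" where
  "id_lax S =
     \<lparr> LF = \<lparr> FO = (\<lambda>a. if a \<in> Ob S then a else undefined),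
              FA = (\<lambda>a b f. if a \<in> Ob S \<and> b \<in> Ob S \<and> f \<in> Hom S a b then f else undefined) \<rparr>,
       L0 = Idn S (Unit S),
       L2 = (\<lambda>a b. if a \<in> Ob S \<and> b \<in> Ob S then Idn S (a \<otimes>\<^bsub>S\<^esub> b) else undefined) \<rparr>"

definition comp_lax ::
  "('o, 'm) skmon \<Rightarrow> ('o, 'm) skmon \<Rightarrow> ('o, 'm) skmon \<Rightarrow>
   ('o, 'm) laxmor \<Rightarrow> ('o, 'm) laxmor \<Rightarrow> ('o, 'm) laxmor" where
  "comp_lax S R Q \<Psi> \<Phi> =
     (let F = FO (LF \<Phi>); G = FO (LF \<Psi>); GA = FA (LF \<Psi>) in
      \<lparr> LF = \<lparr> FO = (\<lambda>a. if a \<in> Ob S then G (F a) else undefined),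
               FA = (\<lambda>a b f. if a \<in> Ob S \<and> b \<in> Ob S \<and> f \<in> Hom S a b
                       then GA (F a) (F b) (FA (LF \<Phi>) a b f) else undefined) \<rparr>,
        L0 = Comp Q (Unit Q) (G (Unit R)) (G (F (Unit S)))
               (GA (Unit R) (F (Unit S)) (L0 \<Phi>)) (L0 \<Psi>),
        L2 = (\<lambda>a b. if a \<in> Ob S \<and> b \<in> Ob S
                then Comp Q (G (F a) \<otimes>\<^bsub>Q\<^esub> G (F b)) (G (F a \<otimes>\<^bsub>R\<^esub> F b)) (G (F (a \<otimes>\<^bsub>S\<^esub> b)))
                       (GA (F a \<otimes>\<^bsub>R\<^esub> F b) (F (a \<otimes>\<^bsub>S\<^esub> b)) (L2 \<Phi> a b)) (L2 \<Psi> (F a) (F b))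
                else undefined) \<rparr>)"

definition SkMon :: "(('o, 'm) skmon, ('o, 'm) laxmor) cat" where
  "SkMon =
     \<lparr> Ob = {S. skew_monoidal_category S},
       Hom = (\<lambda>S R. {\<Phi>. lax_monoidal S R \<Phi>}),
       Idn = id_lax,
       Comp = comp_lax \<rparr>"

definition SkMon_cl :: "(('o, 'm) skmon, ('o, 'm) laxmor) cat" where
  "SkMon_cl = SkMon \<lparr> Ob := {S. skew_monoidal_category S \<and> closed_skmon S} \<rparr>"


section \<open>Multimaps with two types\<close>

datatype ty = Tight | Loose

definition otype :: "ty \<Rightarrow> nat \<Rightarrow> ty \<Rightarrow> ty" where
  "otype x i y =
     (if (x = Tight \<and> y = Tight \<and> i = 1) \<or> (x = Tight \<and> i \<noteq> 1) then Tight else Loose)"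

text \<open>
  One record serves both short skew multicategories and skew multicategories; they differ in
  the arities and operations for which the data are subject to conditions.  Tight unary maps are
  the arrows of the underlying category.  \<open>Sub C x bs c i y as g f\<close> is the substitution
  \<open>g \<circ>\<^sub>i f\<close> (with \<open>i\<close> counted from 1) of \<open>f \<in> C\<^sup>y(as; b\<^sub>i)\<close> into
  \<open>g \<in> C\<^sup>x(bs; c)\<close>; for tight unary \<open>g\<close> or tight unary \<open>f\<close> it is the composition of the
  underlying category or the functorial action of its arrows.
\<close>

record ('o, 'm) multi =
  Obj :: "'o set"
  Maps :: "ty \<Rightarrow> 'o list \<Rightarrow> 'o \<Rightarrow> 'm set"
  Idt :: "'o \<Rightarrow> 'm"
  J :: "'o list \<Rightarrow> 'o \<Rightarrow> 'm \<Rightarrow> 'm"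
  Sub :: "ty \<Rightarrow> 'o list \<Rightarrow> 'o \<Rightarrow> nat \<Rightarrow> ty \<Rightarrow> 'o list \<Rightarrow> 'm \<Rightarrow> 'm \<Rightarrow> 'm"

definition is_map :: "('o, 'm) multi \<Rightarrow> ty \<Rightarrow> 'o list \<Rightarrow> 'o \<Rightarrow> 'm \<Rightarrow> bool" where
  "is_map C x as b f \<longleftrightarrow> set as \<subseteq> Obj C \<and> b \<in> Obj C \<and> f \<in> Maps C x as b"

definition plug :: "'o list \<Rightarrow> nat \<Rightarrow> 'o list \<Rightarrow> 'o list" where
  "plug bs i as = take (i - 1) bs @ as @ drop i bs"

definition arity_long :: "ty \<Rightarrow> nat \<Rightarrow> bool" where
  "arity_long x n \<longleftrightarrow> (x = Tight \<longrightarrow> n \<ge> 1)"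

definition op_long :: "ty \<Rightarrow> nat \<Rightarrow> nat \<Rightarrow> ty \<Rightarrow> nat \<Rightarrow> bool" where
  "op_long x n i y m \<longleftrightarrow> arity_long x n \<and> arity_long y m \<and> 1 \<le> i \<and> i \<le> n"

definition arity_short :: "ty \<Rightarrow> nat \<Rightarrow> bool" where
  "arity_short x n \<longleftrightarrow> (if x = Tight then 1 \<le> n \<and> n \<le> 4 else n \<le> 2)"

text \<open>
  \<open>op_short x n i y m\<close>: maps of type \<open>y\<close> and arity \<open>m\<close> can be substituted into maps of
  type \<open>x\<close> and arity \<open>n\<close>.  The first two disjuncts are the actions of tight unary maps.
\<close>

definition op_short :: "ty \<Rightarrow> nat \<Rightarrow> nat \<Rightarrow> ty \<Rightarrow> nat \<Rightarrow> bool" where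
  "op_short x n i y m \<longleftrightarrow> arity_short x n \<and> arity_short y m \<and> 1 \<le> i \<and> i \<le> n \<and>
     ((x = Tight \<and> n = 1) \<or>
      (y = Tight \<and> m = 1) \<or>
      (x = Tight \<and> n \<in> {2, 3} \<and> y = Tight \<and> m = 2) \<or>
      (x = Tight \<and> n = 2 \<and> y = Tight \<and> m = 3) \<or>
      (x = Tight \<and> n \<in> {2, 3} \<and> y = Loose \<and> m = 0) \<or>
      (x = Loose \<and> n = 1 \<and> y = Loose \<and> m = 0) \<or>
      (x = Tight \<and> n = 2 \<and> y = Loose \<and> m = 1) \<or>
      (x = Loose \<and> n = 1 \<and> y = Tight \<and> m = 2))"

definition well_typed ::
  "(ty \<Rightarrow> nat \<Rightarrow> bool) \<Rightarrow> (ty \<Rightarrow> nat \<Rightarrow> nat \<Rightarrow> ty \<Rightarrow> nat \<Rightarrow> bool) \<Rightarrow> ('o, 'm) multi \<Rightarrow> bool" where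
  "well_typed ar op C \<longleftrightarrow>
     (\<forall>a\<in>Obj C. Idt C a \<in> Maps C Tight [a] a) \<and>
     (\<forall>as b f. ar Tight (length as) \<and> ar Loose (length as) \<and> is_map C Tight as b f \<longrightarrow>
        J C as b f \<in> Maps C Loose as b) \<and>
     (\<forall>x bs c i y as g f. op x (length bs) i y (length as) \<and>
        is_map C x bs c g \<and> is_map C y as (bs ! (i - 1)) f \<longrightarrow>
        Sub C x bs c i y as g f \<in> Maps C (otype x i y) (plug bs i as) c)"

text \<open>\<open>g \<circ>\<^sub>i (f \<circ>\<^sub>j h) = (g \<circ>\<^sub>i f) \<circ>\<^bsub>i+j-1\<^esub> h\<close> for
  \<open>g\<close>, \<open>f\<close>, \<open>h\<close> of types \<open>x\<close>, \<open>y\<close>, \<open>z\<close> and arities \<open>n\<close>, \<open>m\<close>, \<open>p\<close>.\<close>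

definition assoc_law ::
  "('o, 'm) multi \<Rightarrow> ty \<Rightarrow> nat \<Rightarrow> nat \<Rightarrow> ty \<Rightarrow> nat \<Rightarrow> nat \<Rightarrow> ty \<Rightarrow> nat \<Rightarrow> bool" where
  "assoc_law C x n i y m j z p \<longleftrightarrow>
     (\<forall>bs c as ds g f h. length bs = n \<and> length as = m \<and> length ds = p \<and>
        is_map C x bs c g \<and> is_map C y as (bs ! (i - 1)) f \<and> is_map C z ds (as ! (j - 1)) h \<longrightarrow>
        Sub C x bs c i (otype y j z) (plug as j ds) g (Sub C y as (bs ! (i - 1)) j z ds f h) =
        Sub C (otype x i y) (plug bs i as) c (i + j - 1) z ds (Sub C x bs c i y as g f) h)"

text \<open>\<open>(g \<circ>\<^sub>i f) \<circ>\<^bsub>k+m-1\<^esub> h = (g \<circ>\<^sub>k h) \<circ>\<^sub>i f\<close>, used for \<open>i < k\<close>.\<close>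

definition comm_law ::
  "('o, 'm) multi \<Rightarrow> ty \<Rightarrow> nat \<Rightarrow> nat \<Rightarrow> ty \<Rightarrow> nat \<Rightarrow> nat \<Rightarrow> ty \<Rightarrow> nat \<Rightarrow> bool" where
  "comm_law C x n i y m k z p \<longleftrightarrow>
     (\<forall>bs c as ds g f h. length bs = n \<and> length as = m \<and> length ds = p \<and>
        is_map C x bs c g \<and> is_map C y as (bs ! (i - 1)) f \<and> is_map C z ds (bs ! (k - 1)) h \<longrightarrow>
        Sub C (otype x i y) (plug bs i as) c (k + m - 1) z ds (Sub C x bs c i y as g f) h =
        Sub C (otype x k z) (plug bs k ds) c i y as (Sub C x bs c k z ds g h) f)"

definition id_law ::
  "(ty \<Rightarrow> nat \<Rightarrow> bool) \<Rightarrow> ('o, 'm) multi \<Rightarrow> bool" where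
  "id_law ar C \<longleftrightarrow>
     (\<forall>x as b f. ar x (length as) \<and> is_map C x as b f \<longrightarrow>
        Sub C Tight [b] b 1 x as (Idt C b) f = f \<and>
        (\<forall>i. 1 \<le> i \<and> i \<le> length as \<longrightarrow>
           Sub C x as b i Tight [as ! (i - 1)] f (Idt C (as ! (i - 1))) = f))"


section \<open>Short skew multicategories\<close>

text \<open>
  The laws \<open>outer\<close>, \<open>middle\<close>, \<open>inner\<close> and \<open>parallel\<close> have a tight unary map among their
  constituents.  Where the other operation involved is itself an action, they say, with
  \<open>id_law\<close>, that the tight unary maps form a category and that the \<open>C\<^sup>x\<^sub>n\<close> are functors of
  \<open>n + 1\<close> variables; otherwise they say that substitution is natural in \<open>c\<close> (\<open>outer\<close>),
  dinatural in \<open>b\<^sub>i\<close> (\<open>middle\<close>), and natural in the \<open>a\<^sub>k\<close> (\<open>inner\<close>) and in the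
  \<open>b\<^sub>k\<close>, \<open>k \<noteq> i\<close> (\<open>parallel\<close>).
\<close>

locale short_skew_multicategory =
  fixes C :: "('o, 'm) multi"
  assumes typed: "well_typed arity_short op_short C"
    and identities: "id_law arity_short C"
    and outer: "op_short y m j z r \<Longrightarrow> assoc_law C Tight 1 1 y m j z r"
    and middle: "op_short x n i z r \<Longrightarrow> assoc_law C x n i Tight 1 1 z r"
    and inner: "\<lbrakk>op_short x n i y m; 1 \<le> k; k \<le> m\<rbrakk> \<Longrightarrow> assoc_law C x n i y m k Tight 1"
    and parallel_right: "\<lbrakk>op_short x n i y m; i < k; k \<le> n\<rbrakk> \<Longrightarrow> comm_law C x n i y m k Tight 1"
    and parallel_left: "\<lbrakk>op_short x n i y m; 1 \<le> k; k < i\<rbrakk> \<Longrightarrow> comm_law C x n k Tight 1 i y m"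
    and assoc_axiom:
      "\<lbrakk>i \<in> {1, 2}; j \<in> {1, 2}; (z, r) \<in> {(Tight, 2), (Loose, 0)}\<rbrakk> \<Longrightarrow>
       assoc_law C Tight 2 i Tight 2 j z r"
    and comm_axiom:
      "\<lbrakk>(y, n) \<in> {(Tight, 2), (Loose, 0)}; (z, r) \<in> {(Tight, 2), (Loose, 0)}\<rbrakk> \<Longrightarrow>
       comm_law C Tight 2 1 y n 2 z r"
    and j_natural_outer:
      "\<lbrakk>length as \<in> {1, 2}; is_map C Tight as b f; is_map C Tight [b] c q\<rbrakk> \<Longrightarrow>
       Sub C Tight [b] c 1 Loose as q (J C as b f) = J C as c (Sub C Tight [b] c 1 Tight as q f)"
    and j_natural_inner:
      "\<lbrakk>length as \<in> {1, 2}; 1 \<le> i; i \<le> length as;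
        is_map C Tight as b f; is_map C Tight [a] (as ! (i - 1)) p\<rbrakk> \<Longrightarrow>
       Sub C Loose as b i Tight [a] (J C as b f) p =
       J C (plug as i [a]) b (Sub C Tight as b i Tight [a] f p)"
    and j_second:
      "\<lbrakk>is_map C Tight [b1, b2] c g; is_map C Tight [a] b2 p\<rbrakk> \<Longrightarrow>
       Sub C Tight [b1, b2] c 2 Loose [a] g (J C [a] b2 p) = Sub C Tight [b1, b2] c 2 Tight [a] g p"
    and j_first:
      "\<lbrakk>is_map C Tight [b1, b2] c g; is_map C Tight [a] b1 p\<rbrakk> \<Longrightarrow>
       Sub C Tight [b1, b2] c 1 Loose [a] g (J C [a] b1 p) =
       J C [a, b2] c (Sub C Tight [b1, b2] c 1 Tight [a] g p)"
    and j_after_unary: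
      "\<lbrakk>is_map C Tight [a] b p; is_map C Tight [b] c q\<rbrakk> \<Longrightarrow>
       Sub C Tight [b] c 1 Loose [a] q (J C [a] b p) = J C [a] c (Sub C Tight [b] c 1 Tight [a] q p)"
    and j_before_binary:
      "\<lbrakk>is_map C Tight [a1, a2] b g; is_map C Tight [b] c p\<rbrakk> \<Longrightarrow>
       Sub C Loose [b] c 1 Tight [a1, a2] (J C [b] c p) g =
       J C [a1, a2] c (Sub C Tight [b] c 1 Tight [a1, a2] p g)"
    and j_before_nullary:
      "\<lbrakk>is_map C Loose [] b v; is_map C Tight [b] c p\<rbrakk> \<Longrightarrow>
       Sub C Loose [b] c 1 Loose [] (J C [b] c p) v = Sub C Tight [b] c 1 Loose [] p v"

text \<open>
  The data \<open>ab\<close>, \<open>\<theta>\<^sub>a\<^sub>,\<^sub>b\<close>, \<open>i\<close>, \<open>u\<close> of left representability, bundled so that a choice of them for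
  every structure is a single function.
\<close>

record ('o, 'm) classifiers =
  ctens :: "'o \<Rightarrow> 'o \<Rightarrow> 'o"
  ctheta :: "'o \<Rightarrow> 'o \<Rightarrow> 'm"
  cunit :: "'o"
  cnull :: "'m"

definition classifiers_short :: "('o, 'm) multi \<Rightarrow> ('o, 'm) classifiers \<Rightarrow> bool" where
  "classifiers_short C \<chi> \<longleftrightarrow>
     (\<forall>a\<in>Obj C. \<forall>b\<in>Obj C.
        is_map C Tight [a, b] (ctens \<chi> a b) (ctheta \<chi> a b) \<and>
        (\<forall>xs d. set xs \<subseteq> Obj C \<and> d \<in> Obj C \<and> Suc (length xs) \<in> {1, 2, 3} \<longrightarrow>
           bij_betw (\<lambda>f. Sub C Tight (ctens \<chi> a b # xs) d 1 Tight [a, b] f (ctheta \<chi> a b))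
             (Maps C Tight (ctens \<chi> a b # xs) d) (Maps C Tight (a # b # xs) d))) \<and>
     is_map C Loose [] (cunit \<chi>) (cnull \<chi>) \<and>
     (\<forall>xs d. set xs \<subseteq> Obj C \<and> d \<in> Obj C \<and> length xs \<in> {0, 1, 2} \<longrightarrow>
        bij_betw (\<lambda>f. Sub C Tight (cunit \<chi> # xs) d 1 Loose [] f (cnull \<chi>))
          (Maps C Tight (cunit \<chi> # xs) d) (Maps C Loose xs d))"

definition left_representable_short :: "('o, 'm) multi \<Rightarrow> bool" where
  "left_representable_short C \<longleftrightarrow> (\<exists>\<chi>. classifiers_short C \<chi>)"

definition closed_short :: "('o, 'm) multi \<Rightarrow> bool" where
  "closed_short C \<longleftrightarrow>
     (\<forall>b\<in>Obj C. \<forall>c\<in>Obj C. \<exists>h e. h \<in> Obj C \<and> is_map C Tight [h, b] c e \<and>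
        (\<forall>xs. set xs \<subseteq> Obj C \<and> length xs \<in> {1, 2, 3} \<longrightarrow>
           bij_betw (\<lambda>f. Sub C Tight [h, b] c 1 Tight xs e f)
             (Maps C Tight xs h) (Maps C Tight (xs @ [b]) c)) \<and>
        (\<forall>xs. set xs \<subseteq> Obj C \<and> length xs \<in> {0, 1} \<longrightarrow>
           bij_betw (\<lambda>f. Sub C Tight [h, b] c 1 Loose xs e f)
             (Maps C Loose xs h) (Maps C Loose (xs @ [b]) c)))"


section \<open>Skew multicategories\<close>

locale skew_multicategory =
  fixes C :: "('o, 'm) multi"
  assumes typed: "well_typed arity_long op_long C"
    and identities: "id_law arity_long C"
    and associativity:
      "\<lbrakk>op_long x n i y m; op_long y m j z p\<rbrakk> \<Longrightarrow> assoc_law C x n i y m j z p"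
    and commutativity:
      "\<lbrakk>op_long x n i y m; op_long x n k z p; i < k\<rbrakk> \<Longrightarrow> comm_law C x n i y m k z p"
    and j_argument:
      "\<lbrakk>op_long x (length bs) i Tight (length as);
        is_map C x bs c g; is_map C Tight as (bs ! (i - 1)) f\<rbrakk> \<Longrightarrow>
       Sub C x bs c i Loose as g (J C as (bs ! (i - 1)) f) =
       (if otype x i Loose = otype x i Tight then Sub C x bs c i Tight as g f
        else J C (plug bs i as) c (Sub C x bs c i Tight as g f))"
    and j_function:
      "\<lbrakk>op_long Tight (length bs) i y (length as);
        is_map C Tight bs c g; is_map C y as (bs ! (i - 1)) f\<rbrakk> \<Longrightarrow>
       Sub C Loose bs c i y as (J C bs c g) f =
       (if otype Loose i y = otype Tight i y then Sub C Tight bs c i y as g f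
        else J C (plug bs i as) c (Sub C Tight bs c i y as g f))"

definition left_representable :: "('o, 'm) multi \<Rightarrow> bool" where
  "left_representable C \<longleftrightarrow>
     (\<forall>x as. arity_long x (length as) \<and> set as \<subseteq> Obj C \<longrightarrow>
        (\<exists>m \<theta>. is_map C x as m \<theta> \<and>
           (\<forall>ys b. set ys \<subseteq> Obj C \<and> b \<in> Obj C \<longrightarrow>
              bij_betw (\<lambda>f. Sub C Tight (m # ys) b 1 x as f \<theta>)
                (Maps C Tight (m # ys) b) (Maps C x (as @ ys) b))))"

definition closed_multi :: "('o, 'm) multi \<Rightarrow> bool" where
  "closed_multi C \<longleftrightarrow>
     (\<forall>b\<in>Obj C. \<forall>c\<in>Obj C. \<exists>h e. h \<in> Obj C \<and> is_map C Tight [h, b] c e \<and>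
        (\<forall>x as. arity_long x (length as) \<and> set as \<subseteq> Obj C \<longrightarrow>
           bij_betw (\<lambda>f. Sub C Tight [h, b] c 1 x as e f)
             (Maps C x as h) (Maps C x (as @ [b]) c)))"


section \<open>The categories of (short) skew multicategories\<close>

text \<open>The component \<open>F\<^sup>t\<^sub>1\<close> is the arrow part of the underlying functor.\<close>

record ('o, 'm) multimor =
  MO :: "'o \<Rightarrow> 'o"
  MM :: "ty \<Rightarrow> 'o list \<Rightarrow> 'o \<Rightarrow> 'm \<Rightarrow> 'm"

text \<open>
  Preservation of \<open>Idt\<close> and of substitution includes functoriality and naturality, these
  being the cases where one of the maps is tight unary.  As for lax monoidal functors, the
  components are \<open>undefined\<close> off their domains.
\<close>

definition multi_morphism ::
  "(ty \<Rightarrow> nat \<Rightarrow> bool) \<Rightarrow> (ty \<Rightarrow> nat \<Rightarrow> nat \<Rightarrow> ty \<Rightarrow> nat \<Rightarrow> bool) \<Rightarrow>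
   ('o, 'm) multi \<Rightarrow> ('o, 'm) multi \<Rightarrow> ('o, 'm) multimor \<Rightarrow> bool" where
  "multi_morphism ar op C D F \<longleftrightarrow>
     (\<forall>a\<in>Obj C. MO F a \<in> Obj D) \<and>
     (\<forall>x as b f. ar x (length as) \<and> is_map C x as b f \<longrightarrow>
        MM F x as b f \<in> Maps D x (map (MO F) as) (MO F b)) \<and>
     (\<forall>a\<in>Obj C. MM F Tight [a] a (Idt C a) = Idt D (MO F a)) \<and>
     (\<forall>x bs c i y as g f. op x (length bs) i y (length as) \<and>
        is_map C x bs c g \<and> is_map C y as (bs ! (i - 1)) f \<longrightarrow>
        MM F (otype x i y) (plug bs i as) c (Sub C x bs c i y as g f) =
        Sub D x (map (MO F) bs) (MO F c) i y (map (MO F) as)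
          (MM F x bs c g) (MM F y as (bs ! (i - 1)) f)) \<and>
     (\<forall>as b f. ar Tight (length as) \<and> ar Loose (length as) \<and> is_map C Tight as b f \<longrightarrow>
        MM F Loose as b (J C as b f) = J D (map (MO F) as) (MO F b) (MM F Tight as b f)) \<and>
     (\<forall>a. a \<notin> Obj C \<longrightarrow> MO F a = undefined) \<and>
     (\<forall>x as b f. \<not> (ar x (length as) \<and> is_map C x as b f) \<longrightarrow> MM F x as b f = undefined)"

definition id_multimor :: "(ty \<Rightarrow> nat \<Rightarrow> bool) \<Rightarrow> ('o, 'm) multi \<Rightarrow> ('o, 'm) multimor" where
  "id_multimor ar C =
     \<lparr> MO = (\<lambda>a. if a \<in> Obj C then a else undefined),
       MM = (\<lambda>x as b f. if ar x (length as) \<and> is_map C x as b f then f else undefined) \<rparr>"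

definition comp_multimor ::
  "(ty \<Rightarrow> nat \<Rightarrow> bool) \<Rightarrow> ('o, 'm) multi \<Rightarrow> ('o, 'm) multi \<Rightarrow> ('o, 'm) multi \<Rightarrow>
   ('o, 'm) multimor \<Rightarrow> ('o, 'm) multimor \<Rightarrow> ('o, 'm) multimor" where
  "comp_multimor ar C D E G F =
     \<lparr> MO = (\<lambda>a. if a \<in> Obj C then MO G (MO F a) else undefined),
       MM = (\<lambda>x as b f. if ar x (length as) \<and> is_map C x as b f
               then MM G x (map (MO F) as) (MO F b) (MM F x as b f) else undefined) \<rparr>"

definition multi_cat ::
  "(ty \<Rightarrow> nat \<Rightarrow> bool) \<Rightarrow> (ty \<Rightarrow> nat \<Rightarrow> nat \<Rightarrow> ty \<Rightarrow> nat \<Rightarrow> bool) \<Rightarrow> ('o, 'm) multi set \<Rightarrow>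
   (('o, 'm) multi, ('o, 'm) multimor) cat" where
  "multi_cat ar op X =
     \<lparr> Ob = X,
       Hom = (\<lambda>C D. {F. multi_morphism ar op C D F}),
       Idn = id_multimor ar,
       Comp = comp_multimor ar \<rparr>"

definition ShSkMulti_lr :: "(('o, 'm) multi, ('o, 'm) multimor) cat" where
  "ShSkMulti_lr = multi_cat arity_short op_short
     {C. short_skew_multicategory C \<and> left_representable_short C}"

definition ShSkMulti_cl_lr :: "(('o, 'm) multi, ('o, 'm) multimor) cat" where
  "ShSkMulti_cl_lr = multi_cat arity_short op_short
     {C. short_skew_multicategory C \<and> left_representable_short C \<and> closed_short C}"

definition SkMulti_cl_lr :: "(('o, 'm) multi, ('o, 'm) multimor) cat" where
  "SkMulti_cl_lr = multi_cat arity_long op_long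
     {C. skew_multicategory C \<and> left_representable C \<and> closed_multi C}"


section \<open>The forgetful functor and the comparison functors\<close>

definition truncate_multi :: "('o, 'm) multi \<Rightarrow> ('o, 'm) multi" where
  "truncate_multi C =
     \<lparr> Obj = Obj C,
       Maps = (\<lambda>x as b. if arity_short x (length as) then Maps C x as b else {}),
       Idt = Idt C,
       J = (\<lambda>as b f. if arity_short Tight (length as) \<and> arity_short Loose (length as)
              then J C as b f else undefined),
       Sub = (\<lambda>x bs c i y as g f. if op_short x (length bs) i y (length as)
                then Sub C x bs c i y as g f else undefined) \<rparr>"

definition truncate_multimor :: "('o, 'm) multimor \<Rightarrow> ('o, 'm) multimor" where
  "truncate_multimor F =
     \<lparr> MO = MO F,
       MM = (\<lambda>x as b f. if arity_short x (length as) then MM F x as b f else undefined) \<rparr>"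

definition U_cl_lr ::
  "(('o, 'm) multi, ('o, 'm) multimor, ('o, 'm) multi, ('o, 'm) multimor) fctr" where
  "U_cl_lr = \<lparr> FO = truncate_multi, FA = (\<lambda>C D F. truncate_multimor F) \<rparr>"

definition skmon_of :: "('o, 'm) multi \<Rightarrow> ('o, 'm) classifiers \<Rightarrow> ('o, 'm) skmon" where
  "skmon_of C \<chi> =
     (let t = ctens \<chi>; \<theta> = ctheta \<chi>; i = cunit \<chi>; u = cnull \<chi> in
      \<lparr> Ob = Obj C,
        Hom = (\<lambda>a b. Maps C Tight [a] b),
        Idn = Idt C,
        Comp = (\<lambda>a b c g f. Sub C Tight [b] c 1 Tight [a] g f),
        TO = t,
        TA = (\<lambda>a b c d f g. THE k. k \<in> Maps C Tight [t a c] (t b d) \<and>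
                Sub C Tight [t a c] (t b d) 1 Tight [a, c] k (\<theta> a c) =
                Sub C Tight [a, d] (t b d) 2 Tight [c]
                  (Sub C Tight [b, d] (t b d) 1 Tight [a] (\<theta> b d) f) g),
        Unit = i,
        Assoc = (\<lambda>a b c. THE k. k \<in> Maps C Tight [t (t a b) c] (t a (t b c)) \<and>
                Sub C Tight [t a b, c] (t a (t b c)) 1 Tight [a, b]
                  (Sub C Tight [t (t a b) c] (t a (t b c)) 1 Tight [t a b, c] k (\<theta> (t a b) c))
                  (\<theta> a b) =
                Sub C Tight [a, t b c] (t a (t b c)) 2 Tight [b, c] (\<theta> a (t b c)) (\<theta> b c)),
        LUnit = (\<lambda>a. THE k. k \<in> Maps C Tight [t i a] a \<and>
                Sub C Tight [i, a] a 1 Loose []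
                  (Sub C Tight [t i a] a 1 Tight [i, a] k (\<theta> i a)) u =
                J C [a] a (Idt C a)),
        RUnit = (\<lambda>a. Sub C Tight [a, i] (t a i) 2 Loose [] (\<theta> a i) u) \<rparr>)"

definition lax_of ::
  "('o, 'm) multi \<Rightarrow> ('o, 'm) classifiers \<Rightarrow> ('o, 'm) multi \<Rightarrow> ('o, 'm) classifiers \<Rightarrow>
   ('o, 'm) multimor \<Rightarrow> ('o, 'm) laxmor" where
  "lax_of C \<chi> D \<psi> F =
     \<lparr> LF = \<lparr> FO = MO F, FA = (\<lambda>a b f. MM F Tight [a] b f) \<rparr>,
       L0 = (THE k. k \<in> Maps D Tight [cunit \<psi>] (MO F (cunit \<chi>)) \<and>
              Sub D Tight [cunit \<psi>] (MO F (cunit \<chi>)) 1 Loose [] k (cnull \<psi>) =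
              MM F Loose [] (cunit \<chi>) (cnull \<chi>)),
       L2 = (\<lambda>a b. if a \<in> Obj C \<and> b \<in> Obj C
              then (THE k. k \<in> Maps D Tight [ctens \<psi> (MO F a) (MO F b)] (MO F (ctens \<chi> a b)) \<and>
                     Sub D Tight [ctens \<psi> (MO F a) (MO F b)] (MO F (ctens \<chi> a b)) 1
                       Tight [MO F a, MO F b] k (ctheta \<psi> (MO F a) (MO F b)) =
                     MM F Tight [a, b] (ctens \<chi> a b) (ctheta \<chi> a b))
              else undefined) \<rparr>"

text \<open>
  The functor \<open>K_s ch\<close> depends on a choice \<open>ch\<close> of classifiers for left representable short
  skew multicategories; \<open>T_s ch\<close> is computed in a skew multicategory \<open>C\<close> itself, with the
  classifiers chosen for its truncation.
\<close>

definition K_s ::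
  "(('o, 'm) multi \<Rightarrow> ('o, 'm) classifiers) \<Rightarrow>
   (('o, 'm) multi, ('o, 'm) multimor, ('o, 'm) skmon, ('o, 'm) laxmor) fctr" where
  "K_s ch = \<lparr> FO = (\<lambda>C. skmon_of C (ch C)), FA = (\<lambda>C D F. lax_of C (ch C) D (ch D) F) \<rparr>"

definition T_s ::
  "(('o, 'm) multi \<Rightarrow> ('o, 'm) classifiers) \<Rightarrow>
   (('o, 'm) multi, ('o, 'm) multimor, ('o, 'm) skmon, ('o, 'm) laxmor) fctr" where
  "T_s ch =
     \<lparr> FO = (\<lambda>C. skmon_of C (ch (truncate_multi C))),
       FA = (\<lambda>C D F. lax_of C (ch (truncate_multi C)) D (ch (truncate_multi D)) F) \<rparr>"

end

theory Submission
  imports Defs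
begin

text \<open>
  In a left representable (short) skew multicategory the maps are arrows of the underlying category
  in disguise.  Substituting binary classifiers one after another, and finally the nullary
  classifier if the map is to be loose, gives a bijection \<open>EM\<close> from the arrows out of the left
  bracketed product \<open>a\<^sub>1\<dots>a\<^sub>n\<close>, or \<open>i a\<^sub>1\<dots>a\<^sub>n\<close> for loose maps, to the maps with inputs
  \<open>a\<^sub>1,\<dots>,a\<^sub>n\<close>.  In terms of arrows, substitution is a formula \<open>lsub\<close> and \<open>j\<close> is a formula
  \<open>loosen\<close>, both built from tensor product, composition, \<open>\<alpha>\<close>, \<open>\<lambda>\<close> and \<open>\<rho>\<close> only (\<open>EC_sub\<close>,
  \<open>EC_jj\<close>).  This dictionary does all the work.

  Each skew monoidal axiom says that two arrows are equal; under the dictionary the equation is an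
  associativity or commutativity law, or a compatibility with \<open>j\<close>, for maps of small arity built
  from classifiers.  So \<open>skmon_of\<close> yields skew monoidal categories (\<open>skew_monoidal_S\<close>).

  A morphism \<open>F\<close> of multicategories sends the map that corresponds to an arrow \<open>f\<close> to the one that
  corresponds to \<open>F f\<close> composed with iterated coherence maps \<open>f\<^sub>2\<close> and \<open>f\<^sub>0\<close> (\<open>mact_EC\<close>).  Hence \<open>F\<close> is
  determined by its lax monoidal functor, and the same formula turns any lax monoidal functor into a
  morphism of multicategories: the comparison functors are fully faithful (\<open>lax_of_faithful\<close>,
  \<open>lax_of_full\<close>).

  Conversely, a skew monoidal category \<open>S\<close> has a skew multicategory \<open>multi_of S\<close>: its maps are, by
  definition, arrows out of left bracketed products, and it composes by \<open>lsub\<close>.  The axioms of a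
  skew multicategory become coherence statements in \<open>S\<close> (\<open>lsub_assoc\<close>, \<open>lsub_comm\<close>).  With identity
  arrows as classifiers its skew monoidal category is \<open>S\<close> again, and another choice of classifiers
  gives an isomorphic one, because a change of classifiers is a change of the skew monoidal category
  assigned to the same multicategory, along which the identity morphism becomes invertible
  (\<open>iso_in_choice\<close>).  So the comparison functors are essentially surjective.

  None of this depends on whether maps of all arities are present or only those of a short skew
  multicategory.  Therefore the argument is carried out once, in a locale with an arbitrary supply
  of arities and substitutions that satisfies a list of closure conditions
  (\<open>truncated_multicategory\<close>), of which both notions are instances.

  The closed structure restricts along all this: a right adjoint of \<open>- \<otimes> b\<close> is the bijection in the
  definition of closedness for unary maps, and it already implies the bijections for all arities,
  since maps of any arity are arrows (\<open>closed_skmonI\<close>, \<open>closed_multi_of\<close>).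

  Finally, the formulas that define the skew monoidal category and the lax monoidal functor mention
  only maps that truncation keeps, so the triangle commutes on the nose, and the forgetful functor
  is an equivalence because the other two sides of the triangle are.
\<close>

section \<open>Arrows with their source and target\<close>

text \<open>
  Hom-sets need not be disjoint, so an element of a hom-set does not know its source and target.
  Carrying them along makes composition and tensor product operations on arrows alone, and equations
  between long composites become readable.
\<close>

type_synonym ('o, 'm) arrow = "'o \<times> 'm \<times> 'o"

abbreviation source :: "('o, 'm) arrow \<Rightarrow> 'o" where "source f \<equiv> fst f"
abbreviation label :: "('o, 'm) arrow \<Rightarrow> 'm" where "label f \<equiv> fst (snd f)"
abbreviation target :: "('o, 'm) arrow \<Rightarrow> 'o" where "target f \<equiv> snd (snd f)"

definition arr :: "('o, 'm, 'z) cat_scheme \<Rightarrow> ('o, 'm) arrow \<Rightarrow> bool" where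
  "arr C f \<longleftrightarrow> source f \<in> Ob C \<and> target f \<in> Ob C \<and> label f \<in> Hom C (source f) (target f)"

definition cmp :: "('o, 'm, 'z) cat_scheme \<Rightarrow> ('o, 'm) arrow \<Rightarrow> ('o, 'm) arrow \<Rightarrow> ('o, 'm) arrow"
    (infixr "\<cdot>\<index>" 65) where
  "cmp C g f =
     (source f, Comp C (source f) (source g) (target g) (label g) (label f), target g)"

definition idar :: "('o, 'm, 'z) cat_scheme \<Rightarrow> 'o \<Rightarrow> ('o, 'm) arrow" ("\<I>\<index>") where
  "idar C a = (a, Idn C a, a)"

lemma cmp_source [simp]: "source (cmp C g f) = source f"
  and cmp_target [simp]: "target (cmp C g f) = target g"
  by (simp_all add: cmp_def)

lemma idar_source [simp]: "source (idar C a) = a"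
  and idar_target [simp]: "target (idar C a) = a"
  by (simp_all add: idar_def)

lemma arr_source [simp]: "arr C f \<Longrightarrow> source f \<in> Ob C"
  and arr_target [simp]: "arr C f \<Longrightarrow> target f \<in> Ob C"
  by (simp_all add: arr_def)

lemma arr_triple [simp]: "arr C (a, m, b) \<longleftrightarrow> a \<in> Ob C \<and> b \<in> Ob C \<and> m \<in> Hom C a b"
  by (simp add: arr_def)

locale cat_laws =
  fixes C :: "('o, 'm, 'z) cat_scheme" (structure)
  assumes category: "category C"
begin

lemma arr_cmp [simp]: "\<lbrakk>arr C f; arr C g; target f = source g\<rbrakk> \<Longrightarrow> arr C (g \<cdot> f)"
  using category unfolding category_def arr_def cmp_def by auto

lemma arr_idar [simp]: "arr C (\<I> a) \<longleftrightarrow> a \<in> Ob C"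
  using category unfolding category_def arr_def idar_def by auto

lemma cmp_idar_right [simp]: "\<lbrakk>arr C f; source f = a\<rbrakk> \<Longrightarrow> f \<cdot> \<I> a = f"
  using category unfolding category_def arr_def cmp_def idar_def by (auto simp: prod_eq_iff)

lemma cmp_idar_left [simp]: "\<lbrakk>arr C f; target f = a\<rbrakk> \<Longrightarrow> \<I> a \<cdot> f = f"
  using category unfolding category_def arr_def cmp_def idar_def by (auto simp: prod_eq_iff)

lemma cmp_assoc [simp]:
  "\<lbrakk>arr C f; arr C g; arr C h; target f = source g; target g = source h\<rbrakk> \<Longrightarrow>
   (h \<cdot> g) \<cdot> f = h \<cdot> g \<cdot> f"
  using category unfolding category_def arr_def cmp_def by (auto simp: prod_eq_iff)

end

section \<open>Tensor products of arrows\<close>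

definition tns :: "('o, 'm) skmon \<Rightarrow> ('o, 'm) arrow \<Rightarrow> ('o, 'm) arrow \<Rightarrow> ('o, 'm) arrow"
    (infixl "\<star>\<index>" 71) where
  "tns S f g =
     (source f \<otimes>\<^bsub>S\<^esub> source g,
      TA S (source f) (target f) (source g) (target g) (label f) (label g),
      target f \<otimes>\<^bsub>S\<^esub> target g)"

definition asr :: "('o, 'm) skmon \<Rightarrow> 'o \<Rightarrow> 'o \<Rightarrow> 'o \<Rightarrow> ('o, 'm) arrow" ("\<alpha>\<index>") where
  "asr S a b c = (a \<otimes>\<^bsub>S\<^esub> b \<otimes>\<^bsub>S\<^esub> c, Assoc S a b c, a \<otimes>\<^bsub>S\<^esub> (b \<otimes>\<^bsub>S\<^esub> c))"

definition lun :: "('o, 'm) skmon \<Rightarrow> 'o \<Rightarrow> ('o, 'm) arrow" ("\<Lambda>\<index>") where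
  "lun S a = (Unit S \<otimes>\<^bsub>S\<^esub> a, LUnit S a, a)"

definition run :: "('o, 'm) skmon \<Rightarrow> 'o \<Rightarrow> ('o, 'm) arrow" ("\<rho>\<index>") where
  "run S a = (a, RUnit S a, a \<otimes>\<^bsub>S\<^esub> Unit S)"

lemma tns_source [simp]: "source (tns S f g) = source f \<otimes>\<^bsub>S\<^esub> source g"
  and tns_target [simp]: "target (tns S f g) = target f \<otimes>\<^bsub>S\<^esub> target g"
  by (simp_all add: tns_def)

lemma asr_source [simp]: "source (asr S a b c) = a \<otimes>\<^bsub>S\<^esub> b \<otimes>\<^bsub>S\<^esub> c"
  and asr_target [simp]: "target (asr S a b c) = a \<otimes>\<^bsub>S\<^esub> (b \<otimes>\<^bsub>S\<^esub> c)"
  by (simp_all add: asr_def)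

lemma lun_source [simp]: "source (lun S a) = Unit S \<otimes>\<^bsub>S\<^esub> a"
  and lun_target [simp]: "target (lun S a) = a"
  by (simp_all add: lun_def)

lemma run_source [simp]: "source (run S a) = a"
  and run_target [simp]: "target (run S a) = a \<otimes>\<^bsub>S\<^esub> Unit S"
  by (simp_all add: run_def)

locale tensor_category =
  fixes S :: "('o, 'm) skmon" (structure)
  assumes tensor_functor: "is_functor (prod_cat S S) S (tensor_fctr S)"
    and underlying_category: "category S"
    and unit_ob [simp]: "Unit S \<in> Ob S"
    and assoc_hom: "\<lbrakk>a \<in> Ob S; b \<in> Ob S; c \<in> Ob S\<rbrakk> \<Longrightarrow>
          Assoc S a b c \<in> Hom S (a \<otimes> b \<otimes> c) (a \<otimes> (b \<otimes> c))"
    and lunit_hom: "a \<in> Ob S \<Longrightarrow> LUnit S a \<in> Hom S (Unit S \<otimes> a) a"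
    and runit_hom: "a \<in> Ob S \<Longrightarrow> RUnit S a \<in> Hom S a (a \<otimes> Unit S)"

sublocale skew_monoidal_category \<subseteq> tensor_category S
  by unfold_locales
    (rule tensor_functor underlying_category unit_ob assoc_hom lunit_hom runit_hom; assumption?)+

sublocale tensor_category \<subseteq> cat_laws S
  by unfold_locales (rule underlying_category)

lemma tensor_functor_iff:
  assumes "category S"
  shows "is_functor (prod_cat S S) S (tensor_fctr S) \<longleftrightarrow>
     (\<forall>a\<in>Ob S. \<forall>b\<in>Ob S. a \<otimes>\<^bsub>S\<^esub> b \<in> Ob S) \<and>
     (\<forall>f g. arr S f \<longrightarrow> arr S g \<longrightarrow> arr S (f \<star>\<^bsub>S\<^esub> g)) \<and>
     (\<forall>a\<in>Ob S. \<forall>b\<in>Ob S. \<I>\<^bsub>S\<^esub> a \<star>\<^bsub>S\<^esub> \<I>\<^bsub>S\<^esub> b = \<I>\<^bsub>S\<^esub> (a \<otimes>\<^bsub>S\<^esub> b)) \<and>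
     (\<forall>f g f' g'. arr S f \<longrightarrow> arr S g \<longrightarrow> arr S f' \<longrightarrow> arr S g' \<longrightarrow>
        target f = source g \<longrightarrow> target f' = source g' \<longrightarrow>
        (g \<cdot>\<^bsub>S\<^esub> f) \<star>\<^bsub>S\<^esub> (g' \<cdot>\<^bsub>S\<^esub> f') = g \<star>\<^bsub>S\<^esub> g' \<cdot>\<^bsub>S\<^esub> f \<star>\<^bsub>S\<^esub> f')" (is "?l = ?r")
proof
  have pc: "category (prod_cat S S)"
    using assms unfolding category_def prod_cat_def by auto
  show "?l \<Longrightarrow> ?r"
    unfolding is_functor_def prod_cat_def tensor_fctr_def arr_def cmp_def idar_def tns_def
    apply simp apply blast done
  assume ?r
  then show ?l using pc assms
    unfolding is_functor_def
    apply (simp add: prod_cat_def tensor_fctr_def)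
    apply (simp add: arr_def cmp_def idar_def tns_def)
    done
qed

context tensor_category
begin

lemma tensor_ob [simp]: "\<lbrakk>a \<in> Ob S; b \<in> Ob S\<rbrakk> \<Longrightarrow> a \<otimes> b \<in> Ob S"
  and arr_tns [simp]: "\<lbrakk>arr S f; arr S g\<rbrakk> \<Longrightarrow> arr S (f \<star> g)"
  and tns_idar [simp]: "\<lbrakk>a \<in> Ob S; b \<in> Ob S\<rbrakk> \<Longrightarrow> \<I> a \<star> \<I> b = \<I> (a \<otimes> b)"
  and tns_cmp: "\<lbrakk>arr S f; arr S g; arr S f'; arr S g'; target f = source g; target f' = source g'\<rbrakk> \<Longrightarrow>
        (g \<cdot> f) \<star> (g' \<cdot> f') = g \<star> g' \<cdot> f \<star> f'"
  using tensor_functor unfolding tensor_functor_iff[OF underlying_category] by blast+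

lemma arr_asr [simp]: "\<lbrakk>a \<in> Ob S; b \<in> Ob S; c \<in> Ob S\<rbrakk> \<Longrightarrow> arr S (\<alpha> a b c)"
  and arr_lun [simp]: "a \<in> Ob S \<Longrightarrow> arr S (\<Lambda> a)"
  and arr_run [simp]: "a \<in> Ob S \<Longrightarrow> arr S (\<rho> a)"
  by (simp_all add: asr_def lun_def run_def assoc_hom lunit_hom runit_hom)

lemma tns_cmp_right [simp]:
  "\<lbrakk>arr S f; arr S g; a \<in> Ob S; target f = source g\<rbrakk> \<Longrightarrow> \<I> a \<star> (g \<cdot> f) = \<I> a \<star> g \<cdot> \<I> a \<star> f"
  using tns_cmp[of "\<I> a" "\<I> a" f g] by simp

lemma tns_cmp_left [simp]:
  "\<lbrakk>arr S f; arr S g; a \<in> Ob S; target f = source g\<rbrakk> \<Longrightarrow> (g \<cdot> f) \<star> \<I> a = g \<star> \<I> a \<cdot> f \<star> \<I> a"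
  using tns_cmp[of f g "\<I> a" "\<I> a"] by simp

end

section \<open>Left bracketed products and substitution of arrows\<close>

primrec tob :: "('o, 'm) skmon \<Rightarrow> 'o \<Rightarrow> 'o list \<Rightarrow> 'o" where
  "tob S a [] = a"
| "tob S a (x # xs) = tob S (a \<otimes>\<^bsub>S\<^esub> x) xs"

text \<open>
  The functor \<open>tob S _ xs\<close> on arrows.
\<close>

primrec tar :: "('o, 'm) skmon \<Rightarrow> 'o list \<Rightarrow> ('o, 'm) arrow \<Rightarrow> ('o, 'm) arrow" where
  "tar S [] f = f"
| "tar S (x # xs) f = tar S xs (f \<star>\<^bsub>S\<^esub> \<I>\<^bsub>S\<^esub> x)"

text \<open>
  The canonical arrow \<open>(w a) x\<^sub>1 \<dots> x\<^sub>n \<rightarrow> w (a x\<^sub>1 \<dots> x\<^sub>n)\<close> obtained by iterating \<open>\<alpha>\<close>, where all products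
  are bracketed to the left.
\<close>

primrec gam :: "('o, 'm) skmon \<Rightarrow> 'o \<Rightarrow> 'o \<Rightarrow> 'o list \<Rightarrow> ('o, 'm) arrow" where
  "gam S w a [] = \<I>\<^bsub>S\<^esub> (w \<otimes>\<^bsub>S\<^esub> a)"
| "gam S w a (x # xs) = gam S w (a \<otimes>\<^bsub>S\<^esub> x) xs \<cdot>\<^bsub>S\<^esub> tar S xs (\<alpha>\<^bsub>S\<^esub> w a x)"

lemma tob_append [simp]: "tob S a (xs @ ys) = tob S (tob S a xs) ys"
  by (induction xs arbitrary: a) auto

lemma tar_append [simp]: "tar S (xs @ ys) f = tar S ys (tar S xs f)"
  by (induction xs arbitrary: f) auto

lemma tar_source [simp]: "source (tar S xs f) = tob S (source f) xs"
  and tar_target [simp]: "target (tar S xs f) = tob S (target f) xs"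
  by (induction xs arbitrary: f) auto

lemma gam_source [simp]: "source (gam S w a xs) = tob S (w \<otimes>\<^bsub>S\<^esub> a) xs"
  and gam_target [simp]: "target (gam S w a xs) = w \<otimes>\<^bsub>S\<^esub> tob S a xs"
  by (induction xs arbitrary: a) auto

definition base :: "('o, 'm) skmon \<Rightarrow> ty \<Rightarrow> 'o list \<Rightarrow> 'o" where
  "base S x as = (if x = Tight then hd as else Unit S)"

definition body :: "ty \<Rightarrow> 'o list \<Rightarrow> 'o list" where
  "body x as = (if x = Tight then tl as else as)"

text \<open>
  The source of the arrows that stand for maps of type \<open>x\<close> with inputs \<open>as\<close>.  A loose map has the
  unit as an additional first factor.
\<close>

definition tobx :: "('o, 'm) skmon \<Rightarrow> ty \<Rightarrow> 'o list \<Rightarrow> 'o" where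
  "tobx S x as = tob S (base S x as) (body x as)"

text \<open>
  An arrow \<open>f\<close> that stands for a map \<open>as \<rightarrow> b\<close>, transported behind a further factor \<open>w\<close>: the result
  goes from \<open>w a\<^sub>1 \<dots> a\<^sub>n\<close> to \<open>w b\<close>.  For loose \<open>f\<close> the unit has to be inserted after \<open>w\<close>, by \<open>\<rho>\<close>.
\<close>

definition sharp ::
  "('o, 'm) skmon \<Rightarrow> ty \<Rightarrow> 'o list \<Rightarrow> ('o, 'm) arrow \<Rightarrow> 'o \<Rightarrow> ('o, 'm) arrow" where
  "sharp S x as f w =
     (if x = Tight then \<I>\<^bsub>S\<^esub> w \<star>\<^bsub>S\<^esub> f \<cdot>\<^bsub>S\<^esub> gam S w (hd as) (tl as)
      else \<I>\<^bsub>S\<^esub> w \<star>\<^bsub>S\<^esub> f \<cdot>\<^bsub>S\<^esub> gam S w (Unit S) as \<cdot>\<^bsub>S\<^esub> tar S as (\<rho>\<^bsub>S\<^esub> w))"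

text \<open>
  Substitution of \<open>f\<close> with inputs \<open>as\<close> for the input of \<open>g\<close> between \<open>us\<close> and \<open>vs\<close>.  The input is the
  leftmost factor of the source of \<open>g\<close> only if \<open>g\<close> is tight and \<open>us\<close> is empty; otherwise \<open>f\<close> must
  pass the factors to its left.
\<close>

definition lsub ::
  "('o, 'm) skmon \<Rightarrow> ty \<Rightarrow> 'o list \<Rightarrow> 'o list \<Rightarrow> ty \<Rightarrow> 'o list \<Rightarrow>
   ('o, 'm) arrow \<Rightarrow> ('o, 'm) arrow \<Rightarrow> ('o, 'm) arrow" where
  "lsub S x us vs y as g f =
     (if x = Tight \<and> us = [] then g \<cdot>\<^bsub>S\<^esub> tar S vs f
      else g \<cdot>\<^bsub>S\<^esub> tar S vs (sharp S y as f (tobx S x us)))"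

text \<open>
  The arrow for the image of a map under \<open>j\<close>.  Leaving loose maps alone lets statements about both
  types be reduced to the loose case by applying them to \<open>loosen S x as f\<close>.
\<close>

definition loosen :: "('o, 'm) skmon \<Rightarrow> ty \<Rightarrow> 'o list \<Rightarrow> ('o, 'm) arrow \<Rightarrow> ('o, 'm) arrow" where
  "loosen S x as f = (if x = Tight then f \<cdot>\<^bsub>S\<^esub> tar S (tl as) (\<Lambda>\<^bsub>S\<^esub> (hd as)) else f)"

text \<open>An arrow of the kind that represents a map of type \<open>x\<close> with inputs \<open>as\<close>.\<close>

definition lmap :: "('o, 'm) skmon \<Rightarrow> ty \<Rightarrow> 'o list \<Rightarrow> ('o, 'm) arrow \<Rightarrow> bool" where
  "lmap S x as f \<longleftrightarrow> (x = Tight \<longrightarrow> as \<noteq> []) \<and> set as \<subseteq> Ob S \<and> arr S f \<and> source f = tobx S x as"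

lemma tobx_Tight_Cons [simp]: "tobx S Tight (a # as) = tob S a as"
  and tobx_Loose [simp]: "tobx S Loose as = tob S (Unit S) as"
  by (simp_all add: tobx_def base_def body_def)

lemma tobx_append [simp]:
  "x = Tight \<longrightarrow> us \<noteq> [] \<Longrightarrow> tobx S x (us @ vs) = tob S (tobx S x us) vs"
  by (cases x; cases us) auto

lemma sharp_source [simp]:
  "x = Tight \<longrightarrow> as \<noteq> [] \<Longrightarrow> source (sharp S x as f w) = tob S w as"
  by (cases as) (auto simp: sharp_def)

lemma sharp_target [simp]: "target (sharp S x as f w) = w \<otimes>\<^bsub>S\<^esub> target f"
  by (simp add: sharp_def)

lemma loosen_target [simp]: "target (loosen S x as f) = target f"
  by (simp add: loosen_def)

lemma lsub_target [simp]: "target (lsub S x us vs y as g f) = target g"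
  by (simp add: lsub_def)

lemma lsub_source [simp]:
  "lmap S y as f \<Longrightarrow> source (lsub S x us vs y as g f) = tobx S (otype x (Suc (length us)) y) (us @ as @ vs)"
  by (cases as; cases us; cases x; cases y) (auto simp: lsub_def lmap_def otype_def)

context tensor_category
begin

lemma tob_ob [simp]: "\<lbrakk>a \<in> Ob S; set xs \<subseteq> Ob S\<rbrakk> \<Longrightarrow> tob S a xs \<in> Ob S"
  by (induction xs arbitrary: a) auto

lemma arr_tar [simp]: "\<lbrakk>arr S f; set xs \<subseteq> Ob S\<rbrakk> \<Longrightarrow> arr S (tar S xs f)"
  by (induction xs arbitrary: f) auto

lemma tar_cmp [simp]:
  "\<lbrakk>arr S f; arr S g; target f = source g; set xs \<subseteq> Ob S\<rbrakk> \<Longrightarrow>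
   tar S xs (g \<cdot> f) = tar S xs g \<cdot> tar S xs f"
  by (induction xs arbitrary: f g) auto

lemma tar_idar [simp]: "\<lbrakk>a \<in> Ob S; set xs \<subseteq> Ob S\<rbrakk> \<Longrightarrow> tar S xs (\<I> a) = \<I> (tob S a xs)"
  by (induction xs arbitrary: a) auto

lemma arr_gam [simp]: "\<lbrakk>w \<in> Ob S; a \<in> Ob S; set xs \<subseteq> Ob S\<rbrakk> \<Longrightarrow> arr S (gam S w a xs)"
  by (induction xs arbitrary: a) auto

lemma arr_sharp [simp]: "\<lbrakk>lmap S x as f; w \<in> Ob S\<rbrakk> \<Longrightarrow> arr S (sharp S x as f w)"
  by (cases as; cases x) (auto simp: sharp_def lmap_def)

lemma tobx_ob [simp]: "\<lbrakk>x = Tight \<longrightarrow> as \<noteq> []; set as \<subseteq> Ob S\<rbrakk> \<Longrightarrow> tobx S x as \<in> Ob S"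
  by (cases as; cases x) auto

lemma lmap_loosen [simp]: "lmap S x as f \<Longrightarrow> lmap S Loose as (loosen S x as f)"
  by (cases as; cases x) (auto simp: loosen_def lmap_def)

lemma lmap_lsub [simp]:
  assumes "lmap S x (us @ target f # vs) g" "lmap S y as f"
  shows "lmap S (otype x (Suc (length us)) y) (us @ as @ vs) (lsub S x us vs y as g f)"
proof -
  have "arr S (lsub S x us vs y as g f)"
    using assms by (cases us; cases as; cases x) (auto simp: lsub_def lmap_def)
  moreover have "otype x (Suc (length us)) y = Tight \<Longrightarrow> us @ as @ vs \<noteq> []"
    using assms by (auto simp: lmap_def otype_def split: if_splits)
  ultimately show ?thesis using assms by (auto simp: lmap_def[of S "otype _ _ _"]) (auto simp: lmap_def)
qed

end

section \<open>Coherence in a skew monoidal category\<close>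

lemma otype_front: "otype Tight (Suc 0) y = y"
  by (cases y) (auto simp: otype_def)

lemma otype_other: "\<not> (x = Tight \<and> i = Suc 0) \<Longrightarrow> otype x i y = x"
  by (cases x) (auto simp: otype_def)

context skew_monoidal_category
begin

lemma asr_natural:
  "\<lbrakk>arr S f; arr S g; arr S h\<rbrakk> \<Longrightarrow>
   \<alpha> (target f) (target g) (target h) \<cdot> f \<star> g \<star> h =
   f \<star> (g \<star> h) \<cdot> \<alpha> (source f) (source g) (source h)"
  using assoc_natural[of "source f" "target f" "source g" "target g" "source h" "target h"
      "label f" "label g" "label h"]
  by (simp add: arr_def cmp_def tns_def asr_def del: arr_source arr_target)

lemma lun_natural: "arr S f \<Longrightarrow> \<Lambda> (target f) \<cdot> \<I> (Unit S) \<star> f = f \<cdot> \<Lambda> (source f)"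
  using lunit_natural[of "source f" "target f" "label f"]
  by (simp add: arr_def cmp_def tns_def lun_def idar_def del: arr_source arr_target)

lemma run_natural: "arr S f \<Longrightarrow> \<rho> (target f) \<cdot> f = f \<star> \<I> (Unit S) \<cdot> \<rho> (source f)"
  using runit_natural[of "source f" "target f" "label f"]
  by (simp add: arr_def cmp_def tns_def run_def idar_def del: arr_source arr_target)

lemma asr_pentagon:
  "\<lbrakk>a \<in> Ob S; b \<in> Ob S; c \<in> Ob S; d \<in> Ob S\<rbrakk> \<Longrightarrow>
   \<alpha> a b (c \<otimes> d) \<cdot> \<alpha> (a \<otimes> b) c d = \<I> a \<star> \<alpha> b c d \<cdot> \<alpha> a (b \<otimes> c) d \<cdot> \<alpha> a b c \<star> \<I> d"
  using pentagon[of a b c d] by (simp add: cmp_def tns_def asr_def idar_def)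

lemma lun_asr: "\<lbrakk>a \<in> Ob S; b \<in> Ob S\<rbrakk> \<Longrightarrow> \<Lambda> (a \<otimes> b) \<cdot> \<alpha> (Unit S) a b = \<Lambda> a \<star> \<I> b"
  using lunit_assoc[of a b] by (simp add: cmp_def tns_def asr_def lun_def idar_def)

lemma asr_run: "\<lbrakk>a \<in> Ob S; b \<in> Ob S\<rbrakk> \<Longrightarrow> \<alpha> a b (Unit S) \<cdot> \<rho> (a \<otimes> b) = \<I> a \<star> \<rho> b"
  using runit_assoc[of a b] by (simp add: cmp_def tns_def asr_def run_def idar_def)

lemma lun_asr_run:
  "\<lbrakk>a \<in> Ob S; b \<in> Ob S\<rbrakk> \<Longrightarrow> \<I> a \<star> \<Lambda> b \<cdot> \<alpha> a (Unit S) b \<cdot> \<rho> a \<star> \<I> b = \<I> (a \<otimes> b)"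
  using unit_triangle[of a b] by (simp add: cmp_def tns_def asr_def run_def lun_def idar_def)

lemma lun_run: "\<Lambda> (Unit S) \<cdot> \<rho> (Unit S) = \<I> (Unit S)"
  using unit_unit by (simp add: cmp_def run_def lun_def idar_def)

lemma tns_exchange:
  "\<lbrakk>arr S f; arr S g\<rbrakk> \<Longrightarrow>
   \<I> (target f) \<star> g \<cdot> f \<star> \<I> (source g) = f \<star> \<I> (target g) \<cdot> \<I> (source f) \<star> g"
  by (simp add: tns_cmp[symmetric])

lemma gam_natural:
  "\<lbrakk>arr S f; arr S g; set xs \<subseteq> Ob S\<rbrakk> \<Longrightarrow>
   f \<star> tar S xs g \<cdot> gam S (source f) (source g) xs =
   gam S (target f) (target g) xs \<cdot> tar S xs (f \<star> g)"
proof (induction xs arbitrary: g)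
  case (Cons x xs)
  have "f \<star> tar S (x # xs) g \<cdot> gam S (source f) (source g) (x # xs) =
        (f \<star> tar S xs (g \<star> \<I> x) \<cdot> gam S (source f) (source (g \<star> \<I> x)) xs) \<cdot>
          tar S xs (\<alpha> (source f) (source g) x)"
    using Cons.prems by simp
  also have "\<dots> = gam S (target f) (target g \<otimes> x) xs \<cdot>
      tar S xs (f \<star> (g \<star> \<I> x) \<cdot> \<alpha> (source f) (source g) x)"
    using Cons.prems by (subst Cons.IH) auto
  also have "f \<star> (g \<star> \<I> x) \<cdot> \<alpha> (source f) (source g) x =
      \<alpha> (target f) (target g) x \<cdot> f \<star> g \<star> \<I> x"
    using asr_natural[of f g "\<I> x"] Cons.prems by simp
  finally show ?case using Cons.prems by simp
qed simp

text \<open>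
  This is the pentagon, iterated.  The next lemma iterates \<open>\<lambda>_{ab} \<alpha> = \<lambda>_a b\<close> in the same way.
\<close>

lemma gam_asr:
  "\<lbrakk>w \<in> Ob S; p \<in> Ob S; q \<in> Ob S; set xs \<subseteq> Ob S\<rbrakk> \<Longrightarrow>
   \<alpha> w p (tob S q xs) \<cdot> gam S (w \<otimes> p) q xs =
   \<I> w \<star> gam S p q xs \<cdot> gam S w (p \<otimes> q) xs \<cdot> tar S xs (\<alpha> w p q)"
proof (induction xs arbitrary: q)
  case (Cons x xs)
  have "\<alpha> w p (tob S q (x # xs)) \<cdot> gam S (w \<otimes> p) q (x # xs) =
      (\<alpha> w p (tob S (q \<otimes> x) xs) \<cdot> gam S (w \<otimes> p) (q \<otimes> x) xs) \<cdot> tar S xs (\<alpha> (w \<otimes> p) q x)"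
    using Cons.prems by simp
  also have "\<dots> = \<I> w \<star> gam S p (q \<otimes> x) xs \<cdot> gam S w (p \<otimes> (q \<otimes> x)) xs \<cdot>
      tar S xs (\<alpha> w p (q \<otimes> x) \<cdot> \<alpha> (w \<otimes> p) q x)"
    using Cons.prems by (subst Cons.IH) auto
  also have "\<dots> = \<I> w \<star> gam S p (q \<otimes> x) xs \<cdot>
      (gam S w (p \<otimes> (q \<otimes> x)) xs \<cdot> tar S xs (\<I> w \<star> \<alpha> p q x)) \<cdot>
      tar S xs (\<alpha> w (p \<otimes> q) x \<cdot> \<alpha> w p q \<star> \<I> x)"
    using Cons.prems by (subst asr_pentagon) auto
  also have "gam S w (p \<otimes> (q \<otimes> x)) xs \<cdot> tar S xs (\<I> w \<star> \<alpha> p q x) =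
      \<I> w \<star> tar S xs (\<alpha> p q x) \<cdot> gam S w (p \<otimes> q \<otimes> x) xs"
    using gam_natural[of "\<I> w" "\<alpha> p q x" xs] Cons.prems by simp
  finally show ?case using Cons.prems by simp
qed simp

lemma gam_lun:
  "\<lbrakk>p \<in> Ob S; set xs \<subseteq> Ob S\<rbrakk> \<Longrightarrow> \<Lambda> (tob S p xs) \<cdot> gam S (Unit S) p xs = tar S xs (\<Lambda> p)"
proof (induction xs arbitrary: p)
  case (Cons x xs)
  have "\<Lambda> (tob S p (x # xs)) \<cdot> gam S (Unit S) p (x # xs) =
      (\<Lambda> (tob S (p \<otimes> x) xs) \<cdot> gam S (Unit S) (p \<otimes> x) xs) \<cdot> tar S xs (\<alpha> (Unit S) p x)"
    using Cons.prems by simp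
  also have "\<dots> = tar S xs (\<Lambda> (p \<otimes> x) \<cdot> \<alpha> (Unit S) p x)"
    using Cons.prems by (subst Cons.IH) auto
  finally show ?case using Cons.prems by (simp add: lun_asr)
qed simp

lemma gam_append:
  "\<lbrakk>w \<in> Ob S; p \<in> Ob S; set xs \<subseteq> Ob S; set ys \<subseteq> Ob S\<rbrakk> \<Longrightarrow>
   gam S w p (xs @ ys) = gam S w (tob S p xs) ys \<cdot> tar S ys (gam S w p xs)"
  by (induction xs arbitrary: p) auto

lemma lmap_sharp_source: "lmap S x as f \<Longrightarrow> source (sharp S x as f w) = tob S w as"
  by (simp add: lmap_def)

text \<open>
  The triangle \<open>(a\<lambda>)\<alpha>(\<rho>b) = 1\<close> is what makes the detour of a loose map over the unit harmless: behind a
  factor \<open>w\<close>, tight maps and their loose images agree.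
\<close>

lemma sharp_loosen [simp]:
  assumes "lmap S x as f" "w \<in> Ob S"
  shows "sharp S Loose as (loosen S x as f) w = sharp S x as f w"
proof (cases x)
  case Tight
  then obtain a as' where as: "as = a # as'" using assms by (cases as) (auto simp: lmap_def)
  have f: "arr S f" "source f = tob S a as'" and ob: "a \<in> Ob S" "set as' \<subseteq> Ob S"
    using assms as Tight by (auto simp: lmap_def)
  have "sharp S Loose as (loosen S x as f) w =
      \<I> w \<star> f \<cdot> (\<I> w \<star> tar S as' (\<Lambda> a) \<cdot> gam S w (Unit S \<otimes> a) as') \<cdot>
      tar S as' (\<alpha> w (Unit S) a \<cdot> \<rho> w \<star> \<I> a)"
    using f ob assms(2) Tight as by (simp add: sharp_def loosen_def)
  also have "\<I> w \<star> tar S as' (\<Lambda> a) \<cdot> gam S w (Unit S \<otimes> a) as' =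
      gam S w a as' \<cdot> tar S as' (\<I> w \<star> \<Lambda> a)"
    using gam_natural[of "\<I> w" "\<Lambda> a" as'] ob assms(2) by simp
  also have "\<I> w \<star> f \<cdot> (gam S w a as' \<cdot> tar S as' (\<I> w \<star> \<Lambda> a)) \<cdot>
      tar S as' (\<alpha> w (Unit S) a \<cdot> \<rho> w \<star> \<I> a) =
      \<I> w \<star> f \<cdot> gam S w a as' \<cdot> tar S as' (\<I> w \<star> \<Lambda> a \<cdot> \<alpha> w (Unit S) a \<cdot> \<rho> w \<star> \<I> a)"
    using f ob assms(2) by simp
  also have "\<dots> = \<I> w \<star> f \<cdot> gam S w a as'"
    using f ob assms(2) by (simp add: lun_asr_run)
  finally show ?thesis using Tight as by (simp add: sharp_def)
qed (simp add: loosen_def)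

text \<open>
  Only loose maps need to be treated: the general case follows by applying it to \<open>loosen S x as f\<close>,
  by \<open>sharp_loosen\<close>.  The next lemmas on \<open>sharp\<close> are proved in the same way.
\<close>

lemma sharp_natural:
  assumes "lmap S x as f" "arr S k"
  shows "k \<star> \<I> (target f) \<cdot> sharp S x as f (source k) = sharp S x as f (target k) \<cdot> tar S as k"
proof -
  have loose: "k \<star> \<I> (target f) \<cdot> sharp S Loose as f (source k) =
      sharp S Loose as f (target k) \<cdot> tar S as k" if "lmap S Loose as f" for f
  proof -
    have f: "arr S f" "source f = tob S (Unit S) as" and ob: "set as \<subseteq> Ob S"
      using that by (auto simp: lmap_def)
    have "k \<star> \<I> (target f) \<cdot> sharp S Loose as f (source k) =
        (k \<star> \<I> (target f) \<cdot> \<I> (source k) \<star> f) \<cdot>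
        gam S (source k) (Unit S) as \<cdot> tar S as (\<rho> (source k))"
      using f ob assms(2) by (simp add: sharp_def)
    also have "k \<star> \<I> (target f) \<cdot> \<I> (source k) \<star> f = \<I> (target k) \<star> f \<cdot> k \<star> tar S as (\<I> (Unit S))"
      using f ob assms(2) tns_exchange[of k f] by simp
    also have "(\<I> (target k) \<star> f \<cdot> k \<star> tar S as (\<I> (Unit S))) \<cdot>
        gam S (source k) (Unit S) as \<cdot> tar S as (\<rho> (source k)) = \<I> (target k) \<star> f \<cdot>
        (k \<star> tar S as (\<I> (Unit S)) \<cdot> gam S (source k) (Unit S) as) \<cdot> tar S as (\<rho> (source k))"
      using f ob assms(2) by simp
    also have "k \<star> tar S as (\<I> (Unit S)) \<cdot> gam S (source k) (Unit S) as =
        gam S (target k) (Unit S) as \<cdot> tar S as (k \<star> \<I> (Unit S))"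
      using gam_natural[of k "\<I> (Unit S)" as] ob assms(2) by simp
    also have "\<I> (target k) \<star> f \<cdot> (gam S (target k) (Unit S) as \<cdot> tar S as (k \<star> \<I> (Unit S))) \<cdot>
        tar S as (\<rho> (source k)) =
        \<I> (target k) \<star> f \<cdot> gam S (target k) (Unit S) as \<cdot> tar S as (\<rho> (target k) \<cdot> k)"
      using f ob assms(2) by (simp add: run_natural)
    finally show ?thesis using f ob assms(2) by (simp add: sharp_def)
  qed
  show ?thesis
    using loose[of "loosen S x as f"] assms by simp
qed

text \<open>
  Transporting behind \<open>w p\<close> amounts to transporting behind \<open>p\<close> and then behind \<open>w\<close>, up to \<open>\<alpha>\<close>.  The
  pentagon and \<open>\<alpha>\<rho> = a\<rho>\<close> enter here.
\<close>

lemma sharp_strong: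
  assumes "lmap S x as f" "w \<in> Ob S" "p \<in> Ob S"
  shows "\<alpha> w p (target f) \<cdot> sharp S x as f (w \<otimes> p) = \<I> w \<star> sharp S x as f p \<cdot> gam S w p as"
proof -
  have loose: "\<alpha> w p (target f) \<cdot> sharp S Loose as f (w \<otimes> p) =
      \<I> w \<star> sharp S Loose as f p \<cdot> gam S w p as" if "lmap S Loose as f" for f
  proof -
    have f: "arr S f" "source f = tob S (Unit S) as" and ob: "set as \<subseteq> Ob S"
      using that by (auto simp: lmap_def)
    note ob' = f ob assms(2,3)
    have "\<alpha> w p (target f) \<cdot> sharp S Loose as f (w \<otimes> p) =
        (\<alpha> w p (target f) \<cdot> \<I> w \<star> \<I> p \<star> f) \<cdot> gam S (w \<otimes> p) (Unit S) as \<cdot> tar S as (\<rho> (w \<otimes> p))"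
      using ob' by (simp add: sharp_def)
    also have "\<alpha> w p (target f) \<cdot> \<I> w \<star> \<I> p \<star> f =
        \<I> w \<star> (\<I> p \<star> f) \<cdot> \<alpha> w p (tob S (Unit S) as)"
      using ob' asr_natural[of "\<I> w" "\<I> p" f] by simp
    also have "(\<I> w \<star> (\<I> p \<star> f) \<cdot> \<alpha> w p (tob S (Unit S) as)) \<cdot>
        gam S (w \<otimes> p) (Unit S) as \<cdot> tar S as (\<rho> (w \<otimes> p)) =
        \<I> w \<star> (\<I> p \<star> f) \<cdot> (\<alpha> w p (tob S (Unit S) as) \<cdot> gam S (w \<otimes> p) (Unit S) as) \<cdot>
        tar S as (\<rho> (w \<otimes> p))"
      using ob' by simp
    also have "\<dots> = \<I> w \<star> (\<I> p \<star> f) \<cdot> \<I> w \<star> gam S p (Unit S) as \<cdot> gam S w (p \<otimes> Unit S) as \<cdot>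
        tar S as (\<alpha> w p (Unit S) \<cdot> \<rho> (w \<otimes> p))"
      using ob' by (subst gam_asr) auto
    also have "\<dots> = \<I> w \<star> (\<I> p \<star> f) \<cdot> \<I> w \<star> gam S p (Unit S) as \<cdot>
        (gam S w (p \<otimes> Unit S) as \<cdot> tar S as (\<I> w \<star> \<rho> p))"
      using ob' by (simp add: asr_run)
    also have "gam S w (p \<otimes> Unit S) as \<cdot> tar S as (\<I> w \<star> \<rho> p) =
        \<I> w \<star> tar S as (\<rho> p) \<cdot> gam S w p as"
      using gam_natural[of "\<I> w" "\<rho> p" as] ob' by simp
    finally show ?thesis using ob' by (simp add: sharp_def)
  qed
  show ?thesis
    using loose[of "loosen S x as f"] assms by simp
qed

lemma lun_sharp:
  assumes "lmap S x as f"
  shows "\<Lambda> (target f) \<cdot> sharp S x as f (Unit S) = loosen S x as f"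
proof -
  have loose: "\<Lambda> (target f) \<cdot> sharp S Loose as f (Unit S) = f" if "lmap S Loose as f" for f
  proof -
    have f: "arr S f" "source f = tob S (Unit S) as" and ob: "set as \<subseteq> Ob S"
      using that by (auto simp: lmap_def)
    have "\<Lambda> (target f) \<cdot> sharp S Loose as f (Unit S) =
        (\<Lambda> (target f) \<cdot> \<I> (Unit S) \<star> f) \<cdot> gam S (Unit S) (Unit S) as \<cdot> tar S as (\<rho> (Unit S))"
      using f ob by (simp add: sharp_def)
    also have "\<dots> = f \<cdot> (\<Lambda> (tob S (Unit S) as) \<cdot> gam S (Unit S) (Unit S) as) \<cdot> tar S as (\<rho> (Unit S))"
      using f ob by (subst lun_natural) auto
    also have "\<dots> = f \<cdot> tar S as (\<Lambda> (Unit S) \<cdot> \<rho> (Unit S))"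
      using f ob by (subst gam_lun) auto
    finally show ?thesis using f ob by (simp add: lun_run)
  qed
  show ?thesis
    using loose[of "loosen S x as f"] assms by simp
qed

text \<open>
  Moving a composite behind \<open>w\<close> moves \<open>f\<close> past both \<open>w\<close> and \<open>us\<close>, in one step or in two.  The key case is a composite of loose maps, where
  \<open>sharp_strong\<close> splits the two transports.
\<close>

lemma sharp_lsub:
  assumes g: "lmap S Loose (us @ target f # vs) g" and f: "lmap S y as f" and w: "w \<in> Ob S"
  shows "sharp S Loose (us @ as @ vs) (lsub S Loose us vs y as g f) w =
    sharp S Loose (us @ target f # vs) g w \<cdot> tar S vs (sharp S y as f (tob S w us))"
proof -
  have loose: "sharp S Loose (us @ as @ vs) (lsub S Loose us vs Loose as g f) w =
      sharp S Loose (us @ target f # vs) g w \<cdot> tar S vs (sharp S Loose as f (tob S w us))"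
    if f': "lmap S Loose as f" and g': "lmap S Loose (us @ target f # vs) g" for f
  proof -
    let ?p = "tob S (Unit S) us" and ?b = "target f"
    let ?k = "sharp S Loose as f ?p" and ?G = "gam S w (Unit S) us"
    have ob: "arr S f" "source f = tob S (Unit S) as" "set as \<subseteq> Ob S" "set us \<subseteq> Ob S"
      "set vs \<subseteq> Ob S" "w \<in> Ob S" "arr S g" "source g = tob S (?p \<otimes> ?b) vs"
      using f' g' w by (auto simp: lmap_def)
    have "\<I> w \<star> ?k \<cdot> gam S w ?p as \<cdot> tar S as ?G \<cdot> tar S as (tar S us (\<rho> w)) =
        (\<I> w \<star> ?k \<cdot> gam S w ?p as) \<cdot> tar S as (?G \<cdot> tar S us (\<rho> w))"
      using ob f' by simp
    also have "\<dots> = \<alpha> w ?p ?b \<cdot> sharp S Loose as f (w \<otimes> ?p) \<cdot> tar S as (?G \<cdot> tar S us (\<rho> w))"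
      using ob f' by (subst sharp_strong[symmetric]) auto
    also have "sharp S Loose as f (w \<otimes> ?p) \<cdot> tar S as (?G \<cdot> tar S us (\<rho> w)) =
        (?G \<cdot> tar S us (\<rho> w)) \<star> \<I> ?b \<cdot> sharp S Loose as f (tob S w us)"
      using sharp_natural[OF f', of "?G \<cdot> tar S us (\<rho> w)"] ob by simp
    finally have M: "\<I> w \<star> ?k \<cdot> gam S w ?p as \<cdot> tar S as ?G \<cdot> tar S as (tar S us (\<rho> w)) =
        \<alpha> w ?p ?b \<cdot> ?G \<star> \<I> ?b \<cdot> tar S us (\<rho> w) \<star> \<I> ?b \<cdot> sharp S Loose as f (tob S w us)"
      using ob f' by simp
    have "sharp S Loose (us @ as @ vs) (lsub S Loose us vs Loose as g f) w =
        \<I> w \<star> g \<cdot> (\<I> w \<star> tar S vs ?k \<cdot> gam S w (tob S ?p as) vs) \<cdot>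
        tar S vs (gam S w ?p as) \<cdot> tar S vs (tar S as ?G) \<cdot> tar S vs (tar S as (tar S us (\<rho> w)))"
      unfolding sharp_def[of _ _ _ "lsub _ _ _ _ _ _ _ _"]
      using ob f' by (simp add: lsub_def gam_append)
    also have "\<I> w \<star> tar S vs ?k \<cdot> gam S w (tob S ?p as) vs =
        gam S w (?p \<otimes> ?b) vs \<cdot> tar S vs (\<I> w \<star> ?k)"
      using gam_natural[of "\<I> w" ?k vs] ob f' by simp
    also have "\<I> w \<star> g \<cdot> (gam S w (?p \<otimes> ?b) vs \<cdot> tar S vs (\<I> w \<star> ?k)) \<cdot>
        tar S vs (gam S w ?p as) \<cdot> tar S vs (tar S as ?G) \<cdot> tar S vs (tar S as (tar S us (\<rho> w))) =
        \<I> w \<star> g \<cdot> gam S w (?p \<otimes> ?b) vs \<cdot>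
        tar S vs (\<I> w \<star> ?k \<cdot> gam S w ?p as \<cdot> tar S as ?G \<cdot> tar S as (tar S us (\<rho> w)))"
      using ob f' by simp
    finally show ?thesis
      using ob f' unfolding M by (simp add: sharp_def[of _ _ "_ @ _"] gam_append)
  qed
  have "lsub S Loose us vs y as g f = lsub S Loose us vs Loose as g (loosen S y as f)"
    using f g by (simp add: lsub_def lmap_def)
  then show ?thesis
    using loose[OF lmap_loosen[OF f]] assms tob_ob[of w us] by (simp add: lmap_def[of S Loose])
qed

text \<open>
  If \<open>f\<close> is substituted at the front, the
  unit created by \<open>loosen\<close> is absorbed by \<open>lun_sharp\<close>; otherwise \<open>\<lambda>\<close> acts on factors that \<open>f\<close> does not
  touch and commutes with it by naturality.
\<close>

lemma loosen_lsub:
  assumes g: "lmap S x (us @ target f # vs) g" and f: "lmap S y as f"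
  shows "loosen S (otype x (Suc (length us)) y) (us @ as @ vs) (lsub S x us vs y as g f) =
    lsub S Loose us vs y as (loosen S x (us @ target f # vs) g) f"
proof (cases x)
  case Loose
  then show ?thesis by (simp add: otype_def loosen_def)
next
  case Tight
  show ?thesis
  proof (cases us)
    case Nil
    have ob: "arr S g" "source g = tob S (target f) vs" "set vs \<subseteq> Ob S" "arr S f"
      "set as \<subseteq> Ob S" "source f = tobx S y as" "y = Tight \<longrightarrow> as \<noteq> []"
      using f g Nil Tight by (auto simp: lmap_def)
    have "lsub S Loose us vs y as (loosen S x (us @ target f # vs) g) f =
        g \<cdot> tar S vs (\<Lambda> (target f) \<cdot> sharp S y as f (Unit S))"
      using ob f Nil Tight by (simp add: lsub_def loosen_def)
    also have "\<dots> = g \<cdot> tar S vs (loosen S y as f)"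
      using f by (simp add: lun_sharp)
    finally show ?thesis
      using ob Nil Tight by (cases as; cases y) (auto simp: otype_def loosen_def lsub_def)
  next
    case (Cons u us')
    have ob: "arr S g" "source g = tob S (tob S u us' \<otimes> target f) vs" "set vs \<subseteq> Ob S" "arr S f"
      "u \<in> Ob S" "set us' \<subseteq> Ob S" "set as \<subseteq> Ob S" "y = Tight \<longrightarrow> as \<noteq> []"
      using f g Cons Tight by (auto simp: lmap_def)
    have "loosen S (otype x (Suc (length us)) y) (us @ as @ vs) (lsub S x us vs y as g f) =
        g \<cdot> tar S vs (sharp S y as f (tob S u us') \<cdot> tar S as (tar S us' (\<Lambda> u)))"
      using ob f Cons Tight by (simp add: otype_def loosen_def lsub_def)
    also have "sharp S y as f (tob S u us') \<cdot> tar S as (tar S us' (\<Lambda> u)) =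
        tar S us' (\<Lambda> u) \<star> \<I> (target f) \<cdot> sharp S y as f (tob S (Unit S \<otimes> u) us')"
      using sharp_natural[OF f, of "tar S us' (\<Lambda> u)"] ob by simp
    finally show ?thesis
      using ob f Cons Tight by (simp add: loosen_def lsub_def)
  qed
qed

lemma sharp_lsub_any:
  assumes g: "lmap S x (us @ target f # vs) g" and f: "lmap S y as f" and w: "w \<in> Ob S"
  shows "sharp S (otype x (Suc (length us)) y) (us @ as @ vs) (lsub S x us vs y as g f) w =
    sharp S x (us @ target f # vs) g w \<cdot> tar S vs (sharp S y as f (tob S w us))"
proof -
  have "sharp S (otype x (Suc (length us)) y) (us @ as @ vs) (lsub S x us vs y as g f) w =
      sharp S Loose (us @ as @ vs)
        (loosen S (otype x (Suc (length us)) y) (us @ as @ vs) (lsub S x us vs y as g f)) w"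
    using assms by (subst sharp_loosen) auto
  also have "\<dots> = sharp S Loose (us @ target f # vs) (loosen S x (us @ target f # vs) g) w \<cdot>
      tar S vs (sharp S y as f (tob S w us))"
    using assms by (subst loosen_lsub[OF g f], subst sharp_lsub) auto
  finally show ?thesis using assms by simp
qed

lemma lsub_other:
  "x = Tight \<longrightarrow> us \<noteq> [] \<Longrightarrow>
   lsub S x us vs y as g f = g \<cdot> tar S vs (sharp S y as f (tobx S x us))"
  by (auto simp: lsub_def)

text \<open>
  If nothing precedes the outer input, both sides are the same
  composite up to functoriality; otherwise they agree by \<open>sharp_lsub_any\<close>.
\<close>

theorem lsub_assoc:
  assumes h: "lmap S x (us @ target g # vs) h" and g: "lmap S y (us' @ target f # vs') g"
    and f: "lmap S z ds f"
  shows "lsub S x us vs (otype y (Suc (length us')) z) (us' @ ds @ vs') h (lsub S y us' vs' z ds g f) =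
    lsub S (otype x (Suc (length us)) y) (us @ us') (vs' @ vs) z ds
      (lsub S x us vs y (us' @ target f # vs') h g) f"
proof (cases "x = Tight \<and> us = []")
  case True
  have ob: "arr S h" "arr S g" "arr S f" "set vs \<subseteq> Ob S" "set us' \<subseteq> Ob S" "set vs' \<subseteq> Ob S"
    "source h = tob S (target g) vs" "source g = tobx S y (us' @ target f # vs')"
    "source f = tobx S z ds"
    using assms True by (auto simp: lmap_def)
  show ?thesis
  proof (cases "y = Tight \<and> us' = []")
    case True
    then show ?thesis using \<open>x = Tight \<and> us = []\<close> ob
      by (simp add: lsub_def otype_front)
  next
    case False
    then have "tobx S y us' \<in> Ob S" "y = Tight \<longrightarrow> us' \<noteq> []" using ob by auto
    then show ?thesis using \<open>x = Tight \<and> us = []\<close> ob False f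
      by (cases "y = Tight") (auto simp: lsub_def otype_front lmap_def)
  qed
next
  case False
  then have us: "x = Tight \<longrightarrow> us \<noteq> []" by auto
  have ob: "arr S h" "arr S g" "arr S f" "set vs \<subseteq> Ob S" "set us \<subseteq> Ob S" "set us' \<subseteq> Ob S"
    "set vs' \<subseteq> Ob S" "source h = tob S (tobx S x us \<otimes> target g) vs" "tobx S x us \<in> Ob S"
    using assms us by (auto simp: lmap_def)
  have t: "otype x (Suc (length us)) y = x" using us by (intro otype_other) auto
  have "lsub S x us vs (otype y (Suc (length us')) z) (us' @ ds @ vs') h (lsub S y us' vs' z ds g f) =
      h \<cdot> tar S vs (sharp S y (us' @ target f # vs') g (tobx S x us) \<cdot>
        tar S vs' (sharp S z ds f (tob S (tobx S x us) us')))"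
    using sharp_lsub_any[OF g f, of "tobx S x us"] us ob by (simp add: lsub_other[of x])
  then show ?thesis using ob us g f by (simp add: lsub_other t)
qed

text \<open>
  Two arrows acting on different factors commute because \<open>sharp\<close> is natural in the factor it passes.
\<close>

theorem lsub_comm:
  assumes g: "lmap S x (us @ target f # vs @ target h # ws) g" and f: "lmap S y as f"
    and h: "lmap S z ds h"
  shows "lsub S (otype x (Suc (length us)) y) (us @ as @ vs) ws z ds
      (lsub S x us (vs @ target h # ws) y as g f) h =
    lsub S (otype x (Suc (length (us @ target f # vs))) z) us (vs @ ds @ ws) y as
      (lsub S x (us @ target f # vs) ws z ds g h) f"
proof -
  \<comment> \<open>the arrow by which \<open>f\<close> acts on the factors up to its own position\<close>
  define k where "k = (if x = Tight \<and> us = [] then f else sharp S y as f (tobx S x us))"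
  have ob: "arr S g" "arr S f" "arr S h" "set us \<subseteq> Ob S" "set vs \<subseteq> Ob S" "set ws \<subseteq> Ob S"
    "set ds \<subseteq> Ob S" "set as \<subseteq> Ob S" "source f = tobx S y as" "y = Tight \<longrightarrow> as \<noteq> []"
    "source g = tobx S x (us @ target f # vs @ target h # ws)"
    using assms by (auto simp: lmap_def)
  have k: "arr S k" "tob S (target k) vs = tobx S x (us @ target f # vs)"
     "tob S (source k) vs = tobx S (otype x (Suc (length us)) y) (us @ as @ vs)"
    using ob f unfolding k_def
    by (auto simp: otype_front otype_other)
  have t: "otype x (Suc (length (us @ target f # vs))) z = x" by (intro otype_other) auto
  have sg: "source g = tob S (tobx S x (us @ target f # vs) \<otimes> target h) ws"
    using ob by (cases us) (auto simp: tobx_def base_def body_def)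
  have 1: "lsub S x us (vs @ target h # ws) y as g f = g \<cdot> tar S (vs @ target h # ws) k"
    by (simp add: lsub_def k_def)
  have ne: "otype x (Suc (length us)) y = Tight \<longrightarrow> us @ as @ vs \<noteq> []"
    using ob by (auto simp: otype_def split: if_splits)
  have "lsub S (otype x (Suc (length us)) y) (us @ as @ vs) ws z ds
      (lsub S x us (vs @ target h # ws) y as g f) h =
      g \<cdot> tar S ws (tar S vs k \<star> \<I> (target h) \<cdot> sharp S z ds h (tob S (source k) vs))"
    unfolding 1 lsub_other[OF ne] k(3)[symmetric] using ob k(1,2) h sg by simp
  also have "tar S vs k \<star> \<I> (target h) \<cdot> sharp S z ds h (tob S (source k) vs) =
      sharp S z ds h (tobx S x (us @ target f # vs)) \<cdot> tar S ds (tar S vs k)"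
    using sharp_natural[OF h, of "tar S vs k"] ob k by simp
  also have "g \<cdot> tar S ws \<dots> = (g \<cdot> tar S ws (sharp S z ds h (tobx S x (us @ target f # vs)))) \<cdot>
      tar S (vs @ ds @ ws) k"
    using ob k h sg by (simp add: lmap_sharp_source)
  also have "\<dots> = lsub S x us (vs @ ds @ ws) y as
      (lsub S x (us @ target f # vs) ws z ds g h) f"
    by (simp add: lsub_def[of _ x us] k_def) (simp add: lsub_def)
  finally show ?thesis unfolding t .
qed

end

section \<open>The skew multicategory of a skew monoidal category\<close>

text \<open>
  The maps of \<open>multi_of S\<close> are labels of arrows; \<open>rep\<close> restores the source and target.
\<close>

abbreviation rep :: "('o, 'm) skmon \<Rightarrow> ty \<Rightarrow> 'o list \<Rightarrow> 'o \<Rightarrow> 'm \<Rightarrow> ('o, 'm) arrow" where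
  "rep S x as b f \<equiv> (tobx S x as, f, b)"

definition multi_of :: "('o, 'm) skmon \<Rightarrow> ('o, 'm) multi" where
  "multi_of S =
     \<lparr> Obj = Ob S,
       Maps = (\<lambda>x as b. Hom S (tobx S x as) b),
       Idt = Idn S,
       J = (\<lambda>as b f. label (loosen S Tight as (rep S Tight as b f))),
       Sub = (\<lambda>x bs c i y as g f. label (lsub S x (take (i - 1) bs) (drop i bs) y as
                (rep S x bs c g) (rep S y as (bs ! (i - 1)) f))) \<rparr>"

lemma split_list_at:
  assumes "1 \<le> i" "i \<le> length bs"
  obtains us b vs where "bs = us @ b # vs" "i = Suc (length us)"
proof
  show "bs = take (i - 1) bs @ bs ! (i - 1) # drop i bs"
    using assms id_take_nth_drop[of "i - 1" bs] by simp
  show "i = Suc (length (take (i - 1) bs))" using assms by simp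
qed

lemma plug_split [simp]: "plug (us @ b # vs) (Suc (length us)) as = us @ as @ vs"
  by (simp add: plug_def)

lemma multi_of_simps [simp]:
  "Obj (multi_of S) = Ob S"
  "Maps (multi_of S) x as b = Hom S (tobx S x as) b"
  "Idt (multi_of S) = Idn S"
  "J (multi_of S) as b f = label (loosen S Tight as (rep S Tight as b f))"
  "Sub (multi_of S) x (us @ b # vs) c (Suc (length us)) y as g f =
     label (lsub S x us vs y as (rep S x (us @ b # vs) c g) (rep S y as b f))"
  by (simp_all add: multi_of_def)

lemma is_map_multi_of:
  assumes "tensor_category S" "arity_long x (length as)"
  shows "is_map (multi_of S) x as b f \<longleftrightarrow> lmap S x as (rep S x as b f)"
proof -
  interpret tensor_category S by fact
  have "x = Tight \<longrightarrow> as \<noteq> []" using assms(2) by (auto simp: arity_long_def)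
  then show ?thesis by (auto simp: is_map_def lmap_def)
qed

lemma rep_label:
  "source f = tobx S x as \<Longrightarrow> target f = b \<Longrightarrow> rep S x as b (label f) = f"
  by (simp add: prod_eq_iff)

context skew_monoidal_category
begin

lemma rep_lsub:
  assumes "lmap S y as f" "target g = c"
  shows "rep S (otype x (Suc (length us)) y) (us @ as @ vs) c (label (lsub S x us vs y as g f)) =
    lsub S x us vs y as g f"
  using assms by (auto intro!: rep_label)

lemma is_map_rep: "\<lbrakk>is_map (multi_of S) x as b f; arity_long x (length as)\<rbrakk> \<Longrightarrow> lmap S x as (rep S x as b f)"
  using is_map_multi_of[OF tensor_category_axioms, of x as b f] by simp

lemma rep_loosen:
  assumes "lmap S Tight as f" "target f = b"
  shows "rep S Loose as b (label (loosen S Tight as f)) = loosen S Tight as f"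
proof (rule rep_label)
  show "source (loosen S Tight as f) = tobx S Loose as"
    using lmap_loosen[OF assms(1)] by (simp only: lmap_def)
qed (simp add: assms)

lemma multi_of_typed: "well_typed arity_long op_long (multi_of S)"
  unfolding well_typed_def
proof (intro conjI allI impI ballI; (elim conjE)?)
  fix a assume "a \<in> Obj (multi_of S)"
  then show "Idt (multi_of S) a \<in> Maps (multi_of S) Tight [a] a"
    using arr_idar[of a] by (simp add: idar_def)
next
  fix as b f assume "arity_long Tight (length as)" "is_map (multi_of S) Tight as b f"
  then have f: "lmap S Tight as (rep S Tight as b f)" by (simp add: is_map_rep)
  have "lmap S Loose as (loosen S Tight as (rep S Tight as b f))" using f by simp
  then show "J (multi_of S) as b f \<in> Maps (multi_of S) Loose as b"
    by (auto simp: lmap_def arr_def)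
next
  fix x bs c i y as g f
  assume op: "op_long x (length bs) i y (length as)"
    and "is_map (multi_of S) x bs c g" "is_map (multi_of S) y as (bs ! (i - 1)) f"
  moreover obtain us b vs where bs: "bs = us @ b # vs" "i = Suc (length us)"
    using op unfolding op_long_def by (metis split_list_at)
  ultimately have "lmap S x (us @ b # vs) (rep S x bs c g)" "lmap S y as (rep S y as b f)"
    by (auto intro!: is_map_rep simp: op_long_def)
  then have "lmap S (otype x i y) (us @ as @ vs) (lsub S x us vs y as (rep S x bs c g) (rep S y as b f))"
    unfolding bs(2) by (intro lmap_lsub) auto
  then show "Sub (multi_of S) x bs c i y as g f \<in> Maps (multi_of S) (otype x i y) (plug bs i as) c"
    by (auto simp: bs lmap_def arr_def)
qed

lemma sharp_idar [simp]: "\<lbrakk>a \<in> Ob S; w \<in> Ob S\<rbrakk> \<Longrightarrow> sharp S Tight [a] (\<I> a) w = \<I> (w \<otimes> a)"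
  by (simp add: sharp_def)

lemma lsub_idar:
  assumes "lmap S x (us @ b # vs) g"
  shows "lsub S x us vs Tight [b] g (\<I> b) = g"
  using assms by (cases us; cases x) (auto simp: lsub_def lmap_def)

lemma multi_of_identities: "id_law arity_long (multi_of S)"
  unfolding id_law_def
proof (intro allI impI conjI; elim conjE)
  fix x as b f assume "arity_long x (length as)" "is_map (multi_of S) x as b f"
  then have f: "lmap S x as (rep S x as b f)" by (simp add: is_map_rep)
  then have "b \<in> Ob S" by (simp add: lmap_def)
  then show "Sub (multi_of S) Tight [b] b 1 x as (Idt (multi_of S) b) f = f"
    using multi_of_simps(5)[of S Tight "[]" b "[]"] f
    by (simp add: lsub_def lmap_def idar_def[symmetric])
next
  fix x as b f i
  assume "arity_long x (length as)" "is_map (multi_of S) x as b f" and i: "1 \<le> i" "i \<le> length as"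
  then have f: "lmap S x as (rep S x as b f)" by (simp add: is_map_rep)
  obtain us a vs where as: "as = us @ a # vs" "i = Suc (length us)"
    using i by (rule split_list_at)
  then show "Sub (multi_of S) x as b i Tight [as ! (i - 1)] f (Idt (multi_of S) (as ! (i - 1))) = f"
    using lsub_idar[OF f[unfolded as]] by (simp add: idar_def)
qed

lemma multi_of_assoc:
  assumes "op_long x n i y m" "op_long y m j z p"
  shows "assoc_law (multi_of S) x n i y m j z p"
  unfolding assoc_law_def
proof (intro allI impI; elim conjE)
  fix bs c as ds g f h
  assume len: "length bs = n" "length as = m" "length ds = p"
    and maps: "is_map (multi_of S) x bs c g" "is_map (multi_of S) y as (bs ! (i - 1)) f"
      "is_map (multi_of S) z ds (as ! (j - 1)) h"
  obtain us b vs where bs: "bs = us @ b # vs" "i = Suc (length us)"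
    using assms len unfolding op_long_def by (metis split_list_at)
  obtain us' a vs' where as: "as = us' @ a # vs'" "j = Suc (length us')"
    using assms len unfolding op_long_def by (metis split_list_at)
  let ?g = "rep S x bs c g" and ?f = "rep S y as b f" and ?h = "rep S z ds a h"
  have l: "lmap S x (us @ target ?f # vs) ?g" "lmap S y (us' @ target ?h # vs') ?f" "lmap S z ds ?h"
    using maps len assms unfolding bs as
    by (auto intro!: is_map_rep simp: op_long_def)
  have fh: "lmap S (otype y j z) (us' @ ds @ vs') (lsub S y us' vs' z ds ?f ?h)"
    using lmap_lsub[OF l(2,3)] by (simp add: as)
  have 1: "Sub (multi_of S) x bs c i (otype y j z) (plug as j ds) g
        (Sub (multi_of S) y as (bs ! (i - 1)) j z ds f h) =
      label (lsub S x us vs (otype y j z) (us' @ ds @ vs') ?g (lsub S y us' vs' z ds ?f ?h))"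
    using rep_lsub[OF l(3), of ?f b y us' vs'] by (simp add: bs as)
  have gf: "lmap S (otype x i y) (us @ as @ vs) (lsub S x us vs y as ?g ?f)"
    using lmap_lsub[OF l(1), of y as] l(2) by (simp add: bs as)
  have ij: "i + j - 1 = Suc (length (us @ us'))" by (simp add: bs as)
  have 2: "Sub (multi_of S) (otype x i y) (plug bs i as) c (i + j - 1) z ds
        (Sub (multi_of S) x bs c i y as g f) h =
      label (lsub S (otype x i y) (us @ us') (vs' @ vs) z ds (lsub S x us vs y as ?g ?f) ?h)"
    unfolding ij
    using rep_lsub[of y as ?f ?g c x us vs] l(2)
      multi_of_simps(5)[of S "otype x i y" "us @ us'" a "vs' @ vs"]
    by (simp add: bs as)
  show "Sub (multi_of S) x bs c i (otype y j z) (plug as j ds) g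
        (Sub (multi_of S) y as (bs ! (i - 1)) j z ds f h) =
      Sub (multi_of S) (otype x i y) (plug bs i as) c (i + j - 1) z ds
        (Sub (multi_of S) x bs c i y as g f) h"
    unfolding 1 2 using lsub_assoc[OF l] by (simp add: bs as)
qed

lemma multi_of_comm:
  assumes "op_long x n i y m" "op_long x n k z p" "i < k"
  shows "comm_law (multi_of S) x n i y m k z p"
  unfolding comm_law_def
proof (intro allI impI; elim conjE)
  fix bs c as ds g f h
  assume len: "length bs = n" "length as = m" "length ds = p"
    and maps: "is_map (multi_of S) x bs c g" "is_map (multi_of S) y as (bs ! (i - 1)) f"
      "is_map (multi_of S) z ds (bs ! (k - 1)) h"
  obtain us b vs1 where bs1: "bs = us @ b # vs1" "i = Suc (length us)"
    using assms len unfolding op_long_def by (metis split_list_at)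
  have "1 \<le> k - i" "k - i \<le> length vs1"
    using assms len bs1 by (auto simp: op_long_def)
  then obtain vs d ws where vs: "vs1 = vs @ d # ws" "k - i = Suc (length vs)"
    by (rule split_list_at)
  have bs: "bs = us @ b # vs @ d # ws" and k: "k = Suc (length (us @ b # vs))"
    using bs1 vs assms(3) by auto
  have bk: "bs ! (i - 1) = b" "bs ! (k - 1) = d"
    by (simp_all add: bs bs1(2) k nth_append)
  let ?g = "rep S x bs c g" and ?f = "rep S y as b f" and ?h = "rep S z ds d h"
  have l: "lmap S x (us @ target ?f # vs @ target ?h # ws) ?g" "lmap S y as ?f" "lmap S z ds ?h"
    using maps len assms bk unfolding bs
    by (auto intro!: is_map_rep simp: op_long_def)
  have p1: "plug bs i as = (us @ as @ vs) @ d # ws"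
    and p2: "plug bs k ds = us @ b # (vs @ ds @ ws)"
    using plug_split[of "us @ b # vs" d ws] by (simp_all add: bs bs1(2) k)
  have s1: "Sub (multi_of S) x bs c i y as g f = label (lsub S x us (vs @ d # ws) y as ?g ?f)"
    by (simp add: bs bs1(2))
  have s2: "Sub (multi_of S) x bs c k z ds g h = label (lsub S x (us @ b # vs) ws z ds ?g ?h)"
    using multi_of_simps(5)[of S x "us @ b # vs" d ws] by (simp add: bs k)
  have km: "k + m - 1 = Suc (length (us @ as @ vs))" using k len by simp
  have 1: "Sub (multi_of S) (otype x i y) (plug bs i as) c (k + m - 1) z ds
        (Sub (multi_of S) x bs c i y as g f) h =
      label (lsub S (otype x i y) (us @ as @ vs) ws z ds (lsub S x us (vs @ d # ws) y as ?g ?f) ?h)"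
    unfolding km p1 s1 multi_of_simps(5) using rep_lsub[OF l(2), of ?g c x us "vs @ d # ws"]
    by (simp add: bs1(2))
  have 2: "Sub (multi_of S) (otype x k z) (plug bs k ds) c i y as
        (Sub (multi_of S) x bs c k z ds g h) f =
      label (lsub S (otype x k z) us (vs @ ds @ ws) y as (lsub S x (us @ b # vs) ws z ds ?g ?h) ?f)"
    unfolding bs1(2) p2 s2 multi_of_simps(5) using rep_lsub[OF l(3), of ?g c x "us @ b # vs" ws]
    by (simp add: k)
  show "Sub (multi_of S) (otype x i y) (plug bs i as) c (k + m - 1) z ds
        (Sub (multi_of S) x bs c i y as g f) h =
      Sub (multi_of S) (otype x k z) (plug bs k ds) c i y as (Sub (multi_of S) x bs c k z ds g h) f"
    unfolding 1 2 using lsub_comm[OF l] by (simp add: bs1(2) k)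
qed

theorem skew_multicategory_multi_of: "skew_multicategory (multi_of S)"
proof
  show "well_typed arity_long op_long (multi_of S)" by (rule multi_of_typed)
  show "id_law arity_long (multi_of S)" by (rule multi_of_identities)
  show "assoc_law (multi_of S) x n i y m j z p"
    if "op_long x n i y m" "op_long y m j z p" for x n i y m j z p
    using that by (rule multi_of_assoc)
  show "comm_law (multi_of S) x n i y m k z p"
    if "op_long x n i y m" "op_long x n k z p" "i < k" for x n i y m k z p
    using that by (rule multi_of_comm)
next
  fix x bs i as c g f
  assume op: "op_long x (length bs) i Tight (length as)"
    and "is_map (multi_of S) x bs c g" "is_map (multi_of S) Tight as (bs ! (i - 1)) f"
  moreover obtain us b vs where bs: "bs = us @ b # vs" "i = Suc (length us)"
    using op unfolding op_long_def by (metis split_list_at)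
  ultimately have l: "lmap S x (us @ b # vs) (rep S x bs c g)" "lmap S Tight as (rep S Tight as b f)"
    by (auto intro!: is_map_rep simp: op_long_def)
  let ?g = "rep S x bs c g" and ?f = "rep S Tight as b f"
  have "lsub S x us vs Loose as ?g (loosen S Tight as ?f) =
    (if otype x i Loose = otype x i Tight then lsub S x us vs Tight as ?g ?f
     else loosen S Tight (us @ as @ vs) (lsub S x us vs Tight as ?g ?f))"
  proof (cases "x = Tight \<and> us = []")
    case True
    then show ?thesis
      using l by (cases as) (auto simp: lsub_def otype_def bs loosen_def lmap_def)
  next
    case False
    then have "tobx S x us \<in> Ob S" using l(1) by (auto simp: lmap_def)
    then show ?thesis using False l by (auto simp: lsub_def otype_def bs)
  qed
  then show "Sub (multi_of S) x bs c i Loose as g (J (multi_of S) as (bs ! (i - 1)) f) =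
      (if otype x i Loose = otype x i Tight then Sub (multi_of S) x bs c i Tight as g f
       else J (multi_of S) (plug bs i as) c (Sub (multi_of S) x bs c i Tight as g f))"
    using rep_loosen[OF l(2)] rep_lsub[OF l(2), of ?g c x us vs]
    by (auto simp: bs otype_def split: if_splits)
next
  fix bs i y as c g f
  assume op: "op_long Tight (length bs) i y (length as)"
    and "is_map (multi_of S) Tight bs c g" "is_map (multi_of S) y as (bs ! (i - 1)) f"
  moreover obtain us b vs where bs: "bs = us @ b # vs" "i = Suc (length us)"
    using op unfolding op_long_def by (metis split_list_at)
  ultimately have l: "lmap S Tight (us @ b # vs) (rep S Tight bs c g)" "lmap S y as (rep S y as b f)"
    by (auto intro!: is_map_rep simp: op_long_def)
  let ?g = "rep S Tight bs c g" and ?f = "rep S y as b f"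
  have "lsub S Loose us vs y as (loosen S Tight bs ?g) ?f =
      loosen S (otype Tight i y) (us @ as @ vs) (lsub S Tight us vs y as ?g ?f)"
    using loosen_lsub[of Tight us ?f vs ?g] l by (simp add: bs)
  then show "Sub (multi_of S) Loose bs c i y as (J (multi_of S) bs c g) f =
      (if otype Loose i y = otype Tight i y then Sub (multi_of S) Tight bs c i y as g f
       else J (multi_of S) (plug bs i as) c (Sub (multi_of S) Tight bs c i y as g f))"
    using rep_loosen[of bs ?g c] rep_lsub[OF l(2), of ?g c Tight us vs] l(1)
    by (cases y) (auto simp: bs otype_def loosen_def split: if_splits)
qed

text \<open>
  Substituting an identity changes nothing, so the identity of \<open>a\<^sub>1 \<dots> a\<^sub>n\<close> classifies all maps whose
  inputs begin with \<open>a\<^sub>1, \<dots>, a\<^sub>n\<close>.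
\<close>

theorem left_representable_multi_of: "left_representable (multi_of S)"
  unfolding left_representable_def
proof (intro allI impI; elim conjE)
  fix x as assume ar: "arity_long x (length as)" and "set as \<subseteq> Obj (multi_of S)"
  then have ob: "set as \<subseteq> Ob S" "x = Tight \<longrightarrow> as \<noteq> []" by (auto simp: arity_long_def)
  let ?m = "tobx S x as"
  have m: "?m \<in> Ob S" using ob by simp
  have I: "rep S x as ?m (Idn S ?m) = \<I> ?m" by (simp add: idar_def)
  have map: "is_map (multi_of S) x as ?m (Idn S ?m)"
    using m ob by (simp add: is_map_multi_of[OF tensor_category_axioms ar] I) (simp add: lmap_def)
  have "bij_betw (\<lambda>f. Sub (multi_of S) Tight (?m # ys) b 1 x as f (Idn S ?m))
        (Maps (multi_of S) Tight (?m # ys) b) (Maps (multi_of S) x (as @ ys) b)"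
    if "set ys \<subseteq> Ob S" "b \<in> Ob S" for ys b
  proof -
    have "Sub (multi_of S) Tight (?m # ys) b 1 x as f (Idn S ?m) = f"
      if "f \<in> Maps (multi_of S) Tight (?m # ys) b" for f
      using multi_of_simps(5)[of S Tight "[]" ?m ys] that \<open>set ys \<subseteq> Ob S\<close> \<open>b \<in> Ob S\<close> m
      by (simp add: I lsub_def)
    then have "bij_betw (\<lambda>f. Sub (multi_of S) Tight (?m # ys) b 1 x as f (Idn S ?m))
        (Maps (multi_of S) Tight (?m # ys) b) (Maps (multi_of S) Tight (?m # ys) b)"
      by (subst bij_betw_cong[where g = id]) auto
    then show ?thesis using ob by simp
  qed
  then show "\<exists>m \<theta>. is_map (multi_of S) x as m \<theta> \<and> (\<forall>ys b. set ys \<subseteq> Obj (multi_of S) \<and> b \<in> Obj (multi_of S) \<longrightarrow>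
      bij_betw (\<lambda>f. Sub (multi_of S) Tight (m # ys) b 1 x as f \<theta>)
        (Maps (multi_of S) Tight (m # ys) b) (Maps (multi_of S) x (as @ ys) b))"
    using map by (intro exI[of _ ?m] exI[of _ "Idn S ?m"]) simp
qed

end

section \<open>Multimaps with their inputs and output\<close>

text \<open>
  As for arrows, a map is bundled with its type, inputs and output, so that substitution takes two
  maps and a position only.
\<close>

type_synonym ('o, 'm) mmap = "ty \<times> 'o list \<times> 'o \<times> 'm"

abbreviation kind :: "('o, 'm) mmap \<Rightarrow> ty" where "kind f \<equiv> fst f"
abbreviation inputs :: "('o, 'm) mmap \<Rightarrow> 'o list" where "inputs f \<equiv> fst (snd f)"
abbreviation out :: "('o, 'm) mmap \<Rightarrow> 'o" where "out f \<equiv> fst (snd (snd f))"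
abbreviation elem :: "('o, 'm) mmap \<Rightarrow> 'm" where "elem f \<equiv> snd (snd (snd f))"

definition sub :: "('o, 'm) multi \<Rightarrow> ('o, 'm) mmap \<Rightarrow> nat \<Rightarrow> ('o, 'm) mmap \<Rightarrow> ('o, 'm) mmap" where
  "sub C g i f =
     (otype (kind g) i (kind f), plug (inputs g) i (inputs f), out g,
      Sub C (kind g) (inputs g) (out g) i (kind f) (inputs f) (elem g) (elem f))"

definition jj :: "('o, 'm) multi \<Rightarrow> ('o, 'm) mmap \<Rightarrow> ('o, 'm) mmap" where
  "jj C f = (Loose, inputs f, out f, J C (inputs f) (out f) (elem f))"

definition idm :: "('o, 'm) multi \<Rightarrow> 'o \<Rightarrow> ('o, 'm) mmap" where
  "idm C a = (Tight, [a], a, Idt C a)"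

lemma sub_simps [simp]:
  "kind (sub C g i f) = otype (kind g) i (kind f)"
  "inputs (sub C g i f) = plug (inputs g) i (inputs f)"
  "out (sub C g i f) = out g"
  by (simp_all add: sub_def)

lemma jj_simps [simp]: "kind (jj C f) = Loose" "inputs (jj C f) = inputs f" "out (jj C f) = out f"
  by (simp_all add: jj_def)

lemma idm_simps [simp]: "kind (idm C a) = Tight" "inputs (idm C a) = [a]" "out (idm C a) = a"
  by (simp_all add: idm_def)

lemma mmap_eqI:
  "\<lbrakk>kind f = kind g; inputs f = inputs g; out f = out g; elem f = elem g\<rbrakk> \<Longrightarrow> f = (g :: ('o, 'm) mmap)"
  by (simp add: prod_eq_iff)

lemma plug_simps [simp]:
  "plug (b # bs) (Suc 0) as = as @ bs"
  "plug (b # bs) (Suc (Suc n)) as = b # plug bs (Suc n) as"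
  by (simp_all add: plug_def)

lemma length_plug: "1 \<le> i \<Longrightarrow> i \<le> length bs \<Longrightarrow> length (plug bs i as) = length bs + length as - 1"
  by (auto simp: plug_def)

lemma plug_plug:
  assumes "1 \<le> i" "i \<le> length bs" "1 \<le> j" "j \<le> length as"
  shows "plug bs i (plug as j ds) = plug (plug bs i as) (i + j - 1) ds"
proof -
  obtain us b vs where bs: "bs = us @ b # vs" "i = Suc (length us)"
    using assms by (metis split_list_at)
  obtain us' a vs' where as: "as = us' @ a # vs'" "j = Suc (length us')"
    using assms by (metis split_list_at)
  show ?thesis
    using plug_split[of "us @ us'" a "vs' @ vs" ds] by (simp add: bs as)
qed

lemma plug_commute:
  assumes "1 \<le> i" "i < k" "k \<le> length bs"
  shows "plug (plug bs i as) (k + length as - 1) ds = plug (plug bs k ds) i as"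
proof -
  obtain us b vs1 where bs1: "bs = us @ b # vs1" "i = Suc (length us)"
    using assms by (metis split_list_at less_le_trans less_imp_le)
  have "1 \<le> k - i" "k - i \<le> length vs1" using assms bs1 by auto
  then obtain vs d ws where vs: "vs1 = vs @ d # ws" "k - i = Suc (length vs)"
    by (rule split_list_at)
  have bs: "bs = us @ b # vs @ d # ws" and k: "k = Suc (length (us @ b # vs))"
    using bs1 vs assms by auto
  have "k + length as - 1 = Suc (length (us @ as @ vs))" using k by simp
  then have "plug (plug bs i as) (k + length as - 1) ds = (us @ as @ vs) @ ds @ ws"
    using plug_split[of "us @ as @ vs" d ws ds] by (simp add: bs bs1(2))
  then show ?thesis
    using plug_split[of "us @ b # vs" d ws ds] by (simp add: bs bs1(2) k)
qed

lemma otype_Loose [simp]: "otype Loose i y = Loose"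
  unfolding otype_def by simp

lemma otype_first_Loose [simp]: "otype x (Suc 0) Loose = Loose"
  unfolding otype_def by simp

lemma otype_first_Tight [simp]: "otype x (Suc 0) Tight = x"
  unfolding otype_def by (cases x) simp_all

declare otype_front [simp]

lemma otype_later: "i \<noteq> Suc 0 \<Longrightarrow> otype x i y = x"
  unfolding otype_def by (cases x) simp_all

lemma otype_assoc:
  assumes "1 \<le> i" "1 \<le> j"
  shows "otype x i (otype y j z) = otype (otype x i y) (i + j - 1) z"
proof (cases "i = Suc 0")
  case True
  then show ?thesis by (cases y; cases "j = Suc 0") (auto simp: otype_later)
next
  case False
  then have "i + j - 1 \<noteq> Suc 0" using assms by linarith
  then show ?thesis using False by (simp add: otype_later)
qed

lemma otype_commute:
  assumes "1 \<le> i" "i < k" "y = Tight \<longrightarrow> 1 \<le> m"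
  shows "otype (otype x i y) (k + m - 1) z = otype (otype x k z) i y"
proof -
  have k: "otype x k z = x" using assms(1,2) by (intro otype_later) linarith
  show ?thesis
  proof (cases "i = Suc 0 \<and> y = Loose")
    case True
    then show ?thesis by simp
  next
    case False
    then have "otype x i y = x" by (cases y; cases "i = Suc 0") (auto simp: otype_later)
    moreover have "k + m - 1 \<noteq> Suc 0" using False assms by (cases y) linarith+
    ultimately show ?thesis using k by (simp add: otype_later)
  qed
qed

section \<open>Truncated skew multicategories\<close>

text \<open>
  A skew multicategory restricted to the arities \<open>ar\<close> and the substitutions \<open>op\<close>.  The conditions on
  \<open>ar\<close> and \<open>op\<close> provide what is met when classifiers are split off an outer map one at a time, or off
  the map that is substituted into it: the substitutions that remain after a splitting step must be
  available, and the laws relating them must hold.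
\<close>

locale truncated_multicategory =
  fixes ar :: "ty \<Rightarrow> nat \<Rightarrow> bool" and op :: "ty \<Rightarrow> nat \<Rightarrow> nat \<Rightarrow> ty \<Rightarrow> nat \<Rightarrow> bool"
    and C :: "('o, 'm) multi"
  assumes typed: "well_typed ar op C"
    and identities: "id_law ar C"
    and op_ar: "op x n i y m \<Longrightarrow> ar x n \<and> ar y m \<and> 1 \<le> i \<and> i \<le> n \<and> ar (otype x i y) (n + m - 1)"
    and ar_Tight: "ar Tight n \<Longrightarrow> 1 \<le> n"
    and ar_small: "ar Tight 4" "ar Loose 2"
    and ar_Tight_le: "\<lbrakk>ar Tight n; 1 \<le> k; k \<le> n\<rbrakk> \<Longrightarrow> ar Tight k"
    and ar_Loose_le: "\<lbrakk>ar Loose n; k \<le> n\<rbrakk> \<Longrightarrow> ar Loose k"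
    and ar_Loose: "ar Loose n \<Longrightarrow> ar Tight (Suc n)"
    and op_outer: "ar y m \<Longrightarrow> op Tight 1 1 y m"
    and op_inner: "\<lbrakk>ar x n; 1 \<le> i; i \<le> n\<rbrakk> \<Longrightarrow> op x n i Tight 1"
    and op_binary: "\<lbrakk>ar Tight (Suc n); 1 \<le> i; i \<le> n\<rbrakk> \<Longrightarrow> op Tight n i Tight 2"
    and op_nullary: "\<lbrakk>ar Loose n; 1 \<le> i; i \<le> Suc n\<rbrakk> \<Longrightarrow> op Tight (Suc n) i Loose 0"
    and op_loose_unary: "\<lbrakk>ar Loose n; 1 \<le> n\<rbrakk> \<Longrightarrow> op Tight n 1 Loose 1"
    and op_special: "op Tight 2 2 Tight 3" "op Tight 2 2 Loose 1" "op Loose 1 1 Tight 2" "op Loose 1 1 Loose 0"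
    and op_shift_first: "\<lbrakk>op Tight (Suc n) 1 y m; 1 \<le> n\<rbrakk> \<Longrightarrow> op Tight n 1 y (Suc m)"
    and op_shift_second: "\<lbrakk>op Tight (Suc n) 2 y m; 1 \<le> n\<rbrakk> \<Longrightarrow> op Tight n 1 Tight (Suc m)"
    and op_shift_later: "\<lbrakk>op Tight (Suc n) (Suc k) y m; 2 \<le> k\<rbrakk> \<Longrightarrow> op Tight n k y m"
    and op_shift_loose: "op Loose n i y m \<Longrightarrow> op Tight (Suc n) (Suc i) y m"
    and op_reduce: "\<lbrakk>op Tight n i y m; 2 \<le> n; i \<le> 2\<rbrakk> \<Longrightarrow> op Tight 2 i y m"
    and op_lower: "\<lbrakk>op Tight 2 i Tight (Suc m); 1 \<le> m\<rbrakk> \<Longrightarrow> op Tight 2 i Tight m"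
    and op_tighten: "op Tight 2 i Loose m \<Longrightarrow> op Tight 2 i Tight (Suc m)"
    and op_second: "op Tight 2 i Loose m \<Longrightarrow> ar Loose (Suc m)"
    and outer: "op y m j z r \<Longrightarrow> assoc_law C Tight 1 1 y m j z r"
    and middle: "op x n i z r \<Longrightarrow> assoc_law C x n i Tight 1 1 z r"
    and inner: "\<lbrakk>op x n i y m; 1 \<le> k; k \<le> m\<rbrakk> \<Longrightarrow> assoc_law C x n i y m k Tight 1"
    and parallel_right: "\<lbrakk>op x n i y m; i < k; k \<le> n\<rbrakk> \<Longrightarrow> comm_law C x n i y m k Tight 1"
    and parallel_left: "\<lbrakk>op x n i y m; 1 \<le> k; k < i\<rbrakk> \<Longrightarrow> comm_law C x n k Tight 1 i y m"
    and assoc_first: "\<lbrakk>op Tight (Suc n) j y m; 1 \<le> n; j \<in> {1, 2}\<rbrakk> \<Longrightarrow> assoc_law C Tight n 1 Tight 2 j y m"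
    and assoc_second: "(z, r) \<in> {(Tight, 2), (Loose, 0)} \<Longrightarrow> assoc_law C Tight 2 2 Tight 2 2 z r"
    and assoc_binary: "\<lbrakk>op Tight 2 i Tight (Suc m); 1 \<le> m\<rbrakk> \<Longrightarrow> assoc_law C Tight 2 i Tight m 1 Tight 2"
    and assoc_nullary: "op Tight 2 i Loose m \<Longrightarrow> assoc_law C Tight 2 i Tight (Suc m) 1 Loose 0"
    and comm_first: "\<lbrakk>op Tight (Suc n) (Suc k) y m; 2 \<le> k\<rbrakk> \<Longrightarrow> comm_law C Tight n 1 Tight 2 k y m"
    and comm_nullary: "op Loose n i y m \<Longrightarrow> comm_law C Tight (Suc n) 1 Loose 0 (Suc i) y m"
    and j_first: "\<lbrakk>ar Loose (length bs); is_map C Tight bs c g; bs = b # bs'; is_map C Tight [a] b p\<rbrakk> \<Longrightarrow>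
       Sub C Tight bs c 1 Loose [a] g (J C [a] b p) =
       J C (a # bs') c (Sub C Tight bs c 1 Tight [a] g p)"
    and j_inner: "\<lbrakk>is_map C Tight [b] c q; is_map C Tight [a] b p\<rbrakk> \<Longrightarrow>
       Sub C Loose [b] c 1 Tight [a] (J C [b] c q) p = J C [a] c (Sub C Tight [b] c 1 Tight [a] q p)"
    and j_second:
      "\<lbrakk>is_map C Tight [b1, b2] c g; is_map C Tight [a] b2 p\<rbrakk> \<Longrightarrow>
       Sub C Tight [b1, b2] c 2 Loose [a] g (J C [a] b2 p) = Sub C Tight [b1, b2] c 2 Tight [a] g p"
    and j_before_binary:
      "\<lbrakk>is_map C Tight [a1, a2] b g; is_map C Tight [b] c p\<rbrakk> \<Longrightarrow>
       Sub C Loose [b] c 1 Tight [a1, a2] (J C [b] c p) g =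
       J C [a1, a2] c (Sub C Tight [b] c 1 Tight [a1, a2] p g)"
    and j_before_nullary:
      "\<lbrakk>is_map C Loose [] b v; is_map C Tight [b] c p\<rbrakk> \<Longrightarrow>
       Sub C Loose [b] c 1 Loose [] (J C [b] c p) v = Sub C Tight [b] c 1 Loose [] p v"

lemma (in skew_multicategory) truncated_long: "truncated_multicategory arity_long op_long C"
proof
  fix bs c g b bs' a p
  assume "arity_long Loose (length bs)" "is_map C Tight bs c g" "bs = b # bs'" "is_map C Tight [a] b p"
  then show "Sub C Tight bs c 1 Loose [a] g (J C [a] b p) =
       J C (a # bs') c (Sub C Tight bs c 1 Tight [a] g p)"
    using j_argument[of Tight bs 1 "[a]" c g p]
    by (simp add: op_long_def arity_long_def otype_def)
next
  fix b c q a p assume "is_map C Tight [b] c q" "is_map C Tight [a] b p"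
  then show "Sub C Loose [b] c 1 Tight [a] (J C [b] c q) p = J C [a] c (Sub C Tight [b] c 1 Tight [a] q p)"
    using j_function[of "[b]" 1 Tight "[a]" c q p]
    by (simp add: op_long_def arity_long_def otype_def)
next
  fix b1 b2 c g a p assume "is_map C Tight [b1, b2] c g" "is_map C Tight [a] b2 p"
  then show "Sub C Tight [b1, b2] c 2 Loose [a] g (J C [a] b2 p) = Sub C Tight [b1, b2] c 2 Tight [a] g p"
    using j_argument[of Tight "[b1, b2]" 2 "[a]" c g p]
    by (simp add: op_long_def arity_long_def otype_def)
next
  fix a1 a2 b g c p assume "is_map C Tight [a1, a2] b g" "is_map C Tight [b] c p"
  then show "Sub C Loose [b] c 1 Tight [a1, a2] (J C [b] c p) g =
       J C [a1, a2] c (Sub C Tight [b] c 1 Tight [a1, a2] p g)"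
    using j_function[of "[b]" 1 Tight "[a1, a2]" c p g]
    by (simp add: op_long_def arity_long_def otype_def)
next
  fix b v c p assume "is_map C Loose [] b v" "is_map C Tight [b] c p"
  then show "Sub C Loose [b] c 1 Loose [] (J C [b] c p) v = Sub C Tight [b] c 1 Loose [] p v"
    using j_function[of "[b]" 1 Loose "[]" c p v]
    by (simp add: op_long_def arity_long_def otype_def)
qed (use typed identities in \<open>auto simp: op_long_def arity_long_def otype_def
       intro!: associativity commutativity\<close>)

lemma op_short_cases:
  "op_short x n i y m \<longleftrightarrow> arity_short x n \<and> arity_short y m \<and> 1 \<le> i \<and> i \<le> n \<and>
     ((x = Tight \<and> n = 1) \<or> (y = Tight \<and> m = 1) \<or>
      (x, n, y, m) \<in> {(Tight, 2, Tight, 2), (Tight, 3, Tight, 2), (Tight, 2, Tight, 3), (Tight, 2, Loose, 0),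
        (Tight, 3, Loose, 0), (Loose, 1, Loose, 0), (Tight, 2, Loose, 1), (Loose, 1, Tight, 2)})"
  unfolding op_short_def by auto

text \<open>
  For unary maps the required laws are naturality.  The remaining instances involve only binary and
  nullary maps in a binary map, and these are exactly the axioms of a short skew multicategory.
\<close>

lemma (in short_skew_multicategory) truncated_short: "truncated_multicategory arity_short op_short C"
proof
  fix bs c g b bs' a p
  assume a: "arity_short Loose (length bs)" "is_map C Tight bs c g" "bs = b # bs'" "is_map C Tight [a] b p"
  show "Sub C Tight bs c 1 Loose [a] g (J C [a] b p) =
       J C (a # bs') c (Sub C Tight bs c 1 Tight [a] g p)"
  proof (cases bs')
    case Nil
    then show ?thesis using a j_after_unary by auto
  next
    case (Cons b2 l)
    then have "bs = [b, b2]" using a by (cases l) (auto simp: arity_short_def)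
    then show ?thesis using a j_first[of b b2 c g a p] by auto
  qed
next
  fix b c q a p assume "is_map C Tight [b] c q" "is_map C Tight [a] b p"
  then show "Sub C Loose [b] c 1 Tight [a] (J C [b] c q) p = J C [a] c (Sub C Tight [b] c 1 Tight [a] q p)"
    using j_natural_inner[of "[b]" 1 c q a p] by simp
next
  fix n j y m assume a: "op_short Tight (Suc n) j y m" "1 \<le> n" "j \<in> {1, 2}"
  show "assoc_law C Tight n 1 Tight 2 j y m"
  proof (cases "y = Tight \<and> m = 1")
    case True
    then have "n = 1 \<or> n = 2 \<or> n = 3" using a by (auto simp: op_short_def arity_short_def)
    then show ?thesis using True a inner[of Tight n 1 Tight 2 j] by (auto simp: op_short_def arity_short_def)
  next
    case False
    then consider "n = 1" | "n = 2" "(y, m) \<in> {(Tight, 2), (Loose, 0)}"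
      using a by (auto simp: op_short_cases)
    then show ?thesis
    proof cases
      case 1
      then show ?thesis using a outer[of Tight 2 j y m] by (simp add: numeral_2_eq_2)
    next
      case 2
      then show ?thesis using a assoc_axiom[of 1 j y m] by blast
    qed
  qed
next
  fix i m assume a: "op_short Tight 2 i Tight (Suc m)" "1 \<le> m"
  then have "i \<in> {1, 2}" by (auto simp: op_short_cases)
  then consider "m = 1" | "m = 2" "i \<in> {1, 2}"
    using a by (auto simp: op_short_cases)
  then show "assoc_law C Tight 2 i Tight m 1 Tight 2"
  proof cases
    case 1
    then show ?thesis using a middle[of Tight 2 i Tight 2] by (simp add: numeral_2_eq_2)
  next
    case 2
    then show ?thesis using assoc_axiom[of i 1 Tight 2] by blast
  qed
next
  fix i m assume a: "op_short Tight 2 i Loose m"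
  then have "i \<in> {1, 2}" by (auto simp: op_short_cases)
  then consider "m = 0" | "m = 1" "i \<in> {1, 2}"
    using a by (auto simp: op_short_cases)
  then show "assoc_law C Tight 2 i Tight (Suc m) 1 Loose 0"
  proof cases
    case 1
    then show ?thesis using a middle[of Tight 2 i Loose 0] by simp
  next
    case 2
    then show ?thesis using assoc_axiom[of i 1 Loose 0] by (simp add: numeral_2_eq_2)
  qed
next
  fix n k y m assume a: "op_short Tight (Suc n) (Suc k) y m" "(2::nat) \<le> k"
  show "comm_law C Tight n 1 Tight 2 k y m"
  proof (cases "y = Tight \<and> m = 1")
    case True
    then have "n = 2 \<or> n = 3" using a by (auto simp: op_short_def arity_short_def)
    then show ?thesis using True a parallel_right[of Tight n 1 Tight 2 k]
      by (auto simp: op_short_def arity_short_def)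
  next
    case False
    then have "n = 2" "k = 2" "(y, m) \<in> {(Tight, 2), (Loose, 0)}"
      using a by (auto simp: op_short_cases)
    then show ?thesis using comm_axiom[of Tight 2 y m] by simp
  qed
next
  fix n i y m assume a: "op_short Loose n i y m"
  show "comm_law C Tight (Suc n) 1 Loose 0 (Suc i) y m"
  proof (cases "y = Tight \<and> m = 1")
    case True
    then have "n = 1 \<or> n = 2" using a by (auto simp: op_short_def arity_short_def)
    then show ?thesis using True a parallel_right[of Tight "Suc n" 1 Loose 0 "Suc i"]
      by (auto simp: op_short_def arity_short_def)
  next
    case False
    then have "n = 1" "i = 1" "(y, m) \<in> {(Tight, 2), (Loose, 0)}"
      using a by (auto simp: op_short_cases)
    then show ?thesis using comm_axiom[of Loose 0 y m] by (simp add: numeral_2_eq_2)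
  qed
qed ((rule typed identities)
      | (rule assoc_axiom; simp; fail)
      | (rule outer middle inner parallel_right parallel_left j_second j_before_binary
          j_before_nullary; assumption)
      | (auto simp: op_short_cases arity_short_def otype_def)[1])+

section \<open>Maps as arrows out of left bracketed products\<close>

locale classified_multicategory = truncated_multicategory ar op C
  for ar op and C :: "('o, 'm) multi" +
  fixes chi :: "('o, 'm) classifiers"
  assumes theta_map: "\<lbrakk>a \<in> Obj C; b \<in> Obj C\<rbrakk> \<Longrightarrow>
      is_map C Tight [a, b] (ctens chi a b) (ctheta chi a b)"
    and theta_bij: "\<lbrakk>a \<in> Obj C; b \<in> Obj C; set xs \<subseteq> Obj C; d \<in> Obj C; ar Tight (length (a # b # xs))\<rbrakk> \<Longrightarrow>
      bij_betw (\<lambda>f. Sub C Tight (ctens chi a b # xs) d 1 Tight [a, b] f (ctheta chi a b))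
        (Maps C Tight (ctens chi a b # xs) d) (Maps C Tight (a # b # xs) d)"
    and null_map: "is_map C Loose [] (cunit chi) (cnull chi)"
    and null_bij: "\<lbrakk>set xs \<subseteq> Obj C; d \<in> Obj C; ar Loose (length xs)\<rbrakk> \<Longrightarrow>
      bij_betw (\<lambda>f. Sub C Tight (cunit chi # xs) d 1 Loose [] f (cnull chi))
        (Maps C Tight (cunit chi # xs) d) (Maps C Loose xs d)"

definition skmon_theta :: "('o, 'm) multi \<Rightarrow> ('o, 'm) classifiers \<Rightarrow> 'o \<Rightarrow> 'o \<Rightarrow> ('o, 'm) mmap" where
  "skmon_theta C chi a b = (Tight, [a, b], TO (skmon_of C chi) a b, ctheta chi a b)"

definition skmon_null :: "('o, 'm) multi \<Rightarrow> ('o, 'm) classifiers \<Rightarrow> ('o, 'm) mmap" where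
  "skmon_null C chi = (Loose, [], Unit (skmon_of C chi), cnull chi)"

definition up :: "'o \<Rightarrow> ('o, 'm) arrow \<Rightarrow> ('o, 'm) mmap" where
  "up a f = (Tight, [a], target f, label f)"

text \<open>
  The tight map with inputs \<open>a # xs\<close> that corresponds to an arrow out of \<open>a x\<^sub>1 \<dots> x\<^sub>n\<close>: the binary
  classifiers are substituted in the first position, outermost factor first.
\<close>

primrec EE :: "('o, 'm) multi \<Rightarrow> ('o, 'm) classifiers \<Rightarrow> 'o \<Rightarrow> 'o list \<Rightarrow> ('o, 'm) arrow \<Rightarrow> ('o, 'm) mmap" where
  "EE C chi a [] f = up a f"
| "EE C chi a (x # xs) f = sub C (EE C chi (TO (skmon_of C chi) a x) xs f) (Suc 0) (skmon_theta C chi a x)"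

text \<open>
  The dictionary between arrows and maps, for both types.
\<close>

definition EM :: "('o, 'm) multi \<Rightarrow> ('o, 'm) classifiers \<Rightarrow> ty \<Rightarrow> 'o list \<Rightarrow> ('o, 'm) arrow \<Rightarrow> ('o, 'm) mmap" where
  "EM C chi x as f =
    (if x = Tight then EE C chi (hd as) (tl as) f
     else sub C (EE C chi (Unit (skmon_of C chi)) as f) (Suc 0) (skmon_null C chi))"

definition mm :: "(ty \<Rightarrow> nat \<Rightarrow> bool) \<Rightarrow> ('o, 'm) multi \<Rightarrow> ('o, 'm) mmap \<Rightarrow> bool" where
  "mm ar C f \<longleftrightarrow> ar (kind f) (length (inputs f)) \<and> is_map C (kind f) (inputs f) (out f) (elem f)"

lemma up_simps [simp]: "kind (up a f) = Tight" "inputs (up a f) = [a]" "out (up a f) = target f"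
  by (simp_all add: up_def)

lemma skmon_theta_simps [simp]: "kind (skmon_theta C chi a b) = Tight" "inputs (skmon_theta C chi a b) = [a, b]"
  "out (skmon_theta C chi a b) = TO (skmon_of C chi) a b"
  by (simp_all add: skmon_theta_def)

lemma skmon_null_simps [simp]: "kind (skmon_null C chi) = Loose" "inputs (skmon_null C chi) = []"
  "out (skmon_null C chi) = Unit (skmon_of C chi)"
  by (simp_all add: skmon_null_def)

lemma EE_simps [simp]: "kind (EE C chi a xs f) = Tight" "inputs (EE C chi a xs f) = a # xs"
  "out (EE C chi a xs f) = target f"
  by (induction xs arbitrary: a) auto

lemma EM_simps [simp]: "kind (EM C chi x as f) = x"
  "x = Tight \<longrightarrow> as \<noteq> [] \<Longrightarrow> inputs (EM C chi x as f) = as"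
  "out (EM C chi x as f) = target f"
  by (cases x; auto simp: EM_def)+

lemma EM_Tight: "EM C chi Tight (a # as) f = EE C chi a as f"
  and EM_Loose: "EM C chi Loose as f = sub C (EE C chi (Unit (skmon_of C chi)) as f) (Suc 0) (skmon_null C chi)"
  by (simp_all add: EM_def)

lemma skmon_of_simps [simp]:
  "Ob (skmon_of C chi) = Obj C"
  "Hom (skmon_of C chi) = (\<lambda>a b. Maps C Tight [a] b)"
  "Idn (skmon_of C chi) = Idt C"
  "Comp (skmon_of C chi) = (\<lambda>a b c g f. Sub C Tight [b] c 1 Tight [a] g f)"
  by (simp_all add: skmon_of_def Let_def)

lemma skmon_of_TO: "TO (skmon_of C chi) = ctens chi"
  and skmon_of_Unit: "Unit (skmon_of C chi) = cunit chi"
  by (simp_all add: skmon_of_def Let_def)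

lemma assoc_lawD:
  "\<lbrakk>assoc_law C x (length bs) i y (length as) j z (length ds); is_map C x bs c g;
    is_map C y as (bs ! (i - 1)) f; is_map C z ds (as ! (j - 1)) h\<rbrakk> \<Longrightarrow>
   Sub C x bs c i (otype y j z) (plug as j ds) g (Sub C y as (bs ! (i - 1)) j z ds f h) =
   Sub C (otype x i y) (plug bs i as) c (i + j - 1) z ds (Sub C x bs c i y as g f) h"
  unfolding assoc_law_def by blast

lemma comm_lawD:
  "\<lbrakk>comm_law C x (length bs) i y (length as) k z (length ds); is_map C x bs c g;
    is_map C y as (bs ! (i - 1)) f; is_map C z ds (bs ! (k - 1)) h\<rbrakk> \<Longrightarrow>
   Sub C (otype x i y) (plug bs i as) c (k + length as - 1) z ds (Sub C x bs c i y as g f) h =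
   Sub C (otype x k z) (plug bs k ds) c i y as (Sub C x bs c k z ds g h) f"
  unfolding comm_law_def by blast

context truncated_multicategory
begin

abbreviation sb :: "('o, 'm) mmap \<Rightarrow> nat \<Rightarrow> ('o, 'm) mmap \<Rightarrow> ('o, 'm) mmap" ("_ \<odot>\<^bsub>_\<^esub> _" [70, 0, 71] 70) where
  "g \<odot>\<^bsub>i\<^esub> f \<equiv> sub C g i f"

abbreviation sb1 :: "('o, 'm) mmap \<Rightarrow> ('o, 'm) mmap \<Rightarrow> ('o, 'm) mmap" (infixl "\<odot>" 70) where
  "g \<odot> f \<equiv> sub C g (Suc 0) f"

lemma ar_unary [simp]: "ar Tight (Suc 0)" "ar Tight 2" "ar Tight 3" "ar Tight 4"
  "ar Tight (Suc (Suc 0))" "ar Tight (Suc (Suc (Suc 0)))" "ar Tight (Suc (Suc (Suc (Suc 0))))"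
  "ar Loose 0" "ar Loose (Suc 0)" "ar Loose 2" "ar Loose (Suc (Suc 0))"
  using ar_small ar_Tight_le[of 4] ar_Loose_le[of 2] by (auto simp: eval_nat_numeral)

lemma mm_sub [simp]:
  assumes "op (kind g) (length (inputs g)) i (kind f) (length (inputs f))"
    "mm ar C g" "mm ar C f" "inputs g ! (i - 1) = out f"
  shows "mm ar C (g \<odot>\<^bsub>i\<^esub> f)"
proof -
  have g: "is_map C (kind g) (inputs g) (out g) (elem g)"
    and f: "is_map C (kind f) (inputs f) (inputs g ! (i - 1)) (elem f)"
    using assms by (auto simp: mm_def)
  then have "Sub C (kind g) (inputs g) (out g) i (kind f) (inputs f) (elem g) (elem f) \<in>
      Maps C (otype (kind g) i (kind f)) (plug (inputs g) i (inputs f)) (out g)"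
    using typed assms(1) unfolding well_typed_def by blast
  moreover have "set (plug (inputs g) i (inputs f)) \<subseteq> Obj C"
    using f g set_take_subset set_drop_subset unfolding is_map_def plug_def
    by (fastforce dest: in_set_takeD in_set_dropD)
  ultimately show ?thesis
    using op_ar[OF assms(1)] g by (auto simp: mm_def is_map_def sub_def length_plug)
qed

lemma sub_assoc:
  assumes "assoc_law C (kind g) (length (inputs g)) i (kind f) (length (inputs f)) j (kind h) (length (inputs h))"
    "mm ar C g" "mm ar C f" "mm ar C h"
    "inputs g ! (i - 1) = out f" "inputs f ! (j - 1) = out h"
    "1 \<le> i" "i \<le> length (inputs g)" "1 \<le> j" "j \<le> length (inputs f)"
  shows "g \<odot>\<^bsub>i\<^esub> (f \<odot>\<^bsub>j\<^esub> h) = (g \<odot>\<^bsub>i\<^esub> f) \<odot>\<^bsub>i + j - 1\<^esub> h"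
proof (rule mmap_eqI)
  show "elem (g \<odot>\<^bsub>i\<^esub> (f \<odot>\<^bsub>j\<^esub> h)) = elem ((g \<odot>\<^bsub>i\<^esub> f) \<odot>\<^bsub>i + j - 1\<^esub> h)"
    using assoc_lawD[OF assms(1), of "out g" "elem g" "elem f" "elem h"] assms(2-)
    by (simp add: mm_def sub_def)
qed (use assms in \<open>simp_all add: plug_plug otype_assoc\<close>)

lemma sub_commute:
  assumes "comm_law C (kind g) (length (inputs g)) i (kind f) (length (inputs f)) k (kind h) (length (inputs h))"
    "mm ar C g" "mm ar C f" "mm ar C h"
    "inputs g ! (i - 1) = out f" "inputs g ! (k - 1) = out h"
    "1 \<le> i" "i < k" "k \<le> length (inputs g)"
  shows "(g \<odot>\<^bsub>i\<^esub> f) \<odot>\<^bsub>k + length (inputs f) - 1\<^esub> h = (g \<odot>\<^bsub>k\<^esub> h) \<odot>\<^bsub>i\<^esub> f"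
proof (rule mmap_eqI)
  have "kind f = Tight \<longrightarrow> 1 \<le> length (inputs f)"
    using assms(3) ar_Tight by (auto simp: mm_def)
  then show "kind ((g \<odot>\<^bsub>i\<^esub> f) \<odot>\<^bsub>k + length (inputs f) - 1\<^esub> h) = kind ((g \<odot>\<^bsub>k\<^esub> h) \<odot>\<^bsub>i\<^esub> f)"
    using assms otype_commute[of i k "kind f" "length (inputs f)"] by simp
  show "elem ((g \<odot>\<^bsub>i\<^esub> f) \<odot>\<^bsub>k + length (inputs f) - 1\<^esub> h) = elem ((g \<odot>\<^bsub>k\<^esub> h) \<odot>\<^bsub>i\<^esub> f)"
    using comm_lawD[OF assms(1), of "out g" "elem g" "elem f" "elem h"] assms(2-)
    by (simp add: mm_def sub_def)
qed (use assms plug_commute[of i k "inputs g" "inputs f" "inputs h"] in simp_all)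

lemma mm_idm [simp]: "a \<in> Obj C \<Longrightarrow> mm ar C (idm C a)"
  using typed unfolding well_typed_def mm_def by (simp add: idm_def is_map_def)

lemma sub_idm_left [simp]: "\<lbrakk>mm ar C f; out f = b\<rbrakk> \<Longrightarrow> idm C b \<odot> f = f"
  using identities unfolding id_law_def mm_def
  by (intro mmap_eqI) (auto simp: idm_def sub_def)

lemma sub_idm_right [simp]:
  "\<lbrakk>mm ar C f; 1 \<le> i; i \<le> length (inputs f); inputs f ! (i - 1) = a\<rbrakk> \<Longrightarrow> f \<odot>\<^bsub>i\<^esub> idm C a = f"
proof (rule mmap_eqI)
  assume a: "mm ar C f" "1 \<le> i" "i \<le> length (inputs f)" "inputs f ! (i - 1) = a"
  then show "elem (f \<odot>\<^bsub>i\<^esub> idm C a) = elem f"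
    using identities unfolding id_law_def mm_def by (auto simp: idm_def sub_def)
  obtain us b vs where "inputs f = us @ b # vs" "i = Suc (length us)" using a by (metis split_list_at)
  then show "inputs (f \<odot>\<^bsub>i\<^esub> idm C a) = inputs f" using a by simp
  show "kind (f \<odot>\<^bsub>i\<^esub> idm C a) = kind f"
    by (cases "i = Suc 0") (auto simp: otype_later)
qed simp

definition maps_to :: "ty \<Rightarrow> 'o list \<Rightarrow> 'o \<Rightarrow> ('o, 'm) mmap set" where
  "maps_to x as b = {q. mm ar C q \<and> kind q = x \<and> inputs q = as \<and> out q = b}"

lemma maps_to_image: "\<lbrakk>set as \<subseteq> Obj C; b \<in> Obj C; ar x (length as)\<rbrakk> \<Longrightarrow>
   maps_to x as b = (\<lambda>f. (x, as, b, f)) ` Maps C x as b"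
  unfolding maps_to_def mm_def is_map_def image_def by force

text \<open>
  Transfers the classifying bijections between the bare sets of maps and the sets of bundled maps.
\<close>

lemma bij_betw_elem_iff:
  assumes "set as \<subseteq> Obj C" "b \<in> Obj C" "ar x (length as)"
    "set cs \<subseteq> Obj C" "d \<in> Obj C" "ar y (length cs)"
    "\<And>f. f \<in> Maps C x as b \<Longrightarrow> G (x, as, b, f) = (y, cs, d, F f)"
  shows "bij_betw G (maps_to x as b) (maps_to y cs d) \<longleftrightarrow> bij_betw F (Maps C x as b) (Maps C y cs d)"
proof -
  have 1: "maps_to x as b = (\<lambda>f. (x, as, b, f)) ` Maps C x as b"
    "maps_to y cs d = (\<lambda>f. (y, cs, d, f)) ` Maps C y cs d"
    using assms by (auto simp: maps_to_image)
  show ?thesis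
    unfolding bij_betw_def 1 using assms(7)
    by (auto simp: inj_on_def image_image image_iff set_eq_iff) (metis prod.inject)+
qed

end

context classified_multicategory
begin

abbreviation S where "S \<equiv> skmon_of C chi"
abbreviation E where "E \<equiv> EE C chi"
abbreviation theta where "theta \<equiv> skmon_theta C chi"
abbreviation uu where "uu \<equiv> skmon_null C chi"
abbreviation tensor (infixl "\<otimes>" 70) where "tensor \<equiv> TO (skmon_of C chi)"

lemma arr_S: "arr S f \<longleftrightarrow> mm ar C (up (source f) f)"
  by (auto simp: arr_def mm_def up_def is_map_def)

lemma mm_up [simp]: "\<lbrakk>arr S f; source f = a\<rbrakk> \<Longrightarrow> mm ar C (up a f)"
  using arr_S by blast

lemma mm_theta [simp]: "\<lbrakk>a \<in> Obj C; b \<in> Obj C\<rbrakk> \<Longrightarrow> mm ar C (theta a b)"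
  using theta_map by (simp add: mm_def skmon_theta_def skmon_of_TO)

lemma mm_uu [simp]: "mm ar C uu"
  using null_map by (simp add: mm_def skmon_null_def skmon_of_Unit)

lemma tens_ob [simp]: "\<lbrakk>a \<in> Obj C; b \<in> Obj C\<rbrakk> \<Longrightarrow> a \<otimes> b \<in> Obj C"
  using mm_theta[of a b] by (simp add: mm_def is_map_def)

lemma Unit_ob [simp]: "Unit S \<in> Obj C"
  using mm_uu by (simp add: mm_def is_map_def)

lemma sub_theta_bij:
  assumes "a \<in> Obj C" "b \<in> Obj C" "set xs \<subseteq> Obj C" "d \<in> Obj C" "ar Tight (length (a # b # xs))"
  shows "bij_betw (\<lambda>q. q \<odot> theta a b) (maps_to Tight ((a \<otimes> b) # xs) d) (maps_to Tight (a # b # xs) d)"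
  by (rule bij_betw_elem_iff[THEN iffD2, OF _ _ _ _ _ _ _ theta_bij[OF assms, folded skmon_of_TO[of C]]])
    (use assms ar_Tight_le[of "Suc (Suc (length xs))" "Suc (length xs)"] in \<open>auto simp: sub_def skmon_theta_def\<close>)

lemma sub_uu_bij:
  assumes "set xs \<subseteq> Obj C" "d \<in> Obj C" "ar Loose (length xs)"
  shows "bij_betw (\<lambda>q. q \<odot> uu) (maps_to Tight (Unit S # xs) d) (maps_to Loose xs d)"
  by (rule bij_betw_elem_iff[THEN iffD2, OF _ _ _ _ _ _ _ null_bij[OF assms, folded skmon_of_Unit[of C]]])
    (use assms ar_Loose in \<open>auto simp: sub_def skmon_null_def\<close>)

lemma category_S: "category S"
  unfolding category_def
proof (intro conjI ballI; simp)
  fix a b f assume "a \<in> Obj C" "b \<in> Obj C" "f \<in> Maps C Tight [a] b"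
  then show "Sub C Tight [a] b (Suc 0) Tight [a] f (Idt C a) = f"
    "Sub C Tight [b] b (Suc 0) Tight [a] (Idt C b) f = f"
    using identities ar_unary unfolding id_law_def is_map_def by force+
next
  fix a assume "a \<in> Obj C"
  then show "Idt C a \<in> Maps C Tight [a] a" using typed by (simp add: well_typed_def)
next
  fix a b c f g
  assume "a \<in> Obj C" "b \<in> Obj C" "c \<in> Obj C" "f \<in> Maps C Tight [a] b" "g \<in> Maps C Tight [b] c"
  then show "Sub C Tight [b] c (Suc 0) Tight [a] g f \<in> Maps C Tight [a] c"
    using mm_sub[of "(Tight, [b], c, g)" 1 "(Tight, [a], b, f)"] op_outer[of Tight 1]
    by (simp add: mm_def is_map_def sub_def)
next
  fix a b c d f g h
  assume "a \<in> Obj C" "b \<in> Obj C" "c \<in> Obj C" "d \<in> Obj C"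
    "f \<in> Maps C Tight [a] b" "g \<in> Maps C Tight [b] c" "h \<in> Maps C Tight [c] d"
  then show "Sub C Tight [b] d (Suc 0) Tight [a] (Sub C Tight [c] d (Suc 0) Tight [b] h g) f =
      Sub C Tight [c] d (Suc 0) Tight [a] h (Sub C Tight [b] c (Suc 0) Tight [a] g f)"
    using sub_assoc[of "(Tight, [c], d, h)" 1 "(Tight, [b], c, g)" 1 "(Tight, [a], b, f)"]
      outer[OF op_outer[of Tight 1]]
    by (simp add: mm_def is_map_def sub_def)
qed

end

sublocale classified_multicategory \<subseteq> S: cat_laws "skmon_of C chi"
  by unfold_locales (rule category_S)

context classified_multicategory
begin

lemma up_cmp: "\<lbrakk>arr S f; arr S g; target f = source g; source f = a; source g = b\<rbrakk> \<Longrightarrow>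
    up a (g \<cdot>\<^bsub>S\<^esub> f) = up b g \<odot> up a f"
  by (simp add: up_def cmp_def sub_def)

lemma up_idar [simp]: "up a (\<I>\<^bsub>S\<^esub> a) = idm C a"
  by (simp add: up_def idar_def idm_def)

lemma sub_outer:
  assumes "op (kind f) (length (inputs f)) j (kind h) (length (inputs h))" "arr S g"
    "mm ar C f" "mm ar C h" "source g = out f" "inputs f ! (j - 1) = out h" "source g = b"
  shows "up b g \<odot> (f \<odot>\<^bsub>j\<^esub> h) = (up b g \<odot> f) \<odot>\<^bsub>j\<^esub> h"
  using sub_assoc[of "up b g" 1 f j h] outer[OF assms(1)] op_ar[OF assms(1)] assms by simp

text \<open>
  Each factor is split off by one of the classifying bijections.
\<close>

lemma E_bij:
  assumes "ar Tight (Suc (length xs))" "a \<in> Obj C" "set xs \<subseteq> Obj C" "b \<in> Obj C"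
  shows "bij_betw (E a xs) {f. arr S f \<and> source f = tob S a xs \<and> target f = b} (maps_to Tight (a # xs) b)"
  using assms
proof (induction xs arbitrary: a)
  case Nil
  have "bij_betw (up a) {f. arr S f \<and> source f = a \<and> target f = b} (maps_to Tight [a] b)"
    by (rule bij_betw_byWitness[where f' = "\<lambda>q. (a, elem q, b)"])
      (use Nil in \<open>auto simp: maps_to_def mm_def up_def is_map_def arr_def prod_eq_iff\<close>)
  moreover have "E a [] = up a" by (simp add: fun_eq_iff)
  ultimately show ?case by simp
next
  case (Cons x xs)
  have ar: "ar Tight (Suc (length xs))" using Cons.prems(1) ar_Tight_le by fastforce
  have "bij_betw ((\<lambda>q. q \<odot> theta a x) \<circ> E (a \<otimes> x) xs)
     {f. arr S f \<and> source f = tob S (a \<otimes> x) xs \<and> target f = b} (maps_to Tight (a # x # xs) b)"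
    by (rule bij_betw_trans[OF Cons.IH sub_theta_bij]) (use Cons.prems ar in auto)
  then show ?case by (simp add: comp_def)
qed

end

section \<open>The tensor product and the structure maps in terms of classifiers\<close>

lemma plug_numeral [simp]:
  "plug (b # bs) 2 as = b # plug bs (Suc 0) as"
  "plug (b # bs) 3 as = b # plug bs 2 as"
  by (simp_all add: plug_def numeral_2_eq_2 numeral_3_eq_3)

lemma otype_numeral [simp]: "otype x 2 y = x" "otype x 3 y = x"
  by (simp_all add: otype_later)

text \<open>
  The structure of \<open>skmon_of\<close> is given by definite descriptions; each of them inverts a classifying
  bijection.
\<close>

lemma THE_bij_betw:
  assumes "bij_betw F A B" "y \<in> B"
  shows "(THE k. k \<in> A \<and> F k = y) \<in> A" "F (THE k. k \<in> A \<and> F k = y) = y"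
proof -
  have "\<exists>!k. k \<in> A \<and> F k = y"
    using assms unfolding bij_betw_def inj_on_def by blast
  from theI'[OF this] show "(THE k. k \<in> A \<and> F k = y) \<in> A" "F (THE k. k \<in> A \<and> F k = y) = y"
    by auto
qed

context classified_multicategory
begin

lemma mm_elem: "\<lbrakk>mm ar C q; kind q = x; inputs q = as; out q = b\<rbrakk> \<Longrightarrow> elem q \<in> Maps C x as b"
  by (auto simp: mm_def is_map_def)

lemma ops [simp]:
  "op Tight (Suc 0) (Suc 0) Tight (Suc 0)" "op Tight (Suc (Suc 0)) (Suc 0) Tight (Suc 0)" "op Tight (Suc (Suc 0)) 2 Tight (Suc 0)"
  "op Tight (Suc (Suc (Suc 0))) (Suc 0) Tight (Suc 0)" "op Tight (Suc (Suc (Suc 0))) 2 Tight (Suc 0)" "op Tight (Suc (Suc (Suc 0))) 3 Tight (Suc 0)"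
  "op Tight (Suc 0) (Suc 0) Tight (Suc (Suc 0))" "op Tight (Suc (Suc 0)) (Suc 0) Tight (Suc (Suc 0))" "op Tight (Suc (Suc 0)) 2 Tight (Suc (Suc 0))"
  "op Tight (Suc (Suc (Suc 0))) (Suc 0) Tight (Suc (Suc 0))" "op Tight (Suc (Suc (Suc 0))) 2 Tight (Suc (Suc 0))" "op Tight (Suc (Suc (Suc 0))) 3 Tight (Suc (Suc 0))"
  "op Tight (Suc 0) (Suc 0) Loose 0" "op Tight (Suc (Suc 0)) (Suc 0) Loose 0" "op Tight (Suc (Suc 0)) 2 Loose 0"
  "op Tight (Suc (Suc (Suc 0))) 3 Loose 0" "op Tight (Suc (Suc (Suc 0))) 2 Loose 0" "op Tight (Suc 0) (Suc 0) Loose (Suc 0)"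
  "op Tight (Suc (Suc 0)) (Suc 0) Loose (Suc 0)" "op Tight (Suc (Suc 0)) 2 Loose (Suc 0)" "op Loose (Suc 0) (Suc 0) Tight (Suc 0)"
  "op Loose (Suc 0) (Suc 0) Tight (Suc (Suc 0))" "op Loose (Suc 0) (Suc 0) Loose 0" "op Tight (Suc 0) (Suc 0) Tight (Suc (Suc (Suc 0)))"
  "op Tight 2 (Suc 0) Tight (Suc 0)" "op Tight 2 2 Tight (Suc 0)" "op Tight 2 (Suc 0) Tight (Suc (Suc 0))"
  "op Tight 2 2 Tight (Suc (Suc 0))" "op Tight 2 2 Tight (Suc (Suc (Suc 0)))"
  "op Tight 2 (Suc 0) Loose 0" "op Tight 2 2 Loose 0" "op Tight 2 2 Loose (Suc 0)"
  using op_outer op_special op_inner[of Tight 1 1] op_inner[of Loose 1 1] op_inner[of Tight 2]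
    op_inner[of Tight 3] op_binary[of 1 1] op_binary[of 2] op_binary[of 3] op_nullary[of 1] op_nullary[of 2]
    op_nullary[of 0 1] op_loose_unary[of 1] op_loose_unary[of 2]
  by (auto simp: eval_nat_numeral)

lemma sub_middle:
  assumes "op (kind g) (length (inputs g)) i (kind h) (length (inputs h))"
    "mm ar C g" "arr S f" "mm ar C h" "inputs g ! (i - 1) = target f" "source f = out h" "source f = b"
  shows "g \<odot>\<^bsub>i\<^esub> (up b f \<odot> h) = (g \<odot>\<^bsub>i\<^esub> up b f) \<odot>\<^bsub>i\<^esub> h"
  using sub_assoc[of g i "up b f" 1 h] middle[OF assms(1)] op_ar[OF assms(1)] assms by simp

lemma sub_inner:
  assumes "op (kind g) (length (inputs g)) i (kind f) (length (inputs f))"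
    "mm ar C g" "mm ar C f" "arr S h" "inputs g ! (i - 1) = out f" "inputs f ! (k - 1) = target h"
    "source h = b" "1 \<le> k" "k \<le> length (inputs f)"
  shows "g \<odot>\<^bsub>i\<^esub> (f \<odot>\<^bsub>k\<^esub> up b h) = (g \<odot>\<^bsub>i\<^esub> f) \<odot>\<^bsub>i + k - 1\<^esub> up b h"
  using sub_assoc[of g i f k "up b h"] inner[OF assms(1)] op_ar[OF assms(1)] assms by simp

lemma sub_parallel_left:
  assumes "op (kind g) (length (inputs g)) i (kind f) (length (inputs f))"
    "mm ar C g" "mm ar C f" "arr S h" "inputs g ! (i - 1) = out f" "inputs g ! (k - 1) = target h"
    "source h = b" "1 \<le> k" "k < i"
  shows "(g \<odot>\<^bsub>k\<^esub> up b h) \<odot>\<^bsub>i\<^esub> f = (g \<odot>\<^bsub>i\<^esub> f) \<odot>\<^bsub>k\<^esub> up b h"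
  using sub_commute[of g k "up b h" i f] parallel_left[OF assms(1)] op_ar[OF assms(1)] assms by simp

text \<open>
  With \<open>asr_up\<close>, \<open>lun_up\<close> and \<open>run_up\<close> below, this turns the definition of \<open>skmon_of\<close> into equations
  between maps, which is how tensor product, \<open>\<alpha>\<close>, \<open>\<lambda>\<close> and \<open>\<rho>\<close> are used from here on.
\<close>

lemma tns_up:
  assumes "arr S f" "arr S g"
  shows "arr S (f \<star>\<^bsub>S\<^esub> g)"
    and "up (source f \<otimes> source g) (f \<star>\<^bsub>S\<^esub> g) \<odot> theta (source f) (source g) =
      (theta (target f) (target g) \<odot> up (source f) f) \<odot>\<^bsub>2\<^esub> up (source g) g"
proof -
  let ?q = "(theta (target f) (target g) \<odot> up (source f) f) \<odot>\<^bsub>2\<^esub> up (source g) g"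
  have ob: "source f \<in> Obj C" "target f \<in> Obj C" "source g \<in> Obj C" "target g \<in> Obj C"
    using arr_source[OF assms(1)] arr_target[OF assms(1)] arr_source[OF assms(2)] arr_target[OF assms(2)]
    by simp_all
  have q: "mm ar C ?q" using assms ob by simp
  have b: "bij_betw (\<lambda>k. Sub C Tight [source f \<otimes> source g] (target f \<otimes> target g) 1 Tight
        [source f, source g] k (ctheta chi (source f) (source g)))
      (Maps C Tight [source f \<otimes> source g] (target f \<otimes> target g))
      (Maps C Tight [source f, source g] (target f \<otimes> target g))"
    using theta_bij[of "source f" "source g" "[]" "target f \<otimes> target g"] ob
    by (simp add: skmon_of_TO[symmetric, where C = C])
  have e: "label (f \<star>\<^bsub>S\<^esub> g) = (THE k. k \<in> Maps C Tight [source f \<otimes> source g] (target f \<otimes> target g) \<and>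
      Sub C Tight [source f \<otimes> source g] (target f \<otimes> target g) 1 Tight
        [source f, source g] k (ctheta chi (source f) (source g)) = elem ?q)"
    by (simp add: tns_def skmon_of_def Let_def sub_def up_def skmon_theta_def)
  have "elem ?q \<in> Maps C Tight [source f, source g] (target f \<otimes> target g)"
    by (rule mm_elem[OF q]) (simp_all add: otype_later)
  note * = THE_bij_betw[OF b this, folded e]
  show "arr S (f \<star>\<^bsub>S\<^esub> g)"
    using *(1) ob by (simp add: arr_def)
  show "up (source f \<otimes> source g) (f \<star>\<^bsub>S\<^esub> g) \<odot> theta (source f) (source g) = ?q"
    using *(2) by (intro mmap_eqI) (simp_all add: otype_later, simp add: sub_def up_def skmon_theta_def)
qed

text \<open>
  Equations between arrows out of a product may be tested on the binary classifier.
\<close>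

lemma theta_inj:
  assumes "up a f \<odot> theta b c = up a g \<odot> theta b c" "arr S f" "arr S g" "source f = b \<otimes> c"
    "source g = b \<otimes> c" "a = b \<otimes> c" "b \<in> Obj C" "c \<in> Obj C"
  shows "f = g"
proof -
  have t: "target f = target g" using arg_cong[OF assms(1), of out] by simp
  have "inj_on (E b [c]) {h. arr S h \<and> source h = tob S b [c] \<and> target h = target f}"
    using E_bij[of "[c]" b "target f"] assms arr_target[OF assms(2)] by (auto simp: bij_betw_def)
  then show ?thesis
    by (rule inj_onD) (use assms t in auto)
qed

lemma tensor_functor_S: "is_functor (prod_cat S S) S (tensor_fctr S)"
  unfolding tensor_functor_iff[OF category_S]
proof (intro conjI ballI allI impI)
  fix a b assume "a \<in> Ob S" "b \<in> Ob S"
  then have ab: "a \<in> Obj C" "b \<in> Obj C" by simp_all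
  then show "a \<otimes> b \<in> Ob S" by simp
  show "\<I>\<^bsub>S\<^esub> a \<star>\<^bsub>S\<^esub> \<I>\<^bsub>S\<^esub> b = \<I>\<^bsub>S\<^esub> (a \<otimes> b)"
    by (rule theta_inj[of "a \<otimes> b" _ a b])
      (use tns_up[of "\<I>\<^bsub>S\<^esub> a" "\<I>\<^bsub>S\<^esub> b"] ab in simp_all)
next
  fix f g assume "arr S f" "arr S g"
  then show "arr S (f \<star>\<^bsub>S\<^esub> g)" by (rule tns_up)
next
  fix f g f' g' assume a: "arr S f" "arr S g" "arr S f'" "arr S g'" "target f = source g" "target f' = source g'"
  let ?a = "source f" and ?b = "source g" and ?c = "target g"
  let ?a' = "source f'" and ?b' = "source g'" and ?c' = "target g'"
  have ob: "?a \<in> Obj C" "?b \<in> Obj C" "?c \<in> Obj C" "?a' \<in> Obj C" "?b' \<in> Obj C" "?c' \<in> Obj C"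
    using a arr_source[of S] arr_target[of S] by simp_all
  show "(g \<cdot>\<^bsub>S\<^esub> f) \<star>\<^bsub>S\<^esub> (g' \<cdot>\<^bsub>S\<^esub> f') = g \<star>\<^bsub>S\<^esub> g' \<cdot>\<^bsub>S\<^esub> f \<star>\<^bsub>S\<^esub> f'"
  proof (rule theta_inj[of "?a \<otimes> ?a'" _ ?a ?a'])
    have "up (?a \<otimes> ?a') (g \<star>\<^bsub>S\<^esub> g' \<cdot>\<^bsub>S\<^esub> f \<star>\<^bsub>S\<^esub> f') \<odot> theta ?a ?a' =
        (up (?b \<otimes> ?b') (g \<star>\<^bsub>S\<^esub> g') \<odot> up (?a \<otimes> ?a') (f \<star>\<^bsub>S\<^esub> f')) \<odot> theta ?a ?a'"
      using a tns_up(1) by (subst up_cmp) auto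
    also have "\<dots> = up (?b \<otimes> ?b') (g \<star>\<^bsub>S\<^esub> g') \<odot> (up (?a \<otimes> ?a') (f \<star>\<^bsub>S\<^esub> f') \<odot> theta ?a ?a')"
      using a ob tns_up(1) by (subst sub_outer) auto
    also have "\<dots> = up (?b \<otimes> ?b') (g \<star>\<^bsub>S\<^esub> g') \<odot> ((theta ?b ?b' \<odot> up ?a f) \<odot>\<^bsub>2\<^esub> up ?a' f')"
      using a tns_up(2)[of f f'] by simp
    also have "\<dots> = ((up (?b \<otimes> ?b') (g \<star>\<^bsub>S\<^esub> g') \<odot> theta ?b ?b') \<odot> up ?a f) \<odot>\<^bsub>2\<^esub> up ?a' f'"
      using a ob tns_up(1) by (simp add: sub_outer)
    also have "\<dots> = (((theta ?c ?c' \<odot> up ?b g) \<odot>\<^bsub>2\<^esub> up ?b' g') \<odot> up ?a f) \<odot>\<^bsub>2\<^esub> up ?a' f'"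
      using a tns_up(2)[of g g'] by simp
    also have "((theta ?c ?c' \<odot> up ?b g) \<odot>\<^bsub>2\<^esub> up ?b' g') \<odot> up ?a f =
        ((theta ?c ?c' \<odot> up ?b g) \<odot> up ?a f) \<odot>\<^bsub>2\<^esub> up ?b' g'"
      using a ob by (subst sub_parallel_left) auto
    also have "(theta ?c ?c' \<odot> up ?b g) \<odot> up ?a f = theta ?c ?c' \<odot> up ?a (g \<cdot>\<^bsub>S\<^esub> f)"
      using a ob by (subst up_cmp[where b = ?b]) (auto simp: sub_middle)
    also have "((theta ?c ?c' \<odot> up ?a (g \<cdot>\<^bsub>S\<^esub> f)) \<odot>\<^bsub>2\<^esub> up ?b' g') \<odot>\<^bsub>2\<^esub> up ?a' f' =
        (theta ?c ?c' \<odot> up ?a (g \<cdot>\<^bsub>S\<^esub> f)) \<odot>\<^bsub>2\<^esub> up ?a' (g' \<cdot>\<^bsub>S\<^esub> f')"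
      using a ob by (subst up_cmp[where b = ?b']) (auto simp: sub_middle)
    also have "\<dots> = up (?a \<otimes> ?a') ((g \<cdot>\<^bsub>S\<^esub> f) \<star>\<^bsub>S\<^esub> (g' \<cdot>\<^bsub>S\<^esub> f')) \<odot> theta ?a ?a'"
      using a tns_up(2)[of "g \<cdot>\<^bsub>S\<^esub> f" "g' \<cdot>\<^bsub>S\<^esub> f'"] by simp
    finally show "up (?a \<otimes> ?a') ((g \<cdot>\<^bsub>S\<^esub> f) \<star>\<^bsub>S\<^esub> (g' \<cdot>\<^bsub>S\<^esub> f')) \<odot> theta ?a ?a' =
      up (?a \<otimes> ?a') (g \<star>\<^bsub>S\<^esub> g' \<cdot>\<^bsub>S\<^esub> f \<star>\<^bsub>S\<^esub> f') \<odot> theta ?a ?a'" ..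
  qed (use a ob tns_up(1) in simp_all)
qed

lemma asr_up:
  assumes "a \<in> Obj C" "b \<in> Obj C" "c \<in> Obj C"
  shows "arr S (\<alpha>\<^bsub>S\<^esub> a b c)"
    and "(up (a \<otimes> b \<otimes> c) (\<alpha>\<^bsub>S\<^esub> a b c) \<odot> theta (a \<otimes> b) c) \<odot> theta a b =
      theta a (b \<otimes> c) \<odot>\<^bsub>2\<^esub> theta b c"
proof -
  let ?q = "theta a (b \<otimes> c) \<odot>\<^bsub>2\<^esub> theta b c" and ?d = "a \<otimes> (b \<otimes> c)"
  have q: "mm ar C ?q" using assms by simp
  have b: "bij_betw ((\<lambda>k. Sub C Tight [a \<otimes> b, c] ?d 1 Tight [a, b] k (ctheta chi a b)) \<circ>
      (\<lambda>k. Sub C Tight [a \<otimes> b \<otimes> c] ?d 1 Tight [a \<otimes> b, c] k (ctheta chi (a \<otimes> b) c)))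
      (Maps C Tight [a \<otimes> b \<otimes> c] ?d) (Maps C Tight [a, b, c] ?d)"
    by (rule bij_betw_trans[of _ _ "Maps C Tight [a \<otimes> b, c] ?d"])
     (use theta_bij[of "a \<otimes> b" c "[]" ?d] theta_bij[of a b "[c]" ?d] assms in
      \<open>simp_all add: skmon_of_TO[symmetric, where C = C]\<close>)
  have e: "label (\<alpha>\<^bsub>S\<^esub> a b c) = (THE k. k \<in> Maps C Tight [a \<otimes> b \<otimes> c] ?d \<and>
     ((\<lambda>k. Sub C Tight [a \<otimes> b, c] ?d 1 Tight [a, b] k (ctheta chi a b)) \<circ>
      (\<lambda>k. Sub C Tight [a \<otimes> b \<otimes> c] ?d 1 Tight [a \<otimes> b, c] k (ctheta chi (a \<otimes> b) c))) k = elem ?q)"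
    by (simp add: asr_def skmon_of_def Let_def sub_def skmon_theta_def)
  have "elem ?q \<in> Maps C Tight [a, b, c] ?d"
    by (rule mm_elem[OF q]) (simp_all add: otype_later numeral_2_eq_2)
  note * = THE_bij_betw[OF b this, folded e]
  show "arr S (\<alpha>\<^bsub>S\<^esub> a b c)"
    using *(1) assms by (simp add: arr_def)
  show "(up (a \<otimes> b \<otimes> c) (\<alpha>\<^bsub>S\<^esub> a b c) \<odot> theta (a \<otimes> b) c) \<odot> theta a b = ?q"
    using *(2) by (intro mmap_eqI)
      (simp_all add: otype_later numeral_2_eq_2, simp add: sub_def up_def skmon_theta_def)
qed

lemma lun_up:
  assumes "a \<in> Obj C"
  shows "arr S (\<Lambda>\<^bsub>S\<^esub> a)"
    and "(up (Unit S \<otimes> a) (\<Lambda>\<^bsub>S\<^esub> a) \<odot> theta (Unit S) a) \<odot> uu = jj C (idm C a)"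
proof -
  have b: "bij_betw ((\<lambda>k. Sub C Tight [Unit S, a] a 1 Loose [] k (cnull chi)) \<circ>
      (\<lambda>k. Sub C Tight [Unit S \<otimes> a] a 1 Tight [Unit S, a] k (ctheta chi (Unit S) a)))
      (Maps C Tight [Unit S \<otimes> a] a) (Maps C Loose [a] a)"
    by (rule bij_betw_trans[of _ _ "Maps C Tight [Unit S, a] a"])
     (use theta_bij[of "Unit S" a "[]" a] null_bij[of "[a]" a] assms in
      \<open>simp_all add: skmon_of_TO[symmetric, where C = C] skmon_of_Unit[symmetric, where C = C]\<close>)
  have e: "label (\<Lambda>\<^bsub>S\<^esub> a) = (THE k. k \<in> Maps C Tight [Unit S \<otimes> a] a \<and>
     ((\<lambda>k. Sub C Tight [Unit S, a] a 1 Loose [] k (cnull chi)) \<circ>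
      (\<lambda>k. Sub C Tight [Unit S \<otimes> a] a 1 Tight [Unit S, a] k (ctheta chi (Unit S) a))) k = J C [a] a (Idt C a))"
    by (simp add: lun_def skmon_of_def Let_def)
  have "J C [a] a (Idt C a) \<in> Maps C Loose [a] a"
    using typed assms unfolding well_typed_def by (simp add: is_map_def)
  note * = THE_bij_betw[OF b this, folded e]
  show "arr S (\<Lambda>\<^bsub>S\<^esub> a)"
    using *(1) assms by (simp add: arr_def)
  show "(up (Unit S \<otimes> a) (\<Lambda>\<^bsub>S\<^esub> a) \<odot> theta (Unit S) a) \<odot> uu = jj C (idm C a)"
    using *(2) by (intro mmap_eqI)
      (simp_all, simp add: sub_def up_def skmon_theta_def skmon_null_def jj_def idm_def)
qed

lemma run_up:
  assumes "a \<in> Obj C"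
  shows "up a (\<rho>\<^bsub>S\<^esub> a) = theta a (Unit S) \<odot>\<^bsub>2\<^esub> uu" and "arr S (\<rho>\<^bsub>S\<^esub> a)"
proof -
  show eq: "up a (\<rho>\<^bsub>S\<^esub> a) = theta a (Unit S) \<odot>\<^bsub>2\<^esub> uu"
    by (intro mmap_eqI)
      (simp_all add: otype_later numeral_2_eq_2,
       simp add: up_def run_def sub_def skmon_theta_def skmon_null_def, simp add: skmon_of_def Let_def numeral_2_eq_2)
  have "mm ar C (theta a (Unit S) \<odot>\<^bsub>2\<^esub> uu)" using assms by simp
  then show "arr S (\<rho>\<^bsub>S\<^esub> a)" unfolding eq[symmetric] arr_S by simp
qed

lemma tensor_category_S: "tensor_category S"
proof
  fix a b c assume "a \<in> Ob S" "b \<in> Ob S" "c \<in> Ob S"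
  then show "Assoc S a b c \<in> Hom S (a \<otimes> b \<otimes> c) (a \<otimes> (b \<otimes> c))"
    using asr_up(1)[of a b c] by (simp add: arr_def asr_def)
next
  fix a assume "a \<in> Ob S"
  then show "LUnit S a \<in> Hom S (Unit S \<otimes> a) a" using lun_up(1)[of a] by (simp add: arr_def lun_def)
next
  fix a assume "a \<in> Ob S"
  then show "RUnit S a \<in> Hom S a (a \<otimes> Unit S)" using run_up(2)[of a] by (simp add: arr_def run_def)
qed (simp_all add: tensor_functor_S category_S)

end

section \<open>Substitution in terms of arrows\<close>

sublocale classified_multicategory \<subseteq> S: tensor_category "skmon_of C chi"
  by (rule tensor_category_S)

context classified_multicategory
begin

abbreviation EC where "EC \<equiv> EM C chi"

lemmas ob_S [simp] = S.tob_ob[simplified] S.tobx_ob[simplified]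
  arr_source[of "skmon_of C chi", simplified] arr_target[of "skmon_of C chi", simplified]

lemma mm_E [simp]:
  assumes "ar Tight (Suc (length xs))" "a \<in> Obj C" "set xs \<subseteq> Obj C" "arr S f" "source f = tob S a xs"
  shows "mm ar C (E a xs f)"
  using E_bij[OF assms(1-3), of "target f"] assms unfolding bij_betw_def maps_to_def by auto

lemma mm_EC [simp]:
  assumes "lmap S x as f" "ar x (length as)"
  shows "mm ar C (EC x as f)"
proof (cases x)
  case Tight
  then obtain a as' where "as = a # as'" using assms by (cases as) (auto simp: lmap_def)
  then show ?thesis using assms Tight by (simp add: lmap_def EM_Tight)
next
  case Loose
  have "op Tight (Suc (length as)) 1 Loose 0"
    using assms Loose by (intro op_nullary) auto
  then show ?thesis using assms Loose ar_Loose by (simp add: lmap_def EM_Loose)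
qed

lemma EC_bij:
  assumes "ar x (length as)" "set as \<subseteq> Obj C" "b \<in> Obj C"
  shows "bij_betw (EC x as) {f. lmap S x as f \<and> target f = b} (maps_to x as b)"
proof (cases x)
  case Tight
  then obtain a as' where as: "as = a # as'" using assms ar_Tight by (cases as) force+
  have "{f. lmap S x as f \<and> target f = b} = {f. arr S f \<and> source f = tob S a as' \<and> target f = b}"
    using assms Tight as by (auto simp: lmap_def)
  moreover have "EC x as = E a as'" using Tight as by (auto simp: EM_Tight)
  ultimately show ?thesis using E_bij[of as' a b] assms Tight as by simp
next
  case Loose
  have 1: "{f. lmap S x as f \<and> target f = b} = {f. arr S f \<and> source f = tob S (Unit S) as \<and> target f = b}"
    using assms Loose by (auto simp: lmap_def)
  have 2: "EC x as = (\<lambda>q. q \<odot> uu) \<circ> E (Unit S) as" using Loose by (auto simp: EM_Loose)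
  have "bij_betw (\<lambda>q. q \<odot> uu) (maps_to Tight (Unit S # as) b) (maps_to Loose as b)"
    using sub_uu_bij[of as b] assms Loose by simp
  then show ?thesis unfolding 1 2 unfolding Loose
    using assms Loose ar_Loose by (intro bij_betw_trans[OF E_bij]) auto
qed

lemma EC_inj:
  assumes "EC x as f = EC x as g" "lmap S x as f" "lmap S x as g" "ar x (length as)"
  shows "f = g"
proof -
  have t: "target f = target g" using arg_cong[OF assms(1), of out] by simp
  have "inj_on (EC x as) {h. lmap S x as h \<and> target h = target f}"
    using EC_bij[of x as "target f"] assms by (auto simp: bij_betw_def lmap_def)
  then show ?thesis by (rule inj_onD) (use assms t in auto)
qed

lemma EC_surj:
  assumes "mm ar C q"
  obtains f where "lmap S (kind q) (inputs q) f" "target f = out q" "q = EC (kind q) (inputs q) f"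
proof -
  have "q \<in> maps_to (kind q) (inputs q) (out q)" using assms by (simp add: maps_to_def)
  then have "q \<in> EC (kind q) (inputs q) ` {f. lmap S (kind q) (inputs q) f \<and> target f = out q}"
    using EC_bij[of "kind q" "inputs q" "out q"] assms
    unfolding bij_betw_def mm_def is_map_def by blast
  then show ?thesis using that by blast
qed

text \<open>
  The laws used below, for maps from which one classifier has been split off.
\<close>

lemma sub_theta_assoc:
  assumes "op Tight (Suc (length (inputs g))) j (kind f) (length (inputs f))" "j = Suc 0 \<or> j = 2"
    "mm ar C g" "kind g = Tight" "inputs g = (b \<otimes> c) # ws" "mm ar C f" "[b, c] ! (j - 1) = out f"
    "b \<in> Obj C" "c \<in> Obj C"
  shows "g \<odot> (theta b c \<odot>\<^bsub>j\<^esub> f) = (g \<odot> theta b c) \<odot>\<^bsub>j\<^esub> f"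
  using sub_assoc[of g "Suc 0" "theta b c" j f] assoc_first[OF assms(1)] assms
  by (auto simp: numeral_2_eq_2)

lemma theta_sub_binary:
  assumes "op Tight 2 i Tight (Suc (length (inputs f)))" "mm ar C f" "kind f = Tight"
    "inputs f = (a \<otimes> x) # ws" "[b, c] ! (i - 1) = out f" "b \<in> Obj C" "c \<in> Obj C" "a \<in> Obj C" "x \<in> Obj C"
  shows "theta b c \<odot>\<^bsub>i\<^esub> (f \<odot> theta a x) = (theta b c \<odot>\<^bsub>i\<^esub> f) \<odot>\<^bsub>i\<^esub> theta a x"
  using sub_assoc[of "theta b c" i f "Suc 0" "theta a x"] assoc_binary[OF assms(1)] op_ar[OF assms(1)] assms
  by (auto simp: numeral_2_eq_2)

lemma theta_sub_nullary:
  assumes "op Tight 2 i Loose (length ws)" "mm ar C f" "kind f = Tight"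
    "inputs f = Unit S # ws" "[b, c] ! (i - 1) = out f" "b \<in> Obj C" "c \<in> Obj C"
  shows "theta b c \<odot>\<^bsub>i\<^esub> (f \<odot> uu) = (theta b c \<odot>\<^bsub>i\<^esub> f) \<odot>\<^bsub>i\<^esub> uu"
  using sub_assoc[of "theta b c" i f "Suc 0" uu] assoc_nullary[OF assms(1)] op_ar[OF assms(1)] assms
  by (auto simp: numeral_2_eq_2)

lemma sub_theta_commute:
  assumes "op Tight (Suc (length (inputs g))) (Suc k) (kind f) (length (inputs f))" "2 \<le> k"
    "mm ar C g" "kind g = Tight" "inputs g = (b \<otimes> c) # ws" "mm ar C f" "inputs g ! (k - 1) = out f"
    "b \<in> Obj C" "c \<in> Obj C"
  shows "(g \<odot> theta b c) \<odot>\<^bsub>Suc k\<^esub> f = (g \<odot>\<^bsub>k\<^esub> f) \<odot> theta b c"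
  using sub_commute[of g "Suc 0" "theta b c" k f] comm_first[OF assms(1,2)] op_ar[OF assms(1)] assms
  by (auto simp: numeral_2_eq_2)

lemma sub_uu_commute:
  assumes "op Loose (length ws) i (kind f) (length (inputs f))"
    "mm ar C g" "kind g = Tight" "inputs g = Unit S # ws" "mm ar C f" "ws ! (i - 1) = out f"
  shows "(g \<odot> uu) \<odot>\<^bsub>i\<^esub> f = (g \<odot>\<^bsub>Suc i\<^esub> f) \<odot> uu"
  using sub_commute[of g "Suc 0" uu "Suc i" f] comm_nullary[OF assms(1)] op_ar[OF assms(1)] assms
  by (cases i) auto

lemma up_E:
  assumes "ar Tight (Suc (length xs))" "a \<in> Obj C" "set xs \<subseteq> Obj C" "arr S f" "source f = tob S a xs"
    "arr S g" "source g = target f"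
  shows "up (target f) g \<odot> E a xs f = E a xs (g \<cdot>\<^bsub>S\<^esub> f)"
  using assms
proof (induction xs arbitrary: a)
  case Nil
  then show ?case by (simp add: up_cmp)
next
  case (Cons x xs)
  have ar: "ar Tight (Suc (length xs))" using Cons.prems(1) ar_Tight_le by fastforce
  have op: "op Tight (Suc (length xs)) (Suc 0) Tight (Suc (Suc 0))"
    using op_binary[of "Suc (length xs)" 1] Cons.prems(1) by (simp add: numeral_2_eq_2)
  have "up (target f) g \<odot> E a (x # xs) f = (up (target f) g \<odot> E (a \<otimes> x) xs f) \<odot> theta a x"
    using Cons.prems ar op by (simp add: sub_outer)
  then show ?case using Cons.IH[of "a \<otimes> x"] Cons.prems ar by simp
qed

lemma up_EC:
  assumes "ar y (length as)" "lmap S y as f" "arr S g" "source g = target f"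
  shows "up (target f) g \<odot> EC y as f = EC y as (g \<cdot>\<^bsub>S\<^esub> f)"
proof (cases y)
  case Tight
  then obtain a as' where "as = a # as'" using assms by (cases as) (auto simp: lmap_def)
  then show ?thesis using up_E[of as' a f g] assms Tight by (simp add: EM_Tight lmap_def)
next
  case Loose
  have op: "op Tight (Suc (length as)) (Suc 0) Loose 0"
    using op_nullary[of "length as" 1] assms Loose by simp
  have ar: "ar Tight (Suc (length as))" using assms Loose ar_Loose by simp
  have "up (target f) g \<odot> EC y as f = (up (target f) g \<odot> E (Unit S) as f) \<odot> uu"
    using assms op ar Loose by (simp add: EM_Loose sub_outer lmap_def)
  then show ?thesis using up_E[of as "Unit S" f g] assms ar Loose by (simp add: EM_Loose lmap_def)
qed

lemma theta_E_first:
  assumes "op Tight 2 1 Tight (Suc (length xs))" "a \<in> Obj C" "set xs \<subseteq> Obj C" "arr S f"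
    "source f = tob S a xs" "c \<in> Obj C"
  shows "theta (target f) c \<odot> E a xs f = E a (xs @ [c]) (f \<star>\<^bsub>S\<^esub> \<I>\<^bsub>S\<^esub> c)"
  using assms
proof (induction xs arbitrary: a)
  case Nil
  then show ?case using tns_up(2)[of f "\<I>\<^bsub>S\<^esub> c"] by simp
next
  case (Cons x xs)
  have op: "op Tight 2 (Suc 0) Tight (Suc (length xs))" using Cons.prems(1) op_lower by simp
  have ar: "ar Tight (Suc (length xs))" using op_ar[OF op] by simp
  have "theta (target f) c \<odot> E a (x # xs) f = (theta (target f) c \<odot> E (a \<otimes> x) xs f) \<odot> theta a x"
    using Cons.prems ar by (simp add: theta_sub_binary)
  then show ?case using Cons.IH[of "a \<otimes> x"] Cons.prems op by simp
qed

lemma theta_EC_first: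
  assumes "op Tight 2 1 y (length as)" "lmap S y as f" "c \<in> Obj C"
  shows "theta (target f) c \<odot> EC y as f = EC y (as @ [c]) (f \<star>\<^bsub>S\<^esub> \<I>\<^bsub>S\<^esub> c)"
proof (cases y)
  case Tight
  then obtain a as' where "as = a # as'" using assms by (cases as) (auto simp: lmap_def)
  then show ?thesis using theta_E_first[of as' a f c] assms Tight by (simp add: EM_Tight lmap_def)
next
  case Loose
  have op: "op Tight 2 (Suc 0) Tight (Suc (length as))" using assms Loose op_tighten by simp
  have ar: "ar Tight (Suc (length as))" using op_ar[OF op] by simp
  have "theta (target f) c \<odot> EC y as f = (theta (target f) c \<odot> E (Unit S) as f) \<odot> uu"
    using assms op ar Loose by (simp add: EM_Loose theta_sub_nullary lmap_def)
  then show ?thesis using theta_E_first[of as "Unit S" f c] assms op Loose by (simp add: EM_Loose lmap_def)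
qed

text \<open>
  Substitution in the first position.  Splitting a classifier off the outer map makes it the outer
  map for \<open>f\<close>, which thereby gains a factor on its right; after all factors are split off, an arrow
  is left to be composed.
\<close>

lemma E_sub_first:
  assumes "op Tight (Suc (length bs)) 1 y (length as)" "lmap S y as f" "set bs \<subseteq> Obj C"
    "arr S g" "source g = tob S (target f) bs"
  shows "E (target f) bs g \<odot> EC y as f = EC y (as @ bs) (g \<cdot>\<^bsub>S\<^esub> tar S bs f)"
  using assms
proof (induction bs arbitrary: as f)
  case Nil
  then show ?case using up_EC op_ar[OF Nil(1)] by simp
next
  case (Cons b bs)
  have f: "arr S f" "target f \<in> Obj C" using Cons.prems(2) by (auto simp: lmap_def)
  have op2: "op Tight 2 1 y (length as)" using Cons.prems(1) op_reduce[of "Suc (length (b # bs))" 1] by simp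
  have op: "op Tight (Suc (length bs)) 1 y (length (as @ [b]))"
    using op_shift_first[OF Cons.prems(1)] by simp
  have ar: "ar Tight (Suc (length bs))" "ar y (length as)" using op_ar[OF op] op_ar[OF op2] by auto
  have l: "lmap S y (as @ [b]) (f \<star>\<^bsub>S\<^esub> \<I>\<^bsub>S\<^esub> b)"
    using Cons.prems f by (auto simp: lmap_def)
  have "E (target f) (b # bs) g \<odot> EC y as f = E (target f \<otimes> b) bs g \<odot> (theta (target f) b \<odot> EC y as f)"
    using Cons.prems f ar by (simp add: sub_theta_assoc lmap_def)
  also have "\<dots> = E (target f \<otimes> b) bs g \<odot> EC y (as @ [b]) (f \<star>\<^bsub>S\<^esub> \<I>\<^bsub>S\<^esub> b)"
    using theta_EC_first[OF op2 Cons.prems(2)] Cons.prems(3) by simp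
  also have "\<dots> = EC y ((as @ [b]) @ bs) (g \<cdot>\<^bsub>S\<^esub> tar S bs (f \<star>\<^bsub>S\<^esub> \<I>\<^bsub>S\<^esub> b))"
    using Cons.IH[OF op l] Cons.prems by simp
  finally show ?case by simp
qed

text \<open>
  Substitution in the second input of a classifier produces the arrow \<open>sharp\<close>.  Each input of the
  substituted map after its first contributes one \<open>\<theta> \<circ>\<^sub>2 \<theta>\<close>, that is, one \<open>\<alpha>\<close>.
\<close>

lemma theta_E_second:
  assumes "op Tight 2 2 Tight (Suc (length xs))" "a \<in> Obj C" "set xs \<subseteq> Obj C" "arr S f"
    "source f = tob S a xs" "w \<in> Obj C"
  shows "theta w (target f) \<odot>\<^bsub>2\<^esub> E a xs f = E w (a # xs) (sharp S Tight (a # xs) f w)"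
  using assms
proof (induction xs arbitrary: a)
  case Nil
  then show ?case using tns_up(2)[of "\<I>\<^bsub>S\<^esub> w" f] by (simp add: sharp_def)
next
  case (Cons x xs)
  have op: "op Tight 2 2 Tight (Suc (length xs))" using Cons.prems(1) op_lower by simp
  have ar: "ar Tight (Suc (length xs))" "ar Tight (Suc (Suc (Suc (length xs))))" "ar Tight (Suc (Suc (length xs)))"
    using op_ar[OF op] op_ar[OF Cons.prems(1)] by auto
  have op22: "op Tight (Suc (Suc (length xs))) 2 Tight (Suc (Suc 0))"
    using op_binary[of "Suc (Suc (length xs))" 2] ar by (simp add: numeral_2_eq_2)
  then have op23: "op Tight (Suc (length xs)) 1 Tight (length [w, a, x])"
    using op_shift_second[of "Suc (length xs)" Tight "Suc (Suc 0)"] by simp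
  let ?h = "sharp S Tight ((a \<otimes> x) # xs) f w"
  have h: "arr S ?h" "source ?h = tob S (w \<otimes> (a \<otimes> x)) xs"
    using Cons.prems by (auto simp: lmap_def)
  have "theta w (target f) \<odot>\<^bsub>2\<^esub> E a (x # xs) f = (theta w (target f) \<odot>\<^bsub>2\<^esub> E (a \<otimes> x) xs f) \<odot>\<^bsub>2\<^esub> theta a x"
    using Cons.prems ar by (simp add: theta_sub_binary)
  also have "\<dots> = (E (w \<otimes> (a \<otimes> x)) xs ?h \<odot> theta w (a \<otimes> x)) \<odot>\<^bsub>2\<^esub> theta a x"
    using Cons.IH[of "a \<otimes> x"] Cons.prems op by simp
  also have "\<dots> = E (w \<otimes> (a \<otimes> x)) xs ?h \<odot> (theta w (a \<otimes> x) \<odot>\<^bsub>2\<^esub> theta a x)"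
    using Cons.prems h ar op22 by (subst sub_theta_assoc) auto
  also have "theta w (a \<otimes> x) \<odot>\<^bsub>2\<^esub> theta a x = EC Tight [w, a, x] (\<alpha>\<^bsub>S\<^esub> w a x)"
    using asr_up(2)[of w a x] Cons.prems by (simp add: EM_Tight)
  also have "E (w \<otimes> (a \<otimes> x)) xs ?h \<odot> EC Tight [w, a, x] (\<alpha>\<^bsub>S\<^esub> w a x) =
      EC Tight ([w, a, x] @ xs) (?h \<cdot>\<^bsub>S\<^esub> tar S xs (\<alpha>\<^bsub>S\<^esub> w a x))"
    using E_sub_first[OF op23, of "\<alpha>\<^bsub>S\<^esub> w a x" ?h] Cons.prems h by (simp add: lmap_def)
  finally show ?case using Cons.prems by (simp add: EM_Tight sharp_def)
qed

text \<open>
  For a loose map the factor \<open>\<theta> \<circ>\<^sub>2 u\<close> appears in addition; this is \<open>\<rho>\<close>.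
\<close>

lemma theta_EC_second:
  assumes "op Tight 2 2 y (length as)" "lmap S y as f" "w \<in> Obj C"
  shows "theta w (target f) \<odot>\<^bsub>2\<^esub> EC y as f = E w as (sharp S y as f w)"
proof (cases y)
  case Tight
  then obtain a as' where "as = a # as'" using assms by (cases as) (auto simp: lmap_def)
  then show ?thesis using theta_E_second[of as' a f w] assms Tight by (simp add: EM_Tight lmap_def)
next
  case Loose
  have op: "op Tight 2 2 Tight (Suc (length as))" using assms Loose op_tighten by simp
  have ar: "ar Tight (Suc (length as))" "ar Loose (length as)" "ar Tight (Suc (Suc (length as)))"
    using op_ar[OF op] op_ar[OF assms(1)] Loose by auto
  have f: "arr S f" "source f = tob S (Unit S) as" "set as \<subseteq> Obj C"
    using assms Loose by (auto simp: lmap_def)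
  let ?h = "sharp S Tight (Unit S # as) f w"
  have h: "arr S ?h" "source ?h = tob S (w \<otimes> Unit S) as"
    using f assms by (auto simp: lmap_def)
  have op1: "op Tight (Suc (length as)) 1 Tight (length [w])" using ar op_inner by simp
  have op20: "op Tight (Suc (Suc (length as))) 2 Loose 0"
    using op_second assms(1) Loose by (intro op_nullary) auto
  have "theta w (target f) \<odot>\<^bsub>2\<^esub> EC y as f = (theta w (target f) \<odot>\<^bsub>2\<^esub> E (Unit S) as f) \<odot>\<^bsub>2\<^esub> uu"
    using assms op ar f Loose by (simp add: EM_Loose theta_sub_nullary)
  also have "\<dots> = (E (w \<otimes> Unit S) as ?h \<odot> theta w (Unit S)) \<odot>\<^bsub>2\<^esub> uu"
    using theta_E_second[OF op, of "Unit S" f w] assms f by simp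
  also have "\<dots> = E (w \<otimes> Unit S) as ?h \<odot> (theta w (Unit S) \<odot>\<^bsub>2\<^esub> uu)"
    using assms h ar f op20 by (subst sub_theta_assoc) auto
  also have "theta w (Unit S) \<odot>\<^bsub>2\<^esub> uu = EC Tight [w] (\<rho>\<^bsub>S\<^esub> w)"
    using run_up(1)[of w] assms by (simp add: EM_Tight)
  also have "E (w \<otimes> Unit S) as ?h \<odot> EC Tight [w] (\<rho>\<^bsub>S\<^esub> w) =
      EC Tight ([w] @ as) (?h \<cdot>\<^bsub>S\<^esub> tar S as (\<rho>\<^bsub>S\<^esub> w))"
    using E_sub_first[OF op1, of "\<rho>\<^bsub>S\<^esub> w" ?h] assms f h by (simp add: lmap_def)
  finally show ?thesis using assms f Loose by (simp add: EM_Tight sharp_def)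
qed

text \<open>
  In a later position, the factors in front of it are split off first, by commutativity, until the
  position is the second one.
\<close>

lemma E_sub_later:
  assumes "op Tight (length (b # us @ target f # vs)) (Suc (Suc (length us))) y (length as)"
    "lmap S y as f" "b \<in> Obj C" "set us \<subseteq> Obj C" "set vs \<subseteq> Obj C" "arr S g"
    "source g = tob S b (us @ target f # vs)"
  shows "E b (us @ target f # vs) g \<odot>\<^bsub>Suc (Suc (length us))\<^esub> EC y as f =
    E b (us @ as @ vs) (g \<cdot>\<^bsub>S\<^esub> tar S vs (sharp S y as f (tob S b us)))"
  using assms
proof (induction us arbitrary: b)
  case Nil
  have f: "arr S f" "target f \<in> Obj C" "set as \<subseteq> Obj C" using Nil.prems(2) by (auto simp: lmap_def)
  have op: "op Tight (Suc (Suc (length vs))) 2 y (length as)" using Nil.prems(1) by (simp add: numeral_2_eq_2)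
  have op2: "op Tight 2 2 y (length as)" using op op_reduce[of "Suc (Suc (length vs))" 2] by simp
  have op': "op Tight (Suc (length vs)) 1 Tight (length (b # as))"
    using op_shift_second[OF op] by simp
  have ar: "ar Tight (Suc (length vs))" "ar y (length as)" using op_ar[OF op'] op_ar[OF op] by auto
  let ?h = "sharp S y as f b"
  have h: "lmap S Tight (b # as) ?h" using Nil.prems f by (auto simp: lmap_def)
  have "E b (target f # vs) g \<odot>\<^bsub>2\<^esub> EC y as f =
      E (b \<otimes> target f) vs g \<odot> (theta b (target f) \<odot>\<^bsub>2\<^esub> EC y as f)"
    using Nil.prems f ar op by (subst sub_theta_assoc) (auto simp: lmap_def)
  also have "\<dots> = E (b \<otimes> target f) vs g \<odot> EC Tight (b # as) ?h"
    using theta_EC_second[OF op2 Nil.prems(2)] Nil.prems by (simp add: EM_Tight)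
  also have "\<dots> = EC Tight ((b # as) @ vs) (g \<cdot>\<^bsub>S\<^esub> tar S vs ?h)"
    using E_sub_first[OF op' h] Nil.prems by simp
  finally show ?case by (simp add: EM_Tight numeral_2_eq_2)
next
  case (Cons u us)
  have f: "arr S f" "target f \<in> Obj C" "set as \<subseteq> Obj C" using Cons.prems(2) by (auto simp: lmap_def)
  have op: "op Tight (length ((b \<otimes> u) # us @ target f # vs)) (Suc (Suc (length us))) y (length as)"
    using op_shift_later[of "length ((b \<otimes> u) # us @ target f # vs)" "Suc (Suc (length us))"] Cons.prems(1) by simp
  have ar: "ar Tight (Suc (length (us @ target f # vs)))" "ar y (length as)" using op_ar[OF op] by auto
  have "E b ((u # us) @ target f # vs) g \<odot>\<^bsub>Suc (Suc (length (u # us)))\<^esub> EC y as f =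
     (E (b \<otimes> u) (us @ target f # vs) g \<odot>\<^bsub>Suc (Suc (length us))\<^esub> EC y as f) \<odot> theta b u"
    using Cons.prems f ar by (simp, subst sub_theta_commute) (auto simp: lmap_def)
  then show ?case using Cons.IH[OF op] Cons.prems by simp
qed

text \<open>
  The centre of the development: every computation with maps becomes one with arrows.  A loose outer
  map is a tight one with the nullary classifier in its first input, which commutes with the
  substitution in a later input.
\<close>

theorem EC_sub:
  assumes "op x (length (us @ target f # vs)) (Suc (length us)) y (length as)"
    "lmap S x (us @ target f # vs) g" "lmap S y as f"
  shows "EC x (us @ target f # vs) g \<odot>\<^bsub>Suc (length us)\<^esub> EC y as f =
    EC (otype x (Suc (length us)) y) (us @ as @ vs) (lsub S x us vs y as g f)"
proof (cases x)
  case Tight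
  show ?thesis
  proof (cases us)
    case Nil
    then show ?thesis
      using E_sub_first[of vs y as f g] assms Tight by (simp add: lsub_def EM_Tight lmap_def)
  next
    case (Cons u us')
    then show ?thesis
      using E_sub_later[of u us' f vs y as g] assms Tight
      by (simp add: lsub_def EM_Tight lmap_def otype_later)
  qed
next
  case Loose
  have op: "op Tight (length (Unit S # us @ target f # vs)) (Suc (Suc (length us))) y (length as)"
    using op_shift_loose assms(1) Loose by simp
  have ar: "ar y (length as)" "ar Tight (Suc (length (us @ target f # vs)))" using op_ar[OF op] by auto
  have "EC x (us @ target f # vs) g \<odot>\<^bsub>Suc (length us)\<^esub> EC y as f =
     (E (Unit S) (us @ target f # vs) g \<odot>\<^bsub>Suc (Suc (length us))\<^esub> EC y as f) \<odot> uu"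
    using assms ar Loose unfolding Loose EM_Loose by (subst sub_uu_commute) (auto simp: lmap_def)
  also have "\<dots> = E (Unit S) (us @ as @ vs) (g \<cdot>\<^bsub>S\<^esub> tar S vs (sharp S y as f (tob S (Unit S) us))) \<odot> uu"
    using assms Loose by (subst E_sub_later[OF op]) (auto simp: lmap_def)
  finally show ?thesis using Loose by (simp add: lsub_def EM_Loose)
qed

end

section \<open>The skew monoidal axioms\<close>

lemma (in tensor_category) skew_monoidal_categoryI:
  assumes asr_natural: "\<And>f g h. \<lbrakk>arr S f; arr S g; arr S h\<rbrakk> \<Longrightarrow>
      \<alpha> (target f) (target g) (target h) \<cdot> f \<star> g \<star> h =
      f \<star> (g \<star> h) \<cdot> \<alpha> (source f) (source g) (source h)"
    and lun_natural: "\<And>f. arr S f \<Longrightarrow> \<Lambda> (target f) \<cdot> \<I> (Unit S) \<star> f = f \<cdot> \<Lambda> (source f)"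
    and run_natural: "\<And>f. arr S f \<Longrightarrow> \<rho> (target f) \<cdot> f = f \<star> \<I> (Unit S) \<cdot> \<rho> (source f)"
    and asr_pentagon: "\<And>a b c d. \<lbrakk>a \<in> Ob S; b \<in> Ob S; c \<in> Ob S; d \<in> Ob S\<rbrakk> \<Longrightarrow>
      \<alpha> a b (c \<otimes> d) \<cdot> \<alpha> (a \<otimes> b) c d = \<I> a \<star> \<alpha> b c d \<cdot> \<alpha> a (b \<otimes> c) d \<cdot> \<alpha> a b c \<star> \<I> d"
    and lun_asr: "\<And>a b. \<lbrakk>a \<in> Ob S; b \<in> Ob S\<rbrakk> \<Longrightarrow> \<Lambda> (a \<otimes> b) \<cdot> \<alpha> (Unit S) a b = \<Lambda> a \<star> \<I> b"
    and asr_run: "\<And>a b. \<lbrakk>a \<in> Ob S; b \<in> Ob S\<rbrakk> \<Longrightarrow> \<alpha> a b (Unit S) \<cdot> \<rho> (a \<otimes> b) = \<I> a \<star> \<rho> b"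
    and lun_asr_run: "\<And>a b. \<lbrakk>a \<in> Ob S; b \<in> Ob S\<rbrakk> \<Longrightarrow>
      \<I> a \<star> \<Lambda> b \<cdot> \<alpha> a (Unit S) b \<cdot> \<rho> a \<star> \<I> b = \<I> (a \<otimes> b)"
    and lun_run: "\<Lambda> (Unit S) \<cdot> \<rho> (Unit S) = \<I> (Unit S)"
  shows "skew_monoidal_category S"
proof (rule skew_monoidal_category.intro)
  fix a a' b b' c c' f g h
  assume "a \<in> Ob S" "a' \<in> Ob S" "b \<in> Ob S" "b' \<in> Ob S" "c \<in> Ob S" "c' \<in> Ob S"
    "f \<in> Hom S a a'" "g \<in> Hom S b b'" "h \<in> Hom S c c'"
  then show "Comp S (a \<otimes> b \<otimes> c) (a' \<otimes> b' \<otimes> c') (a' \<otimes> (b' \<otimes> c'))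
         (Assoc S a' b' c') (TA S (a \<otimes> b) (a' \<otimes> b') c c' (TA S a a' b b' f g) h) =
       Comp S (a \<otimes> b \<otimes> c) (a \<otimes> (b \<otimes> c)) (a' \<otimes> (b' \<otimes> c'))
         (TA S a a' (b \<otimes> c) (b' \<otimes> c') f (TA S b b' c c' g h)) (Assoc S a b c)"
    using arg_cong[OF asr_natural[of "(a, f, a')" "(b, g, b')" "(c, h, c')"], of label]
    by (simp add: cmp_def tns_def asr_def)
next
  fix a a' f assume "a \<in> Ob S" "a' \<in> Ob S" "f \<in> Hom S a a'"
  then show "Comp S (Unit S \<otimes> a) (Unit S \<otimes> a') a'
         (LUnit S a') (TA S (Unit S) (Unit S) a a' (Idn S (Unit S)) f) =
       Comp S (Unit S \<otimes> a) a a' f (LUnit S a)"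
    using arg_cong[OF lun_natural[of "(a, f, a')"], of label]
    by (simp add: cmp_def tns_def lun_def idar_def)
next
  fix a a' f assume "a \<in> Ob S" "a' \<in> Ob S" "f \<in> Hom S a a'"
  then show "Comp S a a' (a' \<otimes> Unit S) (RUnit S a') f =
       Comp S a (a \<otimes> Unit S) (a' \<otimes> Unit S)
         (TA S a a' (Unit S) (Unit S) f (Idn S (Unit S))) (RUnit S a)"
    using arg_cong[OF run_natural[of "(a, f, a')"], of label]
    by (simp add: cmp_def tns_def run_def idar_def)
next
  fix a b c d assume "a \<in> Ob S" "b \<in> Ob S" "c \<in> Ob S" "d \<in> Ob S"
  then show "Comp S (a \<otimes> b \<otimes> c \<otimes> d) (a \<otimes> b \<otimes> (c \<otimes> d)) (a \<otimes> (b \<otimes> (c \<otimes> d)))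
         (Assoc S a b (c \<otimes> d)) (Assoc S (a \<otimes> b) c d) =
       Comp S (a \<otimes> b \<otimes> c \<otimes> d) (a \<otimes> (b \<otimes> c \<otimes> d)) (a \<otimes> (b \<otimes> (c \<otimes> d)))
         (TA S a a (b \<otimes> c \<otimes> d) (b \<otimes> (c \<otimes> d)) (Idn S a) (Assoc S b c d))
         (Comp S (a \<otimes> b \<otimes> c \<otimes> d) (a \<otimes> (b \<otimes> c) \<otimes> d) (a \<otimes> (b \<otimes> c \<otimes> d))
           (Assoc S a (b \<otimes> c) d)
           (TA S (a \<otimes> b \<otimes> c) (a \<otimes> (b \<otimes> c)) d d (Assoc S a b c) (Idn S d)))"
    using arg_cong[OF asr_pentagon[of a b c d], of label]
    by (simp add: cmp_def tns_def asr_def idar_def)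
next
  fix a b assume o: "a \<in> Ob S" "b \<in> Ob S"
  show "Comp S (Unit S \<otimes> a \<otimes> b) (Unit S \<otimes> (a \<otimes> b)) (a \<otimes> b)
         (LUnit S (a \<otimes> b)) (Assoc S (Unit S) a b) =
       TA S (Unit S \<otimes> a) a b b (LUnit S a) (Idn S b)"
    using arg_cong[OF lun_asr[OF o], of label]
    by (simp add: cmp_def tns_def asr_def lun_def idar_def)
  show "Comp S (a \<otimes> b) (a \<otimes> b \<otimes> Unit S) (a \<otimes> (b \<otimes> Unit S))
         (Assoc S a b (Unit S)) (RUnit S (a \<otimes> b)) =
       TA S a a b (b \<otimes> Unit S) (Idn S a) (RUnit S b)"
    using arg_cong[OF asr_run[OF o], of label]
    by (simp add: cmp_def tns_def asr_def run_def idar_def)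
  show "Comp S (a \<otimes> b) (a \<otimes> (Unit S \<otimes> b)) (a \<otimes> b)
         (TA S a a (Unit S \<otimes> b) b (Idn S a) (LUnit S b))
         (Comp S (a \<otimes> b) (a \<otimes> Unit S \<otimes> b) (a \<otimes> (Unit S \<otimes> b))
           (Assoc S a (Unit S) b)
           (TA S a (a \<otimes> Unit S) b b (RUnit S a) (Idn S b))) =
       Idn S (a \<otimes> b)"
    using arg_cong[OF lun_asr_run[OF o], of label]
    by (simp add: cmp_def tns_def asr_def run_def lun_def idar_def)
next
  show "Comp S (Unit S) (Unit S \<otimes> Unit S) (Unit S) (LUnit S (Unit S)) (RUnit S (Unit S)) =
       Idn S (Unit S)"
    using arg_cong[OF lun_run, of label]
    by (simp add: cmp_def run_def lun_def idar_def)
qed (simp_all add: tensor_functor underlying_category assoc_hom lunit_hom runit_hom)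

context classified_multicategory
begin

lemma theta_EC: "\<lbrakk>a \<in> Obj C; b \<in> Obj C\<rbrakk> \<Longrightarrow> theta a b = EC Tight [a, b] (\<I>\<^bsub>S\<^esub> (a \<otimes> b))"
  by (simp add: EM_Tight)

lemma uu_EC: "uu = EC Loose [] (\<I>\<^bsub>S\<^esub> (Unit S))"
  by (simp add: EM_Loose)

lemma up_EC_unary: "up a f = EC Tight [a] f"
  by (simp add: EM_Tight)

lemma idm_EC: "idm C a = EC Tight [a] (\<I>\<^bsub>S\<^esub> a)"
  by (simp add: EM_Tight)

lemma jj_idm_EC: "a \<in> Obj C \<Longrightarrow> jj C (idm C a) = EC Loose [a] (\<Lambda>\<^bsub>S\<^esub> a)"
  using lun_up(2)[of a] by (simp add: EM_Loose)

lemma mm_D: "mm ar C f \<Longrightarrow> is_map C (kind f) (inputs f) (out f) (elem f)"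
  by (simp add: mm_def)

lemma jj_inner:
  assumes "mm ar C q" "kind q = Tight" "inputs q = [out p]" "mm ar C p" "kind p = Tight" "inputs p = [a]"
  shows "jj C q \<odot> p = jj C (q \<odot> p)"
  using j_inner[of "out p" "out q" "elem q" a "elem p"] mm_D[OF assms(1)] mm_D[OF assms(4)] assms
  by (intro mmap_eqI) (simp_all, simp add: sub_def jj_def)

lemma jj_first:
  assumes "ar Loose (Suc (length bs))" "mm ar C g" "kind g = Tight" "inputs g = out p # bs"
    "mm ar C p" "kind p = Tight" "inputs p = [a]"
  shows "g \<odot> jj C p = jj C (g \<odot> p)"
  using j_first[of "out p # bs" "out g" "elem g" "out p" bs a "elem p"] mm_D[OF assms(2)] mm_D[OF assms(5)] assms
  by (intro mmap_eqI) (simp_all, simp add: sub_def jj_def)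

lemma jj_second:
  assumes "mm ar C g" "kind g = Tight" "inputs g = [b, out p]" "mm ar C p" "kind p = Tight" "inputs p = [a]"
  shows "g \<odot>\<^bsub>2\<^esub> jj C p = g \<odot>\<^bsub>2\<^esub> p"
  using j_second[of b "out p" "out g" "elem g" a "elem p"] mm_D[OF assms(1)] mm_D[OF assms(4)] assms
  by (intro mmap_eqI) (simp_all, simp add: sub_def jj_def)

lemma jj_before_binary:
  assumes "mm ar C p" "kind p = Tight" "inputs p = [out g]" "mm ar C g" "kind g = Tight" "inputs g = [a, b]"
  shows "jj C p \<odot> g = jj C (p \<odot> g)"
  using j_before_binary[of a b "out g" "elem g" "out p" "elem p"] mm_D[OF assms(1)] mm_D[OF assms(4)] assms
  by (intro mmap_eqI) (simp_all, simp add: sub_def jj_def)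

lemma jj_before_nullary:
  assumes "mm ar C p" "kind p = Tight" "inputs p = [out v]" "mm ar C v" "kind v = Loose" "inputs v = []"
  shows "jj C p \<odot> v = p \<odot> v"
  using j_before_nullary[of "out v" "elem v" "out p" "elem p"] mm_D[OF assms(1)] mm_D[OF assms(4)] assms
  by (intro mmap_eqI) (simp_all, simp add: sub_def jj_def)

text \<open>
  Since \<open>j\<close> commutes with substitution in the first input, it suffices to know it on identities,
  where it is \<open>\<lambda>\<close> by definition.
\<close>

theorem EC_jj:
  assumes "lmap S Tight as f" "ar Loose (length as)"
  shows "jj C (EC Tight as f) = EC Loose as (loosen S Tight as f)"
proof -
  obtain a xs where as: "as = a # xs" using assms by (cases as) (auto simp: lmap_def)
  have a: "a \<in> Obj C" and xs: "set xs \<subseteq> Obj C" and f: "arr S f" "source f = tob S a xs"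
    using assms as by (auto simp: lmap_def)
  have ar: "ar Tight (length as)" using ar_Loose[OF assms(2)] ar_Tight_le as by fastforce
  have op: "op Tight (Suc (length xs)) 1 Loose (length [a])"
    using op_loose_unary[of "length as"] assms(2) as by simp
  have "jj C (EC Tight as f) = jj C (EC Tight as f \<odot> idm C a)"
    using assms ar as a by simp
  also have "\<dots> = EC Tight as f \<odot> jj C (idm C a)"
    using assms(2) ar as a xs f by (subst jj_first[of xs]) (auto simp: EM_Tight)
  also have "\<dots> = E a xs f \<odot> EC Loose [a] (\<Lambda>\<^bsub>S\<^esub> a)"
    using a as by (simp add: jj_idm_EC EM_Tight)
  also have "\<dots> = EC Loose ([a] @ xs) (f \<cdot>\<^bsub>S\<^esub> tar S xs (\<Lambda>\<^bsub>S\<^esub> a))"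
    using E_sub_first[OF op, of "\<Lambda>\<^bsub>S\<^esub> a" f] a f xs by (simp add: lmap_def)
  finally show ?thesis using as by (simp add: loosen_def)
qed

text \<open>
  Both sides of the pentagon correspond to the two ways of bracketing \<open>\<theta> \<circ>\<^sub>2 (\<theta> \<circ>\<^sub>2 \<theta>)\<close>.
\<close>

lemma asr_pentagon_S:
  assumes o: "a \<in> Obj C" "b \<in> Obj C" "c \<in> Obj C" "d \<in> Obj C"
  shows "\<alpha>\<^bsub>S\<^esub> a b (c \<otimes> d) \<cdot>\<^bsub>S\<^esub> \<alpha>\<^bsub>S\<^esub> (a \<otimes> b) c d =
    \<I>\<^bsub>S\<^esub> a \<star>\<^bsub>S\<^esub> \<alpha>\<^bsub>S\<^esub> b c d \<cdot>\<^bsub>S\<^esub> \<alpha>\<^bsub>S\<^esub> a (b \<otimes> c) d \<cdot>\<^bsub>S\<^esub> \<alpha>\<^bsub>S\<^esub> a b c \<star>\<^bsub>S\<^esub> \<I>\<^bsub>S\<^esub> d"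
proof (rule EC_inj[of Tight "[a, b, c, d]"])
  have op: "op Tight 2 2 Tight (length [b, c, d])" by simp
  have "theta a (b \<otimes> (c \<otimes> d)) \<odot>\<^bsub>2\<^esub> (theta b (c \<otimes> d) \<odot>\<^bsub>2\<^esub> theta c d) =
     theta a (b \<otimes> (c \<otimes> d)) \<odot>\<^bsub>2\<^esub> EC Tight [b, c, d] (\<alpha>\<^bsub>S\<^esub> b c d)"
    using asr_up(2)[of b c d] o by (simp add: EM_Tight)
  also have "\<dots> = EC Tight [a, b, c, d]
      (\<I>\<^bsub>S\<^esub> a \<star>\<^bsub>S\<^esub> \<alpha>\<^bsub>S\<^esub> b c d \<cdot>\<^bsub>S\<^esub> \<alpha>\<^bsub>S\<^esub> a (b \<otimes> c) d \<cdot>\<^bsub>S\<^esub> \<alpha>\<^bsub>S\<^esub> a b c \<star>\<^bsub>S\<^esub> \<I>\<^bsub>S\<^esub> d)"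
    using theta_EC_second[OF op, of "\<alpha>\<^bsub>S\<^esub> b c d" a] o by (simp add: EM_Tight lmap_def sharp_def)
  finally have l: "theta a (b \<otimes> (c \<otimes> d)) \<odot>\<^bsub>2\<^esub> (theta b (c \<otimes> d) \<odot>\<^bsub>2\<^esub> theta c d) = \<dots>" .
  have "theta a (b \<otimes> (c \<otimes> d)) \<odot>\<^bsub>2\<^esub> (theta b (c \<otimes> d) \<odot>\<^bsub>2\<^esub> theta c d) =
     (theta a (b \<otimes> (c \<otimes> d)) \<odot>\<^bsub>2\<^esub> theta b (c \<otimes> d)) \<odot>\<^bsub>3\<^esub> theta c d"
    using sub_assoc[of "theta a (b \<otimes> (c \<otimes> d))" 2 "theta b (c \<otimes> d)" 2 "theta c d"]
      assoc_second[of Tight 2] o by (simp add: numeral_2_eq_2 numeral_3_eq_3)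
  also have "theta a (b \<otimes> (c \<otimes> d)) \<odot>\<^bsub>2\<^esub> theta b (c \<otimes> d) = EC Tight [a, b, c \<otimes> d] (\<alpha>\<^bsub>S\<^esub> a b (c \<otimes> d))"
    using asr_up(2)[of a b "c \<otimes> d"] o by (simp add: EM_Tight)
  also have "EC Tight [a, b, c \<otimes> d] (\<alpha>\<^bsub>S\<^esub> a b (c \<otimes> d)) \<odot>\<^bsub>3\<^esub> theta c d =
      EC Tight [a, b, c, d] (\<alpha>\<^bsub>S\<^esub> a b (c \<otimes> d) \<cdot>\<^bsub>S\<^esub> \<alpha>\<^bsub>S\<^esub> (a \<otimes> b) c d)"
    using EC_sub[of Tight "[a, b]" "\<I>\<^bsub>S\<^esub> (c \<otimes> d)" "[]" Tight "[c, d]" "\<alpha>\<^bsub>S\<^esub> a b (c \<otimes> d)"]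
      ops(12) o unfolding theta_EC[OF o(3,4)]
    by (simp add: numeral_3_eq_3 lmap_def lsub_def sharp_def otype_later)
  finally show "EC Tight [a, b, c, d] (\<alpha>\<^bsub>S\<^esub> a b (c \<otimes> d) \<cdot>\<^bsub>S\<^esub> \<alpha>\<^bsub>S\<^esub> (a \<otimes> b) c d) = EC Tight [a, b, c, d]
      (\<I>\<^bsub>S\<^esub> a \<star>\<^bsub>S\<^esub> \<alpha>\<^bsub>S\<^esub> b c d \<cdot>\<^bsub>S\<^esub> \<alpha>\<^bsub>S\<^esub> a (b \<otimes> c) d \<cdot>\<^bsub>S\<^esub> \<alpha>\<^bsub>S\<^esub> a b c \<star>\<^bsub>S\<^esub> \<I>\<^bsub>S\<^esub> d)"
    unfolding l ..
qed (use o in \<open>simp_all add: lmap_def\<close>)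

text \<open>
  As for the pentagon, with the innermost binary classifier replaced by the nullary one.
\<close>

lemma asr_run_S:
  assumes o: "a \<in> Obj C" "b \<in> Obj C"
  shows "\<alpha>\<^bsub>S\<^esub> a b (Unit S) \<cdot>\<^bsub>S\<^esub> \<rho>\<^bsub>S\<^esub> (a \<otimes> b) = \<I>\<^bsub>S\<^esub> a \<star>\<^bsub>S\<^esub> \<rho>\<^bsub>S\<^esub> b"
proof (rule EC_inj[of Tight "[a, b]"])
  have "theta a (b \<otimes> Unit S) \<odot>\<^bsub>2\<^esub> (theta b (Unit S) \<odot>\<^bsub>2\<^esub> uu) =
      EC Tight [a, b] (\<I>\<^bsub>S\<^esub> a \<star>\<^bsub>S\<^esub> \<rho>\<^bsub>S\<^esub> b)"
    using theta_EC_second[of Tight "[b]" "\<rho>\<^bsub>S\<^esub> b" a] o run_up(1)[of b]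
    by (simp add: EM_Tight lmap_def sharp_def)
  moreover have "theta a (b \<otimes> Unit S) \<odot>\<^bsub>2\<^esub> (theta b (Unit S) \<odot>\<^bsub>2\<^esub> uu) =
     (theta a (b \<otimes> Unit S) \<odot>\<^bsub>2\<^esub> theta b (Unit S)) \<odot>\<^bsub>3\<^esub> uu"
    using sub_assoc[of "theta a (b \<otimes> Unit S)" 2 "theta b (Unit S)" 2 uu]
      assoc_second[of Loose 0] o by (simp add: numeral_2_eq_2 numeral_3_eq_3)
  moreover have "theta a (b \<otimes> Unit S) \<odot>\<^bsub>2\<^esub> theta b (Unit S) = EC Tight [a, b, Unit S] (\<alpha>\<^bsub>S\<^esub> a b (Unit S))"
    using asr_up(2)[of a b "Unit S"] o by (simp add: EM_Tight)
  moreover have "EC Tight [a, b, Unit S] (\<alpha>\<^bsub>S\<^esub> a b (Unit S)) \<odot>\<^bsub>3\<^esub> uu =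
      EC Tight [a, b] (\<alpha>\<^bsub>S\<^esub> a b (Unit S) \<cdot>\<^bsub>S\<^esub> \<rho>\<^bsub>S\<^esub> (a \<otimes> b))"
    using EC_sub[of Tight "[a, b]" "\<I>\<^bsub>S\<^esub> (Unit S)" "[]" Loose "[]" "\<alpha>\<^bsub>S\<^esub> a b (Unit S)"]
      ops(16) o unfolding uu_EC
    by (simp add: numeral_3_eq_3 lmap_def lsub_def sharp_def otype_later)
  ultimately show "EC Tight [a, b] (\<alpha>\<^bsub>S\<^esub> a b (Unit S) \<cdot>\<^bsub>S\<^esub> \<rho>\<^bsub>S\<^esub> (a \<otimes> b)) =
      EC Tight [a, b] (\<I>\<^bsub>S\<^esub> a \<star>\<^bsub>S\<^esub> \<rho>\<^bsub>S\<^esub> b)" by simp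
qed (use o in \<open>simp_all add: lmap_def\<close>)

text \<open>
  This is \<open>j p \<circ> g = j (p \<circ> g)\<close> for an identity \<open>p\<close> and a binary classifier \<open>g\<close>.
\<close>

lemma lun_asr_S:
  assumes o: "a \<in> Obj C" "b \<in> Obj C"
  shows "\<Lambda>\<^bsub>S\<^esub> (a \<otimes> b) \<cdot>\<^bsub>S\<^esub> \<alpha>\<^bsub>S\<^esub> (Unit S) a b = \<Lambda>\<^bsub>S\<^esub> a \<star>\<^bsub>S\<^esub> \<I>\<^bsub>S\<^esub> b"
proof (rule EC_inj[of Loose "[a, b]"])
  have "jj C (theta a b) = EC Loose [a, b] (\<Lambda>\<^bsub>S\<^esub> a \<star>\<^bsub>S\<^esub> \<I>\<^bsub>S\<^esub> b)"
    using EC_jj[of "[a, b]" "\<I>\<^bsub>S\<^esub> (a \<otimes> b)"] o by (simp add: theta_EC lmap_def loosen_def)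
  moreover have "jj C (theta a b) = jj C (idm C (a \<otimes> b)) \<odot> theta a b"
    using o by (subst jj_before_binary[of _ _ a b]) auto
  moreover have "jj C (idm C (a \<otimes> b)) \<odot> theta a b = EC Loose [a, b] (\<Lambda>\<^bsub>S\<^esub> (a \<otimes> b) \<cdot>\<^bsub>S\<^esub> \<alpha>\<^bsub>S\<^esub> (Unit S) a b)"
    using EC_sub[of Loose "[]" "\<I>\<^bsub>S\<^esub> (a \<otimes> b)" "[]" Tight "[a, b]" "\<Lambda>\<^bsub>S\<^esub> (a \<otimes> b)"] o
    by (simp add: jj_idm_EC theta_EC lmap_def lsub_def sharp_def)
  ultimately show "EC Loose [a, b] (\<Lambda>\<^bsub>S\<^esub> (a \<otimes> b) \<cdot>\<^bsub>S\<^esub> \<alpha>\<^bsub>S\<^esub> (Unit S) a b) =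
      EC Loose [a, b] (\<Lambda>\<^bsub>S\<^esub> a \<star>\<^bsub>S\<^esub> \<I>\<^bsub>S\<^esub> b)" by simp
qed (use o in \<open>simp_all add: lmap_def\<close>)

text \<open>
  This is \<open>g \<circ>\<^sub>2 j p = g \<circ>\<^sub>2 p\<close> for a binary classifier \<open>g\<close> and an identity \<open>p\<close>.
\<close>

lemma lun_asr_run_S:
  assumes o: "a \<in> Obj C" "b \<in> Obj C"
  shows "\<I>\<^bsub>S\<^esub> a \<star>\<^bsub>S\<^esub> \<Lambda>\<^bsub>S\<^esub> b \<cdot>\<^bsub>S\<^esub> \<alpha>\<^bsub>S\<^esub> a (Unit S) b \<cdot>\<^bsub>S\<^esub> \<rho>\<^bsub>S\<^esub> a \<star>\<^bsub>S\<^esub> \<I>\<^bsub>S\<^esub> b = \<I>\<^bsub>S\<^esub> (a \<otimes> b)"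
proof (rule EC_inj[of Tight "[a, b]"])
  have "theta a b \<odot>\<^bsub>2\<^esub> jj C (idm C b) = theta a b"
    using o by (subst jj_second[of _ a _ b]) auto
  moreover have "theta a b \<odot>\<^bsub>2\<^esub> jj C (idm C b) =
      EC Tight [a, b] (\<I>\<^bsub>S\<^esub> a \<star>\<^bsub>S\<^esub> \<Lambda>\<^bsub>S\<^esub> b \<cdot>\<^bsub>S\<^esub> \<alpha>\<^bsub>S\<^esub> a (Unit S) b \<cdot>\<^bsub>S\<^esub> \<rho>\<^bsub>S\<^esub> a \<star>\<^bsub>S\<^esub> \<I>\<^bsub>S\<^esub> b)"
    using theta_EC_second[of Loose "[b]" "\<Lambda>\<^bsub>S\<^esub> b" a] o
    by (simp add: jj_idm_EC EM_Tight lmap_def sharp_def)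
  ultimately show "EC Tight [a, b] (\<I>\<^bsub>S\<^esub> a \<star>\<^bsub>S\<^esub> \<Lambda>\<^bsub>S\<^esub> b \<cdot>\<^bsub>S\<^esub> \<alpha>\<^bsub>S\<^esub> a (Unit S) b \<cdot>\<^bsub>S\<^esub> \<rho>\<^bsub>S\<^esub> a \<star>\<^bsub>S\<^esub> \<I>\<^bsub>S\<^esub> b) =
    EC Tight [a, b] (\<I>\<^bsub>S\<^esub> (a \<otimes> b))" using o by (simp add: theta_EC)
qed (use o in \<open>simp_all add: lmap_def\<close>)

text \<open>
  This is \<open>j p \<circ> v = p \<circ> v\<close> for an identity \<open>p\<close> and the nullary classifier \<open>v\<close>.
\<close>

lemma lun_run_S: "\<Lambda>\<^bsub>S\<^esub> (Unit S) \<cdot>\<^bsub>S\<^esub> \<rho>\<^bsub>S\<^esub> (Unit S) = \<I>\<^bsub>S\<^esub> (Unit S)"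
proof (rule EC_inj[of Loose "[]"])
  have "jj C (idm C (Unit S)) \<odot> uu = uu"
    by (subst jj_before_nullary) auto
  moreover have "jj C (idm C (Unit S)) \<odot> uu = EC Loose [] (\<Lambda>\<^bsub>S\<^esub> (Unit S) \<cdot>\<^bsub>S\<^esub> \<rho>\<^bsub>S\<^esub> (Unit S))"
    using EC_sub[of Loose "[]" "\<I>\<^bsub>S\<^esub> (Unit S)" "[]" Loose "[]" "\<Lambda>\<^bsub>S\<^esub> (Unit S)"]
    by (simp add: jj_idm_EC uu_EC lmap_def lsub_def sharp_def)
  ultimately show "EC Loose [] (\<Lambda>\<^bsub>S\<^esub> (Unit S) \<cdot>\<^bsub>S\<^esub> \<rho>\<^bsub>S\<^esub> (Unit S)) = EC Loose [] (\<I>\<^bsub>S\<^esub> (Unit S))"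
    by (simp add: uu_EC)
qed (simp_all add: lmap_def)

lemma lun_natural_S:
  assumes f: "arr S f"
  shows "\<Lambda>\<^bsub>S\<^esub> (target f) \<cdot>\<^bsub>S\<^esub> \<I>\<^bsub>S\<^esub> (Unit S) \<star>\<^bsub>S\<^esub> f = f \<cdot>\<^bsub>S\<^esub> \<Lambda>\<^bsub>S\<^esub> (source f)"
proof (rule EC_inj[of Loose "[source f]"])
  let ?a = "source f" and ?b = "target f"
  have "jj C (idm C ?b) \<odot> up ?a f = jj C (up ?a f)"
    using f by (subst jj_inner[of _ _ ?a]) auto
  moreover have "jj C (up ?a f) = EC Loose [?a] (f \<cdot>\<^bsub>S\<^esub> \<Lambda>\<^bsub>S\<^esub> ?a)"
    using EC_jj[of "[?a]" f] f by (simp add: up_EC_unary lmap_def loosen_def)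
  moreover have "jj C (idm C ?b) \<odot> up ?a f = EC Loose [?a] (\<Lambda>\<^bsub>S\<^esub> ?b \<cdot>\<^bsub>S\<^esub> \<I>\<^bsub>S\<^esub> (Unit S) \<star>\<^bsub>S\<^esub> f)"
    using EC_sub[of Loose "[]" f "[]" Tight "[?a]" "\<Lambda>\<^bsub>S\<^esub> ?b"] f op_inner[of Loose 1 1]
    by (simp add: jj_idm_EC up_EC_unary lmap_def lsub_def sharp_def)
  ultimately show "EC Loose [?a] (\<Lambda>\<^bsub>S\<^esub> ?b \<cdot>\<^bsub>S\<^esub> \<I>\<^bsub>S\<^esub> (Unit S) \<star>\<^bsub>S\<^esub> f) = EC Loose [?a] (f \<cdot>\<^bsub>S\<^esub> \<Lambda>\<^bsub>S\<^esub> ?a)"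
    by simp
qed (use f in \<open>simp_all add: lmap_def\<close>)

lemma run_natural_S:
  assumes f: "arr S f"
  shows "\<rho>\<^bsub>S\<^esub> (target f) \<cdot>\<^bsub>S\<^esub> f = f \<star>\<^bsub>S\<^esub> \<I>\<^bsub>S\<^esub> (Unit S) \<cdot>\<^bsub>S\<^esub> \<rho>\<^bsub>S\<^esub> (source f)"
proof (rule EC_inj[of Tight "[source f]"])
  let ?a = "source f" and ?b = "target f"
  have "up ?a (\<rho>\<^bsub>S\<^esub> ?b \<cdot>\<^bsub>S\<^esub> f) = (theta ?b (Unit S) \<odot>\<^bsub>2\<^esub> uu) \<odot> up ?a f"
    using f run_up(1)[of ?b] by (simp add: up_cmp)
  also have "\<dots> = (theta ?b (Unit S) \<odot> up ?a f) \<odot>\<^bsub>2\<^esub> uu"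
    using f by (subst sub_parallel_left) auto
  also have "theta ?b (Unit S) \<odot> up ?a f = EC Tight [?a, Unit S] (f \<star>\<^bsub>S\<^esub> \<I>\<^bsub>S\<^esub> (Unit S))"
    using f theta_EC_first[of Tight "[?a]" f "Unit S"] by (simp add: up_EC_unary lmap_def)
  also have "\<dots> \<odot>\<^bsub>2\<^esub> uu = EC Tight [?a] (f \<star>\<^bsub>S\<^esub> \<I>\<^bsub>S\<^esub> (Unit S) \<cdot>\<^bsub>S\<^esub> \<rho>\<^bsub>S\<^esub> ?a)"
    using EC_sub[of Tight "[?a]" "\<I>\<^bsub>S\<^esub> (Unit S)" "[]" Loose "[]" "f \<star>\<^bsub>S\<^esub> \<I>\<^bsub>S\<^esub> (Unit S)"] f ops(15)
    unfolding uu_EC by (simp add: numeral_2_eq_2 lmap_def lsub_def sharp_def otype_later)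
  finally show "EC Tight [?a] (\<rho>\<^bsub>S\<^esub> ?b \<cdot>\<^bsub>S\<^esub> f) = EC Tight [?a] (f \<star>\<^bsub>S\<^esub> \<I>\<^bsub>S\<^esub> (Unit S) \<cdot>\<^bsub>S\<^esub> \<rho>\<^bsub>S\<^esub> ?a)"
    by (simp add: EM_Tight)
qed (use f in \<open>simp_all add: lmap_def\<close>)

lemma asr_EC: "\<lbrakk>a \<in> Obj C; b \<in> Obj C; c \<in> Obj C\<rbrakk> \<Longrightarrow>
    EC Tight [a, b, c] (\<alpha>\<^bsub>S\<^esub> a b c) = theta a (b \<otimes> c) \<odot>\<^bsub>2\<^esub> theta b c"
  using asr_up(2)[of a b c] by (simp add: EM_Tight)

text \<open>
  Naturality is proved in one variable at a time, where it is naturality of substitution.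
\<close>

lemma asr_natural_S:
  assumes a: "arr S f" "arr S g" "arr S h"
  shows "\<alpha>\<^bsub>S\<^esub> (target f) (target g) (target h) \<cdot>\<^bsub>S\<^esub> f \<star>\<^bsub>S\<^esub> g \<star>\<^bsub>S\<^esub> h =
    f \<star>\<^bsub>S\<^esub> (g \<star>\<^bsub>S\<^esub> h) \<cdot>\<^bsub>S\<^esub> \<alpha>\<^bsub>S\<^esub> (source f) (source g) (source h)"
proof -
  have 1: "\<alpha>\<^bsub>S\<^esub> (target f) b c \<cdot>\<^bsub>S\<^esub> f \<star>\<^bsub>S\<^esub> \<I>\<^bsub>S\<^esub> b \<star>\<^bsub>S\<^esub> \<I>\<^bsub>S\<^esub> c = f \<star>\<^bsub>S\<^esub> \<I>\<^bsub>S\<^esub> (b \<otimes> c) \<cdot>\<^bsub>S\<^esub> \<alpha>\<^bsub>S\<^esub> (source f) b c"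
    if f: "arr S f" and o: "b \<in> Obj C" "c \<in> Obj C" for f b c
  proof (rule EC_inj[of Tight "[source f, b, c]"])
    let ?a = "source f" and ?a' = "target f"
    have "EC Tight [?a', b, c] (\<alpha>\<^bsub>S\<^esub> ?a' b c) \<odot> up ?a f =
        EC Tight [?a, b, c] (\<alpha>\<^bsub>S\<^esub> ?a' b c \<cdot>\<^bsub>S\<^esub> f \<star>\<^bsub>S\<^esub> \<I>\<^bsub>S\<^esub> b \<star>\<^bsub>S\<^esub> \<I>\<^bsub>S\<^esub> c)"
      using EC_sub[of Tight "[]" f "[b, c]" Tight "[?a]" "\<alpha>\<^bsub>S\<^esub> ?a' b c"] f o
      by (simp add: up_EC_unary lmap_def lsub_def)
    moreover have "EC Tight [?a', b, c] (\<alpha>\<^bsub>S\<^esub> ?a' b c) \<odot> up ?a f = (theta ?a' (b \<otimes> c) \<odot> up ?a f) \<odot>\<^bsub>2\<^esub> theta b c"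
      using f o unfolding asr_EC[OF arr_target[OF f, simplified] o] by (subst sub_parallel_left) auto
    moreover have "theta ?a' (b \<otimes> c) \<odot> up ?a f = EC Tight [?a, b \<otimes> c] (f \<star>\<^bsub>S\<^esub> \<I>\<^bsub>S\<^esub> (b \<otimes> c))"
      using f o theta_EC_first[of Tight "[?a]" f "b \<otimes> c"] by (simp add: up_EC_unary lmap_def)
    moreover have "EC Tight [?a, b \<otimes> c] (f \<star>\<^bsub>S\<^esub> \<I>\<^bsub>S\<^esub> (b \<otimes> c)) \<odot>\<^bsub>2\<^esub> theta b c =
        EC Tight [?a, b, c] (f \<star>\<^bsub>S\<^esub> \<I>\<^bsub>S\<^esub> (b \<otimes> c) \<cdot>\<^bsub>S\<^esub> \<alpha>\<^bsub>S\<^esub> ?a b c)"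
      using EC_sub[of Tight "[?a]" "\<I>\<^bsub>S\<^esub> (b \<otimes> c)" "[]" Tight "[b, c]" "f \<star>\<^bsub>S\<^esub> \<I>\<^bsub>S\<^esub> (b \<otimes> c)"] f o ops(9)
      unfolding theta_EC[OF o] by (simp add: numeral_2_eq_2 lmap_def lsub_def sharp_def otype_later)
    ultimately show "EC Tight [?a, b, c] (\<alpha>\<^bsub>S\<^esub> ?a' b c \<cdot>\<^bsub>S\<^esub> f \<star>\<^bsub>S\<^esub> \<I>\<^bsub>S\<^esub> b \<star>\<^bsub>S\<^esub> \<I>\<^bsub>S\<^esub> c) =
      EC Tight [?a, b, c] (f \<star>\<^bsub>S\<^esub> \<I>\<^bsub>S\<^esub> (b \<otimes> c) \<cdot>\<^bsub>S\<^esub> \<alpha>\<^bsub>S\<^esub> ?a b c)" by simp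
  qed (use f o in \<open>simp_all add: lmap_def\<close>)
  have 2: "\<alpha>\<^bsub>S\<^esub> a (target g) c \<cdot>\<^bsub>S\<^esub> \<I>\<^bsub>S\<^esub> a \<star>\<^bsub>S\<^esub> g \<star>\<^bsub>S\<^esub> \<I>\<^bsub>S\<^esub> c = \<I>\<^bsub>S\<^esub> a \<star>\<^bsub>S\<^esub> (g \<star>\<^bsub>S\<^esub> \<I>\<^bsub>S\<^esub> c) \<cdot>\<^bsub>S\<^esub> \<alpha>\<^bsub>S\<^esub> a (source g) c"
    if g: "arr S g" and o: "a \<in> Obj C" "c \<in> Obj C" for g a c
  proof (rule EC_inj[of Tight "[a, source g, c]"])
    let ?b = "source g" and ?b' = "target g"
    have "EC Tight [a, ?b', c] (\<alpha>\<^bsub>S\<^esub> a ?b' c) \<odot>\<^bsub>2\<^esub> up ?b g =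
        EC Tight [a, ?b, c] (\<alpha>\<^bsub>S\<^esub> a ?b' c \<cdot>\<^bsub>S\<^esub> \<I>\<^bsub>S\<^esub> a \<star>\<^bsub>S\<^esub> g \<star>\<^bsub>S\<^esub> \<I>\<^bsub>S\<^esub> c)"
      using EC_sub[of Tight "[a]" g "[c]" Tight "[?b]" "\<alpha>\<^bsub>S\<^esub> a ?b' c"] g o ops(5)
      unfolding up_EC_unary
      by (simp add: numeral_2_eq_2 lmap_def lsub_def sharp_def otype_later)
    moreover have "EC Tight [a, ?b', c] (\<alpha>\<^bsub>S\<^esub> a ?b' c) \<odot>\<^bsub>2\<^esub> up ?b g = theta a (?b' \<otimes> c) \<odot>\<^bsub>2\<^esub> (theta ?b' c \<odot> up ?b g)"
      using g o unfolding asr_EC[OF o(1) arr_target[OF g, simplified] o(2)] by (subst sub_inner) auto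
    moreover have "theta a (?b' \<otimes> c) \<odot>\<^bsub>2\<^esub> (theta ?b' c \<odot> up ?b g) =
        EC Tight [a, ?b, c] (\<I>\<^bsub>S\<^esub> a \<star>\<^bsub>S\<^esub> (g \<star>\<^bsub>S\<^esub> \<I>\<^bsub>S\<^esub> c) \<cdot>\<^bsub>S\<^esub> \<alpha>\<^bsub>S\<^esub> a ?b c)"
    proof -
      have "theta ?b' c \<odot> up ?b g = EC Tight [?b, c] (g \<star>\<^bsub>S\<^esub> \<I>\<^bsub>S\<^esub> c)"
        using g o theta_EC_first[of Tight "[?b]" g c] by (simp add: up_EC_unary lmap_def)
      then show ?thesis
        using g o theta_EC_second[of Tight "[?b, c]" "g \<star>\<^bsub>S\<^esub> \<I>\<^bsub>S\<^esub> c" a]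
        by (simp add: EM_Tight[symmetric] lmap_def sharp_def del: EE.simps)
    qed
    ultimately show "EC Tight [a, ?b, c] (\<alpha>\<^bsub>S\<^esub> a ?b' c \<cdot>\<^bsub>S\<^esub> \<I>\<^bsub>S\<^esub> a \<star>\<^bsub>S\<^esub> g \<star>\<^bsub>S\<^esub> \<I>\<^bsub>S\<^esub> c) =
        EC Tight [a, ?b, c] (\<I>\<^bsub>S\<^esub> a \<star>\<^bsub>S\<^esub> (g \<star>\<^bsub>S\<^esub> \<I>\<^bsub>S\<^esub> c) \<cdot>\<^bsub>S\<^esub> \<alpha>\<^bsub>S\<^esub> a ?b c)" by simp
  qed (use g o in \<open>simp_all add: lmap_def\<close>)
  have 3: "\<alpha>\<^bsub>S\<^esub> a b (target h) \<cdot>\<^bsub>S\<^esub> \<I>\<^bsub>S\<^esub> (a \<otimes> b) \<star>\<^bsub>S\<^esub> h = \<I>\<^bsub>S\<^esub> a \<star>\<^bsub>S\<^esub> (\<I>\<^bsub>S\<^esub> b \<star>\<^bsub>S\<^esub> h) \<cdot>\<^bsub>S\<^esub> \<alpha>\<^bsub>S\<^esub> a b (source h)"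
    if h: "arr S h" and o: "a \<in> Obj C" "b \<in> Obj C" for h a b
  proof (rule EC_inj[of Tight "[a, b, source h]"])
    let ?c = "source h" and ?c' = "target h"
    have "EC Tight [a, b, ?c'] (\<alpha>\<^bsub>S\<^esub> a b ?c') \<odot>\<^bsub>3\<^esub> up ?c h =
        EC Tight [a, b, ?c] (\<alpha>\<^bsub>S\<^esub> a b ?c' \<cdot>\<^bsub>S\<^esub> \<I>\<^bsub>S\<^esub> (a \<otimes> b) \<star>\<^bsub>S\<^esub> h)"
      using EC_sub[of Tight "[a, b]" h "[]" Tight "[?c]" "\<alpha>\<^bsub>S\<^esub> a b ?c'"] h o ops(6)
      unfolding up_EC_unary
      by (simp add: numeral_3_eq_3 lmap_def lsub_def sharp_def otype_later)
    moreover have "EC Tight [a, b, ?c'] (\<alpha>\<^bsub>S\<^esub> a b ?c') \<odot>\<^bsub>3\<^esub> up ?c h = theta a (b \<otimes> ?c') \<odot>\<^bsub>2\<^esub> (theta b ?c' \<odot>\<^bsub>2\<^esub> up ?c h)"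
      using h o unfolding asr_EC[OF o arr_target[OF h, simplified]] by (subst sub_inner) auto
    moreover have "theta b ?c' \<odot>\<^bsub>2\<^esub> up ?c h = EC Tight [b, ?c] (\<I>\<^bsub>S\<^esub> b \<star>\<^bsub>S\<^esub> h)"
      using h o theta_EC_second[of Tight "[?c]" h b]
      by (simp add: EM_Tight lmap_def sharp_def)
    moreover have "theta a (b \<otimes> ?c') \<odot>\<^bsub>2\<^esub> EC Tight [b, ?c] (\<I>\<^bsub>S\<^esub> b \<star>\<^bsub>S\<^esub> h) =
        EC Tight [a, b, ?c] (\<I>\<^bsub>S\<^esub> a \<star>\<^bsub>S\<^esub> (\<I>\<^bsub>S\<^esub> b \<star>\<^bsub>S\<^esub> h) \<cdot>\<^bsub>S\<^esub> \<alpha>\<^bsub>S\<^esub> a b ?c)"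
      using h o theta_EC_second[of Tight "[b, ?c]" "\<I>\<^bsub>S\<^esub> b \<star>\<^bsub>S\<^esub> h" a]
      by (simp add: EM_Tight[symmetric] lmap_def sharp_def del: EE.simps)
    ultimately show "EC Tight [a, b, ?c] (\<alpha>\<^bsub>S\<^esub> a b ?c' \<cdot>\<^bsub>S\<^esub> \<I>\<^bsub>S\<^esub> (a \<otimes> b) \<star>\<^bsub>S\<^esub> h) =
        EC Tight [a, b, ?c] (\<I>\<^bsub>S\<^esub> a \<star>\<^bsub>S\<^esub> (\<I>\<^bsub>S\<^esub> b \<star>\<^bsub>S\<^esub> h) \<cdot>\<^bsub>S\<^esub> \<alpha>\<^bsub>S\<^esub> a b ?c)" by simp
  qed (use h o in \<open>simp_all add: lmap_def\<close>)
  let ?a = "source f" and ?b = "source g" and ?c = "source h"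
  let ?a' = "target f" and ?b' = "target g" and ?c' = "target h"
  \<comment> \<open>both products are factored into arrows that act in one variable each\<close>
  have fgh: "f \<star>\<^bsub>S\<^esub> g \<star>\<^bsub>S\<^esub> h = f \<star>\<^bsub>S\<^esub> \<I>\<^bsub>S\<^esub> ?b' \<star>\<^bsub>S\<^esub> \<I>\<^bsub>S\<^esub> ?c' \<cdot>\<^bsub>S\<^esub> \<I>\<^bsub>S\<^esub> ?a \<star>\<^bsub>S\<^esub> g \<star>\<^bsub>S\<^esub> \<I>\<^bsub>S\<^esub> ?c' \<cdot>\<^bsub>S\<^esub> \<I>\<^bsub>S\<^esub> (?a \<otimes> ?b) \<star>\<^bsub>S\<^esub> h"
    using a by (simp add: S.tns_cmp[symmetric])
  have fgh': "f \<star>\<^bsub>S\<^esub> (g \<star>\<^bsub>S\<^esub> h) = f \<star>\<^bsub>S\<^esub> \<I>\<^bsub>S\<^esub> (?b' \<otimes> ?c') \<cdot>\<^bsub>S\<^esub> \<I>\<^bsub>S\<^esub> ?a \<star>\<^bsub>S\<^esub> (g \<star>\<^bsub>S\<^esub> \<I>\<^bsub>S\<^esub> ?c') \<cdot>\<^bsub>S\<^esub> \<I>\<^bsub>S\<^esub> ?a \<star>\<^bsub>S\<^esub> (\<I>\<^bsub>S\<^esub> ?b \<star>\<^bsub>S\<^esub> h)"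
    using a by (simp add: S.tns_cmp[symmetric] S.tns_idar[symmetric] del: S.tns_idar)
  have "\<alpha>\<^bsub>S\<^esub> ?a' ?b' ?c' \<cdot>\<^bsub>S\<^esub> f \<star>\<^bsub>S\<^esub> g \<star>\<^bsub>S\<^esub> h =
      (\<alpha>\<^bsub>S\<^esub> ?a' ?b' ?c' \<cdot>\<^bsub>S\<^esub> f \<star>\<^bsub>S\<^esub> \<I>\<^bsub>S\<^esub> ?b' \<star>\<^bsub>S\<^esub> \<I>\<^bsub>S\<^esub> ?c') \<cdot>\<^bsub>S\<^esub> \<I>\<^bsub>S\<^esub> ?a \<star>\<^bsub>S\<^esub> g \<star>\<^bsub>S\<^esub> \<I>\<^bsub>S\<^esub> ?c' \<cdot>\<^bsub>S\<^esub> \<I>\<^bsub>S\<^esub> (?a \<otimes> ?b) \<star>\<^bsub>S\<^esub> h"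
    unfolding fgh using a by simp
  also have "\<dots> = f \<star>\<^bsub>S\<^esub> \<I>\<^bsub>S\<^esub> (?b' \<otimes> ?c') \<cdot>\<^bsub>S\<^esub> (\<alpha>\<^bsub>S\<^esub> ?a ?b' ?c' \<cdot>\<^bsub>S\<^esub> \<I>\<^bsub>S\<^esub> ?a \<star>\<^bsub>S\<^esub> g \<star>\<^bsub>S\<^esub> \<I>\<^bsub>S\<^esub> ?c') \<cdot>\<^bsub>S\<^esub> \<I>\<^bsub>S\<^esub> (?a \<otimes> ?b) \<star>\<^bsub>S\<^esub> h"
    using a by (subst 1) auto
  also have "\<dots> = f \<star>\<^bsub>S\<^esub> \<I>\<^bsub>S\<^esub> (?b' \<otimes> ?c') \<cdot>\<^bsub>S\<^esub> \<I>\<^bsub>S\<^esub> ?a \<star>\<^bsub>S\<^esub> (g \<star>\<^bsub>S\<^esub> \<I>\<^bsub>S\<^esub> ?c') \<cdot>\<^bsub>S\<^esub> (\<alpha>\<^bsub>S\<^esub> ?a ?b ?c' \<cdot>\<^bsub>S\<^esub> \<I>\<^bsub>S\<^esub> (?a \<otimes> ?b) \<star>\<^bsub>S\<^esub> h)"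
    using a by (subst 2) auto
  also have "\<dots> = f \<star>\<^bsub>S\<^esub> (g \<star>\<^bsub>S\<^esub> h) \<cdot>\<^bsub>S\<^esub> \<alpha>\<^bsub>S\<^esub> ?a ?b ?c"
    unfolding fgh' using a by (subst 3) auto
  finally show ?thesis .
qed

theorem skew_monoidal_S: "skew_monoidal_category S"
proof (rule S.skew_monoidal_categoryI)
  note ob = skmon_of_simps(1)[of C chi]
  show "\<And>a b c d. \<lbrakk>a \<in> Ob S; b \<in> Ob S; c \<in> Ob S; d \<in> Ob S\<rbrakk> \<Longrightarrow>
      \<alpha>\<^bsub>S\<^esub> a b (c \<otimes> d) \<cdot>\<^bsub>S\<^esub> \<alpha>\<^bsub>S\<^esub> (a \<otimes> b) c d =
      \<I>\<^bsub>S\<^esub> a \<star>\<^bsub>S\<^esub> \<alpha>\<^bsub>S\<^esub> b c d \<cdot>\<^bsub>S\<^esub> \<alpha>\<^bsub>S\<^esub> a (b \<otimes> c) d \<cdot>\<^bsub>S\<^esub> \<alpha>\<^bsub>S\<^esub> a b c \<star>\<^bsub>S\<^esub> \<I>\<^bsub>S\<^esub> d"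
    unfolding ob by (rule asr_pentagon_S)
  show "\<And>a b. \<lbrakk>a \<in> Ob S; b \<in> Ob S\<rbrakk> \<Longrightarrow>
      \<Lambda>\<^bsub>S\<^esub> (a \<otimes> b) \<cdot>\<^bsub>S\<^esub> \<alpha>\<^bsub>S\<^esub> (Unit S) a b = \<Lambda>\<^bsub>S\<^esub> a \<star>\<^bsub>S\<^esub> \<I>\<^bsub>S\<^esub> b"
    unfolding ob by (rule lun_asr_S)
  show "\<And>a b. \<lbrakk>a \<in> Ob S; b \<in> Ob S\<rbrakk> \<Longrightarrow>
      \<alpha>\<^bsub>S\<^esub> a b (Unit S) \<cdot>\<^bsub>S\<^esub> \<rho>\<^bsub>S\<^esub> (a \<otimes> b) = \<I>\<^bsub>S\<^esub> a \<star>\<^bsub>S\<^esub> \<rho>\<^bsub>S\<^esub> b"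
    unfolding ob by (rule asr_run_S)
  show "\<And>a b. \<lbrakk>a \<in> Ob S; b \<in> Ob S\<rbrakk> \<Longrightarrow>
      \<I>\<^bsub>S\<^esub> a \<star>\<^bsub>S\<^esub> \<Lambda>\<^bsub>S\<^esub> b \<cdot>\<^bsub>S\<^esub> \<alpha>\<^bsub>S\<^esub> a (Unit S) b \<cdot>\<^bsub>S\<^esub> \<rho>\<^bsub>S\<^esub> a \<star>\<^bsub>S\<^esub> \<I>\<^bsub>S\<^esub> b =
      \<I>\<^bsub>S\<^esub> (a \<otimes> b)"
    unfolding ob by (rule lun_asr_run_S)
qed (fact asr_natural_S lun_natural_S run_natural_S lun_run_S)+

end

sublocale classified_multicategory \<subseteq> S: skew_monoidal_category "skmon_of C chi"
  by (rule skew_monoidal_S)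

section \<open>Lax monoidal functors\<close>

text \<open>
  The data of a lax monoidal functor on arrows that carry their source and target: the action, \<open>f\<^sub>0\<close>
  and \<open>f\<^sub>2\<close>.
\<close>

definition fa :: "('o, 'm) laxmor \<Rightarrow> ('o, 'm) arrow \<Rightarrow> ('o, 'm) arrow" where
  "fa \<Phi> f = (FO (LF \<Phi>) (source f), FA (LF \<Phi>) (source f) (target f) (label f), FO (LF \<Phi>) (target f))"

definition f0 :: "('o, 'm) skmon \<Rightarrow> ('o, 'm) skmon \<Rightarrow> ('o, 'm) laxmor \<Rightarrow> ('o, 'm) arrow" where
  "f0 S R \<Phi> = (Unit R, L0 \<Phi>, FO (LF \<Phi>) (Unit S))"

definition f2 :: "('o, 'm) skmon \<Rightarrow> ('o, 'm) skmon \<Rightarrow> ('o, 'm) laxmor \<Rightarrow> 'o \<Rightarrow> 'o \<Rightarrow> ('o, 'm) arrow" where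
  "f2 S R \<Phi> a b = (TO R (FO (LF \<Phi>) a) (FO (LF \<Phi>) b), L2 \<Phi> a b, FO (LF \<Phi>) (TO S a b))"

text \<open>
  The iterated \<open>f\<^sub>2\<close>, from \<open>F w F x\<^sub>1 \<dots> F x\<^sub>n\<close> to \<open>F (w x\<^sub>1 \<dots> x\<^sub>n)\<close>.
\<close>

primrec phi :: "('o, 'm) skmon \<Rightarrow> ('o, 'm) skmon \<Rightarrow> ('o, 'm) laxmor \<Rightarrow> 'o \<Rightarrow> 'o list \<Rightarrow> ('o, 'm) arrow" where
  "phi S R \<Phi> w [] = \<I>\<^bsub>R\<^esub> (FO (LF \<Phi>) w)"
| "phi S R \<Phi> w (x # xs) = phi S R \<Phi> (TO S w x) xs \<cdot>\<^bsub>R\<^esub> tar R (map (FO (LF \<Phi>)) xs) (f2 S R \<Phi> w x)"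

definition pb :: "('o, 'm) skmon \<Rightarrow> ('o, 'm) skmon \<Rightarrow> ('o, 'm) laxmor \<Rightarrow> ty \<Rightarrow> 'o list \<Rightarrow> ('o, 'm) arrow" where
  "pb S R \<Phi> x as =
    (if x = Tight then phi S R \<Phi> (hd as) (tl as)
     else phi S R \<Phi> (Unit S) as \<cdot>\<^bsub>R\<^esub> tar R (map (FO (LF \<Phi>)) as) (f0 S R \<Phi>))"

text \<open>
  The effect of a lax monoidal functor on arrows that stand for maps: apply it, then restore a source
  of the right form by the iterated \<open>f\<^sub>2\<close>, preceded by \<open>f\<^sub>0\<close> on the unit of a loose map.
\<close>

definition lact ::
  "('o, 'm) skmon \<Rightarrow> ('o, 'm) skmon \<Rightarrow> ('o, 'm) laxmor \<Rightarrow> ty \<Rightarrow> 'o list \<Rightarrow> ('o, 'm) arrow \<Rightarrow> ('o, 'm) arrow" where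
  "lact S R \<Phi> x as f = fa \<Phi> f \<cdot>\<^bsub>R\<^esub> pb S R \<Phi> x as"

lemma fa_source [simp]: "source (fa \<Phi> f) = FO (LF \<Phi>) (source f)"
  and fa_target [simp]: "target (fa \<Phi> f) = FO (LF \<Phi>) (target f)"
  by (simp_all add: fa_def)

lemma f0_source [simp]: "source (f0 S R \<Phi>) = Unit R"
  and f0_target [simp]: "target (f0 S R \<Phi>) = FO (LF \<Phi>) (Unit S)"
  by (simp_all add: f0_def)

lemma f2_source [simp]: "source (f2 S R \<Phi> a b) = TO R (FO (LF \<Phi>) a) (FO (LF \<Phi>) b)"
  and f2_target [simp]: "target (f2 S R \<Phi> a b) = FO (LF \<Phi>) (TO S a b)"
  by (simp_all add: f2_def)

lemma phi_source [simp]: "source (phi S R \<Phi> w xs) = tob R (FO (LF \<Phi>) w) (map (FO (LF \<Phi>)) xs)"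
  and phi_target [simp]: "target (phi S R \<Phi> w xs) = FO (LF \<Phi>) (tob S w xs)"
  by (induction xs arbitrary: w) auto

lemma pb_target [simp]: "x = Tight \<longrightarrow> as \<noteq> [] \<Longrightarrow> target (pb S R \<Phi> x as) = FO (LF \<Phi>) (tobx S x as)"
  and pb_source [simp]: "x = Tight \<longrightarrow> as \<noteq> [] \<Longrightarrow>
    source (pb S R \<Phi> x as) = tobx R x (map (FO (LF \<Phi>)) as)"
  by (cases x; cases as; simp add: pb_def)+

lemma pb_Tight: "pb S R \<Phi> Tight (a # as) = phi S R \<Phi> a as"
  by (simp add: pb_def)

lemma lact_target [simp]: "target (lact S R \<Phi> x as f) = FO (LF \<Phi>) (target f)"
  and lact_source [simp]: "x = Tight \<longrightarrow> as \<noteq> [] \<Longrightarrow>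
    source (lact S R \<Phi> x as f) = tobx R x (map (FO (LF \<Phi>)) as)"
  by (simp_all add: lact_def)

locale lax_data = S: skew_monoidal_category S + R: skew_monoidal_category R
  for S R :: "('o, 'm) skmon" +
  fixes \<Phi> :: "('o, 'm) laxmor"
  assumes lax_is_functor: "is_functor S R (LF \<Phi>)"
    and L0_hom: "L0 \<Phi> \<in> Hom R (Unit R) (FO (LF \<Phi>) (Unit S))"
    and L2_hom: "\<lbrakk>a \<in> Ob S; b \<in> Ob S\<rbrakk> \<Longrightarrow>
      L2 \<Phi> a b \<in> Hom R (TO R (FO (LF \<Phi>) a) (FO (LF \<Phi>) b)) (FO (LF \<Phi>) (TO S a b))"
begin

abbreviation F where "F \<equiv> FO (LF \<Phi>)"
abbreviation "FF \<equiv> fa \<Phi>"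
abbreviation "u0 \<equiv> f0 S R \<Phi>"
abbreviation "m2 \<equiv> f2 S R \<Phi>"
abbreviation "ph \<equiv> phi S R \<Phi>"
abbreviation Fs where "Fs \<equiv> map F"
abbreviation "lc \<equiv> lact S R \<Phi>"

lemma F_ob [simp]: "a \<in> Ob S \<Longrightarrow> F a \<in> Ob R"
  using lax_is_functor by (simp add: is_functor_def)

lemma Fs_image [simp]: "set xs \<subseteq> Ob S \<Longrightarrow> F ` set xs \<subseteq> Ob R"
  by auto

lemma arr_FF [simp]: "arr S f \<Longrightarrow> arr R (FF f)"
  using lax_is_functor by (simp add: is_functor_def arr_def fa_def del: arr_source arr_target)

lemma FF_idar [simp]: "a \<in> Ob S \<Longrightarrow> FF (\<I>\<^bsub>S\<^esub> a) = \<I>\<^bsub>R\<^esub> (F a)"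
  using lax_is_functor by (simp add: is_functor_def fa_def idar_def)

lemma FF_cmp [simp]: "\<lbrakk>arr S f; arr S g; target f = source g\<rbrakk> \<Longrightarrow> FF (g \<cdot>\<^bsub>S\<^esub> f) = FF g \<cdot>\<^bsub>R\<^esub> FF f"
  using lax_is_functor by (simp add: is_functor_def fa_def arr_def cmp_def del: arr_source arr_target)

lemma arr_u0 [simp]: "arr R u0"
  by (simp add: arr_def f0_def L0_hom)

lemma arr_m2 [simp]: "\<lbrakk>a \<in> Ob S; b \<in> Ob S\<rbrakk> \<Longrightarrow> arr R (m2 a b)"
  by (simp add: arr_def f2_def L2_hom)

lemma arr_phi [simp]: "\<lbrakk>w \<in> Ob S; set xs \<subseteq> Ob S\<rbrakk> \<Longrightarrow> arr R (ph w xs)"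
  by (induction xs arbitrary: w) auto

lemma arr_pb [simp]: "\<lbrakk>x = Tight \<longrightarrow> as \<noteq> []; set as \<subseteq> Ob S\<rbrakk> \<Longrightarrow> arr R (pb S R \<Phi> x as)"
  by (cases x; cases as) (auto simp: pb_def)

lemma lmap_lact [simp]: "lmap S x as f \<Longrightarrow> lmap R x (Fs as) (lc x as f)"
  by (auto simp: lmap_def lact_def)

lemma phi_append:
  "\<lbrakk>w \<in> Ob S; set xs \<subseteq> Ob S; set ys \<subseteq> Ob S\<rbrakk> \<Longrightarrow>
   ph w (xs @ ys) = ph (tob S w xs) ys \<cdot>\<^bsub>R\<^esub> tar R (Fs ys) (ph w xs)"
  by (induction xs arbitrary: w) auto

lemma pb_append:
  "\<lbrakk>x = Tight \<longrightarrow> us \<noteq> []; set us \<subseteq> Ob S; set vs \<subseteq> Ob S\<rbrakk> \<Longrightarrow>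
   pb S R \<Phi> x (us @ vs) = ph (tobx S x us) vs \<cdot>\<^bsub>R\<^esub> tar R (Fs vs) (pb S R \<Phi> x us)"
  by (cases x; cases us) (auto simp: pb_def phi_append)

end

locale lax_functor = lax_data S R \<Phi> for S R :: "('o, 'm) skmon" and \<Phi> +
  assumes m2_natural: "\<lbrakk>arr S f; arr S g\<rbrakk> \<Longrightarrow>
      f2 S R \<Phi> (target f) (target g) \<cdot>\<^bsub>R\<^esub> fa \<Phi> f \<star>\<^bsub>R\<^esub> fa \<Phi> g =
      fa \<Phi> (f \<star>\<^bsub>S\<^esub> g) \<cdot>\<^bsub>R\<^esub> f2 S R \<Phi> (source f) (source g)"
    and m2_assoc: "\<lbrakk>a \<in> Ob S; b \<in> Ob S; c \<in> Ob S\<rbrakk> \<Longrightarrow>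
      fa \<Phi> (\<alpha>\<^bsub>S\<^esub> a b c) \<cdot>\<^bsub>R\<^esub> f2 S R \<Phi> (a \<otimes>\<^bsub>S\<^esub> b) c \<cdot>\<^bsub>R\<^esub>
        f2 S R \<Phi> a b \<star>\<^bsub>R\<^esub> \<I>\<^bsub>R\<^esub> (FO (LF \<Phi>) c) =
      f2 S R \<Phi> a (b \<otimes>\<^bsub>S\<^esub> c) \<cdot>\<^bsub>R\<^esub> \<I>\<^bsub>R\<^esub> (FO (LF \<Phi>) a) \<star>\<^bsub>R\<^esub> f2 S R \<Phi> b c \<cdot>\<^bsub>R\<^esub>
        \<alpha>\<^bsub>R\<^esub> (FO (LF \<Phi>) a) (FO (LF \<Phi>) b) (FO (LF \<Phi>) c)"
    and m2_lun: "a \<in> Ob S \<Longrightarrow>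
      fa \<Phi> (\<Lambda>\<^bsub>S\<^esub> a) \<cdot>\<^bsub>R\<^esub> f2 S R \<Phi> (Unit S) a \<cdot>\<^bsub>R\<^esub> f0 S R \<Phi> \<star>\<^bsub>R\<^esub> \<I>\<^bsub>R\<^esub> (FO (LF \<Phi>) a) =
      \<Lambda>\<^bsub>R\<^esub> (FO (LF \<Phi>) a)"
    and m2_run: "a \<in> Ob S \<Longrightarrow>
      f2 S R \<Phi> a (Unit S) \<cdot>\<^bsub>R\<^esub> \<I>\<^bsub>R\<^esub> (FO (LF \<Phi>) a) \<star>\<^bsub>R\<^esub> f0 S R \<Phi> \<cdot>\<^bsub>R\<^esub> \<rho>\<^bsub>R\<^esub> (FO (LF \<Phi>) a) =
      fa \<Phi> (\<rho>\<^bsub>S\<^esub> a)"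

definition normalised :: "('o, 'm) skmon \<Rightarrow> ('o, 'm) laxmor \<Rightarrow> bool" where
  "normalised S \<Phi> \<longleftrightarrow>
     (\<forall>a. a \<notin> Ob S \<longrightarrow> FO (LF \<Phi>) a = undefined) \<and>
     (\<forall>a b f. \<not> (a \<in> Ob S \<and> b \<in> Ob S \<and> f \<in> Hom S a b) \<longrightarrow> FA (LF \<Phi>) a b f = undefined) \<and>
     (\<forall>a b. \<not> (a \<in> Ob S \<and> b \<in> Ob S) \<longrightarrow> L2 \<Phi> a b = undefined)"

lemma lax_functor_iff:
  assumes "skew_monoidal_category S" "skew_monoidal_category R"
  shows "lax_monoidal S R \<Phi> \<longleftrightarrow> lax_functor S R \<Phi> \<and> normalised S \<Phi>"
proof
  assume l: "lax_monoidal S R \<Phi>"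
  have d: "lax_data S R \<Phi>"
    using l assms unfolding lax_data_def lax_data_axioms_def lax_monoidal_def Let_def by blast
  have "lax_functor S R \<Phi>"
    unfolding lax_functor_def lax_functor_axioms_def
    apply (intro conjI d allI impI)
    subgoal for f g using l unfolding lax_monoidal_def Let_def
      by (simp add: arr_def cmp_def tns_def f2_def fa_def del: arr_source arr_target)
    subgoal for a b c using l unfolding lax_monoidal_def Let_def
      by (simp add: cmp_def tns_def f2_def fa_def asr_def idar_def)
    subgoal for a using l unfolding lax_monoidal_def Let_def
      by (simp add: cmp_def tns_def f2_def f0_def fa_def lun_def idar_def)
    subgoal for a using l unfolding lax_monoidal_def Let_def
      by (simp add: cmp_def tns_def f2_def f0_def fa_def run_def idar_def)
    done
  moreover have "normalised S \<Phi>"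
    using l unfolding lax_monoidal_def Let_def normalised_def by blast
  ultimately show "lax_functor S R \<Phi> \<and> normalised S \<Phi>" ..
next
  assume "lax_functor S R \<Phi> \<and> normalised S \<Phi>"
  then interpret lax_functor S R \<Phi> by simp
  have n: "normalised S \<Phi>" using \<open>lax_functor S R \<Phi> \<and> normalised S \<Phi>\<close> by simp
  show "lax_monoidal S R \<Phi>"
    unfolding lax_monoidal_def Let_def
    apply (intro conjI ballI allI)
    subgoal by (rule lax_is_functor)
    subgoal by (rule L0_hom)
    subgoal by (rule L2_hom)
    subgoal for a a' b b' f g using arg_cong[OF m2_natural[of "(a, f, a')" "(b, g, b')"], of label]
      by (simp add: cmp_def tns_def f2_def fa_def)
    subgoal for a b c using arg_cong[OF m2_assoc[of a b c], of label]
      by (simp add: cmp_def tns_def f2_def fa_def asr_def idar_def)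
    subgoal for a using arg_cong[OF m2_lun[of a], of label]
      by (simp add: cmp_def tns_def f2_def f0_def fa_def lun_def idar_def)
    subgoal for a using arg_cong[OF m2_run[of a], of label]
      by (simp add: cmp_def tns_def f2_def f0_def fa_def run_def idar_def)
    subgoal using n unfolding normalised_def by blast
    subgoal using n unfolding normalised_def by blast
    subgoal using n unfolding normalised_def by blast
    done
qed

context lax_functor
begin

lemma phi_natural:
  "\<lbrakk>arr S f; set xs \<subseteq> Ob S\<rbrakk> \<Longrightarrow>
   FF (tar S xs f) \<cdot>\<^bsub>R\<^esub> ph (source f) xs = ph (target f) xs \<cdot>\<^bsub>R\<^esub> tar R (Fs xs) (FF f)"
proof (induction xs arbitrary: f)
  case (Cons x xs)
  have "FF (tar S (x # xs) f) \<cdot>\<^bsub>R\<^esub> ph (source f) (x # xs) =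
      (FF (tar S xs (f \<star>\<^bsub>S\<^esub> \<I>\<^bsub>S\<^esub> x)) \<cdot>\<^bsub>R\<^esub> ph (source (f \<star>\<^bsub>S\<^esub> \<I>\<^bsub>S\<^esub> x)) xs) \<cdot>\<^bsub>R\<^esub>
      tar R (Fs xs) (m2 (source f) x)"
    using Cons.prems by simp
  also have "\<dots> = ph (target f \<otimes>\<^bsub>S\<^esub> x) xs \<cdot>\<^bsub>R\<^esub> tar R (Fs xs) (FF (f \<star>\<^bsub>S\<^esub> \<I>\<^bsub>S\<^esub> x) \<cdot>\<^bsub>R\<^esub> m2 (source f) x)"
    using Cons.prems by (subst Cons.IH) auto
  also have "FF (f \<star>\<^bsub>S\<^esub> \<I>\<^bsub>S\<^esub> x) \<cdot>\<^bsub>R\<^esub> m2 (source f) x = m2 (target f) x \<cdot>\<^bsub>R\<^esub> FF f \<star>\<^bsub>R\<^esub> \<I>\<^bsub>R\<^esub> (F x)"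
    using m2_natural[of f "\<I>\<^bsub>S\<^esub> x"] Cons.prems by simp
  finally show ?case using Cons.prems by simp
qed simp

text \<open>
  The associativity axiom of a lax monoidal functor, iterated.
\<close>

lemma phi_gam:
  "\<lbrakk>w \<in> Ob S; p \<in> Ob S; set xs \<subseteq> Ob S\<rbrakk> \<Longrightarrow>
   m2 w (tob S p xs) \<cdot>\<^bsub>R\<^esub> \<I>\<^bsub>R\<^esub> (F w) \<star>\<^bsub>R\<^esub> ph p xs \<cdot>\<^bsub>R\<^esub> gam R (F w) (F p) (Fs xs) =
   FF (gam S w p xs) \<cdot>\<^bsub>R\<^esub> ph (w \<otimes>\<^bsub>S\<^esub> p) xs \<cdot>\<^bsub>R\<^esub> tar R (Fs xs) (m2 w p)"
proof (induction xs arbitrary: p)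
  case (Cons x xs)
  let ?T = "tar R (Fs xs)" and ?px = "p \<otimes>\<^bsub>S\<^esub> x"
  note o = Cons.prems
  have "m2 w (tob S p (x # xs)) \<cdot>\<^bsub>R\<^esub> \<I>\<^bsub>R\<^esub> (F w) \<star>\<^bsub>R\<^esub> ph p (x # xs) \<cdot>\<^bsub>R\<^esub> gam R (F w) (F p) (Fs (x # xs)) =
      m2 w (tob S ?px xs) \<cdot>\<^bsub>R\<^esub> \<I>\<^bsub>R\<^esub> (F w) \<star>\<^bsub>R\<^esub> ph ?px xs \<cdot>\<^bsub>R\<^esub>
      (\<I>\<^bsub>R\<^esub> (F w) \<star>\<^bsub>R\<^esub> ?T (m2 p x) \<cdot>\<^bsub>R\<^esub> gam R (F w) (F p \<otimes>\<^bsub>R\<^esub> F x) (Fs xs)) \<cdot>\<^bsub>R\<^esub>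
      ?T (\<alpha>\<^bsub>R\<^esub> (F w) (F p) (F x))"
    using o by simp
  also have "\<I>\<^bsub>R\<^esub> (F w) \<star>\<^bsub>R\<^esub> ?T (m2 p x) \<cdot>\<^bsub>R\<^esub> gam R (F w) (F p \<otimes>\<^bsub>R\<^esub> F x) (Fs xs) =
      gam R (F w) (F ?px) (Fs xs) \<cdot>\<^bsub>R\<^esub> ?T (\<I>\<^bsub>R\<^esub> (F w) \<star>\<^bsub>R\<^esub> m2 p x)"
    using R.gam_natural[of "\<I>\<^bsub>R\<^esub> (F w)" "m2 p x" "Fs xs"] o by simp
  also have "m2 w (tob S ?px xs) \<cdot>\<^bsub>R\<^esub> \<I>\<^bsub>R\<^esub> (F w) \<star>\<^bsub>R\<^esub> ph ?px xs \<cdot>\<^bsub>R\<^esub>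
      (gam R (F w) (F ?px) (Fs xs) \<cdot>\<^bsub>R\<^esub> ?T (\<I>\<^bsub>R\<^esub> (F w) \<star>\<^bsub>R\<^esub> m2 p x)) \<cdot>\<^bsub>R\<^esub> ?T (\<alpha>\<^bsub>R\<^esub> (F w) (F p) (F x)) =
      (m2 w (tob S ?px xs) \<cdot>\<^bsub>R\<^esub> \<I>\<^bsub>R\<^esub> (F w) \<star>\<^bsub>R\<^esub> ph ?px xs \<cdot>\<^bsub>R\<^esub> gam R (F w) (F ?px) (Fs xs)) \<cdot>\<^bsub>R\<^esub>
      ?T (\<I>\<^bsub>R\<^esub> (F w) \<star>\<^bsub>R\<^esub> m2 p x \<cdot>\<^bsub>R\<^esub> \<alpha>\<^bsub>R\<^esub> (F w) (F p) (F x))"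
    using o by simp
  also have "\<dots> = FF (gam S w ?px xs) \<cdot>\<^bsub>R\<^esub> ph (w \<otimes>\<^bsub>S\<^esub> ?px) xs \<cdot>\<^bsub>R\<^esub>
      ?T (m2 w ?px \<cdot>\<^bsub>R\<^esub> \<I>\<^bsub>R\<^esub> (F w) \<star>\<^bsub>R\<^esub> m2 p x \<cdot>\<^bsub>R\<^esub> \<alpha>\<^bsub>R\<^esub> (F w) (F p) (F x))"
    using o by (subst Cons.IH) auto
  also have "\<dots> = FF (gam S w ?px xs) \<cdot>\<^bsub>R\<^esub>
      (ph (w \<otimes>\<^bsub>S\<^esub> ?px) xs \<cdot>\<^bsub>R\<^esub> ?T (FF (\<alpha>\<^bsub>S\<^esub> w p x))) \<cdot>\<^bsub>R\<^esub>
      ?T (m2 (w \<otimes>\<^bsub>S\<^esub> p) x \<cdot>\<^bsub>R\<^esub> m2 w p \<star>\<^bsub>R\<^esub> \<I>\<^bsub>R\<^esub> (F x))"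
    using o by (subst m2_assoc[symmetric]) auto
  also have "ph (w \<otimes>\<^bsub>S\<^esub> ?px) xs \<cdot>\<^bsub>R\<^esub> ?T (FF (\<alpha>\<^bsub>S\<^esub> w p x)) =
      FF (tar S xs (\<alpha>\<^bsub>S\<^esub> w p x)) \<cdot>\<^bsub>R\<^esub> ph (w \<otimes>\<^bsub>S\<^esub> p \<otimes>\<^bsub>S\<^esub> x) xs"
    using phi_natural[of "\<alpha>\<^bsub>S\<^esub> w p x" xs] o by simp
  finally show ?case using o by simp
qed simp

text \<open>
  For a tight map this is \<open>phi_gam\<close> together with naturality; a loose map needs the right unit axiom in
  addition, because of the \<open>\<rho>\<close> in \<open>sharp\<close>.
\<close>

lemma lact_sharp:
  assumes "lmap S x as f" "w \<in> Ob S"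
  shows "m2 w (target f) \<cdot>\<^bsub>R\<^esub> sharp R x (Fs as) (lc x as f) (F w) =
    FF (sharp S x as f w) \<cdot>\<^bsub>R\<^esub> ph w as"
proof (cases x)
  case Tight
  then obtain a xs where as: "as = a # xs" using assms by (cases as) (auto simp: lmap_def)
  have o: "arr S f" "source f = tob S a xs" "a \<in> Ob S" "set xs \<subseteq> Ob S" "w \<in> Ob S"
    using assms as Tight by (auto simp: lmap_def)
  have "m2 w (target f) \<cdot>\<^bsub>R\<^esub> sharp R x (Fs as) (lc x as f) (F w) =
      (m2 w (target f) \<cdot>\<^bsub>R\<^esub> \<I>\<^bsub>R\<^esub> (F w) \<star>\<^bsub>R\<^esub> FF f) \<cdot>\<^bsub>R\<^esub>
      \<I>\<^bsub>R\<^esub> (F w) \<star>\<^bsub>R\<^esub> ph a xs \<cdot>\<^bsub>R\<^esub> gam R (F w) (F a) (Fs xs)"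
    using o Tight as by (simp add: sharp_def lact_def pb_def)
  also have "m2 w (target f) \<cdot>\<^bsub>R\<^esub> \<I>\<^bsub>R\<^esub> (F w) \<star>\<^bsub>R\<^esub> FF f = FF (\<I>\<^bsub>S\<^esub> w \<star>\<^bsub>S\<^esub> f) \<cdot>\<^bsub>R\<^esub> m2 w (tob S a xs)"
    using m2_natural[of "\<I>\<^bsub>S\<^esub> w" f] o by simp
  also have "(FF (\<I>\<^bsub>S\<^esub> w \<star>\<^bsub>S\<^esub> f) \<cdot>\<^bsub>R\<^esub> m2 w (tob S a xs)) \<cdot>\<^bsub>R\<^esub>
      \<I>\<^bsub>R\<^esub> (F w) \<star>\<^bsub>R\<^esub> ph a xs \<cdot>\<^bsub>R\<^esub> gam R (F w) (F a) (Fs xs) =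
      FF (\<I>\<^bsub>S\<^esub> w \<star>\<^bsub>S\<^esub> f) \<cdot>\<^bsub>R\<^esub> FF (gam S w a xs) \<cdot>\<^bsub>R\<^esub> ph (w \<otimes>\<^bsub>S\<^esub> a) xs \<cdot>\<^bsub>R\<^esub> tar R (Fs xs) (m2 w a)"
    using o phi_gam[of w a xs] by simp
  finally show ?thesis using o Tight as by (simp add: sharp_def)
next
  case Loose
  let ?i = "Unit S" and ?j = "Unit R" and ?T = "tar R (Fs as)"
  have o: "arr S f" "source f = tob S ?i as" "set as \<subseteq> Ob S" "w \<in> Ob S"
    using assms Loose by (auto simp: lmap_def)
  have "m2 w (target f) \<cdot>\<^bsub>R\<^esub> sharp R x (Fs as) (lc x as f) (F w) =
      (m2 w (target f) \<cdot>\<^bsub>R\<^esub> \<I>\<^bsub>R\<^esub> (F w) \<star>\<^bsub>R\<^esub> FF f) \<cdot>\<^bsub>R\<^esub> \<I>\<^bsub>R\<^esub> (F w) \<star>\<^bsub>R\<^esub> ph ?i as \<cdot>\<^bsub>R\<^esub>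
      (\<I>\<^bsub>R\<^esub> (F w) \<star>\<^bsub>R\<^esub> ?T u0 \<cdot>\<^bsub>R\<^esub> gam R (F w) ?j (Fs as)) \<cdot>\<^bsub>R\<^esub> ?T (\<rho>\<^bsub>R\<^esub> (F w))"
    using o Loose by (simp add: sharp_def lact_def pb_def)
  also have "m2 w (target f) \<cdot>\<^bsub>R\<^esub> \<I>\<^bsub>R\<^esub> (F w) \<star>\<^bsub>R\<^esub> FF f = FF (\<I>\<^bsub>S\<^esub> w \<star>\<^bsub>S\<^esub> f) \<cdot>\<^bsub>R\<^esub> m2 w (tob S ?i as)"
    using m2_natural[of "\<I>\<^bsub>S\<^esub> w" f] o by simp
  also have "\<I>\<^bsub>R\<^esub> (F w) \<star>\<^bsub>R\<^esub> ?T u0 \<cdot>\<^bsub>R\<^esub> gam R (F w) ?j (Fs as) =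
      gam R (F w) (F ?i) (Fs as) \<cdot>\<^bsub>R\<^esub> ?T (\<I>\<^bsub>R\<^esub> (F w) \<star>\<^bsub>R\<^esub> u0)"
    using R.gam_natural[of "\<I>\<^bsub>R\<^esub> (F w)" u0 "Fs as"] o by simp
  also have "(FF (\<I>\<^bsub>S\<^esub> w \<star>\<^bsub>S\<^esub> f) \<cdot>\<^bsub>R\<^esub> m2 w (tob S ?i as)) \<cdot>\<^bsub>R\<^esub> \<I>\<^bsub>R\<^esub> (F w) \<star>\<^bsub>R\<^esub> ph ?i as \<cdot>\<^bsub>R\<^esub>
      (gam R (F w) (F ?i) (Fs as) \<cdot>\<^bsub>R\<^esub> ?T (\<I>\<^bsub>R\<^esub> (F w) \<star>\<^bsub>R\<^esub> u0)) \<cdot>\<^bsub>R\<^esub> ?T (\<rho>\<^bsub>R\<^esub> (F w)) =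
      FF (\<I>\<^bsub>S\<^esub> w \<star>\<^bsub>S\<^esub> f) \<cdot>\<^bsub>R\<^esub>
      (m2 w (tob S ?i as) \<cdot>\<^bsub>R\<^esub> \<I>\<^bsub>R\<^esub> (F w) \<star>\<^bsub>R\<^esub> ph ?i as \<cdot>\<^bsub>R\<^esub> gam R (F w) (F ?i) (Fs as)) \<cdot>\<^bsub>R\<^esub>
      ?T (\<I>\<^bsub>R\<^esub> (F w) \<star>\<^bsub>R\<^esub> u0 \<cdot>\<^bsub>R\<^esub> \<rho>\<^bsub>R\<^esub> (F w))"
    using o by simp
  also have "\<dots> = FF (\<I>\<^bsub>S\<^esub> w \<star>\<^bsub>S\<^esub> f) \<cdot>\<^bsub>R\<^esub> FF (gam S w ?i as) \<cdot>\<^bsub>R\<^esub> ph (w \<otimes>\<^bsub>S\<^esub> ?i) as \<cdot>\<^bsub>R\<^esub>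
      ?T (m2 w ?i \<cdot>\<^bsub>R\<^esub> \<I>\<^bsub>R\<^esub> (F w) \<star>\<^bsub>R\<^esub> u0 \<cdot>\<^bsub>R\<^esub> \<rho>\<^bsub>R\<^esub> (F w))"
    using o by (subst phi_gam) auto
  also have "\<dots> = FF (\<I>\<^bsub>S\<^esub> w \<star>\<^bsub>S\<^esub> f) \<cdot>\<^bsub>R\<^esub> FF (gam S w ?i as) \<cdot>\<^bsub>R\<^esub> ph (w \<otimes>\<^bsub>S\<^esub> ?i) as \<cdot>\<^bsub>R\<^esub> ?T (FF (\<rho>\<^bsub>S\<^esub> w))"
    using o by (subst m2_run) auto
  also have "ph (w \<otimes>\<^bsub>S\<^esub> ?i) as \<cdot>\<^bsub>R\<^esub> ?T (FF (\<rho>\<^bsub>S\<^esub> w)) = FF (tar S as (\<rho>\<^bsub>S\<^esub> w)) \<cdot>\<^bsub>R\<^esub> ph w as"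
    using phi_natural[of "\<rho>\<^bsub>S\<^esub> w" as] o by simp
  finally show ?thesis using o Loose by (simp add: sharp_def)
qed

text \<open>
  This follows from \<open>lact_sharp\<close> if \<open>f\<close> has to pass other factors, and from naturality of \<open>phi\<close>
  otherwise.  It is the reason why lax monoidal functors define morphisms of multicategories.
\<close>

theorem lact_lsub:
  assumes g: "lmap S x (us @ target f # vs) g" and f: "lmap S y as f"
  shows "lc (otype x (Suc (length us)) y) (us @ as @ vs) (lsub S x us vs y as g f) =
    lsub R x (Fs us) (Fs vs) y (Fs as) (lc x (us @ target f # vs) g) (lc y as f)"
proof (cases "x = Tight \<and> us = []")
  case True
  have o: "arr S g" "arr S f" "source g = tob S (target f) vs" "source f = tobx S y as"
    "y = Tight \<longrightarrow> as \<noteq> []" "set as \<subseteq> Ob S" "set vs \<subseteq> Ob S"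
    using g f True by (auto simp: lmap_def)
  have "lc y (as @ vs) (g \<cdot>\<^bsub>S\<^esub> tar S vs f) =
      FF g \<cdot>\<^bsub>R\<^esub> (FF (tar S vs f) \<cdot>\<^bsub>R\<^esub> ph (source f) vs) \<cdot>\<^bsub>R\<^esub> tar R (Fs vs) (pb S R \<Phi> y as)"
    using o by (simp add: lact_def pb_append)
  also have "\<dots> = FF g \<cdot>\<^bsub>R\<^esub> ph (target f) vs \<cdot>\<^bsub>R\<^esub> tar R (Fs vs) (lc y as f)"
    using o by (subst phi_natural) (auto simp: lact_def)
  finally show ?thesis
    using True o lmap_lact[OF f] by (simp add: lsub_def lact_def[of _ _ _ Tight] pb_Tight lmap_def)
next
  case False
  then have us: "x = Tight \<longrightarrow> us \<noteq> []" by auto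
  let ?W = "tobx S x us" and ?P = "pb S R \<Phi> x us"
  have o: "arr S g" "arr S f" "source g = tob S (?W \<otimes>\<^bsub>S\<^esub> target f) vs" "source f = tobx S y as"
    "y = Tight \<longrightarrow> as \<noteq> []" "set as \<subseteq> Ob S" "set vs \<subseteq> Ob S" "set us \<subseteq> Ob S" "?W \<in> Ob S"
    using g f us by (auto simp: lmap_def)
  let ?k = "sharp S y as f ?W"
  have k: "arr S ?k" using f o by simp
  have t: "otype x (Suc (length us)) y = x" using us by (cases x) (auto simp: otype_later)
  have "lc x (us @ as @ vs) (g \<cdot>\<^bsub>S\<^esub> tar S vs ?k) =
      FF g \<cdot>\<^bsub>R\<^esub> (FF (tar S vs ?k) \<cdot>\<^bsub>R\<^esub> ph (source ?k) vs) \<cdot>\<^bsub>R\<^esub> tar R (Fs vs) (ph ?W as \<cdot>\<^bsub>R\<^esub> tar R (Fs as) ?P)"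
    using o k us by (simp add: lact_def pb_append phi_append)
  also have "\<dots> = FF g \<cdot>\<^bsub>R\<^esub> ph (?W \<otimes>\<^bsub>S\<^esub> target f) vs \<cdot>\<^bsub>R\<^esub>
      tar R (Fs vs) ((FF ?k \<cdot>\<^bsub>R\<^esub> ph ?W as) \<cdot>\<^bsub>R\<^esub> tar R (Fs as) ?P)"
    using o k us by (subst phi_natural) auto
  also have "(FF ?k \<cdot>\<^bsub>R\<^esub> ph ?W as) \<cdot>\<^bsub>R\<^esub> tar R (Fs as) ?P =
      m2 ?W (target f) \<cdot>\<^bsub>R\<^esub> sharp R y (Fs as) (lc y as f) (F ?W) \<cdot>\<^bsub>R\<^esub> tar R (Fs as) ?P"
    using lact_sharp[OF f o(9), symmetric] o f us by simp
  also have "sharp R y (Fs as) (lc y as f) (F ?W) \<cdot>\<^bsub>R\<^esub> tar R (Fs as) ?P =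
      ?P \<star>\<^bsub>R\<^esub> \<I>\<^bsub>R\<^esub> (F (target f)) \<cdot>\<^bsub>R\<^esub> sharp R y (Fs as) (lc y as f) (tobx R x (Fs us))"
    using R.sharp_natural[OF lmap_lact[OF f], of ?P] o us by simp
  finally show ?thesis
    using us o f by (simp add: t S.lsub_other R.lsub_other lact_def[of _ _ _ x] pb_append)
qed

lemma lact_loosen:
  assumes "lmap S Tight as f"
  shows "lc Loose as (loosen S Tight as f) = loosen R Tight (Fs as) (lc Tight as f)"
proof -
  obtain a xs where as: "as = a # xs" using assms by (cases as) (auto simp: lmap_def)
  let ?T = "tar R (Fs xs)" and ?i = "Unit S"
  have o: "arr S f" "source f = tob S a xs" "a \<in> Ob S" "set xs \<subseteq> Ob S"
    using assms as by (auto simp: lmap_def)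
  have "lc Loose as (loosen S Tight as f) =
      FF f \<cdot>\<^bsub>R\<^esub> (FF (tar S xs (\<Lambda>\<^bsub>S\<^esub> a)) \<cdot>\<^bsub>R\<^esub> ph (?i \<otimes>\<^bsub>S\<^esub> a) xs) \<cdot>\<^bsub>R\<^esub> ?T (m2 ?i a \<cdot>\<^bsub>R\<^esub> u0 \<star>\<^bsub>R\<^esub> \<I>\<^bsub>R\<^esub> (F a))"
    using o as by (simp add: lact_def loosen_def pb_def)
  also have "FF (tar S xs (\<Lambda>\<^bsub>S\<^esub> a)) \<cdot>\<^bsub>R\<^esub> ph (?i \<otimes>\<^bsub>S\<^esub> a) xs = ph a xs \<cdot>\<^bsub>R\<^esub> ?T (FF (\<Lambda>\<^bsub>S\<^esub> a))"
    using phi_natural[of "\<Lambda>\<^bsub>S\<^esub> a" xs] o by simp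
  also have "FF f \<cdot>\<^bsub>R\<^esub> (ph a xs \<cdot>\<^bsub>R\<^esub> ?T (FF (\<Lambda>\<^bsub>S\<^esub> a))) \<cdot>\<^bsub>R\<^esub> ?T (m2 ?i a \<cdot>\<^bsub>R\<^esub> u0 \<star>\<^bsub>R\<^esub> \<I>\<^bsub>R\<^esub> (F a)) =
      FF f \<cdot>\<^bsub>R\<^esub> ph a xs \<cdot>\<^bsub>R\<^esub> ?T (FF (\<Lambda>\<^bsub>S\<^esub> a) \<cdot>\<^bsub>R\<^esub> m2 ?i a \<cdot>\<^bsub>R\<^esub> u0 \<star>\<^bsub>R\<^esub> \<I>\<^bsub>R\<^esub> (F a))"
    using o by simp
  also have "\<dots> = FF f \<cdot>\<^bsub>R\<^esub> ph a xs \<cdot>\<^bsub>R\<^esub> ?T (\<Lambda>\<^bsub>R\<^esub> (F a))"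
    using o by (simp add: m2_lun)
  finally show ?thesis using o as by (simp add: lact_def loosen_def pb_def)
qed

end

section \<open>Morphisms of classified multicategories\<close>

definition mact :: "('o, 'm) multimor \<Rightarrow> ('o, 'm) mmap \<Rightarrow> ('o, 'm) mmap" where
  "mact F f = (kind f, map (MO F) (inputs f), MO F (out f), MM F (kind f) (inputs f) (out f) (elem f))"

lemma mact_simps [simp]: "kind (mact F f) = kind f" "inputs (mact F f) = map (MO F) (inputs f)"
  "out (mact F f) = MO F (out f)"
  by (simp_all add: mact_def)

definition mm_normalised :: "(ty \<Rightarrow> nat \<Rightarrow> bool) \<Rightarrow> ('o, 'm) multi \<Rightarrow> ('o, 'm) multimor \<Rightarrow> bool" where
  "mm_normalised ar C F \<longleftrightarrow> (\<forall>a. a \<notin> Obj C \<longrightarrow> MO F a = undefined) \<and>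
     (\<forall>x as b f. \<not> (ar x (length as) \<and> is_map C x as b f) \<longrightarrow> MM F x as b f = undefined)"

lemma map_plug: "map h (plug bs i as) = plug (map h bs) i (map h as)"
  by (simp add: plug_def take_map drop_map)

lemma (in truncated_multicategory) op_arities: "op x n i y m \<Longrightarrow> ar x n \<and> ar y m \<and> 1 \<le> i \<and> i \<le> n"
  using op_ar by blast

lemma (in truncated_multicategory) multi_morphism_iff:
  "multi_morphism ar op C D F \<longleftrightarrow>
    (\<forall>a\<in>Obj C. MO F a \<in> Obj D) \<and> (\<forall>f. mm ar C f \<longrightarrow> mm ar D (mact F f)) \<and>
    (\<forall>a\<in>Obj C. mact F (idm C a) = idm D (MO F a)) \<and>
    (\<forall>g i f. op (kind g) (length (inputs g)) i (kind f) (length (inputs f)) \<and> mm ar C g \<and> mm ar C f \<and>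
       inputs g ! (i - 1) = out f \<longrightarrow> mact F (sub C g i f) = sub D (mact F g) i (mact F f)) \<and>
    (\<forall>f. mm ar C f \<and> kind f = Tight \<and> ar Loose (length (inputs f)) \<longrightarrow> mact F (jj C f) = jj D (mact F f)) \<and>
    mm_normalised ar C F" (is "?l \<longleftrightarrow> ?r")
proof
  assume l: ?l
  have maps: "mm ar D (mact F f)" if "mm ar C f" for f
    using l that unfolding multi_morphism_def mm_def is_map_def mact_def by auto
  have subs: "mact F (sub C g i f) = sub D (mact F g) i (mact F f)"
    if op: "op (kind g) (length (inputs g)) i (kind f) (length (inputs f))" and "mm ar C g" "mm ar C f"
      "inputs g ! (i - 1) = out f" for g i f
  proof (rule mmap_eqI)
    have "is_map C (kind g) (inputs g) (out g) (elem g)"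
      "is_map C (kind f) (inputs f) (inputs g ! (i - 1)) (elem f)"
      using that by (auto simp: mm_def)
    then show "elem (mact F (sub C g i f)) = elem (sub D (mact F g) i (mact F f))"
      using l op that(4) unfolding multi_morphism_def by (simp add: mact_def sub_def)
  qed (simp_all add: map_plug)
  show ?r
    using l maps subs unfolding multi_morphism_def mm_normalised_def
    by (auto simp: mm_def idm_def jj_def mact_def)
next
  assume r: ?r
  show ?l
    unfolding multi_morphism_def
  proof (intro conjI ballI allI impI; (elim conjE)?)
    fix x as b f assume "ar x (length as)" "is_map C x as b f"
    then show "MM F x as b f \<in> Maps D x (map (MO F) as) (MO F b)"
      using r[THEN conjunct2, THEN conjunct1, rule_format, of "(x, as, b, f)"]
      by (simp add: mm_def is_map_def mact_def)
  next
    fix x bs c i y as g f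
    assume op: "op x (length bs) i y (length as)" and "is_map C x bs c g" "is_map C y as (bs ! (i - 1)) f"
    then have "mact F (sub C (x, bs, c, g) i (y, as, bs ! (i - 1), f)) =
        sub D (mact F (x, bs, c, g)) i (mact F (y, as, bs ! (i - 1), f))"
      using r op_arities[OF op] by (simp add: mm_def)
    then show "MM F (otype x i y) (plug bs i as) c (Sub C x bs c i y as g f) =
        Sub D x (map (MO F) bs) (MO F c) i y (map (MO F) as)
          (MM F x bs c g) (MM F y as (bs ! (i - 1)) f)"
      by (simp add: mact_def sub_def)
  next
    fix as b f assume "ar Tight (length as)" "ar Loose (length as)" "is_map C Tight as b f"
    then have "mact F (jj C (Tight, as, b, f)) = jj D (mact F (Tight, as, b, f))"
      using r by (simp add: mm_def)
    then show "MM F Loose as b (J C as b f) = J D (map (MO F) as) (MO F b) (MM F Tight as b f)"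
      by (simp add: mact_def jj_def)
  qed (use r in \<open>auto simp: mm_normalised_def mact_def idm_def\<close>)
qed

lemma lax_of_simps [simp]: "FO (LF (lax_of C chi D psi F)) = MO F"
  "FA (LF (lax_of C chi D psi F)) = (\<lambda>a b f. MM F Tight [a] b f)"
  by (simp_all add: lax_of_def)

locale classified_pair =
  C: classified_multicategory ar op C chi + D: classified_multicategory ar op D psi
  for ar op and C D :: "('o, 'm) multi" and chi psi
begin

abbreviation "S \<equiv> skmon_of C chi"
abbreviation "R \<equiv> skmon_of D psi"

end

locale classified_morphism = classified_pair ar op C D chi psi
  for ar op and C D :: "('o, 'm) multi" and chi psi +
  fixes F :: "('o, 'm) multimor"
  assumes morphism: "multi_morphism ar op C D F"
begin

abbreviation "\<Phi> \<equiv> lax_of C chi D psi F"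

lemma F_Obj [simp]: "a \<in> Obj C \<Longrightarrow> MO F a \<in> Obj D"
  and mm_mact [simp]: "mm ar C f \<Longrightarrow> mm ar D (mact F f)"
  and mact_idm [simp]: "a \<in> Obj C \<Longrightarrow> mact F (idm C a) = idm D (MO F a)"
  and mact_sub: "\<lbrakk>op (kind g) (length (inputs g)) i (kind f) (length (inputs f)); mm ar C g; mm ar C f;
       inputs g ! (i - 1) = out f\<rbrakk> \<Longrightarrow> mact F (sub C g i f) = sub D (mact F g) i (mact F f)"
  and mact_jj: "\<lbrakk>mm ar C f; kind f = Tight; ar Loose (length (inputs f))\<rbrakk> \<Longrightarrow> mact F (jj C f) = jj D (mact F f)"
  and F_normalised: "mm_normalised ar C F"
  using morphism unfolding C.multi_morphism_iff by blast+

lemma F_image [simp]: "set xs \<subseteq> Obj C \<Longrightarrow> MO F ` set xs \<subseteq> Obj D"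
  by auto

lemma mact_up: "mact F (up a f) = up (MO F a) (FO (LF \<Phi>) (source f), MM F Tight [a] (target f) (label f), FO (LF \<Phi>) (target f))"
  by (simp add: mact_def up_def)

lemma mact_up_fa: "source f = a \<Longrightarrow> mact F (up a f) = up (MO F a) (fa \<Phi> f)"
  by (simp add: mact_up fa_def)

lemma arr_fa: "arr S f \<Longrightarrow> arr R (fa \<Phi> f)"
  using mm_mact[of "up (source f) f"] C.mm_up[of f] D.arr_S[of "fa \<Phi> f"] mact_up_fa[of f "source f"] by simp

lemma u0_theta: "arr R (f0 S R \<Phi>)" "sub D (up (Unit R) (f0 S R \<Phi>)) (Suc 0) (skmon_null D psi) = mact F (skmon_null C chi)"
proof -
  let ?q = "mact F (skmon_null C chi)"
  have q: "mm ar D ?q" by simp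
  have b: "bij_betw (\<lambda>k. Sub D Tight [Unit R] (MO F (Unit S)) 1 Loose [] k (cnull psi))
      (Maps D Tight [Unit R] (MO F (Unit S))) (Maps D Loose [] (MO F (Unit S)))"
    using D.null_bij[of "[]" "MO F (Unit S)"] by (simp add: skmon_of_Unit[symmetric, where C = D])
  have e: "label (f0 S R \<Phi>) = (THE k. k \<in> Maps D Tight [Unit R] (MO F (Unit S)) \<and>
      Sub D Tight [Unit R] (MO F (Unit S)) 1 Loose [] k (cnull psi) = elem ?q)"
    by (simp add: f0_def lax_of_def mact_def skmon_null_def skmon_of_Unit)
  have "elem ?q \<in> Maps D Loose [] (MO F (Unit S))"
    by (rule D.mm_elem[OF q]) simp_all
  note * = THE_bij_betw[OF b this, folded e]
  show "arr R (f0 S R \<Phi>)" using *(1) by (simp add: arr_def)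
  show "sub D (up (Unit R) (f0 S R \<Phi>)) (Suc 0) (skmon_null D psi) = ?q"
    using *(2) by (intro mmap_eqI) (simp_all, simp add: sub_def up_def skmon_null_def)
qed

lemma m2_theta:
  assumes o: "a \<in> Obj C" "b \<in> Obj C"
  shows "arr R (f2 S R \<Phi> a b)"
    "sub D (up (TO R (MO F a) (MO F b)) (f2 S R \<Phi> a b)) (Suc 0) (skmon_theta D psi (MO F a) (MO F b)) =
      mact F (skmon_theta C chi a b)"
proof -
  let ?q = "mact F (skmon_theta C chi a b)" and ?s = "TO R (MO F a) (MO F b)" and ?t = "MO F (TO S a b)"
  have q: "mm ar D ?q" using o by simp
  have b: "bij_betw (\<lambda>k. Sub D Tight [?s] ?t 1 Tight [MO F a, MO F b] k (ctheta psi (MO F a) (MO F b)))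
      (Maps D Tight [?s] ?t) (Maps D Tight [MO F a, MO F b] ?t)"
    using D.theta_bij[of "MO F a" "MO F b" "[]" ?t] o by (simp add: skmon_of_TO[symmetric, where C = D])
  have e: "label (f2 S R \<Phi> a b) = (THE k. k \<in> Maps D Tight [?s] ?t \<and>
      Sub D Tight [?s] ?t 1 Tight [MO F a, MO F b] k (ctheta psi (MO F a) (MO F b)) = elem ?q)"
    using o by (simp add: f2_def lax_of_def mact_def skmon_theta_def skmon_of_TO)
  have "elem ?q \<in> Maps D Tight [MO F a, MO F b] ?t"
    by (rule D.mm_elem[OF q]) simp_all
  note * = THE_bij_betw[OF b this, folded e]
  show "arr R (f2 S R \<Phi> a b)" using *(1) o by (simp add: arr_def)
  show "sub D (up ?s (f2 S R \<Phi> a b)) (Suc 0) (skmon_theta D psi (MO F a) (MO F b)) = ?q"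
    using *(2) by (intro mmap_eqI) (simp_all, simp add: sub_def up_def skmon_theta_def)
qed

lemma functor_F: "is_functor S R (LF \<Phi>)"
  unfolding is_functor_def
proof (intro conjI ballI)
  show "category S" "category R" by (simp_all add: C.category_S D.category_S)
next
  fix a assume "a \<in> Ob S" then show "FO (LF \<Phi>) a \<in> Ob R" by simp
next
  fix a b f assume "a \<in> Ob S" "b \<in> Ob S" "f \<in> Hom S a b"
  then show "FA (LF \<Phi>) a b f \<in> Hom R (FO (LF \<Phi>) a) (FO (LF \<Phi>) b)"
    using arr_fa[of "(a, f, b)"] by (simp add: arr_def fa_def)
next
  fix a assume "a \<in> Ob S"
  then show "FA (LF \<Phi>) a a (Idn S a) = Idn R (FO (LF \<Phi>) a)"
    using mact_idm[of a] by (simp add: mact_def idm_def)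
next
  fix a b c f g assume "a \<in> Ob S" "b \<in> Ob S" "c \<in> Ob S" "f \<in> Hom S a b" "g \<in> Hom S b c"
  then have fg: "arr S (a, f, b)" "arr S (b, g, c)" by simp_all
  have "mact F (sub C (up b (b, g, c)) (Suc 0) (up a (a, f, b))) =
      sub D (mact F (up b (b, g, c))) (Suc 0) (mact F (up a (a, f, b)))"
    using C.mm_up[OF fg(1)] C.mm_up[OF fg(2)] by (intro mact_sub) simp_all
  then show "FA (LF \<Phi>) a c (Comp S a b c g f) =
      Comp R (FO (LF \<Phi>) a) (FO (LF \<Phi>) b) (FO (LF \<Phi>) c) (FA (LF \<Phi>) b c g) (FA (LF \<Phi>) a b f)"
    by (simp add: mact_def sub_def up_def)
qed

end

sublocale classified_morphism \<subseteq> L: lax_data "skmon_of C chi" "skmon_of D psi" "lax_of C chi D psi F"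
  using functor_F u0_theta(1) m2_theta(1)
  by unfold_locales (auto simp: arr_def f0_def f2_def)

context classified_morphism
begin

lemma mact_E:
  assumes "ar Tight (Suc (length xs))" "a \<in> Obj C" "set xs \<subseteq> Obj C" "arr S f" "source f = tob S a xs"
  shows "mact F (EE C chi a xs f) = EE D psi (MO F a) (map (MO F) xs) (fa \<Phi> f \<cdot>\<^bsub>R\<^esub> phi S R \<Phi> a xs)"
  using assms
proof (induction xs arbitrary: a)
  case Nil
  then show ?case by (simp add: mact_up_fa arr_fa)
next
  case (Cons x xs)
  have ar: "ar Tight (Suc (length xs))" using Cons.prems(1) C.ar_Tight_le by fastforce
  have op: "op Tight (Suc (length xs)) (Suc 0) Tight (Suc (Suc 0))"
    using C.op_binary[of "Suc (length xs)" 1] Cons.prems(1) by (simp add: numeral_2_eq_2)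
  have "mact F (EE C chi a (x # xs) f) =
      sub D (mact F (EE C chi (TO S a x) xs f)) (Suc 0) (mact F (skmon_theta C chi a x))"
    using Cons.prems ar op by (simp add: mact_sub)
  also have "mact F (EE C chi (TO S a x) xs f) = EE D psi (MO F (TO S a x)) (map (MO F) xs)
      (fa \<Phi> f \<cdot>\<^bsub>R\<^esub> phi S R \<Phi> (TO S a x) xs)"
    using Cons.IH[of "TO S a x"] Cons.prems ar by simp
  also have "mact F (skmon_theta C chi a x) = EM D psi Tight [MO F a, MO F x] (f2 S R \<Phi> a x)"
    using m2_theta(2)[of a x] Cons.prems by (simp add: EM_Tight)
  also have "sub D (EE D psi (MO F (TO S a x)) (map (MO F) xs) (fa \<Phi> f \<cdot>\<^bsub>R\<^esub> phi S R \<Phi> (TO S a x) xs)) (Suc 0)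
        (EM D psi Tight [MO F a, MO F x] (f2 S R \<Phi> a x)) =
      EM D psi Tight ([MO F a, MO F x] @ map (MO F) xs)
        ((fa \<Phi> f \<cdot>\<^bsub>R\<^esub> phi S R \<Phi> (TO S a x) xs) \<cdot>\<^bsub>R\<^esub> tar R (map (MO F) xs) (f2 S R \<Phi> a x))"
    using D.E_sub_first[of "map (MO F) xs" Tight "[MO F a, MO F x]" "f2 S R \<Phi> a x"
        "fa \<Phi> f \<cdot>\<^bsub>R\<^esub> phi S R \<Phi> (TO S a x) xs"] Cons.prems op arr_fa
    by (simp add: lmap_def m2_theta(1))
  finally show ?case using Cons.prems by (simp add: EM_Tight arr_fa)
qed

text \<open>
  A morphism of multicategories acts on maps as its lax monoidal functor acts on arrows.  It preserves
  substitution, so it suffices to know its values on classifiers, and these are \<open>f\<^sub>2\<close> and \<open>f\<^sub>0\<close> by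
  definition.
\<close>

theorem mact_EC:
  assumes "lmap S x as f" "ar x (length as)"
  shows "mact F (EM C chi x as f) = EM D psi x (map (MO F) as) (lact S R \<Phi> x as f)"
proof (cases x)
  case Tight
  then obtain a as' where "as = a # as'" using assms by (cases as) (auto simp: lmap_def)
  then show ?thesis using mact_E[of as' a f] assms Tight by (simp add: lmap_def EM_Tight lact_def pb_def)
next
  case Loose
  have op: "op Tight (Suc (length as)) (Suc 0) Loose 0"
    using C.op_nullary[of "length as" 1] assms Loose by simp
  have ar: "ar Tight (Suc (length as))" using C.ar_Loose assms Loose by simp
  have o: "arr S f" "source f = tob S (Unit S) as" "set as \<subseteq> Obj C"
    using assms Loose by (auto simp: lmap_def)
  let ?g = "fa \<Phi> f \<cdot>\<^bsub>R\<^esub> phi S R \<Phi> (Unit S) as"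
  have "mact F (EM C chi x as f) = sub D (mact F (EE C chi (Unit S) as f)) (Suc 0) (mact F (skmon_null C chi))"
    using Loose op ar o by (simp add: EM_Loose mact_sub)
  also have "mact F (EE C chi (Unit S) as f) = EE D psi (MO F (Unit S)) (map (MO F) as) ?g"
    using mact_E[OF ar] o by simp
  also have "mact F (skmon_null C chi) = EM D psi Loose [] (f0 S R \<Phi>)"
    using u0_theta(2) by (simp add: EM_Loose)
  also have "sub D (EE D psi (MO F (Unit S)) (map (MO F) as) ?g) (Suc 0) (EM D psi Loose [] (f0 S R \<Phi>)) =
      EM D psi Loose ([] @ map (MO F) as) (?g \<cdot>\<^bsub>R\<^esub> tar R (map (MO F) as) (f0 S R \<Phi>))"
    using D.E_sub_first[of "map (MO F) as" Loose "[]" "f0 S R \<Phi>" ?g] op o u0_theta(1)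
    by (simp add: lmap_def arr_fa)
  finally show ?thesis using Loose o u0_theta(1) by (simp add: lact_def pb_def arr_fa)
qed

end

context classified_morphism
begin

lemma mact_theta:
  assumes "a \<in> Obj C" "b \<in> Obj C"
  shows "mact F (skmon_theta C chi a b) = EM D psi Tight [MO F a, MO F b] (f2 S R \<Phi> a b)"
  using m2_theta(2)[OF assms] by (simp add: EM_Tight)

lemma mact_up_EC: "source f = a \<Longrightarrow> mact F (up a f) = EM D psi Tight [MO F a] (fa \<Phi> f)"
  by (simp add: mact_up_fa EM_Tight)

lemma mact_null: "mact F (skmon_null C chi) = EM D psi Loose [] (f0 S R \<Phi>)"
  using u0_theta(2) by (simp add: EM_Loose)

lemma m2_natural:
  assumes f: "arr S f" and g: "arr S g"
  shows "f2 S R \<Phi> (target f) (target g) \<cdot>\<^bsub>R\<^esub> fa \<Phi> f \<star>\<^bsub>R\<^esub> fa \<Phi> g =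
      fa \<Phi> (f \<star>\<^bsub>S\<^esub> g) \<cdot>\<^bsub>R\<^esub> f2 S R \<Phi> (source f) (source g)"
proof -
  let ?a = "source f" and ?b = "source g" and ?a' = "target f" and ?b' = "target g"
  let ?m = "f2 S R \<Phi> ?a' ?b'"
  have o: "?a \<in> Obj C" "?b \<in> Obj C" "?a' \<in> Obj C" "?b' \<in> Obj C" using f g by simp_all
  have fg: "arr R (fa \<Phi> f)" "arr R (fa \<Phi> g)" "arr R ?m" using f g o by simp_all
  have 1: "sub D (EM D psi Tight [MO F ?a', MO F ?b'] ?m) (Suc 0) (EM D psi Tight [MO F ?a] (fa \<Phi> f)) =
      EM D psi Tight [MO F ?a, MO F ?b'] (?m \<cdot>\<^bsub>R\<^esub> fa \<Phi> f \<star>\<^bsub>R\<^esub> \<I>\<^bsub>R\<^esub> (MO F ?b'))"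
    using D.EC_sub[of Tight "[]" "fa \<Phi> f" "[MO F ?b']" Tight "[MO F ?a]" ?m] o fg
    by (simp add: lmap_def lsub_def)
  have 2: "sub D (EM D psi Tight [MO F ?a, MO F ?b'] (?m \<cdot>\<^bsub>R\<^esub> fa \<Phi> f \<star>\<^bsub>R\<^esub> \<I>\<^bsub>R\<^esub> (MO F ?b'))) 2
        (EM D psi Tight [MO F ?b] (fa \<Phi> g)) =
      EM D psi Tight [MO F ?a, MO F ?b] (?m \<cdot>\<^bsub>R\<^esub> fa \<Phi> f \<star>\<^bsub>R\<^esub> fa \<Phi> g)"
    using D.EC_sub[of Tight "[MO F ?a]" "fa \<Phi> g" "[]" Tight "[MO F ?b]"
        "?m \<cdot>\<^bsub>R\<^esub> fa \<Phi> f \<star>\<^bsub>R\<^esub> \<I>\<^bsub>R\<^esub> (MO F ?b')"] o fg C.ops(3)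
    by (simp add: numeral_2_eq_2 lmap_def lsub_def sharp_def otype_later D.S.tns_cmp[symmetric])
  have "mact F (sub C (up (TO S ?a ?b) (f \<star>\<^bsub>S\<^esub> g)) (Suc 0) (skmon_theta C chi ?a ?b)) =
      EM D psi Tight [MO F ?a, MO F ?b] (fa \<Phi> (f \<star>\<^bsub>S\<^esub> g) \<cdot>\<^bsub>R\<^esub> f2 S R \<Phi> ?a ?b)"
    using mact_EC[of Tight "[?a, ?b]" "f \<star>\<^bsub>S\<^esub> g"] f g o
    by (simp add: EM_Tight lmap_def lact_def pb_Tight)
  moreover have "mact F (sub C (up (TO S ?a ?b) (f \<star>\<^bsub>S\<^esub> g)) (Suc 0) (skmon_theta C chi ?a ?b)) =
      EM D psi Tight [MO F ?a, MO F ?b] (?m \<cdot>\<^bsub>R\<^esub> fa \<Phi> f \<star>\<^bsub>R\<^esub> fa \<Phi> g)"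
    unfolding C.tns_up(2)[OF f g]
    using f g o 1 2 by (simp add: mact_sub mact_theta mact_up_EC)
  ultimately show ?thesis
    by (intro D.EC_inj[of Tight "[MO F ?a, MO F ?b]"]) (use o fg f g in \<open>simp_all add: lmap_def\<close>)
qed

lemma m2_assoc:
  assumes o: "a \<in> Obj C" "b \<in> Obj C" "c \<in> Obj C"
  shows "fa \<Phi> (\<alpha>\<^bsub>S\<^esub> a b c) \<cdot>\<^bsub>R\<^esub> f2 S R \<Phi> (TO S a b) c \<cdot>\<^bsub>R\<^esub> f2 S R \<Phi> a b \<star>\<^bsub>R\<^esub> \<I>\<^bsub>R\<^esub> (MO F c) =
      f2 S R \<Phi> a (TO S b c) \<cdot>\<^bsub>R\<^esub> \<I>\<^bsub>R\<^esub> (MO F a) \<star>\<^bsub>R\<^esub> f2 S R \<Phi> b c \<cdot>\<^bsub>R\<^esub> \<alpha>\<^bsub>R\<^esub> (MO F a) (MO F b) (MO F c)"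
proof (rule D.EC_inj[of Tight "[MO F a, MO F b, MO F c]"])
  let ?m = "f2 S R \<Phi> a (TO S b c)" and ?n = "f2 S R \<Phi> b c"
  have m: "arr R ?m" "arr R ?n" using o by simp_all
  have 1: "sub D (EM D psi Tight [MO F a, MO F (TO S b c)] ?m) 2 (EM D psi Tight [MO F b, MO F c] ?n) =
      EM D psi Tight [MO F a, MO F b, MO F c]
        (?m \<cdot>\<^bsub>R\<^esub> \<I>\<^bsub>R\<^esub> (MO F a) \<star>\<^bsub>R\<^esub> ?n \<cdot>\<^bsub>R\<^esub> \<alpha>\<^bsub>R\<^esub> (MO F a) (MO F b) (MO F c))"
    using D.EC_sub[of Tight "[MO F a]" ?n "[]" Tight "[MO F b, MO F c]" ?m] o m C.ops(9)
    by (simp add: numeral_2_eq_2 lmap_def lsub_def sharp_def otype_later)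
  have "mact F (EM C chi Tight [a, b, c] (\<alpha>\<^bsub>S\<^esub> a b c)) = EM D psi Tight [MO F a, MO F b, MO F c]
      (fa \<Phi> (\<alpha>\<^bsub>S\<^esub> a b c) \<cdot>\<^bsub>R\<^esub> f2 S R \<Phi> (TO S a b) c \<cdot>\<^bsub>R\<^esub> f2 S R \<Phi> a b \<star>\<^bsub>R\<^esub> \<I>\<^bsub>R\<^esub> (MO F c))"
    using mact_EC[of Tight "[a, b, c]" "\<alpha>\<^bsub>S\<^esub> a b c"] o by (simp add: lmap_def lact_def pb_Tight)
  moreover have "mact F (EM C chi Tight [a, b, c] (\<alpha>\<^bsub>S\<^esub> a b c)) =
      EM D psi Tight [MO F a, MO F b, MO F c]
        (?m \<cdot>\<^bsub>R\<^esub> \<I>\<^bsub>R\<^esub> (MO F a) \<star>\<^bsub>R\<^esub> ?n \<cdot>\<^bsub>R\<^esub> \<alpha>\<^bsub>R\<^esub> (MO F a) (MO F b) (MO F c))"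
    unfolding C.asr_EC[OF o] using o 1 by (simp add: mact_sub mact_theta)
  ultimately show "EM D psi Tight [MO F a, MO F b, MO F c]
      (fa \<Phi> (\<alpha>\<^bsub>S\<^esub> a b c) \<cdot>\<^bsub>R\<^esub> f2 S R \<Phi> (TO S a b) c \<cdot>\<^bsub>R\<^esub> f2 S R \<Phi> a b \<star>\<^bsub>R\<^esub> \<I>\<^bsub>R\<^esub> (MO F c)) =
      EM D psi Tight [MO F a, MO F b, MO F c]
        (?m \<cdot>\<^bsub>R\<^esub> \<I>\<^bsub>R\<^esub> (MO F a) \<star>\<^bsub>R\<^esub> ?n \<cdot>\<^bsub>R\<^esub> \<alpha>\<^bsub>R\<^esub> (MO F a) (MO F b) (MO F c))" by simp
qed (use o in \<open>simp_all add: lmap_def\<close>)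

lemma m2_lun:
  assumes o: "a \<in> Obj C"
  shows "fa \<Phi> (\<Lambda>\<^bsub>S\<^esub> a) \<cdot>\<^bsub>R\<^esub> f2 S R \<Phi> (Unit S) a \<cdot>\<^bsub>R\<^esub> f0 S R \<Phi> \<star>\<^bsub>R\<^esub> \<I>\<^bsub>R\<^esub> (MO F a) = \<Lambda>\<^bsub>R\<^esub> (MO F a)"
proof (rule D.EC_inj[of Loose "[MO F a]"])
  have "mact F (jj C (idm C a)) = EM D psi Loose [MO F a]
      (fa \<Phi> (\<Lambda>\<^bsub>S\<^esub> a) \<cdot>\<^bsub>R\<^esub> f2 S R \<Phi> (Unit S) a \<cdot>\<^bsub>R\<^esub> f0 S R \<Phi> \<star>\<^bsub>R\<^esub> \<I>\<^bsub>R\<^esub> (MO F a))"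
    using mact_EC[of Loose "[a]" "\<Lambda>\<^bsub>S\<^esub> a"] o by (simp add: C.jj_idm_EC lmap_def lact_def pb_def)
  moreover have "mact F (jj C (idm C a)) = EM D psi Loose [MO F a] (\<Lambda>\<^bsub>R\<^esub> (MO F a))"
    using o by (simp add: mact_jj D.jj_idm_EC)
  ultimately show "EM D psi Loose [MO F a]
      (fa \<Phi> (\<Lambda>\<^bsub>S\<^esub> a) \<cdot>\<^bsub>R\<^esub> f2 S R \<Phi> (Unit S) a \<cdot>\<^bsub>R\<^esub> f0 S R \<Phi> \<star>\<^bsub>R\<^esub> \<I>\<^bsub>R\<^esub> (MO F a)) =
      EM D psi Loose [MO F a] (\<Lambda>\<^bsub>R\<^esub> (MO F a))" by simp
qed (use o in \<open>simp_all add: lmap_def\<close>)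

lemma m2_run:
  assumes o: "a \<in> Obj C"
  shows "f2 S R \<Phi> a (Unit S) \<cdot>\<^bsub>R\<^esub> \<I>\<^bsub>R\<^esub> (MO F a) \<star>\<^bsub>R\<^esub> f0 S R \<Phi> \<cdot>\<^bsub>R\<^esub> \<rho>\<^bsub>R\<^esub> (MO F a) = fa \<Phi> (\<rho>\<^bsub>S\<^esub> a)"
proof (rule D.EC_inj[of Tight "[MO F a]"])
  let ?m = "f2 S R \<Phi> a (Unit S)"
  have m: "arr R ?m" using o by simp
  have 1: "sub D (EM D psi Tight [MO F a, MO F (Unit S)] ?m) 2 (EM D psi Loose [] (f0 S R \<Phi>)) =
      EM D psi Tight [MO F a] (?m \<cdot>\<^bsub>R\<^esub> \<I>\<^bsub>R\<^esub> (MO F a) \<star>\<^bsub>R\<^esub> f0 S R \<Phi> \<cdot>\<^bsub>R\<^esub> \<rho>\<^bsub>R\<^esub> (MO F a))"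
    using D.EC_sub[of Tight "[MO F a]" "f0 S R \<Phi>" "[]" Loose "[]" ?m] o m C.ops(15)
    by (simp add: numeral_2_eq_2 lmap_def lsub_def sharp_def otype_later)
  have "mact F (up a (\<rho>\<^bsub>S\<^esub> a)) = EM D psi Tight [MO F a] (fa \<Phi> (\<rho>\<^bsub>S\<^esub> a))"
    by (simp add: mact_up_fa EM_Tight)
  moreover have "mact F (up a (\<rho>\<^bsub>S\<^esub> a)) =
      EM D psi Tight [MO F a] (?m \<cdot>\<^bsub>R\<^esub> \<I>\<^bsub>R\<^esub> (MO F a) \<star>\<^bsub>R\<^esub> f0 S R \<Phi> \<cdot>\<^bsub>R\<^esub> \<rho>\<^bsub>R\<^esub> (MO F a))"
    unfolding C.run_up(1)[OF o] using o 1 by (simp add: mact_sub mact_theta mact_null)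
  ultimately show "EM D psi Tight [MO F a] (?m \<cdot>\<^bsub>R\<^esub> \<I>\<^bsub>R\<^esub> (MO F a) \<star>\<^bsub>R\<^esub> f0 S R \<Phi> \<cdot>\<^bsub>R\<^esub> \<rho>\<^bsub>R\<^esub> (MO F a)) =
      EM D psi Tight [MO F a] (fa \<Phi> (\<rho>\<^bsub>S\<^esub> a))" by simp
qed (use o in \<open>simp_all add: lmap_def\<close>)

lemma lax_functor_lax_of: "lax_functor S R \<Phi>"
  using m2_natural m2_assoc m2_lun m2_run by unfold_locales simp_all

theorem lax_monoidal_lax_of: "lax_monoidal S R \<Phi>"
proof -
  have "normalised S \<Phi>"
    using F_normalised unfolding normalised_def mm_normalised_def
    by (auto simp: lax_of_def is_map_def)
  then show ?thesis
    using lax_functor_lax_of by (simp add: lax_functor_iff C.skew_monoidal_S D.skew_monoidal_S)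
qed

end

section \<open>Fullness and faithfulness\<close>

text \<open>
  Morphisms have prescribed values off the maps, so their action on objects and maps determines them.
\<close>

lemma multimor_ext:
  assumes "mm_normalised ar C F" "mm_normalised ar C G" "\<And>a. a \<in> Obj C \<Longrightarrow> MO F a = MO G a"
    "\<And>q. mm ar C q \<Longrightarrow> mact F q = mact G q"
  shows "F = G"
proof -
  have "MM F x as b f = MM G x as b f" for x as b f
  proof (cases "ar x (length as) \<and> is_map C x as b f")
    case True
    then show ?thesis using assms(4)[of "(x, as, b, f)"] by (simp add: mm_def mact_def)
  next
    case False
    then show ?thesis using assms(1,2) unfolding mm_normalised_def by metis
  qed
  then have "MM F = MM G" by (intro ext)
  moreover have "MO F a = MO G a" for a
    using assms(1-3) unfolding mm_normalised_def by (cases "a \<in> Obj C") auto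
  then have "MO F = MO G" by (intro ext)
  ultimately show ?thesis by (cases F; cases G) simp
qed

context classified_pair
begin

lemma morphism_intro: "multi_morphism ar op C D F \<Longrightarrow> classified_morphism ar op C D chi psi F"
  by unfold_locales

theorem lax_of_faithful:
  assumes "multi_morphism ar op C D F" "multi_morphism ar op C D G"
    "lax_of C chi D psi F = lax_of C chi D psi G"
  shows "F = G"
proof -
  interpret F: classified_morphism ar op C D chi psi F using assms(1) by (rule morphism_intro)
  interpret G: classified_morphism ar op C D chi psi G using assms(2) by (rule morphism_intro)
  have MO: "MO F = MO G" using arg_cong[OF assms(3), of "\<lambda>\<Phi>. FO (LF \<Phi>)"] by simp
  show ?thesis
  proof (rule multimor_ext[OF F.F_normalised G.F_normalised])
    show "MO F a = MO G a" for a using MO by simp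
    fix q assume q: "mm ar C q"
    then obtain f where f: "lmap S (kind q) (inputs q) f" "q = EM C chi (kind q) (inputs q) f"
      by (metis C.EC_surj)
    have "ar (kind q) (length (inputs q))" using q by (simp add: mm_def)
    then show "mact F q = mact G q"
      using F.mact_EC[OF f(1)] G.mact_EC[OF f(1)] f(2) MO assms(3) by metis
  qed
qed

definition EC_inv :: "('o, 'm) mmap \<Rightarrow> ('o, 'm) arrow" where
  "EC_inv q = (SOME f. lmap S (kind q) (inputs q) f \<and> q = EM C chi (kind q) (inputs q) f)"

lemma EC_inv:
  assumes "lmap S x as f" "ar x (length as)"
  shows "EC_inv (EM C chi x as f) = f"
proof -
  have a: "x = Tight \<longrightarrow> as \<noteq> []" using assms by (simp add: lmap_def)
  let ?P = "\<lambda>h. lmap S x as h \<and> EM C chi x as f = EM C chi x as h"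
  have "EC_inv (EM C chi x as f) = (SOME h. ?P h)"
    unfolding EC_inv_def EM_simps(1) EM_simps(2)[OF a] ..
  moreover have "?P (SOME h. ?P h)" by (rule someI[of ?P f]) (use assms in simp)
  ultimately have "?P (EC_inv (EM C chi x as f))" by simp
  then show ?thesis using C.EC_inj[of x as f] assms by metis
qed

text \<open>
  The default value off the maps is the one that the definition of a morphism prescribes.
\<close>

definition multi_of_lax :: "('o, 'm) laxmor \<Rightarrow> ('o, 'm) multimor" where
  "multi_of_lax \<Phi> =
     \<lparr> MO = FO (LF \<Phi>),
       MM = (\<lambda>x as b f. if ar x (length as) \<and> is_map C x as b f
               then elem (EM D psi x (map (FO (LF \<Phi>)) as) (lact S R \<Phi> x as (EC_inv (x, as, b, f))))
               else undefined) \<rparr>"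

lemma multi_of_lax_EC:
  assumes "lax_functor S R \<Phi>" "lmap S x as f" "ar x (length as)"
  shows "mact (multi_of_lax \<Phi>) (EM C chi x as f) = EM D psi x (map (FO (LF \<Phi>)) as) (lact S R \<Phi> x as f)"
proof -
  have a: "x = Tight \<longrightarrow> as \<noteq> []" using assms by (simp add: lmap_def)
  have q: "mm ar C (EM C chi x as f)" using assms by simp
  have "(x, as, target f, elem (EM C chi x as f)) = EM C chi x as f"
    using a by (intro mmap_eqI) simp_all
  then show ?thesis
    using q a EC_inv[OF assms(2,3)] by (intro mmap_eqI) (simp_all add: mact_def multi_of_lax_def mm_def)
qed

text \<open>
  Under the dictionary the laws to be checked are \<open>lact_lsub\<close> and \<open>lact_loosen\<close>.
\<close>

theorem multi_morphism_multi_of_lax: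
  assumes l: "lax_monoidal S R \<Phi>"
  shows "multi_morphism ar op C D (multi_of_lax \<Phi>)"
proof -
  have l': "lax_functor S R \<Phi>" "normalised S \<Phi>"
    using l by (simp_all add: lax_functor_iff C.skew_monoidal_S D.skew_monoidal_S)
  interpret lax_functor S R \<Phi> by (rule l')
  let ?F = "multi_of_lax \<Phi>"
  note EC = multi_of_lax_EC[OF l'(1)]
  have MO: "MO ?F = FO (LF \<Phi>)" by (simp add: multi_of_lax_def)
  show ?thesis
    unfolding C.multi_morphism_iff
  proof (intro conjI ballI allI impI; (elim conjE)?)
    fix a assume a: "a \<in> Obj C"
    then show "MO ?F a \<in> Obj D" using F_ob[of a] MO by simp
    show "mact ?F (idm C a) = idm D (MO ?F a)"
      using EC[of Tight "[a]" "\<I>\<^bsub>S\<^esub> a"] a F_ob[of a] by (simp add: C.idm_EC D.idm_EC MO lmap_def lact_def pb_Tight)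
  next
    fix q assume q: "mm ar C q"
    then obtain f where f: "lmap S (kind q) (inputs q) f" "q = EM C chi (kind q) (inputs q) f"
      by (metis C.EC_surj)
    have ar: "ar (kind q) (length (inputs q))" using q by (simp add: mm_def)
    show "mm ar D (mact ?F q)"
      by (subst f(2), subst EC[OF f(1) ar]) (use f ar in simp)
  next
    fix g i f
    assume op: "op (kind g) (length (inputs g)) i (kind f) (length (inputs f))"
      and g: "mm ar C g" and f: "mm ar C f" and nth: "inputs g ! (i - 1) = out f"
    obtain us b vs where us: "inputs g = us @ b # vs" "i = Suc (length us)"
      using C.op_arities[OF op] by (metis split_list_at)
    then have b: "b = out f" using nth by simp
    obtain g' where g': "lmap S (kind g) (inputs g) g'" "g = EM C chi (kind g) (inputs g) g'"
      using g by (metis C.EC_surj)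
    obtain f' where f': "lmap S (kind f) (inputs f) f'" "f = EM C chi (kind f) (inputs f) f'" "target f' = out f"
      using f by (metis C.EC_surj)
    let ?x = "kind g" and ?y = "kind f" and ?as = "inputs f"
    have ins: "inputs g = us @ target f' # vs" using us b f'(3) by simp
    have ar: "ar ?x (length (inputs g))" "ar ?y (length ?as)" "ar (otype ?x i ?y) (length (us @ ?as @ vs))"
      using C.op_ar[OF op] us by (auto simp: ac_simps)
    have lg: "lmap S ?x (us @ target f' # vs) g'" using g' ins by simp
    have "sub C g i f = EM C chi (otype ?x i ?y) (us @ ?as @ vs) (lsub S ?x us vs ?y ?as g' f')"
      using C.EC_sub[of ?x us f' vs ?y ?as g'] op us g' f' lg ins by metis
    then have "mact ?F (sub C g i f) = EM D psi (otype ?x i ?y) (Fs (us @ ?as @ vs))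
        (lc (otype ?x i ?y) (us @ ?as @ vs) (lsub S ?x us vs ?y ?as g' f'))"
      using EC[of "otype ?x i ?y" "us @ ?as @ vs"] C.S.lmap_lsub[OF lg f'(1)] ar us(2) by simp
    also have "\<dots> = EM D psi (otype ?x i ?y) (Fs us @ Fs ?as @ Fs vs)
        (lsub R ?x (Fs us) (Fs vs) ?y (Fs ?as) (lc ?x (inputs g) g') (lc ?y ?as f'))"
      using lact_lsub[OF lg f'(1)] us(2) ins by simp
    also have "\<dots> = sub D (EM D psi ?x (Fs (inputs g)) (lc ?x (inputs g) g')) i (EM D psi ?y (Fs ?as) (lc ?y ?as f'))"
      using D.EC_sub[of ?x "Fs us" "lc ?y ?as f'" "Fs vs" ?y "Fs ?as" "lc ?x (inputs g) g'"]
        lmap_lact[OF g'(1)] lmap_lact[OF f'(1)] op us(2) ins by simp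
    also have "\<dots> = sub D (mact ?F g) i (mact ?F f)"
      using EC[OF g'(1) ar(1)] EC[OF f'(1) ar(2)] g'(2) f'(2) by simp
    finally show "mact ?F (sub C g i f) = sub D (mact ?F g) i (mact ?F f)" .
  next
    fix q assume q: "mm ar C q" "kind q = Tight" "ar Loose (length (inputs q))"
    then obtain f where f: "lmap S Tight (inputs q) f" "q = EM C chi Tight (inputs q) f"
      by (metis C.EC_surj)
    have ar: "ar Tight (length (inputs q))" using q by (simp add: mm_def)
    have "jj C q = EM C chi Loose (inputs q) (loosen S Tight (inputs q) f)"
      using C.EC_jj[OF f(1) q(3)] f(2) by simp
    then have "mact ?F (jj C q) = EM D psi Loose (Fs (inputs q)) (loosen R Tight (Fs (inputs q)) (lc Tight (inputs q) f))"
      using EC[OF C.S.lmap_loosen[OF f(1)] q(3)] lact_loosen[OF f(1)] by simp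
    also have "\<dots> = jj D (EM D psi Tight (Fs (inputs q)) (lc Tight (inputs q) f))"
      using D.EC_jj[OF lmap_lact[OF f(1)]] q(3) by simp
    finally show "mact ?F (jj C q) = jj D (mact ?F q)"
      using EC[OF f(1) ar] f(2) by simp
  next
    show "mm_normalised ar C ?F"
      using l'(2) by (simp add: mm_normalised_def normalised_def multi_of_lax_def)
  qed
qed

theorem lax_of_full:
  assumes l: "lax_monoidal S R \<Phi>"
  shows "lax_of C chi D psi (multi_of_lax \<Phi>) = \<Phi>"
proof -
  let ?F = "multi_of_lax \<Phi>"
  have l': "lax_functor S R \<Phi>" "normalised S \<Phi>"
    using l by (simp_all add: lax_functor_iff C.skew_monoidal_S D.skew_monoidal_S)
  interpret lax_functor S R \<Phi> by (rule l')
  interpret M: classified_morphism ar op C D chi psi ?F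
    using multi_morphism_multi_of_lax[OF l] by (rule morphism_intro)
  note EC = multi_of_lax_EC[OF l'(1)]
  let ?P = "lax_of C chi D psi ?F"
  have MO: "MO ?F = FO (LF \<Phi>)" by (simp add: multi_of_lax_def)
  have fo: "FO (LF ?P) = FO (LF \<Phi>)" by (simp add: MO)
  have "FA (LF ?P) a b f = FA (LF \<Phi>) a b f" for a b f
  proof (cases "a \<in> Obj C \<and> b \<in> Obj C \<and> f \<in> Maps C Tight [a] b")
    case True
    then have a: "arr S (a, f, b)" by simp
    have "fa ?P (a, f, b) = fa \<Phi> (a, f, b)"
    proof (rule D.EC_inj[of Tight "[F a]"])
      show "EM D psi Tight [F a] (fa ?P (a, f, b)) = EM D psi Tight [F a] (fa \<Phi> (a, f, b))"
        using EC[of Tight "[a]" "(a, f, b)"] M.mact_EC[of Tight "[a]" "(a, f, b)"] True MO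
          arr_FF[OF a] M.L.arr_FF[OF a] F_ob[of a] M.L.F_ob[of a]
        by (simp add: lmap_def lact_def pb_Tight)
    qed (use arr_FF[OF a] M.L.arr_FF[OF a] F_ob[of a] True MO in \<open>simp_all add: lmap_def\<close>)
    then show ?thesis by (simp add: fa_def)
  next
    case False
    then show ?thesis using l'(2) M.F_normalised
      by (auto simp: normalised_def mm_normalised_def is_map_def)
  qed
  moreover have "L0 ?P = L0 \<Phi>"
  proof -
    have "f0 S R ?P = f0 S R \<Phi>"
    proof (rule D.EC_inj[of Loose "[]"])
      show "EM D psi Loose [] (f0 S R ?P) = EM D psi Loose [] (f0 S R \<Phi>)"
        using EC[of Loose "[]" "\<I>\<^bsub>S\<^esub> (Unit S)"] M.mact_null C.uu_EC arr_u0
        by (simp add: lmap_def lact_def pb_def MO)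
    qed (use arr_u0 M.L.arr_u0 in \<open>simp_all add: lmap_def\<close>)
    then show ?thesis by (simp add: f0_def)
  qed
  moreover have "L2 ?P a b = L2 \<Phi> a b" for a b
  proof (cases "a \<in> Obj C \<and> b \<in> Obj C")
    case True
    have "f2 S R ?P a b = f2 S R \<Phi> a b"
    proof (rule D.EC_inj[of Tight "[F a, F b]"])
      show "EM D psi Tight [F a, F b] (f2 S R ?P a b) = EM D psi Tight [F a, F b] (f2 S R \<Phi> a b)"
        using EC[of Tight "[a, b]" "\<I>\<^bsub>S\<^esub> (TO S a b)"] M.mact_theta[of a b] C.theta_EC[of a b] True
          arr_m2[of a b] F_ob[of a] F_ob[of b] F_ob[of "TO S a b"]
        by (simp add: lmap_def lact_def pb_Tight MO)
    qed (use True arr_m2[of a b] M.L.arr_m2[of a b] F_ob[of a] F_ob[of b] MO in \<open>simp_all add: lmap_def\<close>)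
    then show ?thesis by (simp add: f2_def)
  next
    case False
    then show ?thesis using l'(2) by (auto simp: normalised_def lax_of_def)
  qed
  ultimately have "FA (LF ?P) = FA (LF \<Phi>)" "L0 ?P = L0 \<Phi>" "L2 ?P = L2 \<Phi>"
    by (blast intro: ext)+
  then have "LF ?P = LF \<Phi>" using fo by (cases "LF ?P"; cases "LF \<Phi>") simp
  then show ?thesis using \<open>L0 ?P = L0 \<Phi>\<close> \<open>L2 ?P = L2 \<Phi>\<close> by (cases ?P; cases \<Phi>) simp
qed

end

section \<open>Equivalences\<close>

text \<open>
  A functor with this property is an equivalence; unlike a quasi-inverse, the property is easily
  checked and passed along the triangle of functors.
\<close>

definition fully_faithful_eso ::
  "('o, 'm, 'y) cat_scheme \<Rightarrow> ('p, 'n, 'z) cat_scheme \<Rightarrow> ('o, 'm, 'p, 'n) fctr \<Rightarrow> bool" where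
  "fully_faithful_eso C D F \<longleftrightarrow> is_functor C D F \<and>
     (\<forall>a\<in>Ob C. \<forall>b\<in>Ob C. bij_betw (FA F a b) (Hom C a b) (Hom D (FO F a) (FO F b))) \<and>
     (\<forall>d\<in>Ob D. \<exists>a\<in>Ob C. \<exists>e. iso_in D (FO F a) d e)"

definition invs :: "('o, 'm, 'z) cat_scheme \<Rightarrow> ('o, 'm) arrow \<Rightarrow> ('o, 'm) arrow \<Rightarrow> bool" where
  "invs C f g \<longleftrightarrow> arr C f \<and> arr C g \<and> source g = target f \<and> target g = source f \<and>
     cmp C g f = idar C (source f) \<and> cmp C f g = idar C (target f)"

lemma iso_in_invs:
  assumes "a \<in> Ob C" "b \<in> Ob C"
  shows "iso_in C a b f \<longleftrightarrow> (\<exists>g. invs C (a, f, b) g)"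
proof
  assume "iso_in C a b f"
  then obtain g where "f \<in> Hom C a b" "g \<in> Hom C b a" "Comp C a b a g f = Idn C a" "Comp C b a b f g = Idn C b"
    by (auto simp: iso_in_def)
  then have "invs C (a, f, b) (b, g, a)" using assms by (simp add: invs_def cmp_def idar_def)
  then show "\<exists>g. invs C (a, f, b) g" ..
next
  assume "\<exists>g. invs C (a, f, b) g"
  then obtain g where "invs C (a, f, b) g" ..
  then show "iso_in C a b f"
    by (cases g) (auto simp: invs_def cmp_def idar_def iso_in_def)
qed

lemma (in cat_laws) invs_cmp:
  assumes "invs C f f'" "invs C g g'" "target f = source g"
  shows "invs C (g \<cdot> f) (f' \<cdot> g')"
proof -
  have a: "arr C f" "arr C f'" "arr C g" "arr C g'" and
    s: "source f' = target f" "target f' = source f" "source g' = target g" "target g' = source g"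
    and e: "f' \<cdot> f = \<I> (source f)" "f \<cdot> f' = \<I> (target f)" "g' \<cdot> g = \<I> (source g)" "g \<cdot> g' = \<I> (target g)"
    using assms by (auto simp: invs_def)
  have "(f' \<cdot> g') \<cdot> g \<cdot> f = f' \<cdot> (g' \<cdot> g) \<cdot> f" using a s assms(3) by simp
  moreover have "(g \<cdot> f) \<cdot> f' \<cdot> g' = g \<cdot> (f \<cdot> f') \<cdot> g'" using a s assms(3) by simp
  ultimately show ?thesis using a s e assms(3) by (simp add: invs_def)
qed

definition fmap :: "('o, 'm, 'p, 'n) fctr \<Rightarrow> ('o, 'm) arrow \<Rightarrow> ('p, 'n) arrow" where
  "fmap F f = (FO F (source f), FA F (source f) (target f) (label f), FO F (target f))"

lemma fmap_simps [simp]: "source (fmap F f) = FO F (source f)" "target (fmap F f) = FO F (target f)"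
  by (simp_all add: fmap_def)

lemma is_functor_iff: "is_functor C D F \<longleftrightarrow> category C \<and> category D \<and> (\<forall>a\<in>Ob C. FO F a \<in> Ob D) \<and>
    (\<forall>f. arr C f \<longrightarrow> arr D (fmap F f)) \<and> (\<forall>a\<in>Ob C. fmap F (idar C a) = idar D (FO F a)) \<and>
    (\<forall>f g. arr C f \<longrightarrow> arr C g \<longrightarrow> target f = source g \<longrightarrow> fmap F (cmp C g f) = cmp D (fmap F g) (fmap F f))"
    (is "?l \<longleftrightarrow> ?r")
proof
  show "?l \<Longrightarrow> ?r" unfolding is_functor_def fmap_def arr_def cmp_def idar_def by auto
  assume r: ?r
  have "FA F a c (Comp C a b c g f) = Comp D (FO F a) (FO F b) (FO F c) (FA F b c g) (FA F a b f)"
    if "a \<in> Ob C" "b \<in> Ob C" "c \<in> Ob C" "f \<in> Hom C a b" "g \<in> Hom C b c" for a b c f g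
  proof -
    have "fmap F (cmp C (b, g, c) (a, f, b)) = cmp D (fmap F (b, g, c)) (fmap F (a, f, b))"
      using r that by simp
    then show ?thesis by (simp add: fmap_def cmp_def)
  qed
  moreover have "FA F a b f \<in> Hom D (FO F a) (FO F b)" if "a \<in> Ob C" "b \<in> Ob C" "f \<in> Hom C a b" for a b f
  proof -
    have "arr D (fmap F (a, f, b))" using r that by simp
    then show ?thesis by (simp add: fmap_def)
  qed
  ultimately show ?l using r unfolding is_functor_def by (simp add: fmap_def idar_def)
qed

locale functor_laws = C: cat_laws C + D: cat_laws D
  for C :: "('o, 'm, 'y) cat_scheme" and D :: "('p, 'n, 'z) cat_scheme" +
  fixes F :: "('o, 'm, 'p, 'n) fctr"
  assumes is_functor: "is_functor C D F"
begin

lemma FO_ob [simp]: "a \<in> Ob C \<Longrightarrow> FO F a \<in> Ob D"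
  and arr_fmap [simp]: "arr C f \<Longrightarrow> arr D (fmap F f)"
  and fmap_idar [simp]: "a \<in> Ob C \<Longrightarrow> fmap F (idar C a) = idar D (FO F a)"
  and fmap_cmp [simp]: "\<lbrakk>arr C f; arr C g; target f = source g\<rbrakk> \<Longrightarrow> fmap F (cmp C g f) = cmp D (fmap F g) (fmap F f)"
  using is_functor unfolding is_functor_iff by blast+

end

lemma functor_laws_iff: "functor_laws C D F \<longleftrightarrow> is_functor C D F"
  unfolding functor_laws_def functor_laws_axioms_def cat_laws_def is_functor_def by blast

lemma fully_faithful_esoD:
  assumes "fully_faithful_eso C D F"
  shows "is_functor C D F"
    and "\<lbrakk>arr C f; arr C g; source f = source g; target f = target g; fmap F f = fmap F g\<rbrakk> \<Longrightarrow> f = g"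
    and "\<lbrakk>a \<in> Ob C; b \<in> Ob C; arr D h; source h = FO F a; target h = FO F b\<rbrakk> \<Longrightarrow>
      \<exists>f. arr C f \<and> source f = a \<and> target f = b \<and> fmap F f = h"
    and "d \<in> Ob D \<Longrightarrow> \<exists>a e e'. a \<in> Ob C \<and> source e = FO F a \<and> target e = d \<and> invs D e e'"
proof -
  show func: "is_functor C D F" using assms by (simp add: fully_faithful_eso_def)
  have bij: "\<And>a b. a \<in> Ob C \<Longrightarrow> b \<in> Ob C \<Longrightarrow> bij_betw (FA F a b) (Hom C a b) (Hom D (FO F a) (FO F b))"
    using assms by (simp add: fully_faithful_eso_def)
  show "f = g" if "arr C f" "arr C g" "source f = source g" "target f = target g" "fmap F f = fmap F g"
  proof -
    have "inj_on (FA F (source f) (target f)) (Hom C (source f) (target f))"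
      using bij[of "source f" "target f"] that by (simp add: arr_def bij_betw_def del: arr_source arr_target)
    then have "label f = label g"
      by (rule inj_onD) (use that in \<open>simp_all add: arr_def fmap_def del: arr_source arr_target\<close>)
    then show ?thesis using that by (simp add: prod_eq_iff)
  qed
  show "\<exists>f. arr C f \<and> source f = a \<and> target f = b \<and> fmap F f = h"
    if "a \<in> Ob C" "b \<in> Ob C" "arr D h" "source h = FO F a" "target h = FO F b"
  proof -
    have "label h \<in> FA F a b ` Hom C a b"
      using bij[OF that(1,2)] that by (simp add: arr_def bij_betw_def del: arr_source arr_target)
    then obtain m where "m \<in> Hom C a b" "label h = FA F a b m" by blast
    then show ?thesis using that by (intro exI[of _ "(a, m, b)"]) (simp add: fmap_def prod_eq_iff)
  qed
  show "\<exists>a e e'. a \<in> Ob C \<and> source e = FO F a \<and> target e = d \<and> invs D e e'" if d: "d \<in> Ob D"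
  proof -
    obtain a e where a: "a \<in> Ob C" and e: "iso_in D (FO F a) d e"
      using assms d by (auto simp: fully_faithful_eso_def)
    have "FO F a \<in> Ob D" using func a by (simp add: is_functor_def)
    then obtain e' where "invs D (FO F a, e, d) e'" using e d iso_in_invs by metis
    then show ?thesis using a by (intro exI[of _ a] exI[of _ "(FO F a, e, d)"] exI[of _ e']) simp
  qed
qed

lemma iso_inI:
  assumes "invs C f g" "source f = a" "target f = b" "label f = m"
  shows "iso_in C a b m"
proof -
  have f: "f = (a, m, b)" using assms by (simp add: prod_eq_iff)
  have "a \<in> Ob C" "b \<in> Ob C" using assms by (auto simp: invs_def)
  then show ?thesis using assms(1) unfolding f by (blast intro: iso_in_invs[THEN iffD2])
qed

text \<open>
  A quasi-inverse is obtained by choosing for every object of \<open>D\<close> a preimage up to isomorphism, and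
  lifting along \<open>F\<close> the arrows conjugated by these isomorphisms.
\<close>

theorem fully_faithful_eso_equivalence:
  assumes "fully_faithful_eso C D F"
  shows "is_equivalence C D F"
proof -
  note F = fully_faithful_esoD[OF assms]
  interpret functor_laws C D F using F(1) by (simp add: functor_laws_iff)
  have "\<forall>d. \<exists>a e e'. d \<in> Ob D \<longrightarrow> a \<in> Ob C \<and> source e = FO F a \<and> target e = d \<and> invs D e e'"
    using F(4) by blast
  then obtain g e e' where g: "\<And>d. d \<in> Ob D \<Longrightarrow> g d \<in> Ob C"
    and e: "\<And>d. d \<in> Ob D \<Longrightarrow> source (e d) = FO F (g d)" "\<And>d. d \<in> Ob D \<Longrightarrow> target (e d) = d"
      "\<And>d. d \<in> Ob D \<Longrightarrow> invs D (e d) (e' d)"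
    unfolding choice_iff by metis
  have ae: "arr D (e d)" "arr D (e' d)" "source (e' d) = d" "target (e' d) = FO F (g d)"
    "e' d \<cdot>\<^bsub>D\<^esub> e d = \<I>\<^bsub>D\<^esub> (FO F (g d))" "e d \<cdot>\<^bsub>D\<^esub> e' d = \<I>\<^bsub>D\<^esub> d" if "d \<in> Ob D" for d
    using e(1,2)[OF that] e(3)[OF that] by (auto simp: invs_def)
  define G1 where "G1 h = (SOME f. arr C f \<and> source f = g (source h) \<and> target f = g (target h) \<and>
      fmap F f = e' (target h) \<cdot>\<^bsub>D\<^esub> h \<cdot>\<^bsub>D\<^esub> e (source h))" for h
  have G1: "arr C (G1 h)" "source (G1 h) = g (source h)" "target (G1 h) = g (target h)"
      "fmap F (G1 h) = e' (target h) \<cdot>\<^bsub>D\<^esub> h \<cdot>\<^bsub>D\<^esub> e (source h)" if h: "arr D h" for h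
  proof -
    have "\<exists>f. arr C f \<and> source f = g (source h) \<and> target f = g (target h) \<and>
      fmap F f = e' (target h) \<cdot>\<^bsub>D\<^esub> h \<cdot>\<^bsub>D\<^esub> e (source h)"
      using h g e ae by (intro F(3)) auto
    from someI_ex[OF this] show "arr C (G1 h)" "source (G1 h) = g (source h)" "target (G1 h) = g (target h)"
      "fmap F (G1 h) = e' (target h) \<cdot>\<^bsub>D\<^esub> h \<cdot>\<^bsub>D\<^esub> e (source h)"
      unfolding G1_def by auto
  qed
  define G where "G = \<lparr> FO = g, FA = (\<lambda>a b m. label (G1 (a, m, b))) \<rparr>"
  have FOG [simp]: "FO G = g" by (simp add: G_def)
  have G: "fmap G h = G1 h" if "arr D h" for h
    using G1[OF that] by (simp add: fmap_def G_def prod_eq_iff)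
  have GF: "is_functor D C G"
    unfolding is_functor_iff
  proof (intro conjI ballI allI impI)
    show "category D" "category C" by (rule D.category C.category)+
    show "\<And>d. d \<in> Ob D \<Longrightarrow> FO G d \<in> Ob C" using g by simp
    show "\<And>h. arr D h \<Longrightarrow> arr C (fmap G h)" using G G1 by simp
    fix d assume d: "d \<in> Ob D"
    show "fmap G (\<I>\<^bsub>D\<^esub> d) = \<I>\<^bsub>C\<^esub> (FO G d)"
      using d g G1[of "\<I>\<^bsub>D\<^esub> d"] e ae[OF d] by (intro F(2)) (auto simp: G)
  next
    fix h k assume a: "arr D h" "arr D k" "target h = source k"
    have "fmap F (G1 k) \<cdot>\<^bsub>D\<^esub> fmap F (G1 h) =
        e' (target k) \<cdot>\<^bsub>D\<^esub> k \<cdot>\<^bsub>D\<^esub> (e (source k) \<cdot>\<^bsub>D\<^esub> e' (source k)) \<cdot>\<^bsub>D\<^esub> h \<cdot>\<^bsub>D\<^esub> e (source h)"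
      using a e(1,2) ae(1-4) by (simp add: G1)
    also have "e (source k) \<cdot>\<^bsub>D\<^esub> e' (source k) = \<I>\<^bsub>D\<^esub> (source k)"
      using a ae by simp
    also have "e' (target k) \<cdot>\<^bsub>D\<^esub> k \<cdot>\<^bsub>D\<^esub> \<I>\<^bsub>D\<^esub> (source k) \<cdot>\<^bsub>D\<^esub> h \<cdot>\<^bsub>D\<^esub> e (source h) = fmap F (G1 (k \<cdot>\<^bsub>D\<^esub> h))"
      using a e ae by (simp add: G1)
    finally have eq: "fmap F (G1 k) \<cdot>\<^bsub>D\<^esub> fmap F (G1 h) = fmap F (G1 (k \<cdot>\<^bsub>D\<^esub> h))" .
    have kh: "arr D (k \<cdot>\<^bsub>D\<^esub> h)" using a by simp
    have "fmap F (G1 (k \<cdot>\<^bsub>D\<^esub> h)) = fmap F (G1 k \<cdot>\<^bsub>C\<^esub> G1 h)"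
      using eq G1(1-3)[OF a(1)] G1(1-3)[OF a(2)] a(3) by simp
    then have "G1 (k \<cdot>\<^bsub>D\<^esub> h) = G1 k \<cdot>\<^bsub>C\<^esub> G1 h"
      using G1(1-3)[OF a(1)] G1(1-3)[OF a(2)] G1(1-3)[OF kh] a(3) by (intro F(2)) auto
    then show "fmap G (k \<cdot>\<^bsub>D\<^esub> h) = fmap G k \<cdot>\<^bsub>C\<^esub> fmap G h"
      using a kh by (simp add: G)
  qed
  \<comment> \<open>components of the unit, and their inverses\<close>
  define H where "H a = (SOME f. arr C f \<and> source f = a \<and> target f = g (FO F a) \<and> fmap F f = e' (FO F a))" for a
  define H' where "H' a = (SOME f. arr C f \<and> source f = g (FO F a) \<and> target f = a \<and> fmap F f = e (FO F a))" for a
  have H: "arr C (H a)" "source (H a) = a" "target (H a) = g (FO F a)" "fmap F (H a) = e' (FO F a)"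
    and H': "arr C (H' a)" "source (H' a) = g (FO F a)" "target (H' a) = a" "fmap F (H' a) = e (FO F a)"
    if a: "a \<in> Ob C" for a
  proof -
    have o: "FO F a \<in> Ob D" using a by simp
    have "\<exists>f. arr C f \<and> source f = a \<and> target f = g (FO F a) \<and> fmap F f = e' (FO F a)"
      using a g[OF o] ae[OF o] by (intro F(3)) auto
    from someI_ex[OF this] show "arr C (H a)" "source (H a) = a" "target (H a) = g (FO F a)" "fmap F (H a) = e' (FO F a)"
      unfolding H_def by auto
    have "\<exists>f. arr C f \<and> source f = g (FO F a) \<and> target f = a \<and> fmap F f = e (FO F a)"
      using a g[OF o] ae[OF o] e[OF o] by (intro F(3)) auto
    from someI_ex[OF this] show "arr C (H' a)" "source (H' a) = g (FO F a)" "target (H' a) = a" "fmap F (H' a) = e (FO F a)"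
      unfolding H'_def by auto
  qed
  have "nat_iso C C id_fctr (comp_fctr G F) (\<lambda>a. label (H a))"
    unfolding nat_iso_def nat_trans_def
  proof (intro conjI ballI)
    fix a assume a: "a \<in> Ob C"
    note o = FO_ob[OF a]
    show "label (H a) \<in> Hom C (FO id_fctr a) (FO (comp_fctr G F) a)"
      using H[OF a] by (simp add: id_fctr_def comp_fctr_def arr_def del: arr_source arr_target)
    have "H' a \<cdot>\<^bsub>C\<^esub> H a = \<I>\<^bsub>C\<^esub> a" using H[OF a] H'[OF a] a ae[OF o] by (intro F(2)) auto
    moreover have "H a \<cdot>\<^bsub>C\<^esub> H' a = \<I>\<^bsub>C\<^esub> (g (FO F a))"
      using H[OF a] H'[OF a] a ae[OF o] g[OF o] by (intro F(2)) auto
    ultimately have "invs C (H a) (H' a)" using H[OF a] H'[OF a] by (simp add: invs_def)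
    then show "iso_in C (FO id_fctr a) (FO (comp_fctr G F) a) (label (H a))"
      using H[OF a] by (auto intro: iso_inI simp: id_fctr_def comp_fctr_def)
  next
    fix a b f assume a: "a \<in> Ob C" and b: "b \<in> Ob C" and f: "f \<in> Hom C a b"
    let ?f = "(a, f, b)"
    have af: "arr C ?f" using a b f by simp
    have "fmap F (H b \<cdot>\<^bsub>C\<^esub> ?f) = e' (FO F b) \<cdot>\<^bsub>D\<^esub> fmap F ?f \<cdot>\<^bsub>D\<^esub> (e (FO F a) \<cdot>\<^bsub>D\<^esub> e' (FO F a))"
      using H[OF a] H[OF b] a b af ae[OF FO_ob[OF a]] arr_fmap[OF af] by simp
    also have "\<dots> = fmap F (G1 (fmap F ?f) \<cdot>\<^bsub>C\<^esub> H a)"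
      using H[OF a] H[OF b] a b af ae[OF FO_ob[OF a]] e[OF FO_ob[OF a]] e[OF FO_ob[OF b]] ae[OF FO_ob[OF b]] arr_fmap[OF af] G1[OF arr_fmap[OF af]] by simp
    finally have "H b \<cdot>\<^bsub>C\<^esub> ?f = G1 (fmap F ?f) \<cdot>\<^bsub>C\<^esub> H a"
      using H[OF a] H[OF b] a b af G1[OF arr_fmap[OF af]] by (intro F(2)) auto
    from arg_cong[OF this, of label] show "Comp C (FO id_fctr a) (FO id_fctr b) (FO (comp_fctr G F) b) (label (H b)) (FA id_fctr a b f) =
        Comp C (FO id_fctr a) (FO (comp_fctr G F) a) (FO (comp_fctr G F) b) (FA (comp_fctr G F) a b f) (label (H a))"
      using H(2,3)[OF a] H(2,3)[OF b] G1(2,3)[OF arr_fmap[OF af]]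
      by (simp add: id_fctr_def comp_fctr_def cmp_def G_def fmap_def)
  qed
  moreover have "nat_iso D D (comp_fctr F G) id_fctr (\<lambda>d. label (e d))"
    unfolding nat_iso_def nat_trans_def
  proof (intro conjI ballI)
    fix d assume d: "d \<in> Ob D"
    show "label (e d) \<in> Hom D (FO (comp_fctr F G) d) (FO id_fctr d)"
      using e[OF d] ae(1)[OF d] by (simp add: id_fctr_def comp_fctr_def arr_def del: arr_source arr_target)
    show "iso_in D (FO (comp_fctr F G) d) (FO id_fctr d) (label (e d))"
      using e[OF d] by (auto intro!: iso_inI[of _ "e d" "e' d"] simp: id_fctr_def comp_fctr_def)
  next
    fix c d h assume c: "c \<in> Ob D" and d: "d \<in> Ob D" and h: "h \<in> Hom D c d"
    let ?h = "(c, h, d)"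
    have ah: "arr D ?h" using c d h by simp
    have "e d \<cdot>\<^bsub>D\<^esub> fmap F (G1 ?h) = (e d \<cdot>\<^bsub>D\<^esub> e' d) \<cdot>\<^bsub>D\<^esub> ?h \<cdot>\<^bsub>D\<^esub> e c"
      using G1[OF ah] ae(1-4)[OF c] ae(1-4)[OF d] e(1,2)[OF c] e(1,2)[OF d] ah by simp
    also have "\<dots> = ?h \<cdot>\<^bsub>D\<^esub> e c"
      using ae[OF c] ae[OF d] e(1,2)[OF c] ah by simp
    finally show "Comp D (FO (comp_fctr F G) c) (FO (comp_fctr F G) d) (FO id_fctr d) (label (e d)) (FA (comp_fctr F G) c d h) =
        Comp D (FO (comp_fctr F G) c) (FO id_fctr c) (FO id_fctr d) (FA id_fctr c d h) (label (e c))"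
      using G1[OF ah] e(1,2)[OF c] e(1,2)[OF d]
      by (simp add: id_fctr_def comp_fctr_def cmp_def G_def fmap_def)
  qed
  ultimately show ?thesis using F(1) GF unfolding is_equivalence_def by blast
qed

section \<open>The categories of multicategories and of skew monoidal categories\<close>

lemma mact_id: "mm ar C q \<Longrightarrow> mact (id_multimor ar C) q = q"
  by (intro mmap_eqI)
    (auto simp: mact_def id_multimor_def mm_def is_map_def map_idI subset_eq)

lemma mact_comp:
  assumes "mm ar C q"
  shows "mact (comp_multimor ar C D E G F) q = mact G (mact F q)"
  using assms by (intro mmap_eqI) (auto simp: mact_def comp_multimor_def mm_def is_map_def subset_eq)

lemma MO_comp: "a \<in> Obj C \<Longrightarrow> MO (comp_multimor ar C D E G F) a = MO G (MO F a)"
  by (simp add: comp_multimor_def)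

lemma mm_normalised_id: "mm_normalised ar C (id_multimor ar C)"
  and mm_normalised_comp: "mm_normalised ar C (comp_multimor ar C D E G F)"
  by (auto simp: mm_normalised_def id_multimor_def comp_multimor_def)

context truncated_multicategory
begin

lemma mm_jj [simp]: "\<lbrakk>mm ar C f; kind f = Tight; ar Loose (length (inputs f))\<rbrakk> \<Longrightarrow> mm ar C (jj C f)"
  using typed unfolding well_typed_def by (auto simp: mm_def jj_def is_map_def)

lemma multi_morphismD:
  assumes "multi_morphism ar op C D F"
  shows "a \<in> Obj C \<Longrightarrow> MO F a \<in> Obj D"
    and "mm ar C f \<Longrightarrow> mm ar D (mact F f)"
    and "a \<in> Obj C \<Longrightarrow> mact F (idm C a) = idm D (MO F a)"
    and "\<lbrakk>op (kind g) (length (inputs g)) i (kind f) (length (inputs f)); mm ar C g; mm ar C f;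
       inputs g ! (i - 1) = out f\<rbrakk> \<Longrightarrow> mact F (sub C g i f) = sub D (mact F g) i (mact F f)"
    and "\<lbrakk>mm ar C f; kind f = Tight; ar Loose (length (inputs f))\<rbrakk> \<Longrightarrow> mact F (jj C f) = jj D (mact F f)"
    and "mm_normalised ar C F"
  using assms unfolding multi_morphism_iff by blast+

lemma multi_morphism_id: "multi_morphism ar op C C (id_multimor ar C)"
  unfolding multi_morphism_iff
  by (auto simp: mact_id mm_normalised_id op_arities) (simp add: id_multimor_def)+

lemma multi_morphism_comp:
  assumes D: "truncated_multicategory ar op D"
    and F: "multi_morphism ar op C D F" and G: "multi_morphism ar op D E G"
  shows "multi_morphism ar op C E (comp_multimor ar C D E G F)"
proof -
  interpret D: truncated_multicategory ar op D by fact
  note f = multi_morphismD[OF F] and g = D.multi_morphismD[OF G]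
  show ?thesis
    unfolding multi_morphism_iff
  proof (intro conjI ballI allI impI; (elim conjE)?)
    fix h i k
    assume op: "op (kind h) (length (inputs h)) i (kind k) (length (inputs k))"
      and m: "mm ar C h" "mm ar C k" and nth: "inputs h ! (i - 1) = out k"
    have i: "i - 1 < length (inputs h)" using op_arities[OF op] by auto
    have "mact F (sub C h i k) = sub D (mact F h) i (mact F k)" using f(4) op m nth by blast
    moreover have "mact G (sub D (mact F h) i (mact F k)) = sub E (mact G (mact F h)) i (mact G (mact F k))"
      using op m nth i by (intro g(4)) (simp_all add: f(2))
    ultimately show "mact (comp_multimor ar C D E G F) (sub C h i k) =
        sub E (mact (comp_multimor ar C D E G F) h) i (mact (comp_multimor ar C D E G F) k)"
      using m op nth by (simp add: mact_comp)
  next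
    fix q assume q: "mm ar C q" "kind q = Tight" "ar Loose (length (inputs q))"
    then show "mact (comp_multimor ar C D E G F) (jj C q) = jj E (mact (comp_multimor ar C D E G F) q)"
      by (simp add: mact_comp f(5) g(5) f(2))
  qed (simp_all add: mact_comp MO_comp mm_normalised_comp f g)
qed

end

lemma category_multi_cat:
  assumes "\<And>C. C \<in> X \<Longrightarrow> truncated_multicategory ar op C"
  shows "category (multi_cat ar op X)"
  unfolding category_def multi_cat_def
proof (simp, intro conjI ballI allI impI)
  fix C assume C: "C \<in> X"
  show "multi_morphism ar op C C (id_multimor ar C)"
    using assms[OF C] by (rule truncated_multicategory.multi_morphism_id)
next
  fix C D E F G assume "C \<in> X" "D \<in> X" "E \<in> X" "multi_morphism ar op C D F" "multi_morphism ar op D E G"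
  then show "multi_morphism ar op C E (comp_multimor ar C D E G F)"
    using assms by (intro truncated_multicategory.multi_morphism_comp)
next
  fix C D F assume CD: "C \<in> X" "D \<in> X" and F: "multi_morphism ar op C D F"
  interpret C: truncated_multicategory ar op C using assms CD by blast
  note f = C.multi_morphismD[OF F]
  show "comp_multimor ar C C D F (id_multimor ar C) = F"
    by (rule multimor_ext[of ar C]) (simp_all add: mm_normalised_comp mact_comp mact_id MO_comp f,
      simp add: id_multimor_def f)
  show "comp_multimor ar C D D (id_multimor ar D) F = F"
    by (rule multimor_ext[of ar C]) (simp_all add: mm_normalised_comp mact_comp mact_id MO_comp f,
      simp add: id_multimor_def f)
next
  fix C D E B F G H
  assume X: "C \<in> X" "D \<in> X" and F: "multi_morphism ar op C D F"
    and G: "multi_morphism ar op D E G" and H: "multi_morphism ar op E B H"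
  interpret C: truncated_multicategory ar op C using assms X by blast
  note f = C.multi_morphismD[OF F]
  show "comp_multimor ar C D B (comp_multimor ar D E B H G) F = comp_multimor ar C E B H (comp_multimor ar C D E G F)"
    by (rule multimor_ext[of ar C]) (simp_all add: mm_normalised_comp mact_comp MO_comp f)
qed

lemma lax_ext:
  assumes "normalised S \<Phi>" "normalised S \<Psi>" "\<And>a. a \<in> Ob S \<Longrightarrow> FO (LF \<Phi>) a = FO (LF \<Psi>) a"
    "\<And>f. arr S f \<Longrightarrow> fa \<Phi> f = fa \<Psi> f" "f0 S R \<Phi> = f0 S R \<Psi>"
    "\<And>a b. \<lbrakk>a \<in> Ob S; b \<in> Ob S\<rbrakk> \<Longrightarrow> f2 S R \<Phi> a b = f2 S R \<Psi> a b"
  shows "\<Phi> = \<Psi>"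
proof -
  have "FO (LF \<Phi>) a = FO (LF \<Psi>) a" for a
    using assms(1-3) unfolding normalised_def by (cases "a \<in> Ob S") auto
  then have o: "FO (LF \<Phi>) = FO (LF \<Psi>)" by (intro ext)
  have "FA (LF \<Phi>) a b f = FA (LF \<Psi>) a b f" for a b f
  proof (cases "a \<in> Ob S \<and> b \<in> Ob S \<and> f \<in> Hom S a b")
    case True
    then show ?thesis using assms(4)[of "(a, f, b)"] by (simp add: fa_def)
  qed (use assms(1,2) in \<open>simp add: normalised_def\<close>)
  then have "FA (LF \<Phi>) = FA (LF \<Psi>)" by (intro ext)
  then have "LF \<Phi> = LF \<Psi>" using o by (cases "LF \<Phi>"; cases "LF \<Psi>") simp
  moreover have "L2 \<Phi> a b = L2 \<Psi> a b" for a b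
    using assms(1,2) assms(6)[of a b] unfolding normalised_def
    by (cases "a \<in> Ob S \<and> b \<in> Ob S") (auto simp: f2_def)
  then have "L2 \<Phi> = L2 \<Psi>" by (intro ext)
  moreover have "L0 \<Phi> = L0 \<Psi>" using assms(5) by (simp add: f0_def)
  ultimately show ?thesis by (cases \<Phi>; cases \<Psi>) simp
qed

lemma id_lax_arrows:
  "a \<in> Ob S \<Longrightarrow> FO (LF (id_lax S)) a = a"
  "arr S f \<Longrightarrow> fa (id_lax S) f = f"
  "Unit S \<in> Ob S \<Longrightarrow> f0 S S (id_lax S) = idar S (Unit S)"
  "\<lbrakk>a \<in> Ob S; b \<in> Ob S; a \<otimes>\<^bsub>S\<^esub> b \<in> Ob S\<rbrakk> \<Longrightarrow> f2 S S (id_lax S) a b = idar S (a \<otimes>\<^bsub>S\<^esub> b)"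
  by (auto simp: id_lax_def fa_def f0_def f2_def idar_def arr_def prod_eq_iff simp del: arr_source arr_target)

lemma comp_lax_arrows:
  "a \<in> Ob S \<Longrightarrow> FO (LF (comp_lax S R Q \<Psi> \<Phi>)) a = FO (LF \<Psi>) (FO (LF \<Phi>) a)"
  "arr S f \<Longrightarrow> fa (comp_lax S R Q \<Psi> \<Phi>) f = fa \<Psi> (fa \<Phi> f)"
  "Unit S \<in> Ob S \<Longrightarrow> f0 S Q (comp_lax S R Q \<Psi> \<Phi>) = fa \<Psi> (f0 S R \<Phi>) \<cdot>\<^bsub>Q\<^esub> f0 R Q \<Psi>"
  "\<lbrakk>a \<in> Ob S; b \<in> Ob S; a \<otimes>\<^bsub>S\<^esub> b \<in> Ob S\<rbrakk> \<Longrightarrow> f2 S Q (comp_lax S R Q \<Psi> \<Phi>) a b =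
     fa \<Psi> (f2 S R \<Phi> a b) \<cdot>\<^bsub>Q\<^esub> f2 R Q \<Psi> (FO (LF \<Phi>) a) (FO (LF \<Phi>) b)"
  by (auto simp: comp_lax_def Let_def fa_def f0_def f2_def cmp_def arr_def simp del: arr_source arr_target)

lemma normalised_id: "normalised S (id_lax S)"
  and normalised_comp: "normalised S (comp_lax S R Q \<Psi> \<Phi>)"
  by (auto simp: normalised_def id_lax_def comp_lax_def Let_def)

lemma lax_data_iff:
  assumes "skew_monoidal_category S" "skew_monoidal_category R"
  shows "lax_data S R \<Phi> \<longleftrightarrow> (\<forall>a\<in>Ob S. FO (LF \<Phi>) a \<in> Ob R) \<and>
    (\<forall>f. arr S f \<longrightarrow> arr R (fa \<Phi> f)) \<and> (\<forall>a\<in>Ob S. fa \<Phi> (idar S a) = idar R (FO (LF \<Phi>) a)) \<and>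
    (\<forall>f g. arr S f \<longrightarrow> arr S g \<longrightarrow> target f = source g \<longrightarrow> fa \<Phi> (cmp S g f) = cmp R (fa \<Phi> g) (fa \<Phi> f)) \<and>
    arr R (f0 S R \<Phi>) \<and> (\<forall>a\<in>Ob S. \<forall>b\<in>Ob S. arr R (f2 S R \<Phi> a b))"
proof -
  interpret S: skew_monoidal_category S by fact
  interpret R: skew_monoidal_category R by fact
  have "fa \<Phi> = fmap (LF \<Phi>)" by (intro ext) (simp add: fa_def fmap_def)
  then show ?thesis
    unfolding lax_data_def lax_data_axioms_def is_functor_iff
    using assms S.underlying_category R.underlying_category
    by (auto simp: arr_def[of R "f0 S R \<Phi>"] arr_def[of R "f2 S R \<Phi> _ _"])
       (auto simp: f0_def f2_def)
qed

lemma lax_functor_id: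
  assumes "skew_monoidal_category S"
  shows "lax_functor S S (id_lax S)"
proof -
  interpret S: skew_monoidal_category S by fact
  interpret lax_data S S "id_lax S"
    by (simp add: lax_data_iff assms id_lax_arrows)
  show ?thesis
    by unfold_locales (simp_all add: id_lax_arrows)
qed

lemma lax_functor_comp:
  assumes "lax_functor S R \<Phi>" "lax_functor R Q \<Psi>"
  shows "lax_functor S Q (comp_lax S R Q \<Psi> \<Phi>)"
proof -
  interpret F: lax_functor S R \<Phi> by fact
  interpret G: lax_functor R Q \<Psi> by fact
  let ?H = "comp_lax S R Q \<Psi> \<Phi>"
  note [simp] = comp_lax_arrows[where S = S and R = R and Q = Q and \<Psi> = \<Psi> and \<Phi> = \<Phi>]
  have d: "lax_data S Q ?H"
    by (simp add: lax_data_iff F.S.skew_monoidal_category_axioms G.R.skew_monoidal_category_axioms)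
  show ?thesis
  proof (intro lax_functor.intro d lax_functor_axioms.intro)
    fix f g assume a: "arr S f" "arr S g"
    have "f2 S Q ?H (target f) (target g) \<cdot>\<^bsub>Q\<^esub> fa ?H f \<star>\<^bsub>Q\<^esub> fa ?H g =
        G.FF (F.m2 (target f) (target g)) \<cdot>\<^bsub>Q\<^esub>
        (G.m2 (F.F (target f)) (F.F (target g)) \<cdot>\<^bsub>Q\<^esub> G.FF (F.FF f) \<star>\<^bsub>Q\<^esub> G.FF (F.FF g))"
      using a by simp
    also have "\<dots> = G.FF (F.m2 (target f) (target g) \<cdot>\<^bsub>R\<^esub> F.FF f \<star>\<^bsub>R\<^esub> F.FF g) \<cdot>\<^bsub>Q\<^esub>
        G.m2 (F.F (source f)) (F.F (source g))"
      using a G.m2_natural[of "F.FF f" "F.FF g"] by simp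
    finally show "f2 S Q ?H (target f) (target g) \<cdot>\<^bsub>Q\<^esub> fa ?H f \<star>\<^bsub>Q\<^esub> fa ?H g =
        fa ?H (f \<star>\<^bsub>S\<^esub> g) \<cdot>\<^bsub>Q\<^esub> f2 S Q ?H (source f) (source g)"
      using a by (simp add: F.m2_natural)
  next
    fix a b c assume o: "a \<in> Ob S" "b \<in> Ob S" "c \<in> Ob S"
    let ?A = "F.F a" and ?B = "F.F b" and ?C = "F.F c" and ?AB = "F.F (a \<otimes>\<^bsub>S\<^esub> b)" and ?BC = "F.F (b \<otimes>\<^bsub>S\<^esub> c)"
    have "fa ?H (\<alpha>\<^bsub>S\<^esub> a b c) \<cdot>\<^bsub>Q\<^esub> f2 S Q ?H (a \<otimes>\<^bsub>S\<^esub> b) c \<cdot>\<^bsub>Q\<^esub> f2 S Q ?H a b \<star>\<^bsub>Q\<^esub> \<I>\<^bsub>Q\<^esub> (FO (LF ?H) c) =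
        G.FF (F.FF (\<alpha>\<^bsub>S\<^esub> a b c)) \<cdot>\<^bsub>Q\<^esub> G.FF (F.m2 (a \<otimes>\<^bsub>S\<^esub> b) c) \<cdot>\<^bsub>Q\<^esub>
        (G.m2 ?AB ?C \<cdot>\<^bsub>Q\<^esub> G.FF (F.m2 a b) \<star>\<^bsub>Q\<^esub> \<I>\<^bsub>Q\<^esub> (G.F ?C)) \<cdot>\<^bsub>Q\<^esub> G.m2 ?A ?B \<star>\<^bsub>Q\<^esub> \<I>\<^bsub>Q\<^esub> (G.F ?C)"
      using o by simp
    also have "G.m2 ?AB ?C \<cdot>\<^bsub>Q\<^esub> G.FF (F.m2 a b) \<star>\<^bsub>Q\<^esub> \<I>\<^bsub>Q\<^esub> (G.F ?C) =
        G.FF (F.m2 a b \<star>\<^bsub>R\<^esub> \<I>\<^bsub>R\<^esub> ?C) \<cdot>\<^bsub>Q\<^esub> G.m2 (?A \<otimes>\<^bsub>R\<^esub> ?B) ?C"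
      using o G.m2_natural[of "F.m2 a b" "\<I>\<^bsub>R\<^esub> ?C"] by simp
    also have "G.FF (F.FF (\<alpha>\<^bsub>S\<^esub> a b c)) \<cdot>\<^bsub>Q\<^esub> G.FF (F.m2 (a \<otimes>\<^bsub>S\<^esub> b) c) \<cdot>\<^bsub>Q\<^esub>
        (G.FF (F.m2 a b \<star>\<^bsub>R\<^esub> \<I>\<^bsub>R\<^esub> ?C) \<cdot>\<^bsub>Q\<^esub> G.m2 (?A \<otimes>\<^bsub>R\<^esub> ?B) ?C) \<cdot>\<^bsub>Q\<^esub> G.m2 ?A ?B \<star>\<^bsub>Q\<^esub> \<I>\<^bsub>Q\<^esub> (G.F ?C) =
        G.FF (F.FF (\<alpha>\<^bsub>S\<^esub> a b c) \<cdot>\<^bsub>R\<^esub> F.m2 (a \<otimes>\<^bsub>S\<^esub> b) c \<cdot>\<^bsub>R\<^esub> F.m2 a b \<star>\<^bsub>R\<^esub> \<I>\<^bsub>R\<^esub> ?C) \<cdot>\<^bsub>Q\<^esub>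
        G.m2 (?A \<otimes>\<^bsub>R\<^esub> ?B) ?C \<cdot>\<^bsub>Q\<^esub> G.m2 ?A ?B \<star>\<^bsub>Q\<^esub> \<I>\<^bsub>Q\<^esub> (G.F ?C)"
      using o by simp
    also have "\<dots> = G.FF (F.m2 a (b \<otimes>\<^bsub>S\<^esub> c)) \<cdot>\<^bsub>Q\<^esub> G.FF (\<I>\<^bsub>R\<^esub> ?A \<star>\<^bsub>R\<^esub> F.m2 b c) \<cdot>\<^bsub>Q\<^esub>
        (G.FF (\<alpha>\<^bsub>R\<^esub> ?A ?B ?C) \<cdot>\<^bsub>Q\<^esub> G.m2 (?A \<otimes>\<^bsub>R\<^esub> ?B) ?C \<cdot>\<^bsub>Q\<^esub> G.m2 ?A ?B \<star>\<^bsub>Q\<^esub> \<I>\<^bsub>Q\<^esub> (G.F ?C))"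
      using o by (subst F.m2_assoc) auto
    also have "\<dots> = G.FF (F.m2 a (b \<otimes>\<^bsub>S\<^esub> c)) \<cdot>\<^bsub>Q\<^esub>
        (G.FF (\<I>\<^bsub>R\<^esub> ?A \<star>\<^bsub>R\<^esub> F.m2 b c) \<cdot>\<^bsub>Q\<^esub> G.m2 ?A (?B \<otimes>\<^bsub>R\<^esub> ?C)) \<cdot>\<^bsub>Q\<^esub>
        \<I>\<^bsub>Q\<^esub> (G.F ?A) \<star>\<^bsub>Q\<^esub> G.m2 ?B ?C \<cdot>\<^bsub>Q\<^esub> \<alpha>\<^bsub>Q\<^esub> (G.F ?A) (G.F ?B) (G.F ?C)"
      using o by (subst G.m2_assoc) auto
    also have "G.FF (\<I>\<^bsub>R\<^esub> ?A \<star>\<^bsub>R\<^esub> F.m2 b c) \<cdot>\<^bsub>Q\<^esub> G.m2 ?A (?B \<otimes>\<^bsub>R\<^esub> ?C) =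
        G.m2 ?A ?BC \<cdot>\<^bsub>Q\<^esub> \<I>\<^bsub>Q\<^esub> (G.F ?A) \<star>\<^bsub>Q\<^esub> G.FF (F.m2 b c)"
      using o G.m2_natural[of "\<I>\<^bsub>R\<^esub> ?A" "F.m2 b c"] by simp
    finally show "fa ?H (\<alpha>\<^bsub>S\<^esub> a b c) \<cdot>\<^bsub>Q\<^esub> f2 S Q ?H (a \<otimes>\<^bsub>S\<^esub> b) c \<cdot>\<^bsub>Q\<^esub> f2 S Q ?H a b \<star>\<^bsub>Q\<^esub> \<I>\<^bsub>Q\<^esub> (FO (LF ?H) c) =
        f2 S Q ?H a (b \<otimes>\<^bsub>S\<^esub> c) \<cdot>\<^bsub>Q\<^esub> \<I>\<^bsub>Q\<^esub> (FO (LF ?H) a) \<star>\<^bsub>Q\<^esub> f2 S Q ?H b c \<cdot>\<^bsub>Q\<^esub>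
        \<alpha>\<^bsub>Q\<^esub> (FO (LF ?H) a) (FO (LF ?H) b) (FO (LF ?H) c)"
      using o by simp
  next
    fix a assume o: "a \<in> Ob S"
    let ?A = "F.F a" and ?i = "F.F (Unit S)"
    have "fa ?H (\<Lambda>\<^bsub>S\<^esub> a) \<cdot>\<^bsub>Q\<^esub> f2 S Q ?H (Unit S) a \<cdot>\<^bsub>Q\<^esub> f0 S Q ?H \<star>\<^bsub>Q\<^esub> \<I>\<^bsub>Q\<^esub> (FO (LF ?H) a) =
        G.FF (F.FF (\<Lambda>\<^bsub>S\<^esub> a)) \<cdot>\<^bsub>Q\<^esub> G.FF (F.m2 (Unit S) a) \<cdot>\<^bsub>Q\<^esub>
        (G.m2 ?i ?A \<cdot>\<^bsub>Q\<^esub> G.FF F.u0 \<star>\<^bsub>Q\<^esub> \<I>\<^bsub>Q\<^esub> (G.F ?A)) \<cdot>\<^bsub>Q\<^esub> G.u0 \<star>\<^bsub>Q\<^esub> \<I>\<^bsub>Q\<^esub> (G.F ?A)"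
      using o by simp
    also have "G.m2 ?i ?A \<cdot>\<^bsub>Q\<^esub> G.FF F.u0 \<star>\<^bsub>Q\<^esub> \<I>\<^bsub>Q\<^esub> (G.F ?A) = G.FF (F.u0 \<star>\<^bsub>R\<^esub> \<I>\<^bsub>R\<^esub> ?A) \<cdot>\<^bsub>Q\<^esub> G.m2 (Unit R) ?A"
      using o G.m2_natural[of "F.u0" "\<I>\<^bsub>R\<^esub> ?A"] by simp
    also have "G.FF (F.FF (\<Lambda>\<^bsub>S\<^esub> a)) \<cdot>\<^bsub>Q\<^esub> G.FF (F.m2 (Unit S) a) \<cdot>\<^bsub>Q\<^esub>
        (G.FF (F.u0 \<star>\<^bsub>R\<^esub> \<I>\<^bsub>R\<^esub> ?A) \<cdot>\<^bsub>Q\<^esub> G.m2 (Unit R) ?A) \<cdot>\<^bsub>Q\<^esub> G.u0 \<star>\<^bsub>Q\<^esub> \<I>\<^bsub>Q\<^esub> (G.F ?A) =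
        G.FF (F.FF (\<Lambda>\<^bsub>S\<^esub> a) \<cdot>\<^bsub>R\<^esub> F.m2 (Unit S) a \<cdot>\<^bsub>R\<^esub> F.u0 \<star>\<^bsub>R\<^esub> \<I>\<^bsub>R\<^esub> ?A) \<cdot>\<^bsub>Q\<^esub>
        G.m2 (Unit R) ?A \<cdot>\<^bsub>Q\<^esub> G.u0 \<star>\<^bsub>Q\<^esub> \<I>\<^bsub>Q\<^esub> (G.F ?A)"
      using o by simp
    finally show "fa ?H (\<Lambda>\<^bsub>S\<^esub> a) \<cdot>\<^bsub>Q\<^esub> f2 S Q ?H (Unit S) a \<cdot>\<^bsub>Q\<^esub> f0 S Q ?H \<star>\<^bsub>Q\<^esub> \<I>\<^bsub>Q\<^esub> (FO (LF ?H) a) =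
        \<Lambda>\<^bsub>Q\<^esub> (FO (LF ?H) a)"
      using o by (simp add: F.m2_lun G.m2_lun)
    have "f2 S Q ?H a (Unit S) \<cdot>\<^bsub>Q\<^esub> \<I>\<^bsub>Q\<^esub> (FO (LF ?H) a) \<star>\<^bsub>Q\<^esub> f0 S Q ?H \<cdot>\<^bsub>Q\<^esub> \<rho>\<^bsub>Q\<^esub> (FO (LF ?H) a) =
        G.FF (F.m2 a (Unit S)) \<cdot>\<^bsub>Q\<^esub> (G.m2 ?A ?i \<cdot>\<^bsub>Q\<^esub> \<I>\<^bsub>Q\<^esub> (G.F ?A) \<star>\<^bsub>Q\<^esub> G.FF F.u0) \<cdot>\<^bsub>Q\<^esub>
        \<I>\<^bsub>Q\<^esub> (G.F ?A) \<star>\<^bsub>Q\<^esub> G.u0 \<cdot>\<^bsub>Q\<^esub> \<rho>\<^bsub>Q\<^esub> (G.F ?A)"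
      using o by simp
    also have "G.m2 ?A ?i \<cdot>\<^bsub>Q\<^esub> \<I>\<^bsub>Q\<^esub> (G.F ?A) \<star>\<^bsub>Q\<^esub> G.FF F.u0 = G.FF (\<I>\<^bsub>R\<^esub> ?A \<star>\<^bsub>R\<^esub> F.u0) \<cdot>\<^bsub>Q\<^esub> G.m2 ?A (Unit R)"
      using o G.m2_natural[of "\<I>\<^bsub>R\<^esub> ?A" "F.u0"] by simp
    also have "G.FF (F.m2 a (Unit S)) \<cdot>\<^bsub>Q\<^esub> (G.FF (\<I>\<^bsub>R\<^esub> ?A \<star>\<^bsub>R\<^esub> F.u0) \<cdot>\<^bsub>Q\<^esub> G.m2 ?A (Unit R)) \<cdot>\<^bsub>Q\<^esub>
        \<I>\<^bsub>Q\<^esub> (G.F ?A) \<star>\<^bsub>Q\<^esub> G.u0 \<cdot>\<^bsub>Q\<^esub> \<rho>\<^bsub>Q\<^esub> (G.F ?A) =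
        G.FF (F.m2 a (Unit S) \<cdot>\<^bsub>R\<^esub> \<I>\<^bsub>R\<^esub> ?A \<star>\<^bsub>R\<^esub> F.u0 \<cdot>\<^bsub>R\<^esub> \<rho>\<^bsub>R\<^esub> ?A)"
      using o by (simp add: G.m2_run[symmetric])
    finally show "f2 S Q ?H a (Unit S) \<cdot>\<^bsub>Q\<^esub> \<I>\<^bsub>Q\<^esub> (FO (LF ?H) a) \<star>\<^bsub>Q\<^esub> f0 S Q ?H \<cdot>\<^bsub>Q\<^esub> \<rho>\<^bsub>Q\<^esub> (FO (LF ?H) a) =
        fa ?H (\<rho>\<^bsub>S\<^esub> a)"
      using o by (simp add: F.m2_run)
  qed
qed

theorem category_SkMon: "category SkMon"
  unfolding category_def SkMon_def
proof (simp, intro conjI ballI allI impI)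
  fix S :: "('o, 'm) skmon" assume "skew_monoidal_category S"
  then show "lax_monoidal S S (id_lax S)" by (simp add: lax_functor_iff lax_functor_id normalised_id)
next
  fix S R Q \<Phi> \<Psi>
  assume "skew_monoidal_category S" "skew_monoidal_category R" "skew_monoidal_category Q"
    "lax_monoidal S R \<Phi>" "lax_monoidal R Q \<Psi>"
  then show "lax_monoidal S Q (comp_lax S R Q \<Psi> \<Phi>)"
    by (simp add: lax_functor_iff lax_functor_comp normalised_comp)
next
  fix S R \<Phi>
  assume s: "skew_monoidal_category S" "skew_monoidal_category R" and l: "lax_monoidal S R \<Phi>"
  interpret lax_functor S R \<Phi> using l s by (simp add: lax_functor_iff)
  have n: "normalised S \<Phi>" using l s by (simp add: lax_functor_iff)
  show "comp_lax S S R \<Phi> (id_lax S) = \<Phi>"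
    by (rule lax_ext[of S _ _ R]) (simp_all add: normalised_comp n comp_lax_arrows id_lax_arrows)
  show "comp_lax S R R (id_lax R) \<Phi> = \<Phi>"
    by (rule lax_ext[of S _ _ R]) (simp_all add: normalised_comp n comp_lax_arrows id_lax_arrows)
next
  fix S R Q P \<Phi> \<Psi> \<Theta>
  assume s: "skew_monoidal_category S" "skew_monoidal_category R" "skew_monoidal_category Q" "skew_monoidal_category P"
   and l: "lax_monoidal S R \<Phi>" "lax_monoidal R Q \<Psi>" "lax_monoidal Q P \<Theta>"
  interpret F: lax_functor S R \<Phi> using l s by (simp add: lax_functor_iff)
  interpret G: lax_functor R Q \<Psi> using l s by (simp add: lax_functor_iff)
  interpret H: lax_functor Q P \<Theta> using l s by (simp add: lax_functor_iff)
  show "comp_lax S R P (comp_lax R Q P \<Theta> \<Psi>) \<Phi> = comp_lax S Q P \<Theta> (comp_lax S R Q \<Psi> \<Phi>)"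
    by (rule lax_ext[of S _ _ P]) (simp_all add: normalised_comp comp_lax_arrows)
qed

text \<open>
  The coherence maps of the lax functor of an identity are determined by the classifiers, on which the
  identity acts trivially.
\<close>

theorem lax_of_id:
  assumes "classified_multicategory ar op C chi"
  shows "lax_of C chi C chi (id_multimor ar C) = id_lax (skmon_of C chi)"
proof -
  interpret C: classified_multicategory ar op C chi by fact
  interpret classified_morphism ar op C C chi chi "id_multimor ar C"
    by unfold_locales (rule C.multi_morphism_id)
  show ?thesis
  proof (rule lax_ext[of S _ _ S])
    show "normalised S \<Phi>" using lax_monoidal_lax_of by (simp add: lax_functor_iff C.skew_monoidal_S)
    show "normalised S (id_lax S)" by (rule normalised_id)
    show "\<And>a. a \<in> Ob S \<Longrightarrow> FO (LF \<Phi>) a = FO (LF (id_lax S)) a"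
      by (simp add: id_lax_arrows) (simp add: id_multimor_def)
    show "fa \<Phi> f = fa (id_lax S) f" if "arr S f" for f
    proof -
      have "label f \<in> Maps C Tight [source f] (target f)"
        using that unfolding arr_def by simp
      then show ?thesis using that by (simp add: id_lax_arrows) (simp add: fa_def id_multimor_def is_map_def)
    qed
    have "EM C chi Loose [] (f0 S S \<Phi>) = EM C chi Loose [] (\<I>\<^bsub>S\<^esub> (Unit S))"
      using mact_null C.uu_EC mact_id[OF C.mm_uu] by metis
    then show "f0 S S \<Phi> = f0 S S (id_lax S)"
      using F_Obj[of "Unit S"] by (intro C.EC_inj[of Loose "[]"]) (simp_all add: id_lax_arrows lmap_def)
    fix a b assume "a \<in> Ob S" "b \<in> Ob S"
    then have o: "a \<in> Obj C" "b \<in> Obj C" by simp_all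
    have i: "MO (id_multimor ar C) a = a" "MO (id_multimor ar C) b = b"
      using o by (simp_all add: id_multimor_def)
    have "EM C chi Tight [a, b] (f2 S S \<Phi> a b) = EM C chi Tight [a, b] (\<I>\<^bsub>S\<^esub> (TO S a b))"
      using mact_theta[OF o] C.theta_EC[OF o] mact_id[OF C.mm_theta[OF o]] i by metis
    then show "f2 S S \<Phi> a b = f2 S S (id_lax S) a b"
      using o i by (intro C.EC_inj[of Tight "[a, b]"]) (simp_all add: id_lax_arrows lmap_def)
  qed
qed

text \<open>
  Both sides have the same effect on classifiers.
\<close>

theorem lax_of_comp:
  assumes "classified_multicategory ar op C chi" "classified_multicategory ar op D psi"
    "classified_multicategory ar op E omega"
    and "multi_morphism ar op C D F" "multi_morphism ar op D E G"
  shows "lax_of C chi E omega (comp_multimor ar C D E G F) =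
    comp_lax (skmon_of C chi) (skmon_of D psi) (skmon_of E omega) (lax_of D psi E omega G) (lax_of C chi D psi F)"
proof -
  interpret C: classified_multicategory ar op C chi by fact
  interpret D: classified_multicategory ar op D psi by fact
  interpret E: classified_multicategory ar op E omega by fact
  interpret F: classified_morphism ar op C D chi psi F by unfold_locales fact
  interpret G: classified_morphism ar op D E psi omega G by unfold_locales fact
  let ?H = "comp_multimor ar C D E G F"
  interpret H: classified_morphism ar op C E chi omega ?H
    by unfold_locales (rule C.multi_morphism_comp[OF D.truncated_multicategory_axioms assms(4,5)])
  let ?S = "skmon_of C chi" and ?R = "skmon_of D psi" and ?Q = "skmon_of E omega"
  show ?thesis
  proof (rule lax_ext[of ?S _ _ ?Q])
    show "normalised ?S H.\<Phi>" using H.lax_monoidal_lax_of by (simp add: lax_functor_iff C.skew_monoidal_S E.skew_monoidal_S)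
    show "normalised ?S (comp_lax ?S ?R ?Q G.\<Phi> F.\<Phi>)" by (rule normalised_comp)
    show "\<And>a. a \<in> Ob ?S \<Longrightarrow> FO (LF H.\<Phi>) a = FO (LF (comp_lax ?S ?R ?Q G.\<Phi> F.\<Phi>)) a"
      by (simp add: comp_lax_arrows MO_comp)
    show "fa H.\<Phi> f = fa (comp_lax ?S ?R ?Q G.\<Phi> F.\<Phi>) f" if "arr ?S f" for f
    proof -
      have "label f \<in> Maps C Tight [source f] (target f)"
        using that unfolding arr_def by simp
      then show ?thesis using that by (simp add: comp_lax_arrows) (simp add: fa_def comp_multimor_def is_map_def)
    qed
    have "EM E omega Loose [] (f0 ?S ?Q H.\<Phi>) = mact G (EM D psi Loose [] (f0 ?S ?R F.\<Phi>))"
      using H.mact_null F.mact_null by (simp add: mact_comp)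
    also have "\<dots> = EM E omega Loose [] (fa G.\<Phi> (f0 ?S ?R F.\<Phi>) \<cdot>\<^bsub>?Q\<^esub> f0 ?R ?Q G.\<Phi>)"
      using G.mact_EC[of Loose "[]" "f0 ?S ?R F.\<Phi>"] F.L.arr_u0 by (simp add: lmap_def lact_def pb_def)
    finally show "f0 ?S ?Q H.\<Phi> = f0 ?S ?Q (comp_lax ?S ?R ?Q G.\<Phi> F.\<Phi>)"
      using F.L.arr_u0 H.L.arr_u0
      by (intro E.EC_inj[of Loose "[]"]) (simp_all add: comp_lax_arrows[where R = ?R] lmap_def)
    fix a b assume "a \<in> Ob ?S" "b \<in> Ob ?S"
    then have o: "a \<in> Obj C" "b \<in> Obj C" by simp_all
    let ?as = "[MO G (MO F a), MO G (MO F b)]"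
    have "EM E omega Tight ?as (f2 ?S ?Q H.\<Phi> a b) =
        mact G (EM D psi Tight [MO F a, MO F b] (f2 ?S ?R F.\<Phi> a b))"
      using H.mact_theta[OF o] F.mact_theta[OF o] o by (simp add: mact_comp MO_comp)
    also have "\<dots> = EM E omega Tight ?as
        (fa G.\<Phi> (f2 ?S ?R F.\<Phi> a b) \<cdot>\<^bsub>?Q\<^esub> f2 ?R ?Q G.\<Phi> (MO F a) (MO F b))"
      using G.mact_EC[of Tight "[MO F a, MO F b]" "f2 ?S ?R F.\<Phi> a b"] F.L.arr_m2[of a b] o
      by (simp add: lmap_def lact_def pb_Tight)
    finally show "f2 ?S ?Q H.\<Phi> a b = f2 ?S ?Q (comp_lax ?S ?R ?Q G.\<Phi> F.\<Phi>) a b"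
      using F.L.arr_m2[of a b] H.L.arr_m2[of a b] o
      by (intro E.EC_inj[of Tight ?as]) (simp_all add: comp_lax_arrows[where R = ?R] lmap_def MO_comp)
  qed
qed

section \<open>Truncation\<close>

lemma truncate_simps [simp]: "Obj (truncate_multi C) = Obj C" "Idt (truncate_multi C) = Idt C"
  by (simp_all add: truncate_multi_def)

lemma is_map_truncate: "is_map (truncate_multi C) x as b f \<longleftrightarrow> arity_short x (length as) \<and> is_map C x as b f"
  by (auto simp: is_map_def truncate_multi_def)

lemma Maps_truncate: "arity_short x (length as) \<Longrightarrow> Maps (truncate_multi C) x as b = Maps C x as b"
  by (simp add: truncate_multi_def)

lemma Sub_truncate: "op_short x (length bs) i y (length as) \<Longrightarrow>
    Sub (truncate_multi C) x bs c i y as g f = Sub C x bs c i y as g f"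
  by (simp add: truncate_multi_def)

lemma J_truncate: "\<lbrakk>arity_short Tight (length as); arity_short Loose (length as)\<rbrakk> \<Longrightarrow>
    J (truncate_multi C) as b f = J C as b f"
  by (simp add: truncate_multi_def)

lemma op_short_arities: "op_short x n i y m \<Longrightarrow> arity_short x n \<and> arity_short y m \<and> 1 \<le> i \<and> i \<le> n"
  by (simp add: op_short_def)

lemma op_short_arity: "op_short x n i y m \<Longrightarrow> arity_short (otype x i y) (n + m - 1)"
  by (auto simp: op_short_cases arity_short_def otype_def)

lemma op_short_outer: "arity_short y m \<Longrightarrow> op_short Tight (Suc 0) (Suc 0) y m"
  and op_short_inner: "\<lbrakk>arity_short x n; Suc 0 \<le> i; i \<le> n\<rbrakk> \<Longrightarrow> op_short x n i Tight (Suc 0)"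
  by (simp_all add: op_short_def arity_short_def)

lemma assoc_law_truncate:
  assumes "assoc_law C x n i y m j z p" "op_short x n i y m" "op_short y m j z p"
    "op_short x n i (otype y j z) (m + p - 1)" "op_short (otype x i y) (n + m - 1) (i + j - 1) z p"
  shows "assoc_law (truncate_multi C) x n i y m j z p"
  unfolding assoc_law_def
proof (intro allI impI; elim conjE)
  fix bs c as ds g f h
  assume l: "length bs = n" "length as = m" "length ds = p"
    and m: "is_map (truncate_multi C) x bs c g" "is_map (truncate_multi C) y as (bs ! (i - 1)) f"
      "is_map (truncate_multi C) z ds (as ! (j - 1)) h"
  have lp: "length (plug as j ds) = m + p - 1" "length (plug bs i as) = n + m - 1"
    using l op_short_arities[OF assms(2)] op_short_arities[OF assms(3)] by (simp_all add: length_plug)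
  show "Sub (truncate_multi C) x bs c i (otype y j z) (plug as j ds) g
        (Sub (truncate_multi C) y as (bs ! (i - 1)) j z ds f h) =
      Sub (truncate_multi C) (otype x i y) (plug bs i as) c (i + j - 1) z ds
        (Sub (truncate_multi C) x bs c i y as g f) h"
    using assms(2-) assoc_lawD[of C x bs i y as j z ds c g f h] assms(1) m l lp
    by (simp add: Sub_truncate is_map_truncate)
qed

lemma comm_law_truncate:
  assumes "comm_law C x n i y m k z p" "op_short x n i y m" "op_short x n k z p"
    "op_short (otype x i y) (n + m - 1) (k + m - 1) z p" "op_short (otype x k z) (n + p - 1) i y m"
  shows "comm_law (truncate_multi C) x n i y m k z p"
  unfolding comm_law_def
proof (intro allI impI; elim conjE)
  fix bs c as ds g f h
  assume l: "length bs = n" "length as = m" "length ds = p"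
    and m: "is_map (truncate_multi C) x bs c g" "is_map (truncate_multi C) y as (bs ! (i - 1)) f"
      "is_map (truncate_multi C) z ds (bs ! (k - 1)) h"
  have lp: "length (plug bs k ds) = n + p - 1" "length (plug bs i as) = n + m - 1"
    using l op_short_arities[OF assms(2)] op_short_arities[OF assms(3)] by (simp_all add: length_plug)
  show "Sub (truncate_multi C) (otype x i y) (plug bs i as) c (k + m - 1) z ds
        (Sub (truncate_multi C) x bs c i y as g f) h =
      Sub (truncate_multi C) (otype x k z) (plug bs k ds) c i y as
        (Sub (truncate_multi C) x bs c k z ds g h) f"
    using assms(2-) comm_lawD[of C x bs i y as k z ds c g f h] assms(1) m l lp
    by (simp add: Sub_truncate is_map_truncate)
qed

lemma op_short_long: "op_short x n i y m \<Longrightarrow> op_long x n i y m"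
  by (auto simp: op_short_def op_long_def arity_short_def arity_long_def split: if_splits)

lemma arity_short_long: "arity_short x n \<Longrightarrow> arity_long x n"
  by (auto simp: arity_short_def arity_long_def)

text \<open>
  Every law of a short skew multicategory is an instance of a law of a skew multicategory that involves
  short maps only.
\<close>

theorem short_truncate:
  assumes "skew_multicategory C"
  shows "short_skew_multicategory (truncate_multi C)"
proof -
  interpret skew_multicategory C by fact
  show ?thesis
  proof
    show "well_typed arity_short op_short (truncate_multi C)"
      unfolding well_typed_def
    proof (intro conjI ballI allI impI; (elim conjE)?)
      fix a assume "a \<in> Obj (truncate_multi C)"
      then show "Idt (truncate_multi C) a \<in> Maps (truncate_multi C) Tight [a] a"
        using typed by (simp add: well_typed_def Maps_truncate arity_short_def)
    next
      fix as b f assume a: "arity_short Tight (length as)" "arity_short Loose (length as)"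
        "is_map (truncate_multi C) Tight as b f"
      then show "J (truncate_multi C) as b f \<in> Maps (truncate_multi C) Loose as b"
        using typed by (simp add: well_typed_def Maps_truncate J_truncate is_map_truncate arity_short_long)
    next
      fix x bs c i y as g f
      assume op: "op_short x (length bs) i y (length as)" and
        "is_map (truncate_multi C) x bs c g" "is_map (truncate_multi C) y as (bs ! (i - 1)) f"
      then have "Sub C x bs c i y as g f \<in> Maps C (otype x i y) (plug bs i as) c"
        using typed op_short_long[OF op] unfolding well_typed_def is_map_truncate by blast
      moreover have "arity_short (otype x i y) (length (plug bs i as))"
        using op_short_arity[OF op] op_short_arities[OF op] by (simp add: length_plug)
      ultimately show "Sub (truncate_multi C) x bs c i y as g f \<in> Maps (truncate_multi C) (otype x i y) (plug bs i as) c"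
        using op by (simp add: Sub_truncate Maps_truncate)
    qed
    show "id_law arity_short (truncate_multi C)"
      using identities unfolding id_law_def is_map_truncate
      by (simp add: Sub_truncate op_short_outer op_short_inner arity_short_long)
  next
    fix y m j z r assume op: "op_short y m j z r"
    then show "assoc_law (truncate_multi C) Tight 1 1 y m j z r"
      using op_short_arities[OF op] op_short_arity[OF op]
      by (intro assoc_law_truncate associativity)
        (auto simp: op_short_long op_short_outer)
  next
    fix x n i z r assume op: "op_short x n i z r"
    then show "assoc_law (truncate_multi C) x n i Tight 1 1 z r"
      using op_short_arities[OF op] op_short_arity[OF op] op_short_outer[of z r] op_short_inner[of x n i]
      by (intro assoc_law_truncate associativity)
        (cases "i = Suc 0"; auto simp: op_short_long otype_later)+
  next
    fix x n i y m k assume op: "op_short x n i y m" and k: "1 \<le> k" "k \<le> m"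
    have "op_short (otype x i y) (n + m - 1) (i + k - 1) Tight (Suc 0)"
      using op_short_arities[OF op] op_short_arity[OF op] k by (intro op_short_inner) auto
    moreover have "op_short y m k Tight (Suc 0)" "otype y k Tight = y"
      using op_short_arities[OF op] k by (auto intro: op_short_inner simp: otype_later, cases "k = Suc 0", auto simp: otype_later)
    ultimately show "assoc_law (truncate_multi C) x n i y m k Tight 1"
      using op by (intro assoc_law_truncate associativity) (auto simp: op_short_long)
  next
    fix x n i y m k assume op: "op_short x n i y m" and k: "i < k" "k \<le> n"
    have t: "otype x k Tight = x" by (cases "k = Suc 0") (auto simp: otype_later)
    have k1: "op_short x n k Tight (Suc 0)"
      using op_short_arities[OF op] k by (intro op_short_inner) auto
    moreover have "op_short (otype x i y) (n + m - 1) (k + m - 1) Tight (Suc 0)"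
      using op_short_arities[OF op] op_short_arity[OF op] k by (intro op_short_inner) auto
    ultimately show "comm_law (truncate_multi C) x n i y m k Tight 1"
      using op k t by (intro comm_law_truncate commutativity) (auto simp: op_short_long)
  next
    fix x n i y m k assume op: "op_short x n i y m" and k: "1 \<le> k" "k < i"
    have t: "otype x k Tight = x" by (cases "k = Suc 0") (auto simp: otype_later)
    have k1: "op_short x n k Tight (Suc 0)"
      using op_short_arities[OF op] k by (intro op_short_inner) auto
    moreover have "op_short (otype x i y) (n + m - 1) k Tight (Suc 0)"
      using op_short_arities[OF op] op_short_arity[OF op] k by (intro op_short_inner) auto
    ultimately show "comm_law (truncate_multi C) x n k Tight 1 i y m"
      using op k t by (intro comm_law_truncate commutativity) (auto simp: op_short_long)
  next
    fix i j :: nat and z and r :: nat assume a: "i \<in> {1, 2}" "j \<in> {1, 2}" "(z, r) \<in> {(Tight, 2), (Loose, 0)}"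
    show "assoc_law (truncate_multi C) Tight 2 i Tight 2 j z r"
      using a by (intro assoc_law_truncate associativity)
        (auto simp: op_long_def arity_long_def op_short_cases arity_short_def otype_def)
  next
    fix y z and n r :: nat assume a: "(y, n) \<in> {(Tight, 2), (Loose, 0)}" "(z, r) \<in> {(Tight, 2), (Loose, 0)}"
    show "comm_law (truncate_multi C) Tight 2 1 y n 2 z r"
      using a by (intro comm_law_truncate commutativity)
        (auto simp: op_long_def arity_long_def op_short_cases arity_short_def otype_def)
  next
    fix as b f c q assume a: "length as \<in> {1, 2}" "is_map (truncate_multi C) Tight as b f" "is_map (truncate_multi C) Tight [b] c q"
    have ar: "arity_short Tight (length as)" "arity_short Loose (length as)"
      using a(1) by (auto simp: arity_short_def)
    then show "Sub (truncate_multi C) Tight [b] c 1 Loose as q (J (truncate_multi C) as b f) =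
        J (truncate_multi C) as c (Sub (truncate_multi C) Tight [b] c 1 Tight as q f)"
      using j_argument[of Tight "[b]" 1 as c q f] a
      by (simp add: is_map_truncate Sub_truncate J_truncate op_short_outer op_long_def arity_short_long arity_long_def[of Tight "Suc 0"])
  next
    fix as i b f a p assume a: "length as \<in> {1, 2}" "1 \<le> i" "i \<le> length as" "is_map (truncate_multi C) Tight as b f"
      "is_map (truncate_multi C) Tight [a] (as ! (i - 1)) p"
    have ar: "arity_short Tight (length as)" "arity_short Loose (length as)" "length (plug as i [a]) = length as"
      using a by (auto simp: arity_short_def length_plug)
    then show "Sub (truncate_multi C) Loose as b i Tight [a] (J (truncate_multi C) as b f) p =
       J (truncate_multi C) (plug as i [a]) b (Sub (truncate_multi C) Tight as b i Tight [a] f p)"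
      using j_function[of as i Tight "[a]" b f p] a
      by (simp add: is_map_truncate Sub_truncate J_truncate op_short_inner op_long_def arity_short_long
          arity_long_def[of Tight "Suc 0"] otype_def)
  next
    fix b1 b2 c g a p assume "is_map (truncate_multi C) Tight [b1, b2] c g" "is_map (truncate_multi C) Tight [a] b2 p"
    then show "Sub (truncate_multi C) Tight [b1, b2] c 2 Loose [a] g (J (truncate_multi C) [a] b2 p) =
        Sub (truncate_multi C) Tight [b1, b2] c 2 Tight [a] g p"
      using j_argument[of Tight "[b1, b2]" 2 "[a]" c g p]
      by (simp add: is_map_truncate Sub_truncate J_truncate op_short_cases arity_short_def op_long_def arity_long_def)
  next
    fix b1 b2 c g a p assume "is_map (truncate_multi C) Tight [b1, b2] c g" "is_map (truncate_multi C) Tight [a] b1 p"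
    then show "Sub (truncate_multi C) Tight [b1, b2] c 1 Loose [a] g (J (truncate_multi C) [a] b1 p) =
        J (truncate_multi C) [a, b2] c (Sub (truncate_multi C) Tight [b1, b2] c 1 Tight [a] g p)"
      using j_argument[of Tight "[b1, b2]" 1 "[a]" c g p]
      by (simp add: is_map_truncate Sub_truncate J_truncate op_short_cases arity_short_def op_long_def arity_long_def)
  next
    fix a b p c q assume "is_map (truncate_multi C) Tight [a] b p" "is_map (truncate_multi C) Tight [b] c q"
    then show "Sub (truncate_multi C) Tight [b] c 1 Loose [a] q (J (truncate_multi C) [a] b p) =
        J (truncate_multi C) [a] c (Sub (truncate_multi C) Tight [b] c 1 Tight [a] q p)"
      using j_argument[of Tight "[b]" 1 "[a]" c q p]
      by (simp add: is_map_truncate Sub_truncate J_truncate op_short_cases arity_short_def op_long_def arity_long_def)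
  next
    fix a1 a2 b g c p assume "is_map (truncate_multi C) Tight [a1, a2] b g" "is_map (truncate_multi C) Tight [b] c p"
    then show "Sub (truncate_multi C) Loose [b] c 1 Tight [a1, a2] (J (truncate_multi C) [b] c p) g =
        J (truncate_multi C) [a1, a2] c (Sub (truncate_multi C) Tight [b] c 1 Tight [a1, a2] p g)"
      using j_function[of "[b]" 1 Tight "[a1, a2]" c p g]
      by (simp add: is_map_truncate Sub_truncate J_truncate op_short_cases arity_short_def op_long_def arity_long_def)
  next
    fix b v c p assume "is_map (truncate_multi C) Loose [] b v" "is_map (truncate_multi C) Tight [b] c p"
    then show "Sub (truncate_multi C) Loose [b] c 1 Loose [] (J (truncate_multi C) [b] c p) v =
        Sub (truncate_multi C) Tight [b] c 1 Loose [] p v"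
      using j_function[of "[b]" 1 Loose "[]" c p v]
      by (simp add: is_map_truncate Sub_truncate J_truncate op_short_cases arity_short_def op_long_def arity_long_def)
  qed
qed

section \<open>Classifiers and truncation\<close>

lemma left_representable_truncate:
  assumes "skew_multicategory C" "left_representable C"
  shows "left_representable_short (truncate_multi C)"
proof -
  have ex: "\<exists>m t. is_map C x as m t \<and> (\<forall>ys b. set ys \<subseteq> Obj C \<and> b \<in> Obj C \<longrightarrow>
      bij_betw (\<lambda>f. Sub C Tight (m # ys) b 1 x as f t) (Maps C Tight (m # ys) b) (Maps C x (as @ ys) b))"
    if "arity_long x (length as)" "set as \<subseteq> Obj C" for x as
    using assms(2) that unfolding left_representable_def by blast
  have "\<forall>a b. \<exists>m t. a \<in> Obj C \<longrightarrow> b \<in> Obj C \<longrightarrow> is_map C Tight [a, b] m t \<and> (\<forall>ys d. set ys \<subseteq> Obj C \<and> d \<in> Obj C \<longrightarrow>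
      bij_betw (\<lambda>f. Sub C Tight (m # ys) d 1 Tight [a, b] f t) (Maps C Tight (m # ys) d) (Maps C Tight ([a, b] @ ys) d))"
    using ex[of Tight "[_, _]"] by (simp add: arity_long_def)
  then obtain m t where mt: "\<And>a b. a \<in> Obj C \<Longrightarrow> b \<in> Obj C \<Longrightarrow> is_map C Tight [a, b] (m a b) (t a b)"
    "\<And>a b ys d. \<lbrakk>a \<in> Obj C; b \<in> Obj C; set ys \<subseteq> Obj C; d \<in> Obj C\<rbrakk> \<Longrightarrow>
      bij_betw (\<lambda>f. Sub C Tight (m a b # ys) d 1 Tight [a, b] f (t a b)) (Maps C Tight (m a b # ys) d) (Maps C Tight ([a, b] @ ys) d)"
    unfolding choice_iff by metis
  obtain i u where iu: "is_map C Loose [] i u" "\<And>ys d. \<lbrakk>set ys \<subseteq> Obj C; d \<in> Obj C\<rbrakk> \<Longrightarrow>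
      bij_betw (\<lambda>f. Sub C Tight (i # ys) d 1 Loose [] f u) (Maps C Tight (i # ys) d) (Maps C Loose ([] @ ys) d)"
    using ex[of Loose "[]"] by (auto simp: arity_long_def)
  have "classifiers_short (truncate_multi C) \<lparr>ctens = m, ctheta = t, cunit = i, cnull = u\<rparr>"
    unfolding classifiers_short_def classifiers.simps truncate_simps
  proof (intro conjI ballI allI impI)
    fix a b assume "a \<in> Obj C" "b \<in> Obj C"
    then show "is_map (truncate_multi C) Tight [a, b] (m a b) (t a b)"
      using mt(1) by (simp add: is_map_truncate arity_short_def)
  next
    fix a b xs d assume o: "a \<in> Obj C" "b \<in> Obj C"
      and xs: "set xs \<subseteq> Obj C \<and> d \<in> Obj C \<and> Suc (length xs) \<in> {1, 2, 3}"
    then have l: "length xs = 0 \<or> length xs = 1 \<or> length xs = 2" by auto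
    have "op_short Tight (Suc (length xs)) (Suc 0) Tight (Suc (Suc 0))"
      "arity_short Tight (Suc (length xs))" "arity_short Tight (Suc (Suc (length xs)))"
      using l by (auto simp: op_short_def arity_short_def)
    then show "bij_betw (\<lambda>f. Sub (truncate_multi C) Tight (m a b # xs) d 1 Tight [a, b] f (t a b))
         (Maps (truncate_multi C) Tight (m a b # xs) d) (Maps (truncate_multi C) Tight (a # b # xs) d)"
      using mt(2)[of a b xs d] o xs by (simp add: Sub_truncate Maps_truncate)
  next
    show "is_map (truncate_multi C) Loose [] i u"
      using iu(1) by (simp add: is_map_truncate arity_short_def)
  next
    fix xs d assume xs: "set xs \<subseteq> Obj C \<and> d \<in> Obj C \<and> length xs \<in> {0, 1, 2}"
    then have "op_short Tight (Suc (length xs)) (Suc 0) Loose 0"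
      "arity_short Tight (Suc (length xs))" "arity_short Loose (length xs)"
      by (auto simp: op_short_def arity_short_def)
    then show "bij_betw (\<lambda>f. Sub (truncate_multi C) Tight (i # xs) d 1 Loose [] f u)
         (Maps (truncate_multi C) Tight (i # xs) d) (Maps (truncate_multi C) Loose xs d)"
      using iu(2)[of xs d] xs by (simp add: Sub_truncate Maps_truncate)
  qed
  then show ?thesis unfolding left_representable_short_def by blast
qed

lemma closed_truncate:
  assumes "closed_multi C"
  shows "closed_short (truncate_multi C)"
  unfolding closed_short_def
proof (intro ballI)
  fix b c assume "b \<in> Obj (truncate_multi C)" "c \<in> Obj (truncate_multi C)"
  then obtain h e where h: "h \<in> Obj C" "is_map C Tight [h, b] c e" and
    bij: "\<forall>x as. arity_long x (length as) \<and> set as \<subseteq> Obj C \<longrightarrow>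
        bij_betw (\<lambda>f. Sub C Tight [h, b] c 1 x as e f) (Maps C x as h) (Maps C x (as @ [b]) c)"
    using assms unfolding closed_multi_def truncate_simps by blast
  have b: "bij_betw (\<lambda>f. Sub (truncate_multi C) Tight [h, b] c 1 x xs e f)
      (Maps (truncate_multi C) x xs h) (Maps (truncate_multi C) x (xs @ [b]) c)"
    if "set xs \<subseteq> Obj C" "op_short Tight 2 (Suc 0) x (length xs)" "arity_short x (length xs)" "arity_short x (Suc (length xs))" for x xs
    using bij[rule_format, of x xs] that by (simp add: Sub_truncate Maps_truncate arity_short_long numeral_2_eq_2)
  show "\<exists>h e. h \<in> Obj (truncate_multi C) \<and> is_map (truncate_multi C) Tight [h, b] c e \<and>
      (\<forall>xs. set xs \<subseteq> Obj (truncate_multi C) \<and> length xs \<in> {1, 2, 3} \<longrightarrow>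
         bij_betw (\<lambda>f. Sub (truncate_multi C) Tight [h, b] c 1 Tight xs e f)
           (Maps (truncate_multi C) Tight xs h) (Maps (truncate_multi C) Tight (xs @ [b]) c)) \<and>
      (\<forall>xs. set xs \<subseteq> Obj (truncate_multi C) \<and> length xs \<in> {0, 1} \<longrightarrow>
         bij_betw (\<lambda>f. Sub (truncate_multi C) Tight [h, b] c 1 Loose xs e f)
           (Maps (truncate_multi C) Loose xs h) (Maps (truncate_multi C) Loose (xs @ [b]) c))"
  proof (intro exI[of _ h] exI[of _ e] conjI allI impI; (elim conjE)?)
    show "h \<in> Obj (truncate_multi C)" using h by simp
    show "is_map (truncate_multi C) Tight [h, b] c e" using h by (simp add: is_map_truncate arity_short_def)
  next
    fix xs assume "set xs \<subseteq> Obj (truncate_multi C)" "length xs \<in> {1, 2, 3}"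
    then show "bij_betw (\<lambda>f. Sub (truncate_multi C) Tight [h, b] c 1 Tight xs e f)
           (Maps (truncate_multi C) Tight xs h) (Maps (truncate_multi C) Tight (xs @ [b]) c)"
      by (intro b) (auto simp: op_short_def arity_short_def)
  next
    fix xs assume "set xs \<subseteq> Obj (truncate_multi C)" "length xs \<in> {0, 1}"
    then show "bij_betw (\<lambda>f. Sub (truncate_multi C) Tight [h, b] c 1 Loose xs e f)
           (Maps (truncate_multi C) Loose xs h) (Maps (truncate_multi C) Loose (xs @ [b]) c)"
      by (intro b) (auto simp: op_short_def arity_short_def)
  qed
qed

lemma multi_morphism_truncate:
  assumes F: "multi_morphism arity_long op_long C D F"
  shows "multi_morphism arity_short op_short (truncate_multi C) (truncate_multi D) (truncate_multimor F)"
proof -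
  note f = F[unfolded multi_morphism_def]
  show ?thesis
    unfolding multi_morphism_def
  proof (intro conjI ballI allI impI; (elim conjE)?)
    fix x as b g assume "arity_short x (length as)" "is_map (truncate_multi C) x as b g"
    then show "MM (truncate_multimor F) x as b g \<in> Maps (truncate_multi D) x (map (MO (truncate_multimor F)) as) (MO (truncate_multimor F) b)"
      using f by (simp add: truncate_multimor_def is_map_truncate Maps_truncate arity_short_long)
  next
    fix x bs c i y as g k
    assume op: "op_short x (length bs) i y (length as)" and m: "is_map (truncate_multi C) x bs c g"
      "is_map (truncate_multi C) y as (bs ! (i - 1)) k"
    then have "MM F (otype x i y) (plug bs i as) c (Sub C x bs c i y as g k) =
        Sub D x (map (MO F) bs) (MO F c) i y (map (MO F) as) (MM F x bs c g) (MM F y as (bs ! (i - 1)) k)"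
      using f op_short_long[OF op] unfolding is_map_truncate by blast
    moreover have "arity_short (otype x i y) (length (plug bs i as))"
      using op_short_arity[OF op] op_short_arities[OF op] by (simp add: length_plug)
    ultimately show "MM (truncate_multimor F) (otype x i y) (plug bs i as) c (Sub (truncate_multi C) x bs c i y as g k) =
        Sub (truncate_multi D) x (map (MO (truncate_multimor F)) bs) (MO (truncate_multimor F) c) i y
          (map (MO (truncate_multimor F)) as) (MM (truncate_multimor F) x bs c g)
          (MM (truncate_multimor F) y as (bs ! (i - 1)) k)"
      using op op_short_arities[OF op] by (simp add: truncate_multimor_def Sub_truncate)
  next
    fix as b g assume "arity_short Tight (length as)" "arity_short Loose (length as)" "is_map (truncate_multi C) Tight as b g"
    then show "MM (truncate_multimor F) Loose as b (J (truncate_multi C) as b g) =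
        J (truncate_multi D) (map (MO (truncate_multimor F)) as) (MO (truncate_multimor F) b) (MM (truncate_multimor F) Tight as b g)"
      using f by (simp add: truncate_multimor_def J_truncate is_map_truncate arity_short_long)
  next
    fix x as b g assume n: "\<not> (arity_short x (length as) \<and> is_map (truncate_multi C) x as b g)"
    have "\<And>x as b g. \<not> (arity_long x (length as) \<and> is_map C x as b g) \<Longrightarrow> MM F x as b g = undefined"
      using f by blast
    then show "MM (truncate_multimor F) x as b g = undefined"
      using n by (auto simp: truncate_multimor_def is_map_truncate)
  qed (use f in \<open>auto simp: truncate_multimor_def arity_short_def\<close>)
qed

lemma classified_short:
  assumes "short_skew_multicategory C" "classifiers_short C chi"
  shows "classified_multicategory arity_short op_short C chi"
proof -
  interpret truncated_multicategory arity_short op_short C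
    using assms(1) by (rule short_skew_multicategory.truncated_short)
  show ?thesis
  proof
    fix a b xs d assume a: "a \<in> Obj C" "b \<in> Obj C" "set xs \<subseteq> Obj C" "d \<in> Obj C"
      "arity_short Tight (length (a # b # xs))"
    then have "length xs \<le> 2" by (simp add: arity_short_def)
    then have "length xs = 0 \<or> length xs = 1 \<or> length xs = 2" by linarith
    then have "Suc (length xs) \<in> {1, 2, 3}" by auto
    then show "bij_betw (\<lambda>f. Sub C Tight (ctens chi a b # xs) d 1 Tight [a, b] f (ctheta chi a b))
        (Maps C Tight (ctens chi a b # xs) d) (Maps C Tight (a # b # xs) d)"
      using a assms(2) unfolding classifiers_short_def by blast
  next
    fix xs d assume a: "set xs \<subseteq> Obj C" "d \<in> Obj C" "arity_short Loose (length xs)"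
    then have "length xs \<in> {0, 1, 2}" by (auto simp: arity_short_def numeral_2_eq_2 le_Suc_eq)
    then show "bij_betw (\<lambda>f. Sub C Tight (cunit chi # xs) d 1 Loose [] f (cnull chi))
        (Maps C Tight (cunit chi # xs) d) (Maps C Loose xs d)"
      using a assms(2) unfolding classifiers_short_def by blast
  qed (use assms(2) in \<open>auto simp: classifiers_short_def\<close>)
qed

text \<open>
  If \<open>t'\<close> classifies maps with arbitrary further inputs \<open>ys\<close>, and \<open>t\<close> has the same inputs and classifies
  maps without further inputs, then \<open>t\<close> and \<open>t'\<close> differ by an isomorphism of their outputs, so \<open>t\<close>
  classifies maps with further inputs too.
\<close>

lemma (in truncated_multicategory) classifier_transfer:
  assumes t: "mm ar C t" "mm ar C t'" "kind t' = kind t" "inputs t' = inputs t"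
    and big: "\<And>ys b. \<lbrakk>set ys \<subseteq> Obj C; b \<in> Obj C; op Tight (Suc (length ys)) 1 (kind t) (length (inputs t))\<rbrakk> \<Longrightarrow>
      bij_betw (\<lambda>q. q \<odot> t') (maps_to Tight (out t' # ys) b) (maps_to (kind t) (inputs t @ ys) b)"
    and small: "\<And>b. b \<in> Obj C \<Longrightarrow> bij_betw (\<lambda>q. q \<odot> t) (maps_to Tight [out t] b) (maps_to (kind t) (inputs t) b)"
    and ys: "set ys \<subseteq> Obj C" "b \<in> Obj C" "op Tight (Suc (length ys)) 1 (kind t) (length (inputs t))"
  shows "bij_betw (\<lambda>q. q \<odot> t) (maps_to Tight (out t # ys) b) (maps_to (kind t) (inputs t @ ys) b)"
proof -
  have o: "out t \<in> Obj C" "out t' \<in> Obj C" using t by (auto simp: mm_def is_map_def)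
  have op1: "op Tight (Suc 0) (Suc 0) (kind t) (length (inputs t))"
    using op_outer[of "kind t"] t by (simp add: mm_def)
  have op11: "op Tight (Suc 0) (Suc 0) Tight (Suc 0)" using op_outer[of Tight 1] by simp
  have big1: "\<And>b. b \<in> Obj C \<Longrightarrow> bij_betw (\<lambda>q. q \<odot> t') (maps_to Tight [out t'] b) (maps_to (kind t) (inputs t) b)"
    using big[of "[]"] op1 by simp
  have "t \<in> maps_to (kind t) (inputs t) (out t)" "t' \<in> maps_to (kind t) (inputs t) (out t')"
    using t by (auto simp: maps_to_def)
  then have "t \<in> (\<lambda>q. q \<odot> t') ` maps_to Tight [out t'] (out t)" "t' \<in> (\<lambda>q. q \<odot> t) ` maps_to Tight [out t] (out t')"
    using big1[OF o(1)] small[OF o(2)] by (simp_all add: bij_betw_def)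
  then obtain k k' where k: "k \<in> maps_to Tight [out t'] (out t)" "t = k \<odot> t'"
    and k': "k' \<in> maps_to Tight [out t] (out t')" "t' = k' \<odot> t"
    by blast
  have kk: "mm ar C k" "kind k = Tight" "inputs k = [out t']" "out k = out t"
    "mm ar C k'" "kind k' = Tight" "inputs k' = [out t]" "out k' = out t'"
    using k(1) k'(1) unfolding maps_to_def by simp_all
  \<comment> \<open>\<open>k\<close> and \<open>k'\<close> are mutually inverse by uniqueness of factorisations\<close>
  have 1: "k' \<odot> k = idm C (out t')"
  proof -
    have eq: "(k' \<odot> k) \<odot> t' = idm C (out t') \<odot> t'"
      using sub_assoc[of k' "Suc 0" k "Suc 0" t'] outer[of Tight 1 1 "kind t" "length (inputs t)"] t kk k(2)[symmetric] k'(2)[symmetric] op1 by simp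
    have inj: "inj_on (\<lambda>q. q \<odot> t') (maps_to Tight [out t'] (out t'))"
      using big1[OF o(2)] by (simp add: bij_betw_def)
    show ?thesis
      by (rule inj_onD[OF inj eq]) (use kk op11 o in \<open>auto simp: maps_to_def\<close>)
  qed
  have 2: "k \<odot> k' = idm C (out t)"
  proof -
    have eq: "(k \<odot> k') \<odot> t = idm C (out t) \<odot> t"
      using sub_assoc[of k "Suc 0" k' "Suc 0" t] outer[of Tight 1 1 "kind t" "length (inputs t)"] t kk k(2)[symmetric] k'(2)[symmetric] op1 by simp
    have inj: "inj_on (\<lambda>q. q \<odot> t) (maps_to Tight [out t] (out t))"
      using small[OF o(1)] by (simp add: bij_betw_def)
    show ?thesis
      by (rule inj_onD[OF inj eq]) (use kk op11 o in \<open>auto simp: maps_to_def\<close>)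
  qed
  have ar: "ar Tight (Suc (length ys))" using op_ar[OF ys(3)] by simp
  have opi: "op Tight (Suc (length ys)) (Suc 0) Tight (Suc 0)" using op_inner[OF ar, of 1] by simp
  have mid: "(q \<odot> f) \<odot> g = q \<odot> (f \<odot> g)" if "mm ar C q" "kind q = Tight" "inputs q = out f # ys"
    "mm ar C f" "kind f = Tight" "inputs f = [out g]" "mm ar C g"
    "op Tight (Suc (length ys)) (Suc 0) (kind g) (length (inputs g))" for q f g
    using sub_assoc[of q "Suc 0" f "Suc 0" g] middle[OF that(8)] that by simp
  have b1: "bij_betw (\<lambda>q. q \<odot> k) (maps_to Tight (out t # ys) b) (maps_to Tight (out t' # ys) b)"
  proof (rule bij_betw_byWitness[where f' = "\<lambda>q. q \<odot> k'"])
    show "\<forall>q\<in>maps_to Tight (out t # ys) b. (q \<odot> k) \<odot> k' = q"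
      using mid[of _ k k'] kk 2 opi by (auto simp: maps_to_def)
    show "\<forall>q\<in>maps_to Tight (out t' # ys) b. (q \<odot> k') \<odot> k = q"
      using mid[of _ k' k] kk 1 opi by (auto simp: maps_to_def)
  qed (use kk opi in \<open>auto simp: maps_to_def\<close>)
  have "bij_betw ((\<lambda>q. q \<odot> t') \<circ> (\<lambda>q. q \<odot> k)) (maps_to Tight (out t # ys) b) (maps_to (kind t) (inputs t @ ys) b)"
    by (rule bij_betw_trans[OF b1 big[OF ys]])
  moreover have "((\<lambda>q. q \<odot> t') \<circ> (\<lambda>q. q \<odot> k)) q = q \<odot> t" if "q \<in> maps_to Tight (out t # ys) b" for q
  proof -
    have "(q \<odot> k) \<odot> t' = q \<odot> (k \<odot> t')"
      by (rule mid) (use that kk t ys in \<open>simp_all add: maps_to_def\<close>)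
    then show ?thesis unfolding k(2)[symmetric] by (simp only: comp_def)
  qed
  ultimately show ?thesis by (rule iffD1[OF bij_betw_cong, rotated])
qed

text \<open>
  The classifiers chosen for the truncation of \<open>C\<close> are classifiers of \<open>C\<close> for all arities: left
  representability of \<open>C\<close> provides classifiers for all arities with the same inputs, and the property is
  transferred from these.
\<close>

lemma classified_long:
  assumes C: "skew_multicategory C" and rep: "left_representable C"
    and chi: "classifiers_short (truncate_multi C) chi"
  shows "classified_multicategory arity_long op_long C chi"
proof -
  interpret truncated_multicategory arity_long op_long C
    using C by (rule skew_multicategory.truncated_long)
  have ex: "\<exists>m t. is_map C x as m t \<and> (\<forall>ys b. set ys \<subseteq> Obj C \<and> b \<in> Obj C \<longrightarrow>
      bij_betw (\<lambda>f. Sub C Tight (m # ys) b 1 x as f t) (Maps C Tight (m # ys) b) (Maps C x (as @ ys) b))"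
    if "arity_long x (length as)" "set as \<subseteq> Obj C" for x as
    using rep that unfolding left_representable_def by blast
  have up: "bij_betw (\<lambda>f. Sub C Tight (m # ys) b 1 x as f t) (Maps C Tight (m # ys) b) (Maps C x (as @ ys) b)"
    if a: "arity_long x (length as)" "is_map C x as m t" "set ys \<subseteq> Obj C" "b \<in> Obj C"
     and s: "\<And>b. b \<in> Obj C \<Longrightarrow> bij_betw (\<lambda>f. Sub C Tight [m] b 1 x as f t) (Maps C Tight [m] b) (Maps C x as b)"
    for x as m t ys b
  proof -
    have o: "set as \<subseteq> Obj C" "m \<in> Obj C" using a by (auto simp: is_map_def)
    obtain m' t' where t': "is_map C x as m' t'" "\<And>ys b. \<lbrakk>set ys \<subseteq> Obj C; b \<in> Obj C\<rbrakk> \<Longrightarrow>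
      bij_betw (\<lambda>f. Sub C Tight (m' # ys) b 1 x as f t') (Maps C Tight (m' # ys) b) (Maps C x (as @ ys) b)"
      using ex[OF a(1) o(1)] by blast
    have o': "m' \<in> Obj C" using t' by (auto simp: is_map_def)
    have ar: "arity_long x (length (as @ ys))" "arity_long x (length as)" for ys :: "'a list" using a(1) by (auto simp: arity_long_def)
    let ?t = "(x, as, m, t)" and ?t' = "(x, as, m', t')"
    have "bij_betw (\<lambda>q. q \<odot> ?t) (maps_to Tight (out ?t # ys) b) (maps_to (kind ?t) (inputs ?t @ ys) b)"
    proof (rule classifier_transfer[of ?t ?t'])
      show "mm arity_long C ?t" "mm arity_long C ?t'" using a t' by (auto simp: mm_def)
      show "bij_betw (\<lambda>q. q \<odot> ?t') (maps_to Tight (out ?t' # ys) b) (maps_to (kind ?t) (inputs ?t @ ys) b)"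
        if "set ys \<subseteq> Obj C" "b \<in> Obj C" for ys b
        using t'(2)[OF that] that o o' ar
        by (subst bij_betw_elem_iff[where F = "\<lambda>f. Sub C Tight (m' # ys) b 1 x as f t'"]) (auto simp: sub_def arity_long_def)
      show "bij_betw (\<lambda>q. q \<odot> ?t) (maps_to Tight [out ?t] b) (maps_to (kind ?t) (inputs ?t) b)" if "b \<in> Obj C" for b
        using s[OF that] that o ar
        by (subst bij_betw_elem_iff[where F = "\<lambda>f. Sub C Tight [m] b 1 x as f t"]) (auto simp: sub_def arity_long_def)
      show "op_long Tight (Suc (length ys)) 1 (kind ?t) (length (inputs ?t))"
        using a(1) by (simp add: op_long_def arity_long_def)
    qed (use a in simp_all)
    then show ?thesis
      using a(3,4) o ar
      by (subst (asm) bij_betw_elem_iff[where F = "\<lambda>f. Sub C Tight (m # ys) b 1 x as f t"]) (auto simp: sub_def arity_long_def)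
  qed
  show ?thesis
  proof
    fix a b assume o: "a \<in> Obj C" "b \<in> Obj C"
    then show m: "is_map C Tight [a, b] (ctens chi a b) (ctheta chi a b)"
      using chi by (simp add: classifiers_short_def is_map_truncate)
    fix xs d assume xs: "set xs \<subseteq> Obj C" "d \<in> Obj C"
    have "bij_betw (\<lambda>f. Sub C Tight [ctens chi a b] d 1 Tight [a, b] f (ctheta chi a b))
        (Maps C Tight [ctens chi a b] d) (Maps C Tight [a, b] d)" if "d \<in> Obj C" for d
    proof -
      have "bij_betw (\<lambda>f. Sub (truncate_multi C) Tight [ctens chi a b] d 1 Tight [a, b] f (ctheta chi a b))
        (Maps (truncate_multi C) Tight [ctens chi a b] d) (Maps (truncate_multi C) Tight [a, b] d)"
        using chi o that unfolding classifiers_short_def by (metis Maps_truncate empty_subsetI insertI1 list.set(1) list.size(3) One_nat_def truncate_simps(1))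
      then show ?thesis by (simp add: Sub_truncate Maps_truncate op_short_def arity_short_def)
    qed
    then show "bij_betw (\<lambda>f. Sub C Tight (ctens chi a b # xs) d 1 Tight [a, b] f (ctheta chi a b))
        (Maps C Tight (ctens chi a b # xs) d) (Maps C Tight (a # b # xs) d)"
      using up[OF _ m xs] by (simp add: arity_long_def)
  next
    show m: "is_map C Loose [] (cunit chi) (cnull chi)"
      using chi by (simp add: classifiers_short_def is_map_truncate)
    fix xs d assume xs: "set xs \<subseteq> Obj C" "d \<in> Obj C"
    have "bij_betw (\<lambda>f. Sub C Tight [cunit chi] d 1 Loose [] f (cnull chi))
        (Maps C Tight [cunit chi] d) (Maps C Loose [] d)" if "d \<in> Obj C" for d
    proof -
      have "bij_betw (\<lambda>f. Sub (truncate_multi C) Tight [cunit chi] d 1 Loose [] f (cnull chi))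
        (Maps (truncate_multi C) Tight [cunit chi] d) (Maps (truncate_multi C) Loose [] d)"
        using chi that unfolding classifiers_short_def by (metis empty_subsetI insertI1 list.set(1) list.size(3) truncate_simps(1))
      then show ?thesis by (simp add: Sub_truncate Maps_truncate op_short_def arity_short_def)
    qed
    then show "bij_betw (\<lambda>f. Sub C Tight (cunit chi # xs) d 1 Loose [] f (cnull chi))
        (Maps C Tight (cunit chi # xs) d) (Maps C Loose xs d)"
      using up[OF _ m xs] by (simp add: arity_long_def)
  qed
qed

section \<open>Closedness\<close>

text \<open>
  The counit of an adjunction gives universal arrows; the inverse of \<open>k \<mapsto> e \<cdot> F k\<close> is transposition along
  the unit.
\<close>

lemma has_right_adjoint_universal:
  assumes "has_right_adjoint C D F" "is_functor C D F" "d \<in> Ob D"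
  shows "\<exists>h e. h \<in> Ob C \<and> arr D e \<and> source e = FO F h \<and> target e = d \<and>
    (\<forall>a\<in>Ob C. bij_betw (\<lambda>k. cmp D e (fmap F k)) {k. arr C k \<and> source k = a \<and> target k = h}
       {f. arr D f \<and> source f = FO F a \<and> target f = d})"
proof -
  interpret functor_laws C D F using assms(2) by (simp add: functor_laws_iff)
  obtain G eta eps where G: "is_functor D C G"
    and eta: "nat_trans C C id_fctr (comp_fctr G F) eta"
    and eps: "nat_trans D D (comp_fctr F G) id_fctr eps"
    and t1: "\<forall>a\<in>Ob C. Comp D (FO F a) (FO F (FO G (FO F a))) (FO F a)
            (eps (FO F a)) (FA F a (FO G (FO F a)) (eta a)) = Idn D (FO F a)"
    and t2: "\<forall>d\<in>Ob D. Comp C (FO G d) (FO G (FO F (FO G d))) (FO G d)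
            (FA G (FO F (FO G d)) d (eps d)) (eta (FO G d)) = Idn C (FO G d)"
    using assms(1) unfolding has_right_adjoint_def by blast
  interpret G: functor_laws D C G using G by (simp add: functor_laws_iff)
  define H where "H a = (a, eta a, FO G (FO F a))" for a
  define e where "e d = (FO F (FO G d), eps d, d)" for d
  have H: "source (H a) = a" "target (H a) = FO G (FO F a)" for a by (simp_all add: H_def)
  have e: "source (e d) = FO F (FO G d)" "target (e d) = d" for d by (simp_all add: e_def)
  have aH: "arr C (H a)" if "a \<in> Ob C" for a
    using eta that by (simp add: nat_trans_def id_fctr_def comp_fctr_def H_def)
  have ae: "arr D (e d)" if "d \<in> Ob D" for d
    using eps that by (simp add: nat_trans_def id_fctr_def comp_fctr_def e_def)
  have nH: "H (target f) \<cdot>\<^bsub>C\<^esub> f = fmap G (fmap F f) \<cdot>\<^bsub>C\<^esub> H (source f)" if "arr C f" for f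
    using eta that arr_source[OF that] arr_target[OF that]
    by (simp add: nat_trans_def id_fctr_def comp_fctr_def H_def cmp_def fmap_def arr_def del: arr_source arr_target)
  have ne: "e (target f) \<cdot>\<^bsub>D\<^esub> fmap F (fmap G f) = f \<cdot>\<^bsub>D\<^esub> e (source f)" if "arr D f" for f
    using eps that arr_source[OF that] arr_target[OF that]
    by (simp add: nat_trans_def id_fctr_def comp_fctr_def e_def cmp_def fmap_def arr_def del: arr_source arr_target)
  have T1: "e (FO F a) \<cdot>\<^bsub>D\<^esub> fmap F (H a) = \<I>\<^bsub>D\<^esub> (FO F a)" if "a \<in> Ob C" for a
    using t1 that by (simp add: e_def H_def cmp_def fmap_def idar_def)
  have T2: "fmap G (e d) \<cdot>\<^bsub>C\<^esub> H (FO G d) = \<I>\<^bsub>C\<^esub> (FO G d)" if "d \<in> Ob D" for d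
    using t2 that by (simp add: e_def H_def cmp_def fmap_def idar_def)
  note d = assms(3)
  have "bij_betw (\<lambda>k. cmp D (e d) (fmap F k)) {k. arr C k \<and> source k = a \<and> target k = FO G d}
       {f. arr D f \<and> source f = FO F a \<and> target f = d}" if a: "a \<in> Ob C" for a
  proof (rule bij_betw_byWitness[where f' = "\<lambda>f. fmap G f \<cdot>\<^bsub>C\<^esub> H a"])
    show "\<forall>k\<in>{k. arr C k \<and> source k = a \<and> target k = FO G d}. fmap G (e d \<cdot>\<^bsub>D\<^esub> fmap F k) \<cdot>\<^bsub>C\<^esub> H a = k"
    proof
      fix k assume "k \<in> {k. arr C k \<and> source k = a \<and> target k = FO G d}"
      then have k: "arr C k" "source k = a" "target k = FO G d" by simp_all
      have "fmap G (e d \<cdot>\<^bsub>D\<^esub> fmap F k) \<cdot>\<^bsub>C\<^esub> H a = fmap G (e d) \<cdot>\<^bsub>C\<^esub> (fmap G (fmap F k) \<cdot>\<^bsub>C\<^esub> H (source k))"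
        using k d e aH[OF a] ae[OF d] H by simp
      also have "\<dots> = (fmap G (e d) \<cdot>\<^bsub>C\<^esub> H (FO G d)) \<cdot>\<^bsub>C\<^esub> k"
        using nH[OF k(1)] k d e aH[of "FO G d"] ae[OF d] H by simp
      finally show "fmap G (e d \<cdot>\<^bsub>D\<^esub> fmap F k) \<cdot>\<^bsub>C\<^esub> H a = k" using T2[OF d] k by simp
    qed
    show "\<forall>f\<in>{f. arr D f \<and> source f = FO F a \<and> target f = d}. e d \<cdot>\<^bsub>D\<^esub> fmap F (fmap G f \<cdot>\<^bsub>C\<^esub> H a) = f"
    proof
      fix f assume "f \<in> {f. arr D f \<and> source f = FO F a \<and> target f = d}"
      then have f: "arr D f" "source f = FO F a" "target f = d" by simp_all
      have "e d \<cdot>\<^bsub>D\<^esub> fmap F (fmap G f \<cdot>\<^bsub>C\<^esub> H a) = (e (target f) \<cdot>\<^bsub>D\<^esub> fmap F (fmap G f)) \<cdot>\<^bsub>D\<^esub> fmap F (H a)"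
        using f d e aH[OF a] ae[OF d] H by simp
      also have "\<dots> = f \<cdot>\<^bsub>D\<^esub> (e (FO F a) \<cdot>\<^bsub>D\<^esub> fmap F (H a))"
        using ne[OF f(1)] f a e aH[OF a] ae[of "FO F a"] H by simp
      finally show "e d \<cdot>\<^bsub>D\<^esub> fmap F (fmap G f \<cdot>\<^bsub>C\<^esub> H a) = f" using T1[OF a] f by simp
    qed
  qed (use a d e ae[OF d] aH[OF a] H in auto)
  then show ?thesis using d e ae[OF d] by (intro exI[of _ "FO G d"] exI[of _ "e d"]) simp
qed

text \<open>
  Universal arrows from a functor to each object assemble to a right adjoint.
\<close>

lemma has_right_adjointI:
  assumes F: "is_functor C D F"
    and univ: "\<And>d. d \<in> Ob D \<Longrightarrow> \<exists>h e. h \<in> Ob C \<and> arr D e \<and> source e = FO F h \<and> target e = d \<and>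
    (\<forall>a\<in>Ob C. bij_betw (\<lambda>k. cmp D e (fmap F k)) {k. arr C k \<and> source k = a \<and> target k = h}
       {f. arr D f \<and> source f = FO F a \<and> target f = d})"
  shows "has_right_adjoint C D F"
proof -
  interpret functor_laws C D F using F by (simp add: functor_laws_iff)
  define Q where "Q d h e \<longleftrightarrow> h \<in> Ob C \<and> arr D e \<and> source e = FO F h \<and> target e = d \<and>
    (\<forall>a\<in>Ob C. bij_betw (\<lambda>k. cmp D e (fmap F k)) {k. arr C k \<and> source k = a \<and> target k = h}
       {f. arr D f \<and> source f = FO F a \<and> target f = d})" for d h e
  have "\<forall>d\<in>Ob D. \<exists>h e. Q d h e" using univ unfolding Q_def by blast
  then obtain h where "\<forall>d\<in>Ob D. \<exists>e. Q d (h d) e" by (rule bchoice[THEN exE])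
  then obtain e where Q: "\<forall>d\<in>Ob D. Q d (h d) (e d)" by (rule bchoice[THEN exE])
  have h [simp]: "h d \<in> Ob C" and e [simp]: "arr D (e d)" "source (e d) = FO F (h d)" "target (e d) = d"
    and bij: "a \<in> Ob C \<Longrightarrow> bij_betw (\<lambda>k. cmp D (e d) (fmap F k))
       {k. arr C k \<and> source k = a \<and> target k = h d} {f. arr D f \<and> source f = FO F a \<and> target f = d}"
    if "d \<in> Ob D" for d a
    using Q that unfolding Q_def by blast+
  have inj: "k = l" if "arr C k" "arr C l" "source k = source l" "target k = h d" "target l = h d" "d \<in> Ob D"
    "e d \<cdot>\<^bsub>D\<^esub> fmap F k = e d \<cdot>\<^bsub>D\<^esub> fmap F l" for k l d
  proof -
    have "inj_on (\<lambda>k. cmp D (e d) (fmap F k)) {k'. arr C k' \<and> source k' = source k \<and> target k' = h d}"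
      using bij[of d "source k"] that by (simp add: bij_betw_def)
    then show ?thesis by (rule inj_onD) (use that in auto)
  qed
  \<comment> \<open>the transpose of an arrow \<open>f\<close> from \<open>F a\<close>\<close>
  define tr where "tr a f = (SOME k. arr C k \<and> source k = a \<and> target k = h (target f) \<and> e (target f) \<cdot>\<^bsub>D\<^esub> fmap F k = f)" for a f
  have tr: "arr C (tr a f)" "source (tr a f) = a" "target (tr a f) = h (target f)"
      "e (target f) \<cdot>\<^bsub>D\<^esub> fmap F (tr a f) = f" if f: "arr D f" "source f = FO F a" and a: "a \<in> Ob C" for a f
  proof -
    have "f \<in> (\<lambda>k. cmp D (e (target f)) (fmap F k)) ` {k. arr C k \<and> source k = a \<and> target k = h (target f)}"
      using bij[of "target f" a] f a by (simp add: bij_betw_def)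
    then obtain k where k: "f = e (target f) \<cdot>\<^bsub>D\<^esub> fmap F k" "k \<in> {k. arr C k \<and> source k = a \<and> target k = h (target f)}"
      by (rule imageE)
    have "\<exists>k. arr C k \<and> source k = a \<and> target k = h (target f) \<and> e (target f) \<cdot>\<^bsub>D\<^esub> fmap F k = f"
      using k(2) k(1)[symmetric] by (intro exI[of _ k]) simp
    from someI_ex[OF this] show "arr C (tr a f)" "source (tr a f) = a" "target (tr a f) = h (target f)"
      "e (target f) \<cdot>\<^bsub>D\<^esub> fmap F (tr a f) = f" unfolding tr_def by auto
  qed
  define G1 where "G1 f = tr (h (source f)) (f \<cdot>\<^bsub>D\<^esub> e (source f))" for f
  have G1: "arr C (G1 f)" "source (G1 f) = h (source f)" "target (G1 f) = h (target f)"
    "e (target f) \<cdot>\<^bsub>D\<^esub> fmap F (G1 f) = f \<cdot>\<^bsub>D\<^esub> e (source f)" if f: "arr D f" for f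
    using tr[of "f \<cdot>\<^bsub>D\<^esub> e (source f)" "h (source f)"] f by (simp_all add: G1_def)
  define G where "G = \<lparr> FO = h, FA = (\<lambda>a b m. label (G1 (a, m, b))) \<rparr>"
  have FOG [simp]: "FO G = h" by (simp add: G_def)
  have G: "fmap G f = G1 f" if "arr D f" for f
    using G1[OF that] by (simp add: fmap_def G_def prod_eq_iff)
  have GF: "is_functor D C G"
    unfolding is_functor_iff
  proof (intro conjI ballI allI impI)
    show "category D" "category C" by (rule D.category C.category)+
    show "\<And>d. d \<in> Ob D \<Longrightarrow> FO G d \<in> Ob C" by simp
    show "\<And>f. arr D f \<Longrightarrow> arr C (fmap G f)" using G G1 by simp
    fix d assume d: "d \<in> Ob D"
    then have ad: "arr D (\<I>\<^bsub>D\<^esub> d)" by simp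
    show "fmap G (\<I>\<^bsub>D\<^esub> d) = \<I>\<^bsub>C\<^esub> (FO G d)"
      unfolding G[OF ad] using G1[OF ad] d by (intro inj[of _ _ d]) simp_all
  next
    fix f g assume a: "arr D f" "arr D g" "target f = source g"
    then have gf: "arr D (g \<cdot>\<^bsub>D\<^esub> f)" by simp
    have "e (target g) \<cdot>\<^bsub>D\<^esub> fmap F (G1 g \<cdot>\<^bsub>C\<^esub> G1 f) = (e (target g) \<cdot>\<^bsub>D\<^esub> fmap F (G1 g)) \<cdot>\<^bsub>D\<^esub> fmap F (G1 f)"
      using a G1(1-3)[OF a(1)] G1(1-3)[OF a(2)] by simp
    also have "\<dots> = g \<cdot>\<^bsub>D\<^esub> (e (target f) \<cdot>\<^bsub>D\<^esub> fmap F (G1 f))"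
      unfolding G1(4)[OF a(2)] using a G1(1-3)[OF a(1)] by simp
    also have "\<dots> = e (target g) \<cdot>\<^bsub>D\<^esub> fmap F (G1 (g \<cdot>\<^bsub>D\<^esub> f))"
      unfolding G1(4)[OF a(1)] using G1(4)[OF gf] a by simp
    finally have "G1 g \<cdot>\<^bsub>C\<^esub> G1 f = G1 (g \<cdot>\<^bsub>D\<^esub> f)"
      using a G1(1-3)[OF a(1)] G1(1-3)[OF a(2)] G1(1-3)[OF gf] by (intro inj[of _ _ "target g"]) simp_all
    then show "fmap G (g \<cdot>\<^bsub>D\<^esub> f) = fmap G g \<cdot>\<^bsub>C\<^esub> fmap G f"
      using a gf by (simp add: G)
  qed
  define H where "H a = tr a (\<I>\<^bsub>D\<^esub> (FO F a))" for a
  have H: "arr C (H a)" "source (H a) = a" "target (H a) = h (FO F a)" "e (FO F a) \<cdot>\<^bsub>D\<^esub> fmap F (H a) = \<I>\<^bsub>D\<^esub> (FO F a)"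
    if "a \<in> Ob C" for a
    using tr[of "\<I>\<^bsub>D\<^esub> (FO F a)" a] that by (simp_all add: H_def)
  have nH: "H (target f) \<cdot>\<^bsub>C\<^esub> f = G1 (fmap F f) \<cdot>\<^bsub>C\<^esub> H (source f)" if f: "arr C f" for f
  proof -
    note o = arr_source[OF f] arr_target[OF f]
    note g = G1[OF arr_fmap[OF f]]
    have "e (FO F (target f)) \<cdot>\<^bsub>D\<^esub> fmap F (H (target f) \<cdot>\<^bsub>C\<^esub> f) =
        (e (FO F (target f)) \<cdot>\<^bsub>D\<^esub> fmap F (H (target f))) \<cdot>\<^bsub>D\<^esub> fmap F f"
      using f o H(1-3)[OF o(2)] by simp
    also have "\<dots> = fmap F f \<cdot>\<^bsub>D\<^esub> (e (FO F (source f)) \<cdot>\<^bsub>D\<^esub> fmap F (H (source f)))"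
      unfolding H(4)[OF o(1)] H(4)[OF o(2)] using f by simp
    also have "\<dots> = (fmap F f \<cdot>\<^bsub>D\<^esub> e (FO F (source f))) \<cdot>\<^bsub>D\<^esub> fmap F (H (source f))"
      using f o H(1-3)[OF o(1)] by simp
    also have "\<dots> = (e (FO F (target f)) \<cdot>\<^bsub>D\<^esub> fmap F (G1 (fmap F f))) \<cdot>\<^bsub>D\<^esub> fmap F (H (source f))"
      using g(4) by simp
    also have "\<dots> = e (FO F (target f)) \<cdot>\<^bsub>D\<^esub> fmap F (G1 (fmap F f) \<cdot>\<^bsub>C\<^esub> H (source f))"
      using f o g(1-3) H(1-3)[OF o(1)] by simp
    finally show ?thesis
      using f o g(1-3) H(1-3)[OF o(1)] H(1-3)[OF o(2)] by (intro inj[of _ _ "FO F (target f)"]) simp_all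
  qed
  have T2: "G1 (e d) \<cdot>\<^bsub>C\<^esub> H (h d) = \<I>\<^bsub>C\<^esub> (h d)" if d: "d \<in> Ob D" for d
  proof -
    note g = G1[OF e(1)[OF d]] and H' = H[OF h[OF d]]
    have "e d \<cdot>\<^bsub>D\<^esub> fmap F (G1 (e d) \<cdot>\<^bsub>C\<^esub> H (h d)) = (e (target (e d)) \<cdot>\<^bsub>D\<^esub> fmap F (G1 (e d))) \<cdot>\<^bsub>D\<^esub> fmap F (H (h d))"
      using d g(1-3) H'(1-3) by simp
    also have "\<dots> = e d \<cdot>\<^bsub>D\<^esub> (e (FO F (h d)) \<cdot>\<^bsub>D\<^esub> fmap F (H (h d)))"
      unfolding g(4) using d H'(1-3) by simp
    also have "\<dots> = e d \<cdot>\<^bsub>D\<^esub> fmap F (\<I>\<^bsub>C\<^esub> (h d))"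
      unfolding H'(4) using d by simp
    finally show ?thesis
      using d g(1-3) H'(1-3) by (intro inj[of _ _ d]) simp_all
  qed
  have eta: "nat_trans C C id_fctr (comp_fctr G F) (\<lambda>a. label (H a))"
    unfolding nat_trans_def
  proof (intro conjI ballI)
    fix a assume a: "a \<in> Ob C"
    show "label (H a) \<in> Hom C (FO id_fctr a) (FO (comp_fctr G F) a)"
      using H(1-3)[OF a] by (simp add: id_fctr_def comp_fctr_def arr_def del: arr_source arr_target)
  next
    fix a b f assume a: "a \<in> Ob C" and b: "b \<in> Ob C" and "f \<in> Hom C a b"
    then have f: "arr C (a, f, b)" by simp
    from arg_cong[OF nH[OF f], of label]
    show "Comp C (FO id_fctr a) (FO id_fctr b) (FO (comp_fctr G F) b) (label (H b)) (FA id_fctr a b f) =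
        Comp C (FO id_fctr a) (FO (comp_fctr G F) a) (FO (comp_fctr G F) b) (FA (comp_fctr G F) a b f) (label (H a))"
      using H(2,3)[OF a] H(2,3)[OF b] G1(2,3)[OF arr_fmap[OF f]]
      by (simp add: id_fctr_def comp_fctr_def cmp_def G_def fmap_def)
  qed
  have eps: "nat_trans D D (comp_fctr F G) id_fctr (\<lambda>d. label (e d))"
    unfolding nat_trans_def
  proof (intro conjI ballI)
    fix d assume d: "d \<in> Ob D"
    show "label (e d) \<in> Hom D (FO (comp_fctr F G) d) (FO id_fctr d)"
      using e[OF d] by (simp add: id_fctr_def comp_fctr_def arr_def del: arr_source arr_target e)
  next
    fix c d f assume c: "c \<in> Ob D" and d: "d \<in> Ob D" and "f \<in> Hom D c d"
    then have f: "arr D (c, f, d)" by simp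
    from arg_cong[OF G1(4)[OF f], of label]
    show "Comp D (FO (comp_fctr F G) c) (FO (comp_fctr F G) d) (FO id_fctr d) (label (e d)) (FA (comp_fctr F G) c d f) =
        Comp D (FO (comp_fctr F G) c) (FO id_fctr c) (FO id_fctr d) (FA id_fctr c d f) (label (e c))"
      using G1(2,3)[OF f] c d
      by (simp add: id_fctr_def comp_fctr_def cmp_def G_def fmap_def)
  qed
  have t1: "Comp D (FO F a) (FO F (FO G (FO F a))) (FO F a) (label (e (FO F a)))
      (FA F a (FO G (FO F a)) (label (H a))) = Idn D (FO F a)" if a: "a \<in> Ob C" for a
    using arg_cong[OF H(4)[OF a], of label] H(2,3)[OF a] a by (simp add: cmp_def fmap_def idar_def)
  have t2: "Comp C (FO G d) (FO G (FO F (FO G d))) (FO G d)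
            (FA G (FO F (FO G d)) d (label (e d))) (label (H (FO G d))) = Idn C (FO G d)" if d: "d \<in> Ob D" for d
  proof -
    have ed: "(FO F (h d), label (e d), d) = e d" using d by (simp add: prod_eq_iff)
    show ?thesis
      using arg_cong[OF T2[OF d], of label] H(2,3)[OF h[OF d]] G1(2,3)[OF e(1)[OF d]] d
      by (simp add: cmp_def G_def idar_def ed)
  qed
  show ?thesis
    unfolding has_right_adjoint_def using GF eta eps t1 t2 by blast
qed

lemma (in tensor_category) fmap_tensor_right: "fmap (tensor_right S b) f = f \<star> \<I> b"
  by (simp add: fmap_def tensor_right_def tns_def idar_def)

lemma (in tensor_category) tensor_right_functor:
  assumes "b \<in> Ob S"
  shows "is_functor S S (tensor_right S b)"
  unfolding is_functor_iff fmap_tensor_right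
  using assms by (simp add: underlying_category) (simp add: tensor_right_def)

lemma FO_tensor_right [simp]: "FO (tensor_right S b) a = TO S a b"
  by (simp add: tensor_right_def)

lemma arrows_image:
  assumes "a \<in> Ob C" "h \<in> Ob C"
  shows "{k. arr C k \<and> source k = a \<and> target k = h} = (\<lambda>m. (a, m, h)) ` Hom C a h"
  using assms by (auto simp: arr_def image_iff simp del: arr_source arr_target)

text \<open>
  Passes from bijections between arrows to bijections between hom-sets.
\<close>

lemma bij_betw_labels:
  assumes "bij_betw \<Phi> {k. arr C k \<and> source k = a \<and> target k = h} {k. arr D k \<and> source k = a' \<and> target k = h'}"
    "a \<in> Ob C" "h \<in> Ob C"
    "\<And>m. m \<in> Hom C a h \<Longrightarrow> F m = label (\<Phi> (a, m, h))"
    and "a' \<in> Ob D" "h' \<in> Ob D"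
  shows "bij_betw F (Hom C a h) (Hom D a' h')"
proof -
  have 1: "bij_betw (\<lambda>m. (a, m, h)) (Hom C a h) {k. arr C k \<and> source k = a \<and> target k = h}"
    unfolding arrows_image[OF assms(2,3)] by (auto simp: bij_betw_def inj_on_def)
  have 2: "bij_betw label {k. arr D k \<and> source k = a' \<and> target k = h'} (Hom D a' h')"
    unfolding arrows_image[OF assms(5,6)] by (auto simp: bij_betw_def inj_on_def image_image)
  have "bij_betw (label \<circ> (\<Phi> \<circ> (\<lambda>m. (a, m, h)))) (Hom C a h) (Hom D a' h')"
    by (rule bij_betw_trans[OF bij_betw_trans[OF 1 assms(1)] 2])
  then show ?thesis
    by (rule iffD1[OF bij_betw_cong, rotated]) (simp add: assms(4))
qed

text \<open>
  The evaluation \<open>e\<close> corresponds to an arrow \<open>\<epsilon>\<close> out of \<open>[b,c] b\<close>, and substitution of a unary map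
  into \<open>e\<close> corresponds to \<open>k \<mapsto> \<epsilon> (k b)\<close>.  So \<open>\<epsilon>\<close> is a universal arrow from \<open>- \<otimes> b\<close> to \<open>c\<close>.
\<close>

theorem (in classified_multicategory) closed_skmonI:
  assumes closed: "\<And>b c. \<lbrakk>b \<in> Obj C; c \<in> Obj C\<rbrakk> \<Longrightarrow> \<exists>h e. h \<in> Obj C \<and> is_map C Tight [h, b] c e \<and>
     (\<forall>a\<in>Obj C. bij_betw (\<lambda>f. Sub C Tight [h, b] c 1 Tight [a] e f) (Maps C Tight [a] h) (Maps C Tight [a, b] c))"
  shows "closed_skmon S"
  unfolding closed_skmon_def
proof
  fix b assume "b \<in> Ob S"
  then have b: "b \<in> Obj C" by simp
  show "has_right_adjoint S S (tensor_right S b)"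
  proof (rule has_right_adjointI)
    show "is_functor S S (tensor_right S b)" using b by (intro S.tensor_right_functor) simp
    fix c assume "c \<in> Ob S"
    then have c: "c \<in> Obj C" by simp
    obtain h e where h: "h \<in> Obj C" "is_map C Tight [h, b] c e"
      and bij: "\<And>a. a \<in> Obj C \<Longrightarrow> bij_betw (\<lambda>f. Sub C Tight [h, b] c 1 Tight [a] e f) (Maps C Tight [a] h) (Maps C Tight [a, b] c)"
      using closed[OF b c] by blast
    let ?e = "(Tight, [h, b], c, e)"
    have me: "mm ar C ?e" using h by (simp add: mm_def)
    obtain \<epsilon> where eps: "lmap S Tight [h, b] \<epsilon>" "target \<epsilon> = c" "?e = EC Tight [h, b] \<epsilon>"
      using EC_surj[OF me] by auto
    have ae: "arr S \<epsilon>" "source \<epsilon> = h \<otimes> b" using eps by (auto simp: lmap_def)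
    have "bij_betw (\<lambda>k. \<epsilon> \<cdot>\<^bsub>S\<^esub> k \<star>\<^bsub>S\<^esub> \<I>\<^bsub>S\<^esub> b) {k. arr S k \<and> source k = a \<and> target k = h}
       {f. arr S f \<and> source f = a \<otimes> b \<and> target f = c}" if a: "a \<in> Obj C" for a
    proof -
      have 1: "bij_betw (E a []) {f. arr S f \<and> source f = tob S a [] \<and> target f = h} (maps_to Tight [a] h)"
        using E_bij[of "[]" a h] a h by simp
      have 2: "bij_betw (\<lambda>q. ?e \<odot> q) (maps_to Tight [a] h) (maps_to Tight [a, b] c)"
        by (rule bij_betw_elem_iff[THEN iffD2, OF _ _ _ _ _ _ _ bij[OF a]])
          (use a b c h in \<open>auto simp: sub_def\<close>)
      have 3: "bij_betw (E a [b]) {f. arr S f \<and> source f = a \<otimes> b \<and> target f = c} (maps_to Tight [a, b] c)"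
        using E_bij[of "[b]" a c] a b c by simp
      have "bij_betw ((\<lambda>q. ?e \<odot> q) \<circ> E a []) {f. arr S f \<and> source f = a \<and> target f = h} (maps_to Tight [a, b] c)"
        using bij_betw_trans[OF 1 2] by simp
      moreover have "((\<lambda>q. ?e \<odot> q) \<circ> E a []) k = (E a [b] \<circ> (\<lambda>k. \<epsilon> \<cdot>\<^bsub>S\<^esub> k \<star>\<^bsub>S\<^esub> \<I>\<^bsub>S\<^esub> b)) k"
        if "k \<in> {f. arr S f \<and> source f = a \<and> target f = h}" for k
      proof -
        have k: "arr S k" "source k = a" "target k = h" using that by auto
        have "E h [b] \<epsilon> \<odot> EC Tight [a] k = EC Tight ([a] @ [b]) (\<epsilon> \<cdot>\<^bsub>S\<^esub> tar S [b] k)"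
          using E_sub_first[of "[b]" Tight "[a]" k \<epsilon>] k ae a b by (simp add: lmap_def)
        then show ?thesis unfolding comp_def eps(3) by (simp add: EM_Tight)
      qed
      ultimately have "bij_betw (E a [b] \<circ> (\<lambda>k. \<epsilon> \<cdot>\<^bsub>S\<^esub> k \<star>\<^bsub>S\<^esub> \<I>\<^bsub>S\<^esub> b)) {f. arr S f \<and> source f = a \<and> target f = h} (maps_to Tight [a, b] c)"
        by (rule iffD1[OF bij_betw_cong, rotated])
      then show ?thesis
        by (subst bij_betw_comp_iff2[OF 3]) (use ae eps(2) b in auto)
    qed
    then show "\<exists>h e. h \<in> Ob S \<and> arr S e \<and> source e = FO (tensor_right S b) h \<and> target e = c \<and>
      (\<forall>a\<in>Ob S. bij_betw (\<lambda>k. e \<cdot>\<^bsub>S\<^esub> fmap (tensor_right S b) k) {k. arr S k \<and> source k = a \<and> target k = h}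
         {f. arr S f \<and> source f = FO (tensor_right S b) a \<and> target f = c})"
      using h eps ae by (intro exI[of _ h] exI[of _ \<epsilon>]) (simp add: S.fmap_tensor_right)
  qed
qed

lemma (in classified_multicategory) closed_skmon_short:
  assumes "closed_short C"
  shows "closed_skmon S"
proof (rule closed_skmonI)
  fix b c assume "b \<in> Obj C" "c \<in> Obj C"
  then obtain h e where h: "h \<in> Obj C" "is_map C Tight [h, b] c e"
    and bij: "\<forall>xs. set xs \<subseteq> Obj C \<and> length xs \<in> {1, 2, 3} \<longrightarrow>
           bij_betw (\<lambda>f. Sub C Tight [h, b] c 1 Tight xs e f) (Maps C Tight xs h) (Maps C Tight (xs @ [b]) c)"
    using assms unfolding closed_short_def by blast
  have "bij_betw (\<lambda>f. Sub C Tight [h, b] c 1 Tight [a] e f) (Maps C Tight [a] h) (Maps C Tight [a, b] c)" if "a \<in> Obj C" for a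
    using bij[rule_format, of "[a]"] that by simp
  then show "\<exists>h e. h \<in> Obj C \<and> is_map C Tight [h, b] c e \<and>
     (\<forall>a\<in>Obj C. bij_betw (\<lambda>f. Sub C Tight [h, b] c 1 Tight [a] e f) (Maps C Tight [a] h) (Maps C Tight [a, b] c))"
    using h by blast
qed

lemma (in classified_multicategory) closed_skmon_long:
  assumes "closed_multi C"
  shows "closed_skmon S"
proof (rule closed_skmonI)
  fix b c assume "b \<in> Obj C" "c \<in> Obj C"
  then obtain h e where h: "h \<in> Obj C" "is_map C Tight [h, b] c e"
    and bij: "\<forall>x as. arity_long x (length as) \<and> set as \<subseteq> Obj C \<longrightarrow>
           bij_betw (\<lambda>f. Sub C Tight [h, b] c 1 x as e f) (Maps C x as h) (Maps C x (as @ [b]) c)"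
    using assms unfolding closed_multi_def by blast
  have "bij_betw (\<lambda>f. Sub C Tight [h, b] c 1 Tight [a] e f) (Maps C Tight [a] h) (Maps C Tight [a, b] c)" if "a \<in> Obj C" for a
    using bij[rule_format, of Tight "[a]"] that by (simp add: arity_long_def)
  then show "\<exists>h e. h \<in> Obj C \<and> is_map C Tight [h, b] c e \<and>
     (\<forall>a\<in>Obj C. bij_betw (\<lambda>f. Sub C Tight [h, b] c 1 Tight [a] e f) (Maps C Tight [a] h) (Maps C Tight [a, b] c))"
    using h by blast
qed

text \<open>
  A map of any type and arity into \<open>[b,c]\<close> is an arrow into it, out of the left bracketed product of its
  inputs, so a single universal arrow serves for all of them.
\<close>

theorem (in skew_monoidal_category) closed_multi_of:
  assumes "closed_skmon S"
  shows "closed_multi (multi_of S)"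
  unfolding closed_multi_def
proof (intro ballI)
  fix b c assume "b \<in> Obj (multi_of S)" "c \<in> Obj (multi_of S)"
  then have o: "b \<in> Ob S" "c \<in> Ob S" by simp_all
  obtain h e where h: "h \<in> Ob S" and e: "arr S e" "source e = h \<otimes> b" "target e = c" and
    univ: "\<And>a. a \<in> Ob S \<Longrightarrow> bij_betw (\<lambda>k. e \<cdot> k \<star> \<I> b) {k. arr S k \<and> source k = a \<and> target k = h}
       {f. arr S f \<and> source f = a \<otimes> b \<and> target f = c}"
    using has_right_adjoint_universal[OF _ tensor_right_functor[OF o(1)] o(2)] assms o(1)
    unfolding closed_skmon_def fmap_tensor_right FO_tensor_right by blast
  have em: "(h \<otimes> b, label e, c) = e" using e by (simp add: prod_eq_iff)
  have "label e \<in> Hom S (h \<otimes> b) c" using e by (simp add: arr_def del: arr_source arr_target)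
  then have "is_map (multi_of S) Tight [h, b] c (label e)" using h o by (simp add: is_map_def)
  moreover have "bij_betw (\<lambda>f. Sub (multi_of S) Tight [h, b] c 1 x as (label e) f)
      (Maps (multi_of S) x as h) (Maps (multi_of S) x (as @ [b]) c)"
    if "arity_long x (length as)" "set as \<subseteq> Ob S" for x as
  proof -
    have x: "x = Tight \<longrightarrow> as \<noteq> []" using that by (auto simp: arity_long_def)
    have "bij_betw (\<lambda>f. Sub (multi_of S) Tight [h, b] c 1 x as (label e) f) (Hom S (tobx S x as) h) (Hom S (tobx S x as \<otimes> b) c)"
    proof (rule bij_betw_labels[OF univ])
      fix m assume "m \<in> Hom S (tobx S x as) h"
      then show "Sub (multi_of S) Tight [h, b] c 1 x as (label e) m = label (e \<cdot> (tobx S x as, m, h) \<star> \<I> b)"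
        using multi_of_simps(5)[of S Tight "[]" h "[b]" c x as "label e" m] by (simp add: lsub_def em)
    qed (use that x h o in simp_all)
    then show ?thesis using x by simp
  qed
  ultimately show "\<exists>h e. h \<in> Obj (multi_of S) \<and> is_map (multi_of S) Tight [h, b] c e \<and>
        (\<forall>x as. arity_long x (length as) \<and> set as \<subseteq> Obj (multi_of S) \<longrightarrow>
           bij_betw (\<lambda>f. Sub (multi_of S) Tight [h, b] c 1 x as e f)
             (Maps (multi_of S) x as h) (Maps (multi_of S) x (as @ [b]) c))"
    using h by (intro exI[of _ h] exI[of _ "label e"]) simp
qed

section \<open>Essential surjectivity\<close>

definition canonical :: "('o, 'm) skmon \<Rightarrow> ('o, 'm) classifiers" where
  "canonical S = \<lparr> ctens = TO S, ctheta = (\<lambda>a b. Idn S (TO S a b)), cunit = Unit S, cnull = Idn S (Unit S) \<rparr>"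

lemma (in skew_monoidal_category) canonical_classifiers:
  "classifiers_short (truncate_multi (multi_of S)) (canonical S)"
proof -
  let ?M = "multi_of S"
  have b: "bij_betw (\<lambda>f. Sub ?M Tight (tobx S x as # ys) d 1 x as f (Idn S (tobx S x as)))
        (Maps ?M Tight (tobx S x as # ys) d) (Maps ?M x (as @ ys) d)"
    if "x = Tight \<longrightarrow> as \<noteq> []" "set as \<subseteq> Ob S" "set ys \<subseteq> Ob S" "d \<in> Ob S" for x as ys d
  proof -
    let ?m = "tobx S x as"
    have m: "?m \<in> Ob S" using that by simp
    have I: "rep S x as ?m (Idn S ?m) = \<I> ?m" by (simp add: idar_def)
    have "Sub ?M Tight (?m # ys) d 1 x as f (Idn S ?m) = f" if "f \<in> Maps ?M Tight (?m # ys) d" for f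
      using multi_of_simps(5)[of S Tight "[]" ?m ys] that \<open>set ys \<subseteq> Ob S\<close> \<open>d \<in> Ob S\<close> m
      by (simp add: I lsub_def)
    then have "bij_betw (\<lambda>f. Sub ?M Tight (?m # ys) d 1 x as f (Idn S ?m))
        (Maps ?M Tight (?m # ys) d) (Maps ?M Tight (?m # ys) d)"
      by (subst bij_betw_cong[where g = id]) auto
    then show ?thesis using that by simp
  qed
  have I: "Idn S a \<in> Hom S a a" if "a \<in> Ob S" for a
    using arr_idar[of a] that by (simp add: idar_def)
  show ?thesis
    unfolding classifiers_short_def canonical_def classifiers.simps truncate_simps multi_of_simps(1)
  proof (intro conjI ballI allI impI)
    fix a b assume "a \<in> Ob S" "b \<in> Ob S"
    then show "is_map (truncate_multi ?M) Tight [a, b] (a \<otimes> b) (Idn S (a \<otimes> b))"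
      using I[of "a \<otimes> b"] by (simp add: is_map_def Maps_truncate arity_short_def)
  next
    fix a b' xs d assume o: "a \<in> Ob S" "b' \<in> Ob S" and xs: "set xs \<subseteq> Ob S \<and> d \<in> Ob S \<and> Suc (length xs) \<in> {1, 2, 3}"
    then have l: "length xs = 0 \<or> length xs = 1 \<or> length xs = 2" by auto
    have "op_short Tight (Suc (length xs)) (Suc 0) Tight (Suc (Suc 0))"
      "arity_short Tight (Suc (length xs))" "arity_short Tight (Suc (Suc (length xs)))"
      using l by (auto simp: op_short_def arity_short_def)
    then show "bij_betw (\<lambda>f. Sub (truncate_multi ?M) Tight (a \<otimes> b' # xs) d 1 Tight [a, b'] f (Idn S (a \<otimes> b')))
           (Maps (truncate_multi ?M) Tight (a \<otimes> b' # xs) d) (Maps (truncate_multi ?M) Tight (a # b' # xs) d)"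
      using b[of Tight "[a, b']" xs d] o xs by (simp add: Sub_truncate Maps_truncate del: multi_of_simps(2))
  next
    show "is_map (truncate_multi ?M) Loose [] (Unit S) (Idn S (Unit S))"
      using I[of "Unit S"] by (simp add: is_map_def Maps_truncate arity_short_def)
  next
    fix xs d assume xs: "set xs \<subseteq> Ob S \<and> d \<in> Ob S \<and> length xs \<in> {0, 1, 2}"
    then have "op_short Tight (Suc (length xs)) (Suc 0) Loose 0"
      "arity_short Tight (Suc (length xs))" "arity_short Loose (length xs)"
      by (auto simp: op_short_def arity_short_def)
    then show "bij_betw (\<lambda>f. Sub (truncate_multi ?M) Tight (Unit S # xs) d 1 Loose [] f (Idn S (Unit S)))
          (Maps (truncate_multi ?M) Tight (Unit S # xs) d) (Maps (truncate_multi ?M) Loose xs d)"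
      using b[of Loose "[]" xs d] xs by (simp add: Sub_truncate Maps_truncate del: multi_of_simps(2))
  qed
qed

text \<open>
  Only short maps occur in the definition of \<open>skmon_of\<close>.
\<close>

lemma skmon_of_truncate: "skmon_of (truncate_multi C) chi = skmon_of C chi"
proof -
  have "op_short Tight (Suc 0) (Suc 0) Tight (Suc 0)" "op_short Tight (Suc 0) (Suc 0) Tight (Suc (Suc 0))"
    "op_short Tight (Suc (Suc 0)) 2 Tight (Suc 0)" "op_short Tight (Suc (Suc 0)) (Suc 0) Tight (Suc 0)"
    "op_short Tight (Suc (Suc 0)) (Suc 0) Tight (Suc (Suc 0))" "op_short Tight (Suc (Suc 0)) 2 Tight (Suc (Suc 0))"
    "op_short Tight (Suc (Suc 0)) (Suc 0) Loose 0" "op_short Tight (Suc (Suc 0)) 2 Loose 0"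
    "arity_short Tight (Suc 0)" "arity_short Loose (Suc 0)"
    by (auto simp: op_short_def arity_short_def)
  then show ?thesis
    by (simp add: skmon_of_def Let_def Sub_truncate Maps_truncate J_truncate)
qed

lemma truncate_multimor_simps [simp]:
  "MO (truncate_multimor F) = MO F"
  "MM (truncate_multimor F) x as b f = (if arity_short x (length as) then MM F x as b f else undefined)"
  by (simp_all add: truncate_multimor_def)

lemma lax_of_truncate:
  "lax_of (truncate_multi C) chi (truncate_multi D) psi (truncate_multimor F) = lax_of C chi D psi F"
proof -
  have "op_short Tight (Suc 0) (Suc 0) Tight (Suc (Suc 0))" "op_short Tight (Suc 0) (Suc 0) Loose 0"
    "arity_short Tight (Suc 0)" "arity_short Tight (Suc (Suc 0))" "arity_short Loose 0"
    by (auto simp: op_short_def arity_short_def)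
  then show ?thesis
    by (simp add: lax_of_def Sub_truncate Maps_truncate cong: if_cong)
qed

text \<open>
  The tensor product of arrows and the structure maps are compared on arrows only: \<open>skmon_of\<close> has no
  control over the values that they take elsewhere.
\<close>

definition same_structure :: "('o, 'm) skmon \<Rightarrow> ('o, 'm) skmon \<Rightarrow> bool" where
  "same_structure S R \<longleftrightarrow> Ob S = Ob R \<and> Hom S = Hom R \<and> Idn S = Idn R \<and> TO S = TO R \<and> Unit S = Unit R \<and>
     cmp S = cmp R \<and>
     (\<forall>f g. arr S f \<longrightarrow> arr S g \<longrightarrow> f \<star>\<^bsub>S\<^esub> g = f \<star>\<^bsub>R\<^esub> g) \<and>
     (\<forall>a\<in>Ob S. \<forall>b\<in>Ob S. \<forall>c\<in>Ob S. \<alpha>\<^bsub>S\<^esub> a b c = \<alpha>\<^bsub>R\<^esub> a b c) \<and>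
     (\<forall>a\<in>Ob S. \<Lambda>\<^bsub>S\<^esub> a = \<Lambda>\<^bsub>R\<^esub> a \<and> \<rho>\<^bsub>S\<^esub> a = \<rho>\<^bsub>R\<^esub> a)"

lemma arr_eqI: "Ob S = Ob R \<Longrightarrow> Hom S = Hom R \<Longrightarrow> arr S = arr R"
  by (intro ext) (simp add: arr_def del: arr_source arr_target)

lemma same_structure_sym: "same_structure S R \<Longrightarrow> same_structure R S"
  using arr_eqI[of S R] unfolding same_structure_def by auto

lemma lax_functor_same_structure:
  assumes "skew_monoidal_category S" "skew_monoidal_category R" "same_structure S R"
  shows "lax_functor S R (id_lax S)"
proof -
  interpret S: skew_monoidal_category S by fact
  interpret R: skew_monoidal_category R by fact
  note a = assms(3)[unfolded same_structure_def]
  have e: "Ob S = Ob R" "arr S = arr R" "TO S = TO R" "Unit S = Unit R" "idar S = idar R"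
    "cmp S = cmp R" "Hom S = Hom R"
    using a arr_eqI[of S R] by (auto simp: idar_def)
  have t: "f \<star>\<^bsub>S\<^esub> g = f \<star>\<^bsub>R\<^esub> g" if "arr R f" "arr R g" for f g
    using a that unfolding e(2) by blast
  have c: "\<alpha>\<^bsub>S\<^esub> a b c = \<alpha>\<^bsub>R\<^esub> a b c" "\<Lambda>\<^bsub>S\<^esub> a = \<Lambda>\<^bsub>R\<^esub> a" "\<rho>\<^bsub>S\<^esub> a = \<rho>\<^bsub>R\<^esub> a"
    if "a \<in> Ob R" "b \<in> Ob R" "c \<in> Ob R" for a b c
    using a that unfolding e(1) by blast+
  have i: "FO (LF (id_lax S)) a = a" if "a \<in> Ob R" for a
    using that e by (simp add: id_lax_arrows)
  have fi: "fa (id_lax S) f = f" if "arr R f" for f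
    using that e by (simp add: id_lax_arrows)
  have f0i: "f0 S R (id_lax S) = idar R (Unit R)"
    using id_lax_arrows(3)[of S] e by (simp add: f0_def)
  have f2i: "f2 S R (id_lax S) a b = idar R (TO R a b)" if "a \<in> Ob R" "b \<in> Ob R" for a b
    using id_lax_arrows(4)[of a S b] that e by (simp add: f2_def)
  interpret lax_data S R "id_lax S"
    by (simp add: lax_data_iff assms) (simp add: e i fi f0i f2i)
  show ?thesis
    by unfold_locales (simp_all add: e i fi f0i f2i t c)
qed

lemma iso_in_same_structure:
  assumes "skew_monoidal_category S" "skew_monoidal_category R" "same_structure S R"
  shows "iso_in SkMon S R (id_lax S)"
proof -
  have e: "id_lax R = id_lax S" "Ob R = Ob S" "arr R = arr S" "idar R = idar S" "TO R = TO S" "Unit R = Unit S"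
    "cmp R = cmp S"
    using assms(3) arr_eqI[of S R] by (auto simp: same_structure_def id_lax_def idar_def cong: if_cong)
  interpret S: skew_monoidal_category S by fact
  interpret R: skew_monoidal_category R by fact
  have 1: "lax_functor S R (id_lax S)" "lax_functor R S (id_lax S)"
    using lax_functor_same_structure[OF assms] lax_functor_same_structure[OF assms(2,1) same_structure_sym[OF assms(3)]] e by simp_all
  have 2: "normalised S (id_lax S)" "normalised R (id_lax S)" using normalised_id[of S] normalised_id[of R] e by simp_all
  have f0i: "f0 S R (id_lax S) = idar S (Unit S)" "f0 R S (id_lax S) = idar S (Unit S)"
    "f0 R R (id_lax S) = idar S (Unit S)"
    using id_lax_arrows(3)[of S] e by (simp_all add: f0_def)
  have f2i: "f2 S R (id_lax S) a b = idar S (TO S a b)" "f2 R S (id_lax S) a b = idar S (TO S a b)"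
    "f2 R R (id_lax S) a b = idar S (TO S a b)"
    if "a \<in> Ob S" "b \<in> Ob S" for a b
    using id_lax_arrows(4)[of a S b] that e by (simp_all add: f2_def)
  have "comp_lax S R S (id_lax S) (id_lax S) = id_lax S"
    by (rule lax_ext[of S _ _ S]) (simp_all add: normalised_comp normalised_id comp_lax_arrows[where R = R] id_lax_arrows f0i f2i)
  moreover have "comp_lax R S R (id_lax S) (id_lax S) = id_lax R"
    by (rule lax_ext[of R _ _ R])
      (simp_all add: normalised_comp normalised_id comp_lax_arrows[where R = S and S = R and Q = R] e id_lax_arrows f0i f2i 2)
  ultimately show ?thesis
    using 1 2 assms unfolding iso_in_def SkMon_def by (auto simp: lax_functor_iff intro!: bexI[of _ "id_lax S"])
qed

context skew_monoidal_category
begin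

lemma the_label:
  assumes "\<And>k. k \<in> H \<Longrightarrow> P k = k" "r \<in> H"
  shows "(THE k. k \<in> H \<and> P k = r) = r"
  by (rule the_equality) (use assms in auto)

text \<open>
  With identities as classifiers, each definite description in \<open>skmon_of\<close> asks for an arrow equal to a
  given one, and the given one is computed from \<open>lsub\<close>.
\<close>

lemma same_structure_canonical: "same_structure (skmon_of (multi_of S) (canonical S)) S"
proof -
  let ?K = "skmon_of (multi_of S) (canonical S)" and ?M = "multi_of S"
  have I: "(a, Idn S a, a) = \<I> a" for a by (simp add: idar_def)
  have basic: "Ob ?K = Ob S" "Hom ?K = Hom S" "Idn ?K = Idn S" "TO ?K = TO S" "Unit ?K = Unit S"
    by (simp_all add: skmon_of_def Let_def canonical_def)
  have arrK: "arr ?K = arr S" using basic by (intro arr_eqI)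
  have sub1: "Sub ?M Tight (b # bs) c (Suc 0) y as g f = label ((tob S b bs, g, c) \<cdot> tar S bs (tobx S y as, f, b))"
    for b bs c y as g f
    by (simp add: multi_of_def lsub_def)
  have sub2: "Sub ?M Tight [a, b] c 2 y as g f = label ((a \<otimes> b, g, c) \<cdot> sharp S y as (tobx S y as, f, b) a)"
    for a b c y as g f
    by (simp add: multi_of_def lsub_def)
  have cmpK: "cmp ?K g f = cmp S g f" for g f
    by (simp add: cmp_def skmon_of_def Let_def sub1)
  have lab: "(a, label f, b) = f" if "source f = a" "target f = b" for a b and f :: "('a, 'b) arrow"
    using that by (simp add: prod_eq_iff)
  have hom: "label f \<in> Hom S a b" if "arr S f" "source f = a" "target f = b" for f a b
    using that by (simp add: arr_def del: arr_source arr_target)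
  have tnsK: "f \<star>\<^bsub>?K\<^esub> g = f \<star> g" if fg: "arr S f" "arr S g" for f g
  proof -
    have "TA ?K (source f) (target f) (source g) (target g) (label f) (label g) = label (f \<star> g)"
    proof -
      let ?a = "source f" and ?b = "target f" and ?c = "source g" and ?d = "target g"
      have "Sub ?M Tight [?a, ?d] (?b \<otimes> ?d) 2 Tight [?c]
            (Sub ?M Tight [?b, ?d] (?b \<otimes> ?d) (Suc 0) Tight [?a] (Idn S (?b \<otimes> ?d)) (label f)) (label g) = label (f \<star> g)"
        using fg by (simp add: sub1 sub2 I lab sharp_def) (simp add: tns_cmp[symmetric])
      moreover have "(THE k. k \<in> Hom S (?a \<otimes> ?c) (?b \<otimes> ?d) \<and>
          Sub ?M Tight [?a \<otimes> ?c] (?b \<otimes> ?d) (Suc 0) Tight [?a, ?c] k (Idn S (?a \<otimes> ?c)) = label (f \<star> g)) = label (f \<star> g)"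
        using fg by (intro the_label) (simp_all add: sub1 I hom)
      ultimately show ?thesis
        by (simp add: skmon_of_def Let_def canonical_def del: multi_of_simps(5))
    qed
    then show ?thesis by (simp add: tns_def basic)
  qed
  have asrK: "\<alpha>\<^bsub>?K\<^esub> a b c = \<alpha> a b c" if o: "a \<in> Ob S" "b \<in> Ob S" "c \<in> Ob S" for a b c
  proof -
    have "Sub ?M Tight [a, b \<otimes> c] (a \<otimes> (b \<otimes> c)) 2 Tight [b, c] (Idn S (a \<otimes> (b \<otimes> c))) (Idn S (b \<otimes> c)) = label (\<alpha> a b c)"
      using o by (simp add: sub2 I sharp_def)
    moreover have "(THE k. k \<in> Hom S (a \<otimes> b \<otimes> c) (a \<otimes> (b \<otimes> c)) \<and>
        Sub ?M Tight [a \<otimes> b, c] (a \<otimes> (b \<otimes> c)) (Suc 0) Tight [a, b]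
          (Sub ?M Tight [a \<otimes> b \<otimes> c] (a \<otimes> (b \<otimes> c)) (Suc 0) Tight [a \<otimes> b, c] k (Idn S (a \<otimes> b \<otimes> c))) (Idn S (a \<otimes> b)) =
        label (\<alpha> a b c)) = label (\<alpha> a b c)"
      using o by (intro the_label) (simp_all add: sub1 I hom)
    ultimately have "Assoc ?K a b c = label (\<alpha> a b c)"
      by (simp add: skmon_of_def Let_def canonical_def del: multi_of_simps(5))
    then show ?thesis by (simp add: asr_def basic)
  qed
  have lunK: "\<Lambda>\<^bsub>?K\<^esub> a = \<Lambda> a" if o: "a \<in> Ob S" for a
  proof -
    have "J ?M [a] a (Idn S a) = label (\<Lambda> a)"
      using o by (simp add: I loosen_def)
    moreover have "(THE k. k \<in> Hom S (Unit S \<otimes> a) a \<and>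
        Sub ?M Tight [Unit S, a] a (Suc 0) Loose []
          (Sub ?M Tight [Unit S \<otimes> a] a (Suc 0) Tight [Unit S, a] k (Idn S (Unit S \<otimes> a))) (Idn S (Unit S)) =
        label (\<Lambda> a)) = label (\<Lambda> a)"
      using o by (intro the_label) (simp_all add: sub1 I hom)
    ultimately have "LUnit ?K a = label (\<Lambda> a)"
      by (simp add: skmon_of_def Let_def canonical_def del: multi_of_simps(4,5))
    then show ?thesis by (simp add: lun_def basic)
  qed
  have runK: "\<rho>\<^bsub>?K\<^esub> a = \<rho> a" if o: "a \<in> Ob S" for a
  proof -
    have "RUnit ?K a = label (\<rho> a)"
      using o by (simp add: skmon_of_def Let_def canonical_def sub2 I sharp_def del: multi_of_simps(5))
    then show ?thesis by (simp add: run_def basic)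
  qed
  show ?thesis
    unfolding same_structure_def arrK basic using cmpK tnsK asrK lunK runK by (auto simp only: fun_eq_iff)
qed

lemma iso_in_canonical:
  "\<exists>e. iso_in SkMon (skmon_of (multi_of S) (canonical S)) S e"
proof -
  have "classified_multicategory arity_long op_long (multi_of S) (canonical S)"
    using skew_multicategory_multi_of left_representable_multi_of canonical_classifiers by (rule classified_long)
  then have "skew_monoidal_category (skmon_of (multi_of S) (canonical S))"
    by (rule classified_multicategory.skew_monoidal_S)
  then show ?thesis
    using iso_in_same_structure same_structure_canonical skew_monoidal_category_axioms by blast
qed

end

section \<open>The comparison functors\<close>

lemma comp_id_multimor:
  assumes "truncated_multicategory ar op C"
  shows "comp_multimor ar C C C (id_multimor ar C) (id_multimor ar C) = id_multimor ar C"
proof -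
  interpret truncated_multicategory ar op C by fact
  have "category (multi_cat ar op {C})" using assms by (intro category_multi_cat) simp
  then show ?thesis
    using multi_morphism_id unfolding category_def multi_cat_def by simp
qed

text \<open>
  The identity morphism of \<open>C\<close> gives lax monoidal functors in both directions between the two skew
  monoidal categories.  They are mutually inverse by functoriality of \<open>lax_of\<close>, which holds for any
  choice of classifiers.
\<close>

lemma iso_in_choice:
  assumes "classified_multicategory ar op C chi" "classified_multicategory ar op C psi"
  shows "\<exists>e. iso_in SkMon (skmon_of C chi) (skmon_of C psi) e"
proof -
  interpret C: classified_multicategory ar op C chi by fact
  interpret C': classified_multicategory ar op C psi by fact
  let ?i = "id_multimor ar C" and ?S = "skmon_of C chi" and ?R = "skmon_of C psi"
  note i = C.multi_morphism_id
  note ii = comp_id_multimor[OF C.truncated_multicategory_axioms]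
  interpret F: classified_morphism ar op C C chi psi ?i by unfold_locales (rule i)
  interpret G: classified_morphism ar op C C psi chi ?i by unfold_locales (rule i)
  have "comp_lax ?S ?R ?S G.\<Phi> F.\<Phi> = id_lax ?S"
    using lax_of_comp[OF assms assms(1) i i] ii lax_of_id[OF assms(1)] by simp
  moreover have "comp_lax ?R ?S ?R F.\<Phi> G.\<Phi> = id_lax ?R"
    using lax_of_comp[OF assms(2,1,2) i i] ii lax_of_id[OF assms(2)] by simp
  ultimately show ?thesis
    using F.lax_monoidal_lax_of G.lax_monoidal_lax_of unfolding iso_in_def SkMon_def by auto
qed

lemma iso_in_trans:
  assumes "category C" "a \<in> Ob C" "b \<in> Ob C" "c \<in> Ob C" "iso_in C a b f" "iso_in C b c g"
  shows "\<exists>h. iso_in C a c h"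
proof -
  interpret cat_laws C using assms(1) by unfold_locales
  obtain f' g' where "invs C (a, f, b) f'" "invs C (b, g, c) g'"
    using assms iso_in_invs by metis
  then have "invs C ((b, g, c) \<cdot>\<^bsub>C\<^esub> (a, f, b)) (f' \<cdot>\<^bsub>C\<^esub> g')" by (intro invs_cmp) simp_all
  then show ?thesis by (intro exI[of _ "label ((b, g, c) \<cdot>\<^bsub>C\<^esub> (a, f, b))"]) (rule iso_inI, simp_all)
qed

abbreviation lax_of_fctr ::
  "(('o, 'm) multi \<Rightarrow> ('o, 'm) classifiers) \<Rightarrow> (('o, 'm) multi, ('o, 'm) multimor, ('o, 'm) skmon, ('o, 'm) laxmor) fctr" where
  "lax_of_fctr c \<equiv> \<lparr> FO = (\<lambda>C. skmon_of C (c C)), FA = (\<lambda>C D F. lax_of C (c C) D (c D) F) \<rparr>"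

lemma category_full: "category C \<Longrightarrow> Y \<subseteq> Ob C \<Longrightarrow> category (C\<lparr>Ob := Y\<rparr>)"
  unfolding category_def by (simp add: subset_iff)

text \<open>
  The common form of the three comparison functors.  What differs is why their values lie in \<open>Y\<close> and
  why they are essentially surjective.
\<close>

theorem fully_faithful_eso_lax_of:
  assumes X: "\<And>C. C \<in> X \<Longrightarrow> classified_multicategory ar op C (c C)"
    and Y: "Y \<subseteq> {S. skew_monoidal_category S}" "\<And>C. C \<in> X \<Longrightarrow> skmon_of C (c C) \<in> Y"
    and surj: "\<And>S. S \<in> Y \<Longrightarrow> \<exists>C\<in>X. \<exists>e. iso_in SkMon (skmon_of C (c C)) S e"
  shows "fully_faithful_eso (multi_cat ar op X) (SkMon\<lparr>Ob := Y\<rparr>) (lax_of_fctr c)"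
proof -
  have lax: "lax_monoidal (skmon_of C (c C)) (skmon_of D (c D)) (lax_of C (c C) D (c D) F)"
    if "C \<in> X" "D \<in> X" "multi_morphism ar op C D F" for C D F
  proof -
    interpret C: classified_multicategory ar op C "c C" using X that by blast
    interpret D: classified_multicategory ar op D "c D" using X that by blast
    interpret classified_morphism ar op C D "c C" "c D" F by unfold_locales fact
    show ?thesis by (rule lax_monoidal_lax_of)
  qed
  have "category (multi_cat ar op X)"
    using X by (intro category_multi_cat) (simp add: classified_multicategory_def)
  then have func: "is_functor (multi_cat ar op X) (SkMon\<lparr>Ob := Y\<rparr>) (lax_of_fctr c)"
    unfolding is_functor_def using category_full[OF category_SkMon, of Y] Y lax
    by (simp add: multi_cat_def SkMon_def X lax_of_id[where ar = ar and op = op] lax_of_comp[where ar = ar and op = op])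
  have "bij_betw (\<lambda>F. lax_of C (c C) D (c D) F) {F. multi_morphism ar op C D F}
      {\<Phi>. lax_monoidal (skmon_of C (c C)) (skmon_of D (c D)) \<Phi>}" if "C \<in> X" "D \<in> X" for C D
  proof -
    interpret C: classified_multicategory ar op C "c C" using X that by blast
    interpret D: classified_multicategory ar op D "c D" using X that by blast
    interpret classified_pair ar op C D "c C" "c D" ..
    show ?thesis
      unfolding bij_betw_def
    proof (intro conjI inj_onI equalityI subsetI)
      fix \<Phi> assume "\<Phi> \<in> {\<Phi>. lax_monoidal S R \<Phi>}"
      then have l: "lax_monoidal S R \<Phi>" by simp
      show "\<Phi> \<in> (\<lambda>F. lax_of C (c C) D (c D) F) ` {F. multi_morphism ar op C D F}"
        using multi_morphism_multi_of_lax[OF l] lax_of_full[OF l] by (intro image_eqI[of _ _ "multi_of_lax \<Phi>"]) simp_all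
    qed (use lax_of_faithful lax that in auto)
  qed
  moreover have "\<exists>C\<in>X. \<exists>e. iso_in (SkMon\<lparr>Ob := Y\<rparr>) (skmon_of C (c C)) S e" if "S \<in> Y" for S
    using surj[OF that] by (simp add: iso_in_def)
  ultimately show ?thesis
    unfolding fully_faithful_eso_def using func by (simp add: multi_cat_def SkMon_def)
qed

lemma iso_in_skmon_of_truncation:
  assumes S: "skew_monoidal_category S"
    and chi: "classifiers_short (truncate_multi (multi_of S)) chi"
  shows "\<exists>e. iso_in SkMon (skmon_of (truncate_multi (multi_of S)) chi) S e"
proof -
  interpret skew_monoidal_category S by fact
  let ?C = "truncate_multi (multi_of S)"
  have "short_skew_multicategory ?C" using skew_multicategory_multi_of by (rule short_truncate)
  then have c: "classified_multicategory arity_short op_short ?C chi"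
    "classified_multicategory arity_short op_short ?C (canonical S)"
    using chi canonical_classifiers by (blast intro: classified_short)+
  obtain e e' where "iso_in SkMon (skmon_of ?C chi) (skmon_of ?C (canonical S)) e"
    "iso_in SkMon (skmon_of (multi_of S) (canonical S)) S e'"
    using iso_in_choice[OF c] iso_in_canonical by blast
  then show ?thesis
    using c[THEN classified_multicategory.skew_monoidal_S] S
    by (intro iso_in_trans[OF category_SkMon, of _ "skmon_of ?C (canonical S)" S]) (simp_all add: skmon_of_truncate SkMon_def)
qed

lemma truncate_id_multimor: "truncate_multimor (id_multimor arity_long C) = id_multimor arity_short (truncate_multi C)"
  by (simp add: truncate_multimor_def id_multimor_def fun_eq_iff is_map_truncate arity_short_long)

lemma truncate_comp_multimor:
  "truncate_multimor (comp_multimor arity_long C D E G F) =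
   comp_multimor arity_short (truncate_multi C) (truncate_multi D) (truncate_multi E) (truncate_multimor G) (truncate_multimor F)"
  by (simp add: truncate_multimor_def comp_multimor_def fun_eq_iff is_map_truncate arity_short_long)

text \<open>
  On hom-sets, a bijection cancels from a composite bijection.  For an object \<open>b\<close>,
  an isomorphism from some \<open>T a = K (U a)\<close> to \<open>K b\<close> lifts along \<open>K\<close> to one from \<open>U a\<close> to \<open>b\<close>.
\<close>

lemma fully_faithful_eso_cancel:
  assumes T: "fully_faithful_eso A E T" and K: "fully_faithful_eso B E K" and U: "is_functor A B U"
    and eq: "fctr_eq A T (comp_fctr K U)"
  shows "fully_faithful_eso A B U"
proof -
  note k = fully_faithful_esoD[OF K]
  interpret K: functor_laws B E K using k(1) by (simp add: functor_laws_iff)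
  interpret U: functor_laws A B U using U by (simp add: functor_laws_iff)
  have o: "FO T a = FO K (FO U a)" if "a \<in> Ob A" for a
    using eq that by (simp add: fctr_eq_def comp_fctr_def)
  have "bij_betw (FA U a b) (Hom A a b) (Hom B (FO U a) (FO U b))" if ab: "a \<in> Ob A" "b \<in> Ob A" for a b
  proof -
    have "bij_betw (FA T a b) (Hom A a b) (Hom E (FO K (FO U a)) (FO K (FO U b)))"
      using T ab o unfolding fully_faithful_eso_def by metis
    moreover have "FA T a b f = (FA K (FO U a) (FO U b) \<circ> FA U a b) f" if "f \<in> Hom A a b" for f
      using eq ab that by (simp add: fctr_eq_def comp_fctr_def)
    ultimately have "bij_betw (FA K (FO U a) (FO U b) \<circ> FA U a b) (Hom A a b) (Hom E (FO K (FO U a)) (FO K (FO U b)))"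
      by (rule iffD1[OF bij_betw_cong, rotated])
    moreover have "bij_betw (FA K (FO U a) (FO U b)) (Hom B (FO U a) (FO U b)) (Hom E (FO K (FO U a)) (FO K (FO U b)))"
      using K ab by (simp add: fully_faithful_eso_def)
    moreover have "FA U a b ` Hom A a b \<subseteq> Hom B (FO U a) (FO U b)"
      using U ab unfolding is_functor_def by blast
    ultimately show ?thesis by (simp add: bij_betw_comp_iff2)
  qed
  moreover have "\<exists>a\<in>Ob A. \<exists>e. iso_in B (FO U a) b e" if b: "b \<in> Ob B" for b
  proof -
    obtain a e e' where a: "a \<in> Ob A" and e: "source e = FO K (FO U a)" "target e = FO K b" "invs E e e'"
      using fully_faithful_esoD(4)[OF T K.FO_ob[OF b]] o by metis
    have e': "arr E e" "arr E e'" "source e' = FO K b" "target e' = FO K (FO U a)"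
      "e' \<cdot>\<^bsub>E\<^esub> e = \<I>\<^bsub>E\<^esub> (FO K (FO U a))" "e \<cdot>\<^bsub>E\<^esub> e' = \<I>\<^bsub>E\<^esub> (FO K b)"
      using e by (auto simp: invs_def)
    obtain f where f: "arr B f" "source f = FO U a" "target f = b" "fmap K f = e"
      using k(3)[OF U.FO_ob[OF a] b e'(1) e(1,2)] by blast
    obtain g where g: "arr B g" "source g = b" "target g = FO U a" "fmap K g = e'"
      using k(3)[OF b U.FO_ob[OF a] e'(2,3,4)] by blast
    have "g \<cdot>\<^bsub>B\<^esub> f = \<I>\<^bsub>B\<^esub> (FO U a)" using f g a e' by (intro k(2)) simp_all
    moreover have "f \<cdot>\<^bsub>B\<^esub> g = \<I>\<^bsub>B\<^esub> b" using f g b e' by (intro k(2)) simp_all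
    ultimately have "invs B f g" using f g by (simp add: invs_def)
    then have "iso_in B (FO U a) b (label f)" using f by (intro iso_inI[of B f g]) simp_all
    then show ?thesis using a by blast
  qed
  ultimately show ?thesis unfolding fully_faithful_eso_def using U by blast
qed

theorem theorem5p15:
  fixes ch :: "('o, 'm) multi \<Rightarrow> ('o, 'm) classifiers"
  assumes "\<And>C. short_skew_multicategory C \<Longrightarrow> left_representable_short C \<Longrightarrow>
             classifiers_short C (ch C)"
  shows "is_equivalence ShSkMulti_lr SkMon (K_s ch) \<and>
         is_equivalence ShSkMulti_cl_lr SkMon_cl (K_s ch) \<and>
         is_equivalence SkMulti_cl_lr ShSkMulti_cl_lr
           (U_cl_lr :: (('o, 'm) multi, ('o, 'm) multimor, ('o, 'm) multi, ('o, 'm) multimor) fctr) \<and>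
         is_equivalence SkMulti_cl_lr SkMon_cl (T_s ch) \<and>
         fctr_eq SkMulti_cl_lr (T_s ch) (comp_fctr (K_s ch) U_cl_lr)"
proof -
  let ?U = "U_cl_lr :: (('o, 'm) multi, ('o, 'm) multimor, ('o, 'm) multi, ('o, 'm) multimor) fctr"
  have short: "classified_multicategory arity_short op_short C (ch C)"
    if "short_skew_multicategory C" "left_representable_short C" for C
    using that assms by (blast intro: classified_short)
  have trunc: "short_skew_multicategory (truncate_multi C)" "left_representable_short (truncate_multi C)"
    if "skew_multicategory C" "left_representable C" for C :: "('o, 'm) multi"
    using that short_truncate left_representable_truncate by blast+
  have long: "classified_multicategory arity_long op_long C (ch (truncate_multi C))"
    if "skew_multicategory C" "left_representable C" for C
    using that assms[OF trunc[OF that]] by (rule classified_long)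
  have of: "skew_multicategory (multi_of S)" "left_representable (multi_of S)"
    if "skew_monoidal_category S" for S :: "('o, 'm) skmon"
    using that skew_monoidal_category.skew_multicategory_multi_of skew_monoidal_category.left_representable_multi_of by blast+
  have of_cl: "closed_multi (multi_of S)" if "skew_monoidal_category S" "closed_skmon S" for S :: "('o, 'm) skmon"
    using that skew_monoidal_category.closed_multi_of by blast
  have iso: "\<exists>e. iso_in SkMon (skmon_of (truncate_multi (multi_of S)) (ch (truncate_multi (multi_of S)))) S e"
    if S: "skew_monoidal_category S" for S
    using S assms[OF trunc[OF of[OF S]]] by (rule iso_in_skmon_of_truncation)
  have K: "fully_faithful_eso ShSkMulti_lr SkMon (K_s ch)"
  proof -
    have "SkMon\<lparr>Ob := {S :: ('o, 'm) skmon. skew_monoidal_category S}\<rparr> = SkMon" by (simp add: SkMon_def)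
    moreover have "fully_faithful_eso ShSkMulti_lr (SkMon\<lparr>Ob := {S :: ('o, 'm) skmon. skew_monoidal_category S}\<rparr>) (K_s ch)"
      unfolding ShSkMulti_lr_def K_s_def
    proof (rule fully_faithful_eso_lax_of)
      fix S :: "('o, 'm) skmon" assume "S \<in> {S. skew_monoidal_category S}"
      then have S: "skew_monoidal_category S" by simp
      show "\<exists>C\<in>{C. short_skew_multicategory C \<and> left_representable_short C}. \<exists>e. iso_in SkMon (skmon_of C (ch C)) S e"
        using iso[OF S] trunc[OF of[OF S]] by blast
    qed (use short classified_multicategory.skew_monoidal_S in blast)+
    ultimately show ?thesis by simp
  qed
  have Kc: "fully_faithful_eso ShSkMulti_cl_lr SkMon_cl (K_s ch)"
    unfolding ShSkMulti_cl_lr_def SkMon_cl_def K_s_def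
  proof (rule fully_faithful_eso_lax_of)
    fix S :: "('o, 'm) skmon" assume "S \<in> {S. skew_monoidal_category S \<and> closed_skmon S}"
    then have S: "skew_monoidal_category S" "closed_skmon S" by simp_all
    show "\<exists>C\<in>{C. short_skew_multicategory C \<and> left_representable_short C \<and> closed_short C}.
        \<exists>e. iso_in SkMon (skmon_of C (ch C)) S e"
      using iso[OF S(1)] trunc[OF of[OF S(1)]] closed_truncate[OF of_cl[OF S]] by blast
  qed (use short classified_multicategory.skew_monoidal_S classified_multicategory.closed_skmon_short in blast)+
  have T: "fully_faithful_eso SkMulti_cl_lr SkMon_cl (T_s ch)"
    unfolding SkMulti_cl_lr_def SkMon_cl_def T_s_def
  proof (rule fully_faithful_eso_lax_of)
    fix S :: "('o, 'm) skmon" assume "S \<in> {S. skew_monoidal_category S \<and> closed_skmon S}"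
    then have S: "skew_monoidal_category S" "closed_skmon S" by simp_all
    show "\<exists>C\<in>{C. skew_multicategory C \<and> left_representable C \<and> closed_multi C}.
        \<exists>e. iso_in SkMon (skmon_of C (ch (truncate_multi C))) S e"
      using iso[OF S(1)] of[OF S(1)] of_cl[OF S] unfolding skmon_of_truncate by blast
  qed (use long classified_multicategory.skew_monoidal_S classified_multicategory.closed_skmon_long in blast)+
  have U: "is_functor SkMulti_cl_lr ShSkMulti_cl_lr ?U"
  proof -
    have "category (SkMulti_cl_lr :: (('o, 'm) multi, ('o, 'm) multimor) cat)"
      "category (ShSkMulti_cl_lr :: (('o, 'm) multi, ('o, 'm) multimor) cat)"
      using T Kc by (simp_all add: fully_faithful_eso_def is_functor_def)
    then show ?thesis
      unfolding is_functor_def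
      by (simp add: SkMulti_cl_lr_def ShSkMulti_cl_lr_def multi_cat_def U_cl_lr_def trunc closed_truncate
          multi_morphism_truncate truncate_id_multimor truncate_comp_multimor)
  qed
  have TKU: "fctr_eq SkMulti_cl_lr (T_s ch) (comp_fctr (K_s ch) ?U)"
    by (simp add: fctr_eq_def comp_fctr_def K_s_def T_s_def U_cl_lr_def skmon_of_truncate lax_of_truncate)
  have Uff: "fully_faithful_eso SkMulti_cl_lr ShSkMulti_cl_lr ?U"
    using T Kc U TKU by (rule fully_faithful_eso_cancel)
  show ?thesis
    by (intro conjI fully_faithful_eso_equivalence K Kc T Uff TKU)
qed

end
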